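(* Any cocomplete Heyting category $\mathbf{C}$ is locale-based under cartesian products (i.e. as a monoidal category whose tensor product is the cartesian product and whose tensor unit is the terminal object). This includes all cocomplete toposes, such as Grothendieck toposes.
   Context: An object name also denotes its identity morphism. Let $\mathbf{C}$ be braided monoidal with tensor unit $I$. A subunit is a subobject $s \colon S \rightarrowtail I$ such that $s \otimes S \colon S \otimes S \to I \otimes S$ is an isomorphism; $\mathrm{ISub}(\mathbf{C})$ is the collection of subunits, ordered as subobjects (size issues are disregarded). Coherence isomorphisms are suppressed, so $s \otimes X$ also denotes the map $S \otimes X \to X$. $\mathbf{C}$ is stiff when for all objects $X$ and subunits $s,t$ the square with top $s \otimes T \otimes X \colon S \otimes T \otimes X \to T \otimes X$, left $S \otimes t \otimes X \colon S \otimes T \otimes X \to S \otimes X$, right $t \otimes X \colon T \otimes X \to X$ and bottom $s \otimes X \colon S \otimes X \to X$ is a pullback of monomorphisms. In a stiff category subunits form a meet-semilattice with $s \wedge t = \lambda_I \circ (s \otimes t)$. For $U \subseteq \mathrm{ISub}(\mathbf{C})$ and an object $X$, $D(U,X)$ is the diagram of objects $S \otimes X$ for $s \in U$ and all morphisms $f \colon S \otimes X \to T \otimes X$ with $(t \otimes X) \circ f = s \otimes X$. $U$ is idempotent when $U = \{ s \wedge t \mid s,t \in U\}$. $\mathbf{C}$ is locale-based when it is stiff, $\mathrm{ISub}(\mathbf{C})$ is a frame, and the canonical maps $S \otimes X \to (\bigvee U) \otimes X$ form a colimit of $D(U,X)$ for each idempotent $U \subseteq \mathrm{ISub}(\mathbf{C})$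 and each $X \in \mathbf{C}$ (here $(\bigvee U) \otimes X$ denotes the domain of the subunit $\bigvee U$ tensored with $X$).
   Formalization: Cocomplete means having small colimits; the collection of subunits is assumed small for Heyting categories, and cocomplete toposes are assumed locally small for being locale-based. Without this the claim fails, e.g. for the ordered class Ord + Ord^op, whose subunits lack a join of Ord. *)

theory Defs
  imports "HOL-Algebra.Galois_Connection" "HOL-Library.FuncSet"
begin

section \<open>Categories, functors, natural transformations\<close>

text \<open>Composition is in applicative order: the composite of f followed by g is Comp C g f.\<close>

record ('o, 'a) cat =
  Obj :: "'o set"
  Arr :: "'a set"
  Dom :: "'a \<Rightarrow> 'o"
  Cod :: "'a \<Rightarrow> 'o"
  Ident :: "'o \<Rightarrow> 'a"
  Comp :: "'a \<Rightarrow> 'a \<Rightarrow> 'a" (infixl "\<cdot>\<index>" 70)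

definition Hom :: "('o, 'a) cat \<Rightarrow> 'o \<Rightarrow> 'o \<Rightarrow> 'a set" where
  "Hom C A B = {f \<in> Arr C. Dom C f = A \<and> Cod C f = B}"

locale category =
  fixes C :: "('o, 'a) cat" (structure)
  assumes Dom_Obj: "f \<in> Arr C \<Longrightarrow> Dom C f \<in> Obj C"
    and Cod_Obj: "f \<in> Arr C \<Longrightarrow> Cod C f \<in> Obj C"
    and Ident_Hom: "A \<in> Obj C \<Longrightarrow> Ident C A \<in> Hom C A A"
    and Comp_Hom: "\<lbrakk>f \<in> Hom C A B; g \<in> Hom C B D\<rbrakk> \<Longrightarrow> g \<cdot> f \<in> Hom C A D"
    and Comp_Ident: "f \<in> Hom C A B \<Longrightarrow> f \<cdot> Ident C A = f"
    and Ident_Comp: "f \<in> Hom C A B \<Longrightarrow> Ident C B \<cdot> f = f"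
    and Comp_assoc:
      "\<lbrakk>f \<in> Hom C A B; g \<in> Hom C B D; h \<in> Hom C D E\<rbrakk> \<Longrightarrow> h \<cdot> (g \<cdot> f) = (h \<cdot> g) \<cdot> f"

definition op_cat :: "('o, 'a) cat \<Rightarrow> ('o, 'a) cat" where
  "op_cat C = \<lparr>Obj = Obj C, Arr = Arr C, Dom = Cod C, Cod = Dom C, Ident = Ident C,
     Comp = (\<lambda>g f. f \<cdot>\<^bsub>C\<^esub> g)\<rparr>"

definition inverse_arrows :: "('o, 'a) cat \<Rightarrow> 'a \<Rightarrow> 'a \<Rightarrow> bool" where
  "inverse_arrows C f g \<longleftrightarrow> f \<in> Arr C \<and> g \<in> Hom C (Cod C f) (Dom C f) \<and>
     g \<cdot>\<^bsub>C\<^esub> f = Ident C (Dom C f) \<and> f \<cdot>\<^bsub>C\<^esub> g = Ident C (Cod C f)"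

definition isomorphism :: "('o, 'a) cat \<Rightarrow> 'a \<Rightarrow> bool" where
  "isomorphism C f \<longleftrightarrow> (\<exists>g. inverse_arrows C f g)"

definition inv_arr :: "('o, 'a) cat \<Rightarrow> 'a \<Rightarrow> 'a" where
  "inv_arr C f = (THE g. inverse_arrows C f g)"

definition monic :: "('o, 'a) cat \<Rightarrow> 'a \<Rightarrow> bool" where
  "monic C m \<longleftrightarrow> m \<in> Arr C \<and>
     (\<forall>X. \<forall>f\<in>Hom C X (Dom C m). \<forall>g\<in>Hom C X (Dom C m). m \<cdot>\<^bsub>C\<^esub> f = m \<cdot>\<^bsub>C\<^esub> g \<longrightarrow> f = g)"

record ('o1, 'a1, 'o2, 'a2) fctr =
  fobj :: "'o1 \<Rightarrow> 'o2"
  farr :: "'a1 \<Rightarrow> 'a2"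

definition is_functor ::
  "('o1, 'a1) cat \<Rightarrow> ('o2, 'a2) cat \<Rightarrow> ('o1, 'a1, 'o2, 'a2) fctr \<Rightarrow> bool" where
  "is_functor A B F \<longleftrightarrow> category A \<and> category B \<and>
     (\<forall>X\<in>Obj A. fobj F X \<in> Obj B) \<and>
     (\<forall>f\<in>Arr A. farr F f \<in> Hom B (fobj F (Dom A f)) (fobj F (Cod A f))) \<and>
     (\<forall>X\<in>Obj A. farr F (Ident A X) = Ident B (fobj F X)) \<and>
     (\<forall>f\<in>Arr A. \<forall>g\<in>Arr A. Cod A f = Dom A g \<longrightarrow>
        farr F (g \<cdot>\<^bsub>A\<^esub> f) = farr F g \<cdot>\<^bsub>B\<^esub> farr F f)"

definition id_functor :: "('o, 'a, 'o, 'a) fctr" where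
  "id_functor = \<lparr>fobj = (\<lambda>X. X), farr = (\<lambda>f. f)\<rparr>"

definition comp_functor ::
  "('o2, 'a2, 'o3, 'a3) fctr \<Rightarrow> ('o1, 'a1, 'o2, 'a2) fctr \<Rightarrow> ('o1, 'a1, 'o3, 'a3) fctr" where
  "comp_functor G F = \<lparr>fobj = fobj G \<circ> fobj F, farr = farr G \<circ> farr F\<rparr>"

definition nat_trans ::
  "('o1, 'a1) cat \<Rightarrow> ('o2, 'a2) cat \<Rightarrow> ('o1, 'a1, 'o2, 'a2) fctr \<Rightarrow> ('o1, 'a1, 'o2, 'a2) fctr
     \<Rightarrow> ('o1 \<Rightarrow> 'a2) \<Rightarrow> bool" where
  "nat_trans A B F G \<eta> \<longleftrightarrow> is_functor A B F \<and> is_functor A B G \<and>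
     (\<forall>X\<in>Obj A. \<eta> X \<in> Hom B (fobj F X) (fobj G X)) \<and>
     (\<forall>f\<in>Arr A. \<eta> (Cod A f) \<cdot>\<^bsub>B\<^esub> farr F f = farr G f \<cdot>\<^bsub>B\<^esub> \<eta> (Dom A f))"

definition nat_iso ::
  "('o1, 'a1) cat \<Rightarrow> ('o2, 'a2) cat \<Rightarrow> ('o1, 'a1, 'o2, 'a2) fctr \<Rightarrow> ('o1, 'a1, 'o2, 'a2) fctr
     \<Rightarrow> ('o1 \<Rightarrow> 'a2) \<Rightarrow> bool" where
  "nat_iso A B F G \<eta> \<longleftrightarrow> nat_trans A B F G \<eta> \<and> (\<forall>X\<in>Obj A. isomorphism B (\<eta> X))"

definition equivalent_cats :: "('o1, 'a1) cat \<Rightarrow> ('o2, 'a2) cat \<Rightarrow> bool" where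
  "equivalent_cats A B \<longleftrightarrow> (\<exists>F G \<eta> \<epsilon>. is_functor A B F \<and> is_functor B A G \<and>
     nat_iso A A id_functor (comp_functor G F) \<eta> \<and>
     nat_iso B B (comp_functor F G) id_functor \<epsilon>)"


section \<open>Limits and colimits\<close>

definition is_cone ::
  "('j, 'k) cat \<Rightarrow> ('o, 'a) cat \<Rightarrow> ('j, 'k, 'o, 'a) fctr \<Rightarrow> 'o \<Rightarrow> ('j \<Rightarrow> 'a) \<Rightarrow> bool" where
  "is_cone J C F L p \<longleftrightarrow> L \<in> Obj C \<and> (\<forall>j\<in>Obj J. p j \<in> Hom C L (fobj F j)) \<and>
     (\<forall>u\<in>Arr J. farr F u \<cdot>\<^bsub>C\<^esub> p (Dom J u) = p (Cod J u))"

definition is_limit ::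
  "('j, 'k) cat \<Rightarrow> ('o, 'a) cat \<Rightarrow> ('j, 'k, 'o, 'a) fctr \<Rightarrow> 'o \<Rightarrow> ('j \<Rightarrow> 'a) \<Rightarrow> bool" where
  "is_limit J C F L p \<longleftrightarrow> is_cone J C F L p \<and>
     (\<forall>X x. is_cone J C F X x \<longrightarrow> (\<exists>!h. h \<in> Hom C X L \<and> (\<forall>j\<in>Obj J. p j \<cdot>\<^bsub>C\<^esub> h = x j)))"

definition is_cocone ::
  "('j, 'k) cat \<Rightarrow> ('o, 'a) cat \<Rightarrow> ('j, 'k, 'o, 'a) fctr \<Rightarrow> 'o \<Rightarrow> ('j \<Rightarrow> 'a) \<Rightarrow> bool" where
  "is_cocone J C F L i \<longleftrightarrow> L \<in> Obj C \<and> (\<forall>j\<in>Obj J. i j \<in> Hom C (fobj F j) L) \<and>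
     (\<forall>u\<in>Arr J. i (Cod J u) \<cdot>\<^bsub>C\<^esub> farr F u = i (Dom J u))"

definition is_colimit ::
  "('j, 'k) cat \<Rightarrow> ('o, 'a) cat \<Rightarrow> ('j, 'k, 'o, 'a) fctr \<Rightarrow> 'o \<Rightarrow> ('j \<Rightarrow> 'a) \<Rightarrow> bool" where
  "is_colimit J C F L i \<longleftrightarrow> is_cocone J C F L i \<and>
     (\<forall>X x. is_cocone J C F X x \<longrightarrow> (\<exists>!h. h \<in> Hom C L X \<and> (\<forall>j\<in>Obj J. h \<cdot>\<^bsub>C\<^esub> i j = x j)))"

text \<open>Every finite category is isomorphic to one whose objects and arrows are natural numbers.\<close>

definition finitely_complete :: "('o, 'a) cat \<Rightarrow> bool" where
  "finitely_complete C \<longleftrightarrow>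
     (\<forall>(J :: (nat, nat) cat) F. category J \<and> finite (Obj J) \<and> finite (Arr J) \<and> is_functor J C F \<longrightarrow>
        (\<exists>L p. is_limit J C F L p))"

text \<open>
  Size. A set, of any type, is small if its cardinality is below a fixed cardinal \<kappa>. Since \<kappa> is a
  well-order on the type 'u, every small set is equipotent to a subset of 'u, so small index
  categories may be taken to have objects and arrows in 'u.
\<close>

definition small :: "'u rel \<Rightarrow> 'x set \<Rightarrow> bool" where
  "small \<kappa> A \<longleftrightarrow> (card_of A, \<kappa>) \<in> ordLess"

text \<open>
  Closure conditions making the small sets the members of a Grothendieck universe:
  \<kappa> is a regular strong limit cardinal (strongly inaccessible, or the first infinite cardinal).
\<close>

definition universe :: "'u rel \<Rightarrow> bool" where
  "universe \<kappa> \<longleftrightarrow> Cinfinite \<kappa> \<and> regularCard \<kappa> \<and>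
     (\<forall>A :: 'u set. small \<kappa> A \<longrightarrow> small \<kappa> (Pow A))"

definition cocomplete :: "'u rel \<Rightarrow> ('o, 'a) cat \<Rightarrow> bool" where
  "cocomplete \<kappa> C \<longleftrightarrow>
     (\<forall>(J :: ('u, 'u) cat) F. category J \<and> small \<kappa> (Obj J) \<and> small \<kappa> (Arr J) \<and> is_functor J C F \<longrightarrow>
        (\<exists>L i. is_colimit J C F L i))"

definition locally_small :: "'u rel \<Rightarrow> ('o, 'a) cat \<Rightarrow> bool" where
  "locally_small \<kappa> C \<longleftrightarrow> (\<forall>A\<in>Obj C. \<forall>B\<in>Obj C. small \<kappa> (Hom C A B))"

definition is_terminal :: "('o, 'a) cat \<Rightarrow> 'o \<Rightarrow> bool" where
  "is_terminal C T \<longleftrightarrow> T \<in> Obj C \<and> (\<forall>X\<in>Obj C. \<exists>!h. h \<in> Hom C X T)"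

definition is_product :: "('o, 'a) cat \<Rightarrow> 'o \<Rightarrow> 'o \<Rightarrow> 'o \<Rightarrow> 'a \<Rightarrow> 'a \<Rightarrow> bool" where
  "is_product C A B P p q \<longleftrightarrow> P \<in> Obj C \<and> p \<in> Hom C P A \<and> q \<in> Hom C P B \<and>
     (\<forall>X. \<forall>f\<in>Hom C X A. \<forall>g\<in>Hom C X B.
        \<exists>!h. h \<in> Hom C X P \<and> p \<cdot>\<^bsub>C\<^esub> h = f \<and> q \<cdot>\<^bsub>C\<^esub> h = g)"

text \<open>is_pullback C f g p q: the square f p = g q is a pullback of f and g.\<close>

definition is_pullback :: "('o, 'a) cat \<Rightarrow> 'a \<Rightarrow> 'a \<Rightarrow> 'a \<Rightarrow> 'a \<Rightarrow> bool" where
  "is_pullback C f g p q \<longleftrightarrow> f \<in> Arr C \<and> g \<in> Arr C \<and> Cod C f = Cod C g \<and>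
     p \<in> Hom C (Dom C p) (Dom C f) \<and> q \<in> Hom C (Dom C p) (Dom C g) \<and> f \<cdot>\<^bsub>C\<^esub> p = g \<cdot>\<^bsub>C\<^esub> q \<and>
     (\<forall>X. \<forall>x\<in>Hom C X (Dom C f). \<forall>y\<in>Hom C X (Dom C g). f \<cdot>\<^bsub>C\<^esub> x = g \<cdot>\<^bsub>C\<^esub> y \<longrightarrow>
        (\<exists>!h. h \<in> Hom C X (Dom C p) \<and> p \<cdot>\<^bsub>C\<^esub> h = x \<and> q \<cdot>\<^bsub>C\<^esub> h = y))"


section \<open>Subobjects\<close>

definition factors_through :: "('o, 'a) cat \<Rightarrow> 'a \<Rightarrow> 'a \<Rightarrow> bool" where
  "factors_through C f m \<longleftrightarrow> (\<exists>k\<in>Hom C (Dom C f) (Dom C m). m \<cdot>\<^bsub>C\<^esub> k = f)"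

text \<open>A subobject of A is an equivalence class of monomorphisms into A.\<close>

definition subobject :: "('o, 'a) cat \<Rightarrow> 'a \<Rightarrow> 'a set" where
  "subobject C m = {n. monic C n \<and> Cod C n = Cod C m \<and> factors_through C n m \<and> factors_through C m n}"

definition sub_le :: "('o, 'a) cat \<Rightarrow> 'a set \<Rightarrow> 'a set \<Rightarrow> bool" where
  "sub_le C u v \<longleftrightarrow> (\<exists>m\<in>u. \<exists>n\<in>v. factors_through C m n)"

definition Sub :: "('o, 'a) cat \<Rightarrow> 'o \<Rightarrow> 'a set gorder" where
  "Sub C A = \<lparr>carrier = subobject C ` {m. monic C m \<and> Cod C m = A}, eq = (=), le = sub_le C\<rparr>"

text \<open>
  The action of f on subobjects of its codomain by pullback. The set of all pullbacks along f of all
  representatives of u is itself an equivalence class of monomorphisms into the domain of f.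
\<close>

definition pull :: "('o, 'a) cat \<Rightarrow> 'a \<Rightarrow> 'a set \<Rightarrow> 'a set" where
  "pull C f u = {p. \<exists>m\<in>u. \<exists>q. is_pullback C f m p q}"


section \<open>Regular, coherent and Heyting categories\<close>

definition is_image :: "('o, 'a) cat \<Rightarrow> 'a \<Rightarrow> 'a \<Rightarrow> bool" where
  "is_image C f m \<longleftrightarrow> monic C m \<and> Cod C m = Cod C f \<and> factors_through C f m \<and>
     (\<forall>n. monic C n \<and> Cod C n = Cod C f \<and> factors_through C f n \<longrightarrow> factors_through C m n)"

definition cover :: "('o, 'a) cat \<Rightarrow> 'a \<Rightarrow> bool" where
  "cover C f \<longleftrightarrow> f \<in> Arr C \<and>
     (\<forall>m. monic C m \<and> Cod C m = Cod C f \<and> factors_through C f m \<longrightarrow> isomorphism C m)"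

definition regular_category :: "('o, 'a) cat \<Rightarrow> bool" where
  "regular_category C \<longleftrightarrow> category C \<and> finitely_complete C \<and>
     (\<forall>f\<in>Arr C. \<exists>m. is_image C f m) \<and>
     (\<forall>f g p q. is_pullback C f g p q \<and> cover C g \<longrightarrow> cover C p)"

definition coherent_category :: "('o, 'a) cat \<Rightarrow> bool" where
  "coherent_category C \<longleftrightarrow> regular_category C \<and>
     (\<forall>A\<in>Obj C. \<forall>U. finite U \<and> U \<subseteq> carrier (Sub C A) \<longrightarrow> (\<exists>s. least (Sub C A) s (Upper (Sub C A) U))) \<and>
     (\<forall>f\<in>Arr C. \<forall>U. finite U \<and> U \<subseteq> carrier (Sub C (Cod C f)) \<longrightarrow>
        pull C f (\<Squnion>\<^bsub>Sub C (Cod C f)\<^esub> U) = \<Squnion>\<^bsub>Sub C (Dom C f)\<^esub> (pull C f ` U))"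

definition heyting_category :: "('o, 'a) cat \<Rightarrow> bool" where
  "heyting_category C \<longleftrightarrow> coherent_category C \<and>
     (\<forall>f\<in>Arr C. \<exists>all_f. galois_connection
        \<lparr>orderA = Sub C (Cod C f), orderB = Sub C (Dom C f), lower = pull C f, upper = all_f\<rparr>)"


section \<open>Elementary toposes\<close>

text \<open>E with evaluation ev, defined on the product P of E and A, is an exponential of B by A.\<close>

definition is_exponential ::
  "('o, 'a) cat \<Rightarrow> 'o \<Rightarrow> 'o \<Rightarrow> 'o \<Rightarrow> 'o \<Rightarrow> 'a \<Rightarrow> 'a \<Rightarrow> 'a \<Rightarrow> bool" where
  "is_exponential C A B E P p q ev \<longleftrightarrow> is_product C E A P p q \<and> ev \<in> Hom C P B \<and>
     (\<forall>Z Q p' q'. is_product C Z A Q p' q' \<longrightarrow> (\<forall>f\<in>Hom C Q B.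
        \<exists>!g. g \<in> Hom C Z E \<and>
          (\<exists>h\<in>Hom C Q P. p \<cdot>\<^bsub>C\<^esub> h = g \<cdot>\<^bsub>C\<^esub> p' \<and> q \<cdot>\<^bsub>C\<^esub> h = q' \<and> ev \<cdot>\<^bsub>C\<^esub> h = f)))"

definition is_subobject_classifier :: "('o, 'a) cat \<Rightarrow> 'o \<Rightarrow> 'a \<Rightarrow> bool" where
  "is_subobject_classifier C \<Omega> tr \<longleftrightarrow> is_terminal C (Dom C tr) \<and> tr \<in> Hom C (Dom C tr) \<Omega> \<and>
     (\<forall>m. monic C m \<longrightarrow>
        (\<exists>!\<chi>. \<chi> \<in> Hom C (Cod C m) \<Omega> \<and> (\<exists>t. is_pullback C \<chi> tr m t)))"

definition elementary_topos :: "('o, 'a) cat \<Rightarrow> bool" where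
  "elementary_topos C \<longleftrightarrow> category C \<and> finitely_complete C \<and>
     (\<forall>A\<in>Obj C. \<forall>B\<in>Obj C. \<exists>E P p q ev. is_exponential C A B E P p q ev) \<and>
     (\<exists>\<Omega> tr. is_subobject_classifier C \<Omega> tr)"


section \<open>Grothendieck toposes\<close>

text \<open>
  The category of small sets, represented by the small subsets of 'u.
  An arrow (A, f, B) is a function f from A to B, undefined outside A.
\<close>

type_synonym 'u set_arr = "'u set \<times> ('u \<Rightarrow> 'u) \<times> 'u set"

definition set_app :: "'u set_arr \<Rightarrow> 'u \<Rightarrow> 'u" where
  "set_app f = fst (snd f)"

definition set_cat :: "'u rel \<Rightarrow> ('u set, 'u set_arr) cat" where
  "set_cat \<kappa> =
     \<lparr>Obj = {A. small \<kappa> A},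
      Arr = {(A, f, B) | A f B. small \<kappa> A \<and> small \<kappa> B \<and> f \<in> A \<rightarrow>\<^sub>E B},
      Dom = (\<lambda>f. fst f),
      Cod = (\<lambda>f. snd (snd f)),
      Ident = (\<lambda>A. (A, (\<lambda>x\<in>A. x), A)),
      Comp = (\<lambda>g f. (fst f, compose (fst f) (set_app g) (set_app f), snd (snd g)))\<rparr>"

definition functor_cat :: "('o1, 'a1) cat \<Rightarrow> ('o2, 'a2) cat \<Rightarrow>
    (('o1, 'a1, 'o2, 'a2) fctr,
     ('o1, 'a1, 'o2, 'a2) fctr \<times> ('o1 \<Rightarrow> 'a2) \<times> ('o1, 'a1, 'o2, 'a2) fctr) cat" where
  "functor_cat A B =
     \<lparr>Obj = {F. is_functor A B F},
      Arr = {(F, \<eta>, G) | F \<eta> G. nat_trans A B F G \<eta> \<and> \<eta> \<in> extensional (Obj A)},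
      Dom = (\<lambda>a. fst a),
      Cod = (\<lambda>a. snd (snd a)),
      Ident = (\<lambda>F. (F, (\<lambda>X\<in>Obj A. Ident B (fobj F X)), F)),
      Comp = (\<lambda>b a. (fst a, (\<lambda>X\<in>Obj A. fst (snd b) X \<cdot>\<^bsub>B\<^esub> fst (snd a) X), snd (snd b)))\<rparr>"

definition full_subcat :: "('o, 'a) cat \<Rightarrow> 'o set \<Rightarrow> ('o, 'a) cat" where
  "full_subcat C S = C\<lparr>Obj := Obj C \<inter> S, Arr := {f \<in> Arr C. Dom C f \<in> S \<and> Cod C f \<in> S}\<rparr>"

definition sieve :: "('o, 'a) cat \<Rightarrow> 'o \<Rightarrow> 'a set \<Rightarrow> bool" where
  "sieve D c S \<longleftrightarrow> S \<subseteq> {f \<in> Arr D. Cod D f = c} \<and>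
     (\<forall>f\<in>S. \<forall>g\<in>Arr D. Cod D g = Dom D f \<longrightarrow> f \<cdot>\<^bsub>D\<^esub> g \<in> S)"

definition pull_sieve :: "('o, 'a) cat \<Rightarrow> 'a \<Rightarrow> 'a set \<Rightarrow> 'a set" where
  "pull_sieve D h S = {g \<in> Arr D. Cod D g = Dom D h \<and> h \<cdot>\<^bsub>D\<^esub> g \<in> S}"

definition grothendieck_topology :: "('o, 'a) cat \<Rightarrow> ('o \<Rightarrow> 'a set set) \<Rightarrow> bool" where
  "grothendieck_topology D J \<longleftrightarrow>
     (\<forall>c\<in>Obj D. \<forall>S\<in>J c. sieve D c S) \<and>
     (\<forall>c\<in>Obj D. {f \<in> Arr D. Cod D f = c} \<in> J c) \<and>
     (\<forall>h\<in>Arr D. \<forall>S\<in>J (Cod D h). pull_sieve D h S \<in> J (Dom D h)) \<and>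
     (\<forall>c\<in>Obj D. \<forall>S\<in>J c. \<forall>R. sieve D c R \<and> (\<forall>h\<in>S. pull_sieve D h R \<in> J (Dom D h)) \<longrightarrow> R \<in> J c)"

text \<open>The set of sheaves of small sets on the site (D, J).\<close>

definition sheaves ::
  "'u rel \<Rightarrow> ('o, 'a) cat \<Rightarrow> ('o \<Rightarrow> 'a set set) \<Rightarrow> ('o, 'a, 'u set, 'u set_arr) fctr set" where
  "sheaves \<kappa> D J = {F. is_functor (op_cat D) (set_cat \<kappa>) F \<and>
     (\<forall>c\<in>Obj D. \<forall>S\<in>J c. \<forall>x.
        (\<forall>f\<in>S. x f \<in> fobj F (Dom D f)) \<and>
        (\<forall>f\<in>S. \<forall>g\<in>Arr D. Cod D g = Dom D f \<longrightarrow> x (f \<cdot>\<^bsub>D\<^esub> g) = set_app (farr F g) (x f)) \<longrightarrow>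
        (\<exists>!y. y \<in> fobj F c \<and> (\<forall>f\<in>S. set_app (farr F f) y = x f)))}"

definition grothendieck_topos :: "'u rel \<Rightarrow> ('o, 'a) cat \<Rightarrow> bool" where
  "grothendieck_topos \<kappa> C \<longleftrightarrow> category C \<and>
     (\<exists>(D :: ('u, 'u) cat) J. category D \<and> small \<kappa> (Obj D) \<and> small \<kappa> (Arr D) \<and>
        grothendieck_topology D J \<and>
        equivalent_cats C (full_subcat (functor_cat (op_cat D) (set_cat \<kappa>)) (sheaves \<kappa> D J)))"


section \<open>Braided monoidal categories\<close>

record ('o, 'a) braided_structure =
  tobj :: "'o \<Rightarrow> 'o \<Rightarrow> 'o"
  tarr :: "'a \<Rightarrow> 'a \<Rightarrow> 'a"
  tunit :: "'o"
  assoc :: "'o \<Rightarrow> 'o \<Rightarrow> 'o \<Rightarrow> 'a"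
  lunit :: "'o \<Rightarrow> 'a"
  runit :: "'o \<Rightarrow> 'a"
  braid :: "'o \<Rightarrow> 'o \<Rightarrow> 'a"

locale tensor_notation =
  fixes M :: "('o, 'a) braided_structure"
begin
abbreviation tensor_obj (infixr "\<otimes>\<^sub>o" 75) where "A \<otimes>\<^sub>o B \<equiv> tobj M A B"
abbreviation tensor_arr (infixr "\<otimes>\<^sub>a" 75) where "f \<otimes>\<^sub>a g \<equiv> tarr M f g"
end

locale braided_monoidal_category = category C + tensor_notation M
  for C :: "('o, 'a) cat" (structure) and M :: "('o, 'a) braided_structure" +
  assumes tobj_Obj: "\<lbrakk>A \<in> Obj C; B \<in> Obj C\<rbrakk> \<Longrightarrow> A \<otimes>\<^sub>o B \<in> Obj C"
    and tarr_Hom: "\<lbrakk>f \<in> Hom C A A'; g \<in> Hom C B B'\<rbrakk> \<Longrightarrow> f \<otimes>\<^sub>a g \<in> Hom C (A \<otimes>\<^sub>o B) (A' \<otimes>\<^sub>o B')"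
    and tarr_Ident: "\<lbrakk>A \<in> Obj C; B \<in> Obj C\<rbrakk> \<Longrightarrow> Ident C A \<otimes>\<^sub>a Ident C B = Ident C (A \<otimes>\<^sub>o B)"
    and tarr_Comp: "\<lbrakk>f \<in> Hom C A A'; f' \<in> Hom C A' A''; g \<in> Hom C B B'; g' \<in> Hom C B' B''\<rbrakk>
      \<Longrightarrow> (f' \<cdot> f) \<otimes>\<^sub>a (g' \<cdot> g) = (f' \<otimes>\<^sub>a g') \<cdot> (f \<otimes>\<^sub>a g)"
    and tunit_Obj: "tunit M \<in> Obj C"
    and assoc_Hom: "\<lbrakk>A \<in> Obj C; B \<in> Obj C; D \<in> Obj C\<rbrakk>
      \<Longrightarrow> assoc M A B D \<in> Hom C ((A \<otimes>\<^sub>o B) \<otimes>\<^sub>o D) (A \<otimes>\<^sub>o (B \<otimes>\<^sub>o D))"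
    and assoc_iso: "\<lbrakk>A \<in> Obj C; B \<in> Obj C; D \<in> Obj C\<rbrakk> \<Longrightarrow> isomorphism C (assoc M A B D)"
    and assoc_nat: "\<lbrakk>f \<in> Hom C A A'; g \<in> Hom C B B'; h \<in> Hom C D D'\<rbrakk>
      \<Longrightarrow> assoc M A' B' D' \<cdot> ((f \<otimes>\<^sub>a g) \<otimes>\<^sub>a h) = (f \<otimes>\<^sub>a (g \<otimes>\<^sub>a h)) \<cdot> assoc M A B D"
    and lunit_Hom: "A \<in> Obj C \<Longrightarrow> lunit M A \<in> Hom C (tunit M \<otimes>\<^sub>o A) A"
    and lunit_iso: "A \<in> Obj C \<Longrightarrow> isomorphism C (lunit M A)"
    and lunit_nat: "f \<in> Hom C A B \<Longrightarrow> lunit M B \<cdot> (Ident C (tunit M) \<otimes>\<^sub>a f) = f \<cdot> lunit M A"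
    and runit_Hom: "A \<in> Obj C \<Longrightarrow> runit M A \<in> Hom C (A \<otimes>\<^sub>o tunit M) A"
    and runit_iso: "A \<in> Obj C \<Longrightarrow> isomorphism C (runit M A)"
    and runit_nat: "f \<in> Hom C A B \<Longrightarrow> runit M B \<cdot> (f \<otimes>\<^sub>a Ident C (tunit M)) = f \<cdot> runit M A"
    and braid_Hom: "\<lbrakk>A \<in> Obj C; B \<in> Obj C\<rbrakk> \<Longrightarrow> braid M A B \<in> Hom C (A \<otimes>\<^sub>o B) (B \<otimes>\<^sub>o A)"
    and braid_iso: "\<lbrakk>A \<in> Obj C; B \<in> Obj C\<rbrakk> \<Longrightarrow> isomorphism C (braid M A B)"
    and braid_nat: "\<lbrakk>f \<in> Hom C A A'; g \<in> Hom C B B'\<rbrakk>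
      \<Longrightarrow> braid M A' B' \<cdot> (f \<otimes>\<^sub>a g) = (g \<otimes>\<^sub>a f) \<cdot> braid M A B"
    and triangle: "\<lbrakk>A \<in> Obj C; B \<in> Obj C\<rbrakk>
      \<Longrightarrow> (Ident C A \<otimes>\<^sub>a lunit M B) \<cdot> assoc M A (tunit M) B = runit M A \<otimes>\<^sub>a Ident C B"
    and pentagon: "\<lbrakk>A \<in> Obj C; B \<in> Obj C; D \<in> Obj C; E \<in> Obj C\<rbrakk>
      \<Longrightarrow> (Ident C A \<otimes>\<^sub>a assoc M B D E) \<cdot> assoc M A (B \<otimes>\<^sub>o D) E \<cdot> (assoc M A B D \<otimes>\<^sub>a Ident C E)
        = assoc M A B (D \<otimes>\<^sub>o E) \<cdot> assoc M (A \<otimes>\<^sub>o B) D E"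
    and hexagon: "\<lbrakk>A \<in> Obj C; B \<in> Obj C; D \<in> Obj C\<rbrakk>
      \<Longrightarrow> assoc M B D A \<cdot> braid M A (B \<otimes>\<^sub>o D) \<cdot> assoc M A B D
        = (Ident C B \<otimes>\<^sub>a braid M A D) \<cdot> assoc M B A D \<cdot> (braid M A B \<otimes>\<^sub>a Ident C D)"
    and hexagon_inv: "\<lbrakk>A \<in> Obj C; B \<in> Obj C; D \<in> Obj C\<rbrakk>
      \<Longrightarrow> inv_arr C (assoc M D A B) \<cdot> braid M (A \<otimes>\<^sub>o B) D \<cdot> inv_arr C (assoc M A B D)
        = (braid M A D \<otimes>\<^sub>a Ident C B) \<cdot> inv_arr C (assoc M A D B) \<cdot> (Ident C A \<otimes>\<^sub>a braid M B D)"


section \<open>Subunits and locale-based categories\<close>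

definition subunit :: "('o, 'a) cat \<Rightarrow> ('o, 'a) braided_structure \<Rightarrow> 'a \<Rightarrow> bool" where
  "subunit C M s \<longleftrightarrow> monic C s \<and> Cod C s = tunit M \<and> isomorphism C (tarr M s (Ident C (Dom C s)))"

definition ISub :: "('o, 'a) cat \<Rightarrow> ('o, 'a) braided_structure \<Rightarrow> 'a set gorder" where
  "ISub C M = \<lparr>carrier = subobject C ` {s. subunit C M s}, eq = (=), le = sub_le C\<rparr>"

text \<open>
  The map from S \<otimes> X to X induced by s, with the left unitor made explicit.
  In stiff, triple tensor products are bracketed to the right.
\<close>

definition act :: "('o, 'a) cat \<Rightarrow> ('o, 'a) braided_structure \<Rightarrow> 'a \<Rightarrow> 'o \<Rightarrow> 'a" where
  "act C M s X = lunit M X \<cdot>\<^bsub>C\<^esub> tarr M s (Ident C X)"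

definition stiff :: "('o, 'a) cat \<Rightarrow> ('o, 'a) braided_structure \<Rightarrow> bool" where
  "stiff C M \<longleftrightarrow> (\<forall>X\<in>Obj C. \<forall>s t. subunit C M s \<and> subunit C M t \<longrightarrow>
     (let top = act C M s (tobj M (Dom C t) X);
          left = tarr M (Ident C (Dom C s)) (act C M t X);
          right = act C M t X;
          bottom = act C M s X
      in monic C top \<and> monic C left \<and> monic C right \<and> monic C bottom \<and>
         is_pullback C right bottom top left))"

text \<open>
  D(U, X), for a set U of subunits with chosen representing monomorphisms r u. Its shape has
  objects U and arrows (u, v, f), where f is an arrow of D(U, X) between the objects indexed by u and v.
\<close>

definition D_shape ::
  "('o, 'a) cat \<Rightarrow> ('o, 'a) braided_structure \<Rightarrow> ('a set \<Rightarrow> 'a) \<Rightarrow> 'a set set \<Rightarrow> 'o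
     \<Rightarrow> ('a set, 'a set \<times> 'a set \<times> 'a) cat" where
  "D_shape C M r U X =
     \<lparr>Obj = U,
      Arr = {(u, v, f) | u v f. u \<in> U \<and> v \<in> U \<and>
               f \<in> Hom C (tobj M (Dom C (r u)) X) (tobj M (Dom C (r v)) X) \<and>
               act C M (r v) X \<cdot>\<^bsub>C\<^esub> f = act C M (r u) X},
      Dom = (\<lambda>a. fst a),
      Cod = (\<lambda>a. fst (snd a)),
      Ident = (\<lambda>u. (u, u, Ident C (tobj M (Dom C (r u)) X))),
      Comp = (\<lambda>b a. (fst a, fst (snd b), snd (snd b) \<cdot>\<^bsub>C\<^esub> snd (snd a)))\<rparr>"

definition D_diagram ::
  "('o, 'a) cat \<Rightarrow> ('o, 'a) braided_structure \<Rightarrow> ('a set \<Rightarrow> 'a) \<Rightarrow> 'o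
     \<Rightarrow> ('a set, 'a set \<times> 'a set \<times> 'a, 'o, 'a) fctr" where
  "D_diagram C M r X = \<lparr>fobj = (\<lambda>u. tobj M (Dom C (r u)) X), farr = (\<lambda>a. snd (snd a))\<rparr>"

definition canonical_map ::
  "('o, 'a) cat \<Rightarrow> ('o, 'a) braided_structure \<Rightarrow> 'a \<Rightarrow> 'a \<Rightarrow> 'o \<Rightarrow> 'a" where
  "canonical_map C M s t X =
     tarr M (THE k. k \<in> Hom C (Dom C s) (Dom C t) \<and> t \<cdot>\<^bsub>C\<^esub> k = s) (Ident C X)"

definition frame :: "'b gorder \<Rightarrow> bool" where
  "frame L \<longleftrightarrow> complete_lattice L \<and>
     (\<forall>a\<in>carrier L. \<forall>B. B \<subseteq> carrier L \<longrightarrow>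
        a \<sqinter>\<^bsub>L\<^esub> (\<Squnion>\<^bsub>L\<^esub> B) = \<Squnion>\<^bsub>L\<^esub> ((\<lambda>b. a \<sqinter>\<^bsub>L\<^esub> b) ` B))"

definition idempotent_subunits ::
  "('o, 'a) cat \<Rightarrow> ('o, 'a) braided_structure \<Rightarrow> 'a set set \<Rightarrow> bool" where
  "idempotent_subunits C M U \<longleftrightarrow> U \<subseteq> carrier (ISub C M) \<and>
     U = {s \<sqinter>\<^bsub>ISub C M\<^esub> t | s t. s \<in> U \<and> t \<in> U}"

text \<open>The colimit condition is imposed for every choice r of representatives of subunits.\<close>

definition locale_based :: "('o, 'a) cat \<Rightarrow> ('o, 'a) braided_structure \<Rightarrow> bool" where
  "locale_based C M \<longleftrightarrow> braided_monoidal_category C M \<and> stiff C M \<and> frame (ISub C M) \<and>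
     (\<forall>U. idempotent_subunits C M U \<longrightarrow>
       (\<forall>X\<in>Obj C. \<forall>r. (\<forall>u\<in>carrier (ISub C M). r u \<in> u) \<longrightarrow>
          is_colimit (D_shape C M r U X) C (D_diagram C M r X)
            (tobj M (Dom C (r (\<Squnion>\<^bsub>ISub C M\<^esub> U))) X)
            (\<lambda>u. canonical_map C M (r u) (r (\<Squnion>\<^bsub>ISub C M\<^esub> U)) X)))"


section \<open>The cartesian monoidal structure\<close>

record ('o, 'a) products =
  one :: "'o"
  prd :: "'o \<Rightarrow> 'o \<Rightarrow> 'o"
  pr1 :: "'o \<Rightarrow> 'o \<Rightarrow> 'a"
  pr2 :: "'o \<Rightarrow> 'o \<Rightarrow> 'a"

definition chosen_products :: "('o, 'a) cat \<Rightarrow> ('o, 'a) products \<Rightarrow> bool" where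
  "chosen_products C P \<longleftrightarrow> is_terminal C (one P) \<and>
     (\<forall>A\<in>Obj C. \<forall>B\<in>Obj C. is_product C A B (prd P A B) (pr1 P A B) (pr2 P A B))"

definition tuple :: "('o, 'a) cat \<Rightarrow> ('o, 'a) products \<Rightarrow> 'a \<Rightarrow> 'a \<Rightarrow> 'a" where
  "tuple C P f g = (THE h. h \<in> Hom C (Dom C f) (prd P (Cod C f) (Cod C g)) \<and>
     pr1 P (Cod C f) (Cod C g) \<cdot>\<^bsub>C\<^esub> h = f \<and> pr2 P (Cod C f) (Cod C g) \<cdot>\<^bsub>C\<^esub> h = g)"

definition cartesian :: "('o, 'a) cat \<Rightarrow> ('o, 'a) products \<Rightarrow> ('o, 'a) braided_structure" where
  "cartesian C P =
     \<lparr>tobj = prd P,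
      tarr = (\<lambda>f g. tuple C P (f \<cdot>\<^bsub>C\<^esub> pr1 P (Dom C f) (Dom C g)) (g \<cdot>\<^bsub>C\<^esub> pr2 P (Dom C f) (Dom C g))),
      tunit = one P,
      assoc = (\<lambda>A B D. tuple C P (pr1 P A B \<cdot>\<^bsub>C\<^esub> pr1 P (prd P A B) D)
                 (tuple C P (pr2 P A B \<cdot>\<^bsub>C\<^esub> pr1 P (prd P A B) D) (pr2 P (prd P A B) D))),
      lunit = (\<lambda>A. pr2 P (one P) A),
      runit = (\<lambda>A. pr1 P A (one P)),
      braid = (\<lambda>A B. tuple C P (pr2 P A B) (pr1 P A B))\<rparr>"

definition cartesian_locale_based :: "('o, 'a) cat \<Rightarrow> bool" where
  "cartesian_locale_based C \<longleftrightarrow> (\<exists>P. chosen_products C P) \<and>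
     (\<forall>P. chosen_products C P \<longrightarrow> locale_based C (cartesian C P))"

definition cartesian_small_ISub :: "'u rel \<Rightarrow> ('o, 'a) cat \<Rightarrow> bool" where
  "cartesian_small_ISub \<kappa> C \<longleftrightarrow>
     (\<forall>P. chosen_products C P \<longrightarrow> small \<kappa> (carrier (ISub C (cartesian C P))))"

end

theory Submission
  imports Defs
begin

text \<open>Why the theorem holds. Under cartesian products the subunits are the subobjects of the terminal object, because a
subterminal S satisfies S \<times> S \<cong> S \<cong> 1 \<times> S. The act map of a subunit is the projection S \<times> X \<rightarrow> X, which is monic, so
stiffness is an elementary statement about projections. What remains is that \<open>Sub 1\<close> is a frame and that a union of
subunits, tensored with X, is a colimit.

Everything about unions rests on one notion. A family of arrows into S is jointly covering when every subobject of S
through which all its members factor is the whole of S. If pulling subobjects back along f has a right adjoint, the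
universal quantification along f, then jointly covering families of monomorphisms are stable under pullback along f
(\<open>covering_pullback\<close>): a pulled back family that factors through n comes from a family that factors through the
quantification of n. With coproducts and images, small unions exist (\<open>join_exists\<close>), and arrows on the members of a
jointly covering family that agree on overlaps glue uniquely (\<open>covering_glue\<close>): the union of their graphs projects
isomorphically to S. The members of an idempotent family U give a family S \<times> X \<rightarrow> (\<Squnion>U) \<times> X that is jointly covering, as
the pullback of S \<rightarrow> \<Squnion>U along a projection, and a cocone on D(U, X) is a compatible family since the overlap of two
members is indexed by their meet, which lies in U (\<open>D_colimit\<close>). The frame law is again the adjunction
(\<open>Sub_frame\<close>). This settles cocomplete Heyting categories.

For a cocomplete elementary topos, universal quantification along f : A \<rightarrow> B of a subobject n is the equalizer of two
arrows from B to the exponential of \<Omega> by A, the transposes of the characters of the graph of f and of its restriction to n (\<open>topos_forall\<close>). It has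
the universal property not only for subobjects of B but for all arrows into B, and this alone makes covers stable under
pullback. Images are equalizers of cokernel pairs, since every monomorphism is an equalizer (\<open>topos_image\<close>). These
facts give the regular, coherent and Heyting structure together (\<open>heyting\<close>). The collection \<open>Sub 1\<close> is small because
it injects into the arrows from 1 to \<Omega>.

For a Grothendieck topos C, an equivalence with sheaves assigns to each object of C a sheaf of elements, and all that is
used afterwards is that arrows of C are the natural maps between these and that every small sheaf, on whatever type, is
realized by an object of C (locale \<open>sheaf_representation\<close>). So the equivalence is used once, and each construction is
made with elements: limits are compatible tuples, the subobject classifier consists of closed sieves, exponentials of
natural maps. A colimit is the sheaf associated with a quotient of the disjoint union of the given sheaves. It is
obtained in one step, without iterating the plus construction: a section is recorded as the set of all its local
representatives (locale \<open>quotient_sheaf\<close>).\<close>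

section \<open>Arrows, monomorphisms and pullbacks\<close>

lemma Hom_iff [simp]: "f \<in> Hom C A B \<longleftrightarrow> f \<in> Arr C \<and> Dom C f = A \<and> Cod C f = B"
  by (auto simp: Hom_def)

context category
begin

declare Dom_Obj [simp] Cod_Obj [simp]

lemma comp_arr [simp]:
  assumes "f \<in> Arr C" "g \<in> Arr C" "Cod C f = Dom C g"
  shows "g \<cdot> f \<in> Arr C" "Dom C (g \<cdot> f) = Dom C f" "Cod C (g \<cdot> f) = Cod C g"
  using Comp_Hom[of f "Dom C f" "Cod C f" g "Cod C g"] assms by auto

lemma ident_arr [simp]:
  assumes "A \<in> Obj C"
  shows "Ident C A \<in> Arr C" "Dom C (Ident C A) = A" "Cod C (Ident C A) = A"
  using Ident_Hom[OF assms] by auto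

lemma comp_ident_right [simp]: "\<lbrakk>f \<in> Arr C; Dom C f = A\<rbrakk> \<Longrightarrow> f \<cdot> Ident C A = f"
  using Comp_Ident[of f A "Cod C f"] by simp

lemma comp_ident_left [simp]: "\<lbrakk>f \<in> Arr C; Cod C f = A\<rbrakk> \<Longrightarrow> Ident C A \<cdot> f = f"
  using Ident_Comp[of f "Dom C f" A] by simp

lemma comp_assoc [simp]:
  assumes "f \<in> Arr C" "g \<in> Arr C" "h \<in> Arr C" "Cod C f = Dom C g" "Cod C g = Dom C h"
  shows "(h \<cdot> g) \<cdot> f = h \<cdot> (g \<cdot> f)"
  using Comp_assoc[of f "Dom C f" "Cod C f" g "Cod C g" h "Cod C h"] assms by simp

text \<open>Composites are kept bracketed to the right; this applies an equation to the head of such a composite.\<close>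

lemma comp_reduce:
  assumes "g \<cdot> f = e" "f \<in> Arr C" "g \<in> Arr C" "x \<in> Arr C" "Cod C f = Dom C g" "Cod C x = Dom C f"
  shows "g \<cdot> (f \<cdot> x) = e \<cdot> x"
  using assms by (metis comp_assoc)

lemma isomorphism_iff:
  "isomorphism C f \<longleftrightarrow> f \<in> Arr C \<and> (\<exists>g \<in> Arr C. Dom C g = Cod C f \<and> Cod C g = Dom C f \<and>
     g \<cdot> f = Ident C (Dom C f) \<and> f \<cdot> g = Ident C (Cod C f))"
  by (auto simp: isomorphism_def inverse_arrows_def)

lemma inverse_unique:
  assumes "inverse_arrows C f g" "inverse_arrows C f h"
  shows "g = h"
proof -
  have "g = g \<cdot> (f \<cdot> h)" using assms by (simp add: inverse_arrows_def)
  also have "\<dots> = (g \<cdot> f) \<cdot> h" using assms by (intro comp_assoc[symmetric]) (auto simp: inverse_arrows_def)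
  also have "\<dots> = h" using assms by (simp add: inverse_arrows_def)
  finally show ?thesis .
qed

lemma inv_arr_eq: "inverse_arrows C f g \<Longrightarrow> inv_arr C f = g"
  unfolding inv_arr_def using inverse_unique by blast

lemma monicD:
  assumes "monic C m" "f \<in> Arr C" "g \<in> Arr C" "Cod C f = Dom C m" "Cod C g = Dom C m"
    "Dom C f = Dom C g" "m \<cdot> f = m \<cdot> g"
  shows "f = g"
  using assms by (auto simp: monic_def)

lemma monicI:
  assumes "m \<in> Arr C"
    "\<And>f g. \<lbrakk>f \<in> Arr C; g \<in> Arr C; Cod C f = Dom C m; Cod C g = Dom C m; Dom C f = Dom C g;
      m \<cdot> f = m \<cdot> g\<rbrakk> \<Longrightarrow> f = g"
  shows "monic C m"
  using assms by (auto simp: monic_def)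

lemma monic_arr [simp]: "monic C m \<Longrightarrow> m \<in> Arr C"
  by (simp add: monic_def)

lemma monic_comp:
  assumes "monic C m" "monic C n" "Cod C n = Dom C m"
  shows "monic C (m \<cdot> n)"
proof (rule monicI)
  fix f g
  assume "f \<in> Arr C" "g \<in> Arr C" "Cod C f = Dom C (m \<cdot> n)" "Cod C g = Dom C (m \<cdot> n)"
    "Dom C f = Dom C g" "m \<cdot> n \<cdot> f = m \<cdot> n \<cdot> g"
  then show "f = g"
    using assms monicD[OF assms(1), of "n \<cdot> f" "n \<cdot> g"] monicD[OF assms(2), of f g] by simp
qed (use assms in simp)

lemma monic_cancel:
  assumes "monic C (m \<cdot> n)" "m \<in> Arr C" "n \<in> Arr C" "Cod C n = Dom C m"
  shows "monic C n"
proof (rule monicI)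
  fix f g
  assume "f \<in> Arr C" "g \<in> Arr C" "Cod C f = Dom C n" "Cod C g = Dom C n"
    "Dom C f = Dom C g" "n \<cdot> f = n \<cdot> g"
  then show "f = g" using assms monicD[OF assms(1), of f g] by simp
qed (use assms in simp)

lemma iso_monic: "isomorphism C f \<Longrightarrow> monic C f"
proof (rule monicI)
  fix g h
  assume f: "isomorphism C f" and gh: "g \<in> Arr C" "h \<in> Arr C" "Cod C g = Dom C f" "Cod C h = Dom C f"
    "Dom C g = Dom C h" "f \<cdot> g = f \<cdot> h"
  obtain k where k: "k \<in> Arr C" "Dom C k = Cod C f" "Cod C k = Dom C f" "k \<cdot> f = Ident C (Dom C f)" "f \<in> Arr C"
    using f by (auto simp: isomorphism_iff)
  have "k \<cdot> (f \<cdot> g) = g" "k \<cdot> (f \<cdot> h) = h" using k gh(1-5) by (simp_all add: comp_reduce[OF k(4)])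
  then show "g = h" using gh(6) by metis
qed (simp add: isomorphism_iff)

lemma ident_monic: "A \<in> Obj C \<Longrightarrow> monic C (Ident C A)"
  by (rule monicI) auto

lemma factors_iff:
  "factors_through C f m \<longleftrightarrow> (\<exists>k \<in> Arr C. Dom C k = Dom C f \<and> Cod C k = Dom C m \<and> m \<cdot> k = f)"
  by (auto simp: factors_through_def)

lemma factors_refl [simp]: "f \<in> Arr C \<Longrightarrow> factors_through C f f"
  unfolding factors_iff by (rule bexI[of _ "Ident C (Dom C f)"]) auto

lemma factors_comp [simp]:
  "\<lbrakk>m \<in> Arr C; k \<in> Arr C; Cod C k = Dom C m\<rbrakk> \<Longrightarrow> factors_through C (m \<cdot> k) m"
  unfolding factors_iff by auto

lemma factors_trans:
  assumes "factors_through C f m" "factors_through C m n" "f \<in> Arr C" "m \<in> Arr C" "n \<in> Arr C"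
  shows "factors_through C f n"
proof -
  obtain k l where "k \<in> Arr C" "Dom C k = Dom C f" "Cod C k = Dom C m" "m \<cdot> k = f"
    "l \<in> Arr C" "Dom C l = Dom C m" "Cod C l = Dom C n" "n \<cdot> l = m"
    using assms by (auto simp: factors_iff)
  then show ?thesis using assms unfolding factors_iff by (intro bexI[of _ "l \<cdot> k"]) (auto simp flip: comp_assoc)
qed

lemma factors_precomp:
  "\<lbrakk>factors_through C f m; f \<in> Arr C; m \<in> Arr C; g \<in> Arr C; Cod C g = Dom C f\<rbrakk> \<Longrightarrow> factors_through C (f \<cdot> g) m"
  by (rule factors_trans[of _ f]) auto

lemma factors_cod: "\<lbrakk>factors_through C f m; m \<in> Arr C\<rbrakk> \<Longrightarrow> Cod C f = Cod C m"
  by (auto simp: factors_iff)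

lemma factors_comp_monic:
  assumes "monic C m" "monic C n" "Cod C n = Dom C m" "f \<in> Arr C" "Cod C f = Dom C m"
  shows "factors_through C (m \<cdot> f) (m \<cdot> n) \<longleftrightarrow> factors_through C f n"
proof
  assume "factors_through C (m \<cdot> f) (m \<cdot> n)"
  then obtain k where "k \<in> Arr C" "Dom C k = Dom C f" "Cod C k = Dom C n" "m \<cdot> n \<cdot> k = m \<cdot> f"
    using assms by (auto simp: factors_iff)
  then show "factors_through C f n"
    using assms monicD[OF assms(1), of "n \<cdot> k" f] unfolding factors_iff by auto
next
  assume "factors_through C f n"
  then show "factors_through C (m \<cdot> f) (m \<cdot> n)"
    using assms unfolding factors_iff by auto
qed

lemma split_monic_iso:
  assumes "monic C m" "factors_through C (Ident C (Cod C m)) m"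
  shows "isomorphism C m"
proof -
  obtain k where k: "k \<in> Arr C" "Dom C k = Cod C m" "Cod C k = Dom C m" "m \<cdot> k = Ident C (Cod C m)"
    using assms by (auto simp: factors_iff)
  have "k \<cdot> m = Ident C (Dom C m)"
    by (rule monicD[OF assms(1)]) (use k assms in \<open>auto simp flip: comp_assoc\<close>)
  with k assms show ?thesis by (auto simp: isomorphism_iff)
qed

lemma iso_factors:
  assumes "isomorphism C m" "f \<in> Arr C" "Cod C f = Cod C m"
  shows "factors_through C f m"
proof -
  obtain k where k: "k \<in> Arr C" "Dom C k = Cod C m" "Cod C k = Dom C m" "m \<cdot> k = Ident C (Cod C m)" "m \<in> Arr C"
    using assms by (auto simp: isomorphism_iff)
  then show ?thesis unfolding factors_iff using assms
    by (intro bexI[of _ "k \<cdot> f"]) (auto simp flip: comp_assoc)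
qed

lemma pullbackD:
  assumes "is_pullback C f g p q"
  shows "f \<in> Arr C" "g \<in> Arr C" "p \<in> Arr C" "q \<in> Arr C" "Cod C f = Cod C g" "Cod C p = Dom C f"
    "Cod C q = Dom C g" "Dom C q = Dom C p" "f \<cdot> p = g \<cdot> q"
  using assms by (auto simp: is_pullback_def)

lemma pullback_univ:
  assumes "is_pullback C f g p q" "x \<in> Arr C" "y \<in> Arr C" "Cod C x = Dom C f" "Cod C y = Dom C g"
    "Dom C x = Dom C y" "f \<cdot> x = g \<cdot> y"
  obtains h where "h \<in> Arr C" "Dom C h = Dom C x" "Cod C h = Dom C p" "p \<cdot> h = x" "q \<cdot> h = y"
proof -
  have "\<exists>!h. h \<in> Hom C (Dom C x) (Dom C p) \<and> p \<cdot> h = x \<and> q \<cdot> h = y"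
    using assms unfolding is_pullback_def by auto
  then show ?thesis using that by auto
qed

lemma pullback_ext:
  assumes pb: "is_pullback C f g p q" and hk: "h \<in> Arr C" "k \<in> Arr C" "Cod C h = Dom C p" "Cod C k = Dom C p"
    "Dom C h = Dom C k" "p \<cdot> h = p \<cdot> k" "q \<cdot> h = q \<cdot> k"
  shows "h = k"
proof -
  note [simp] = pullbackD(1-8)[OF pb]
  have "f \<cdot> (p \<cdot> h) = g \<cdot> (q \<cdot> h)"
    using pullbackD(9)[OF pb] hk by (simp flip: comp_assoc)
  then have "\<exists>!l. l \<in> Hom C (Dom C h) (Dom C p) \<and> p \<cdot> l = p \<cdot> h \<and> q \<cdot> l = q \<cdot> h"
    using pb hk unfolding is_pullback_def by auto
  then show ?thesis using hk by auto
qed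

lemma pullbackI:
  assumes "f \<in> Arr C" "g \<in> Arr C" "p \<in> Arr C" "q \<in> Arr C" "Cod C f = Cod C g" "Cod C p = Dom C f"
    "Cod C q = Dom C g" "Dom C q = Dom C p" "f \<cdot> p = g \<cdot> q"
    and ex: "\<And>x y. \<lbrakk>x \<in> Arr C; y \<in> Arr C; Cod C x = Dom C f; Cod C y = Dom C g; Dom C x = Dom C y;
      f \<cdot> x = g \<cdot> y\<rbrakk> \<Longrightarrow> \<exists>h \<in> Arr C. Dom C h = Dom C x \<and> Cod C h = Dom C p \<and> p \<cdot> h = x \<and> q \<cdot> h = y"
    and un: "\<And>h k. \<lbrakk>h \<in> Arr C; k \<in> Arr C; Cod C h = Dom C p; Cod C k = Dom C p; Dom C h = Dom C k;
      p \<cdot> h = p \<cdot> k; q \<cdot> h = q \<cdot> k\<rbrakk> \<Longrightarrow> h = k"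
  shows "is_pullback C f g p q"
  unfolding is_pullback_def
proof (intro conjI allI ballI impI)
  fix X x y assume x: "x \<in> Hom C X (Dom C f)" and y: "y \<in> Hom C X (Dom C g)" and e: "f \<cdot> x = g \<cdot> y"
  obtain h where "h \<in> Arr C" "Dom C h = Dom C x" "Cod C h = Dom C p" "p \<cdot> h = x" "q \<cdot> h = y"
    using ex[of x y] x y e by auto
  then show "\<exists>!h. h \<in> Hom C X (Dom C p) \<and> p \<cdot> h = x \<and> q \<cdot> h = y"
    using x un by (intro ex1I[of _ h]) auto
qed (use assms in auto)

lemma pullback_sym: "is_pullback C f g p q \<Longrightarrow> is_pullback C g f q p"
  by (rule pullbackI) (auto dest: pullbackD elim: pullback_univ intro: pullback_ext simp: pullbackD)

text \<open>Pulling back a monomorphism is taking an inverse image. This reduces statements about pullbacks of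
  subobjects to statements about generalized elements.\<close>

lemma pullback_factors:
  assumes pb: "is_pullback C f m p q" and m: "monic C m" and x: "x \<in> Arr C" "Cod C x = Dom C f"
  shows "factors_through C x p \<longleftrightarrow> factors_through C (f \<cdot> x) m"
proof
  note [simp] = pullbackD(1-8)[OF pb]
  assume "factors_through C x p"
  then obtain k where "k \<in> Arr C" "Dom C k = Dom C x" "Cod C k = Dom C p" "p \<cdot> k = x" by (auto simp: factors_iff)
  then have "f \<cdot> x = m \<cdot> (q \<cdot> k)" using pullbackD(9)[OF pb] by (simp flip: comp_assoc) (metis (full_types) \<open>p \<cdot> k = x\<close> comp_assoc pullbackD[OF pb])
  then show "factors_through C (f \<cdot> x) m"
    using \<open>k \<in> Arr C\<close> \<open>Cod C k = Dom C p\<close> by simp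
next
  assume "factors_through C (f \<cdot> x) m"
  then obtain y where "y \<in> Arr C" "Dom C y = Dom C x" "Cod C y = Dom C m" "m \<cdot> y = f \<cdot> x"
    using x pullbackD[OF pb] by (auto simp: factors_iff)
  then obtain h where "h \<in> Arr C" "Dom C h = Dom C x" "Cod C h = Dom C p" "p \<cdot> h = x"
    using pullback_univ[OF pb, of x y] x by metis
  then show "factors_through C x p" by (auto simp: factors_iff)
qed

lemma pullback_monic:
  assumes pb: "is_pullback C f m p q" and m: "monic C m"
  shows "monic C p"
proof (rule monicI)
  note [simp] = pullbackD(1-8)[OF pb]
  fix h k
  assume hk: "h \<in> Arr C" "k \<in> Arr C" "Cod C h = Dom C p" "Cod C k = Dom C p" "Dom C h = Dom C k" "p \<cdot> h = p \<cdot> k"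
  have "m \<cdot> (q \<cdot> h) = m \<cdot> (q \<cdot> k)"
    using pullbackD(9)[OF pb] hk by (metis comp_assoc pullbackD[OF pb])
  then have "q \<cdot> h = q \<cdot> k" using hk monicD[OF m, of "q \<cdot> h" "q \<cdot> k"] by simp
  with hk show "h = k" using pullback_ext[OF pb, of h k] by simp
qed (use pullbackD[OF pb] in simp)

section \<open>Subobjects\<close>

lemma subobject_iff:
  "n \<in> subobject C m \<longleftrightarrow> monic C n \<and> Cod C n = Cod C m \<and> factors_through C n m \<and> factors_through C m n"
  by (simp add: subobject_def)

lemma subobject_self [simp]: "monic C m \<Longrightarrow> m \<in> subobject C m"
  by (simp add: subobject_iff)

lemma subobject_eqI:
  assumes "monic C m" "monic C n" "factors_through C n m" "factors_through C m n"
  shows "subobject C m = subobject C n"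
proof -
  have "x \<in> subobject C m \<longleftrightarrow> x \<in> subobject C n" for x
    using assms factors_trans[of x m n] factors_trans[of x n m] factors_trans[of m n x] factors_trans[of n m x]
      factors_cod[OF assms(3)]
    unfolding subobject_iff by auto
  then show ?thesis by auto
qed

lemma subobject_eq_mem: "\<lbrakk>monic C m; n \<in> subobject C m\<rbrakk> \<Longrightarrow> subobject C n = subobject C m"
  by (rule subobject_eqI) (auto simp: subobject_iff)

lemma sub_le_iff:
  assumes "monic C m" "monic C n"
  shows "sub_le C (subobject C m) (subobject C n) \<longleftrightarrow> factors_through C m n"
proof
  assume "sub_le C (subobject C m) (subobject C n)"
  then obtain a b where "a \<in> subobject C m" "b \<in> subobject C n" "factors_through C a b" by (auto simp: sub_le_def)
  then have "factors_through C m b" using assms factors_trans[of m a b] by (auto simp: subobject_iff)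
  then show "factors_through C m n"
    using assms \<open>b \<in> _\<close> factors_trans[of m b n] by (auto simp: subobject_iff)
qed (use assms subobject_self in \<open>unfold sub_le_def, blast\<close>)

lemma carrier_Sub: "carrier (Sub C A) = subobject C ` {m. monic C m \<and> Cod C m = A}"
  by (simp add: Sub_def)

lemma le_Sub [simp]: "le (Sub C A) = sub_le C"
  by (simp add: Sub_def)

lemma Sub_memE:
  assumes "u \<in> carrier (Sub C A)"
  obtains m where "u = subobject C m" "monic C m" "Cod C m = A"
  using assms by (auto simp: carrier_Sub)

lemma Sub_memI: "\<lbrakk>monic C m; Cod C m = A\<rbrakk> \<Longrightarrow> subobject C m \<in> carrier (Sub C A)"
  by (auto simp: carrier_Sub)

lemma Sub_rep:
  assumes "u \<in> carrier (Sub C A)" "m \<in> u"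
  shows "monic C m" "Cod C m = A" "subobject C m = u"
proof -
  obtain n where n: "u = subobject C n" "monic C n" "Cod C n = A" using assms by (rule_tac Sub_memE)
  then have m: "m \<in> subobject C n" using assms by simp
  show "monic C m" "Cod C m = A" using m n by (simp_all add: subobject_iff)
  show "subobject C m = u" using subobject_eq_mem[OF n(2) m] n by simp
qed

lemma Sub_le_rep:
  assumes "u \<in> carrier (Sub C A)" "v \<in> carrier (Sub C B)" "m \<in> u" "n \<in> v"
  shows "sub_le C u v \<longleftrightarrow> factors_through C m n"
  using assms Sub_rep sub_le_iff by metis

lemma Sub_partial_order: "partial_order (Sub C A)"
proof -
  have eq: "eq (Sub C A) = (=)" by (simp add: Sub_def)
  show ?thesis
  proof (unfold_locales; (simp only: eq)?)
    fix x assume "x \<in> carrier (Sub C A)" then show "le (Sub C A) x x"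
      by (elim Sub_memE) (simp add: sub_le_iff)
  next
    fix x y assume le: "le (Sub C A) x y" "le (Sub C A) y x" and mem: "x \<in> carrier (Sub C A)" "y \<in> carrier (Sub C A)"
    obtain a b where "x = subobject C a" "y = subobject C b" "monic C a" "monic C b"
      using mem by (elim Sub_memE) blast
    then show "x = y" using le subobject_eqI[of a b] sub_le_iff by (metis le_Sub)
  next
    fix x y z assume le: "le (Sub C A) x y" "le (Sub C A) y z"
      and mem: "x \<in> carrier (Sub C A)" "y \<in> carrier (Sub C A)" "z \<in> carrier (Sub C A)"
    obtain a b c where "x = subobject C a" "y = subobject C b" "z = subobject C c" "monic C a" "monic C b" "monic C c"
      using mem by (elim Sub_memE) blast
    then show "le (Sub C A) x z" using le factors_trans[of a b c] by (simp add: sub_le_iff)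
  qed
qed

text \<open>Every representative of the class of p is itself a pullback of f and m, since p may be precomposed with an
isomorphism; conversely all pullbacks of representatives of m have the same generalized elements as p.\<close>

lemma pull_subobject:
  assumes pb: "is_pullback C f m p q" and m: "monic C m"
  shows "pull C f (subobject C m) = subobject C p"
proof (intro Set.set_eqI iffI)
  note [simp] = pullbackD(1-8)[OF pb]
  fix p' assume "p' \<in> pull C f (subobject C m)"
  then obtain m' q' where m': "m' \<in> subobject C m" and pb': "is_pullback C f m' p' q'" by (auto simp: pull_def)
  note [simp] = pullbackD(1-8)[OF pb'] 
  have m'm: "monic C m'" using m' by (simp add: subobject_iff)
  have "factors_through C x p' \<longleftrightarrow> factors_through C x p" if "x \<in> Arr C" "Cod C x = Dom C f" for x
    using pullback_factors[OF pb m that] pullback_factors[OF pb' m'm that] m' that m factors_trans[of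
        "f \<cdot> x" m m'] factors_trans[of "f \<cdot> x" m' m]
    by (auto simp: subobject_iff)
  from this[of p] this[of p'] show "p' \<in> subobject C p"
    using pullback_monic[OF pb' m'm] by (auto simp: subobject_iff)
next
  note [simp] = pullbackD(1-8)[OF pb]
  fix n assume n: "n \<in> subobject C p"
  obtain k where k: "k \<in> Arr C" "Dom C k = Dom C n" "Cod C k = Dom C p" "p \<cdot> k = n"
    using n by (auto simp: subobject_iff factors_iff)
  have nm: "monic C n" "Cod C n = Dom C f" using n by (auto simp: subobject_iff)
  have "is_pullback C f m n (q \<cdot> k)"
  proof (rule pullbackI)
    show "f \<cdot> n = m \<cdot> (q \<cdot> k)"
      using k pullbackD(9)[OF pb] by (metis comp_assoc pullbackD[OF pb])
  next
    fix x y assume xy: "x \<in> Arr C" "y \<in> Arr C" "Cod C x = Dom C f" "Cod C y = Dom C m" "Dom C x = Dom C y"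
        "f \<cdot> x = m \<cdot> y"
    obtain h where "h \<in> Arr C" "Dom C h = Dom C x" "Cod C h = Dom C p" "p \<cdot> h = x" "q \<cdot> h = y"
      using pullback_univ[OF pb xy] by metis
    then have "factors_through C x p" by (auto simp: factors_iff)
    then have "factors_through C x n" using n xy factors_trans[of x p n] by (auto simp: subobject_iff)
    then obtain l where l: "l \<in> Arr C" "Dom C l = Dom C x" "Cod C l = Dom C n" "n \<cdot> l = x" by (auto simp: factors_iff)
    have "p \<cdot> (k \<cdot> l) = x" using k l by (simp flip: comp_assoc)
    then have "k \<cdot> l = h" using \<open>p \<cdot> h = x\<close> pullback_monic[OF pb m] k l \<open>h \<in> Arr C\<close> \<open>Dom C h = Dom C x\<close> \<open>Cod C h = Dom C p\<close> monicD[of p "k \<cdot> l" h] by simp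
    then show "\<exists>h\<in>Arr C. Dom C h = Dom C x \<and> Cod C h = Dom C n \<and> n \<cdot> h = x \<and> q \<cdot> k \<cdot> h = y"
      using l k \<open>q \<cdot> h = y\<close> by (intro bexI[of _ l]) auto
  next
    fix h l assume "h \<in> Arr C" "l \<in> Arr C" "Cod C h = Dom C n" "Cod C l = Dom C n" "Dom C h = Dom C l" "n \<cdot> h = n \<cdot> l"
    then show "h = l" using nm monicD by blast
  qed (use k nm in auto)
  then show "n \<in> pull C f (subobject C m)" using m by (auto simp: pull_def)
qed

end

section \<open>Small sets and limits of arbitrary shape\<close>

lemma small_inj:
  assumes "small \<kappa> B" "inj_on f A" "f ` A \<subseteq> B"
  shows "small \<kappa> A"
  using assms unfolding small_def by (meson card_of_ordLeqI card_of_ordLeq ordLeq_ordLess_trans)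

lemma small_subset: "\<lbrakk>small \<kappa> B; A \<subseteq> B\<rbrakk> \<Longrightarrow> small \<kappa> A"
  by (rule small_inj[of _ _ id]) auto

lemma small_image: "small \<kappa> A \<Longrightarrow> small \<kappa> (f ` A)"
  unfolding small_def using card_of_image ordLeq_ordLess_trans by blast

lemma small_finite:
  assumes "Cinfinite \<kappa>" "finite A"
  shows "small \<kappa> A"
  using assms unfolding small_def
  by (intro Cfinite_ordLess_Cinfinite) (auto simp: cfinite_def Field_card_of card_of_card_order_on)

lemma small_embed:
  fixes \<kappa> :: "'u rel"
  assumes "Cinfinite \<kappa>" "small \<kappa> A"
  obtains e :: "'a \<Rightarrow> 'u" where "inj_on e A"
proof -
  have "(card_of A, card_of (Field \<kappa>)) \<in> ordLeq"
    using assms unfolding small_def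
    by (meson card_of_Field_ordIso ordIso_symmetric ordLess_imp_ordLeq ordLeq_ordIso_trans)
  then obtain e :: "'a \<Rightarrow> 'u" where "inj_on e A" using card_of_ordLeq[of A "Field \<kappa>"] by blast
  then show ?thesis by (rule that)
qed

text \<open>The definitions of completeness and cocompleteness quantify over index categories on one type each. Transporting an index
category along injections of its objects and arrows yields limits and colimits of shapes on any type, which makes it
possible to take the natural indexing of each diagram.\<close>

definition transport_cat :: "('j \<Rightarrow> 'j2) \<Rightarrow> ('k \<Rightarrow> 'k2) \<Rightarrow> ('j, 'k) cat \<Rightarrow> ('j2, 'k2) cat" where
  "transport_cat a b J = (let a' = inv_into (Obj J) a; b' = inv_into (Arr J) b in
     \<lparr>Obj = a ` Obj J, Arr = b ` Arr J, Dom = (\<lambda>u. a (Dom J (b' u))), Cod = (\<lambda>u. a (Cod J (b' u))),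
      Ident = (\<lambda>x. b (Ident J (a' x))), Comp = (\<lambda>g f. b (b' g \<cdot>\<^bsub>J\<^esub> b' f))\<rparr>)"

definition transport_fctr ::
  "('j \<Rightarrow> 'j2) \<Rightarrow> ('k \<Rightarrow> 'k2) \<Rightarrow> ('j, 'k) cat \<Rightarrow> ('j, 'k, 'o, 'a) fctr \<Rightarrow> ('j2, 'k2, 'o, 'a) fctr" where
  "transport_fctr a b J F =
     \<lparr>fobj = fobj F \<circ> inv_into (Obj J) a, farr = farr F \<circ> inv_into (Arr J) b\<rparr>"

lemma Obj_transport: "Obj (transport_cat a b J) = a ` Obj J"
  by (simp add: transport_cat_def Let_def)

context
  fixes a :: "'j \<Rightarrow> 'j2" and b :: "'k \<Rightarrow> 'k2" and J :: "('j, 'k) cat"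
  assumes J: "category J" and a: "inj_on a (Obj J)" and b: "inj_on b (Arr J)"
begin

interpretation J: category J by (rule J)

lemma transport_category: "category (transport_cat a b J)"
proof
  fix f A B D E g h
  assume "f \<in> Hom (transport_cat a b J) A B" "g \<in> Hom (transport_cat a b J) B D" "h \<in> Hom (transport_cat a b J) D E"
  then obtain f' g' h' where "f' \<in> Arr J" "g' \<in> Arr J" "h' \<in> Arr J" "f = b f'" "g = b g'" "h = b h'"
     "a (Cod J f') = a (Dom J g')" "a (Cod J g') = a (Dom J h')"
    using b by (auto simp: transport_cat_def Let_def)
  then show "h \<cdot>\<^bsub>transport_cat a b J\<^esub> (g \<cdot>\<^bsub>transport_cat a b J\<^esub> f) =
      h \<cdot>\<^bsub>transport_cat a b J\<^esub> g \<cdot>\<^bsub>transport_cat a b J\<^esub> f"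
    using a b inj_onD[OF a] by (simp add: transport_cat_def Let_def)
qed (use a b inj_onD[OF a] in \<open>auto simp: transport_cat_def Let_def\<close>)

lemma transport_functor: "is_functor J C F \<Longrightarrow> is_functor (transport_cat a b J) C (transport_fctr a b J F)"
  using transport_category a b inj_onD[OF a] unfolding is_functor_def
  by (auto simp: transport_cat_def transport_fctr_def Let_def)

lemma transport_cocone:
  "is_cocone (transport_cat a b J) C (transport_fctr a b J F) L i \<longleftrightarrow> is_cocone J C F L (i \<circ> a)"
  using a b by (auto simp: is_cocone_def transport_cat_def transport_fctr_def Let_def)

lemma transport_cone:
  "is_cone (transport_cat a b J) C (transport_fctr a b J F) L i \<longleftrightarrow> is_cone J C F L (i \<circ> a)"
  using a b by (auto simp: is_cone_def transport_cat_def transport_fctr_def Let_def)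

lemma transport_cocone': "is_cocone J C F X x \<Longrightarrow> is_cocone J C F X (x \<circ> inv_into (Obj J) a \<circ> a)"
  using a by (auto simp: is_cocone_def)

lemma transport_cone': "is_cone J C F X x \<Longrightarrow> is_cone J C F X (x \<circ> inv_into (Obj J) a \<circ> a)"
  using a by (auto simp: is_cone_def)

lemma transport_colimit:
  assumes "is_colimit (transport_cat a b J) C (transport_fctr a b J F) L i"
  shows "is_colimit J C F L (i \<circ> a)"
  unfolding is_colimit_def
proof (intro conjI allI impI)
  show "is_cocone J C F L (i \<circ> a)" using assms by (simp add: is_colimit_def transport_cocone)
next
  fix X x assume "is_cocone J C F X x"
  then have "is_cocone (transport_cat a b J) C (transport_fctr a b J F) X (x \<circ> inv_into (Obj J) a)"
    unfolding transport_cocone by (rule transport_cocone')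
  then have "\<exists>!h. h \<in> Hom C L X \<and> (\<forall>j\<in>a ` Obj J. h \<cdot>\<^bsub>C\<^esub> i j = x (inv_into (Obj J) a j))"
    using conjunct2[OF assms[unfolded is_colimit_def Obj_transport], rule_format, of X "x \<circ> inv_into (Obj J) a"]
    by (simp only: comp_apply)
  then show "\<exists>!h. h \<in> Hom C L X \<and> (\<forall>j\<in>Obj J. h \<cdot>\<^bsub>C\<^esub> (i \<circ> a) j = x j)"
    using a by simp
qed

lemma transport_limit:
  assumes "is_limit (transport_cat a b J) C (transport_fctr a b J F) L i"
  shows "is_limit J C F L (i \<circ> a)"
  unfolding is_limit_def
proof (intro conjI allI impI)
  show "is_cone J C F L (i \<circ> a)" using assms by (simp add: is_limit_def transport_cone)
next
  fix X x assume "is_cone J C F X x"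
  then have "is_cone (transport_cat a b J) C (transport_fctr a b J F) X (x \<circ> inv_into (Obj J) a)"
    unfolding transport_cone by (rule transport_cone')
  then have "\<exists>!h. h \<in> Hom C X L \<and> (\<forall>j\<in>a ` Obj J. i j \<cdot>\<^bsub>C\<^esub> h = x (inv_into (Obj J) a j))"
    using conjunct2[OF assms[unfolded is_limit_def Obj_transport], rule_format, of X "x \<circ> inv_into (Obj J) a"]
    by (simp only: comp_apply)
  then show "\<exists>!h. h \<in> Hom C X L \<and> (\<forall>j\<in>Obj J. (i \<circ> a) j \<cdot>\<^bsub>C\<^esub> h = x j)"
    using a by simp
qed

end

lemma cocomplete_colimit:
  assumes "cocomplete \<kappa> C" "Cinfinite \<kappa>" "category J" "small \<kappa> (Obj J)" "small \<kappa> (Arr J)" "is_functor J C F"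
  obtains L i where "is_colimit J C F L i"
proof -
  obtain a :: "_ \<Rightarrow> 'a" where a: "inj_on a (Obj J)" using small_embed assms by blast
  obtain b :: "_ \<Rightarrow> 'a" where b: "inj_on b (Arr J)" using small_embed assms by blast
  have "small \<kappa> (Obj (transport_cat a b J))" "small \<kappa> (Arr (transport_cat a b J))"
    using assms small_image by (auto simp: transport_cat_def Let_def)
  then obtain L i where "is_colimit (transport_cat a b J) C (transport_fctr a b J F) L i"
    using assms(1) transport_category[OF assms(3) a b] transport_functor[OF assms(3) a b assms(6)]
    unfolding cocomplete_def by blast
  then show ?thesis by (intro that[OF transport_colimit[OF assms(3) a b]])
qed

lemma finitely_complete_limit:
  assumes "finitely_complete C" "category J" "finite (Obj J)" "finite (Arr J)" "is_functor J C F"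
  obtains L p where "is_limit J C F L p"
proof -
  obtain a :: "_ \<Rightarrow> nat" where a: "inj_on a (Obj J)" using finite_imp_inj_to_nat_seg assms by blast
  obtain b :: "_ \<Rightarrow> nat" where b: "inj_on b (Arr J)" using finite_imp_inj_to_nat_seg assms by blast
  have "finite (Obj (transport_cat a b J))" "finite (Arr (transport_cat a b J))"
    using assms by (auto simp: transport_cat_def Let_def)
  then obtain L i where "is_limit (transport_cat a b J) C (transport_fctr a b J F) L i"
    using assms(1) transport_category[OF assms(2) a b] transport_functor[OF assms(2) a b assms(5)]
    unfolding finitely_complete_def by blast
  then show ?thesis by (intro that[OF transport_limit[OF assms(2) a b]])
qed

text \<open>The arrow from x to y is the pair (x, y). Discrete diagrams, cospans and spans have this form.\<close>

definition preorder_cat :: "'x set \<Rightarrow> ('x \<times> 'x) set \<Rightarrow> ('x, 'x \<times> 'x) cat" where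
  "preorder_cat S R =
     \<lparr>Obj = S, Arr = R, Dom = fst, Cod = snd, Ident = (\<lambda>x. (x, x)), Comp = (\<lambda>g f. (fst f, snd g))\<rparr>"

lemma preorder_category: "\<lbrakk>R \<subseteq> S \<times> S; \<And>x. x \<in> S \<Longrightarrow> (x, x) \<in> R; trans R\<rbrakk> \<Longrightarrow> category (preorder_cat S R)"
  by unfold_locales (auto simp: preorder_cat_def dest: transD)

lemma preorder_sel [simp]: "Obj (preorder_cat S R) = S" "Arr (preorder_cat S R) = R"
  "Dom (preorder_cat S R) = fst" "Cod (preorder_cat S R) = snd"
  "Ident (preorder_cat S R) x = (x, x)" "Comp (preorder_cat S R) g f = (fst f, snd g)"
  by (auto simp: preorder_cat_def)

lemma all_bool_option: "(\<forall>x. P x) \<longleftrightarrow> P None \<and> P (Some True) \<and> P (Some False)"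
  by (metis (full_types) not_None_eq)

locale finitely_complete_category = category +
  assumes fin_complete: "finitely_complete C"
begin

lemma terminal_exists: "\<exists>T. is_terminal C T"
proof -
  let ?J = "preorder_cat ({} :: nat set) {}"
  let ?F = "\<lparr>fobj = undefined, farr = undefined\<rparr> :: (nat, nat \<times> nat, 'a, 'b) fctr"
  have J: "category ?J" by (rule preorder_category) auto
  have F: "is_functor ?J C ?F" using J category_axioms by (simp add: is_functor_def)
  obtain L p where "is_limit ?J C ?F L p" using finitely_complete_limit[OF fin_complete J _ _ F] by auto
  then have "is_terminal C L" unfolding is_terminal_def is_limit_def is_cone_def by auto
  then show ?thesis ..
qed

lemma product_exists:
  assumes "A \<in> Obj C" "B \<in> Obj C"
  shows "\<exists>P p q. is_product C A B P p q"
proof -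
  let ?J = "preorder_cat (UNIV :: bool set) Id"
  let ?F = "\<lparr>fobj = (\<lambda>x. if x then A else B), farr = (\<lambda>u. Ident C (if fst u then A else B))\<rparr> :: (bool, bool \<times> bool, 'a, 'b) fctr"
  have J: "category ?J" by (rule preorder_category) (auto simp: trans_Id)
  have F: "is_functor ?J C ?F" using J category_axioms assms by (auto simp: is_functor_def)
  obtain L p where lim: "is_limit ?J C ?F L p" using finitely_complete_limit[OF fin_complete J _ _ F] by auto
  have c: "is_cone ?J C ?F X x \<longleftrightarrow> X \<in> Obj C \<and> x True \<in> Hom C X A \<and> x False \<in> Hom C X B" for X x
    by (auto simp: is_cone_def all_bool_eq)
  have "is_product C A B L (p True) (p False)"
    unfolding is_product_def
  proof (intro conjI allI ballI)
    fix X f g assume f: "f \<in> Hom C X A" and g: "g \<in> Hom C X B"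
    have "is_cone ?J C ?F X (\<lambda>x. if x then f else g)" using f g by (auto simp: c)
    then have "\<exists>!h. h \<in> Hom C X L \<and> (\<forall>j\<in>UNIV. p j \<cdot> h = (if j then f else g))"
      using lim by (simp add: is_limit_def)
    then show "\<exists>!h. h \<in> Hom C X L \<and> p True \<cdot> h = f \<and> p False \<cdot> h = g" by (simp add: all_bool_eq conj_commute)
  qed (use lim in \<open>auto simp: is_limit_def c\<close>)
  then show ?thesis by blast
qed

lemma pullback_exists:
  assumes "f \<in> Arr C" "g \<in> Arr C" "Cod C f = Cod C g"
  shows "\<exists>p q. is_pullback C f g p q"
proof -
  let ?J = "preorder_cat (UNIV :: bool option set) {(x, y). x = y \<or> y = None}"
  let ?o = "\<lambda>x. case x of None \<Rightarrow> Cod C f | Some True \<Rightarrow> Dom C f | Some False \<Rightarrow> Dom C g"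
  let ?a = "\<lambda>(x, y). if x = y then Ident C (?o x) else if x = Some True then f else g"
  let ?F = "\<lparr>fobj = ?o, farr = ?a\<rparr> :: (bool option, bool option \<times> bool option, 'a, 'b) fctr"
  have J: "category ?J" by (rule preorder_category) (auto simp: trans_def)
  have F: "is_functor ?J C ?F" using J category_axioms assms
      by (auto simp: is_functor_def split: option.splits bool.splits)
  obtain L p where lim: "is_limit ?J C ?F L p" using finitely_complete_limit[OF fin_complete J _ _ F] by auto
  have c: "is_cone ?J C ?F X x \<longleftrightarrow> X \<in> Obj C \<and> x (Some True) \<in> Hom C X (Dom C f) \<and>
      x (Some False) \<in> Hom C X (Dom C g) \<and> x None \<in> Hom C X (Cod C f) \<and>
      f \<cdot> x (Some True) = x None \<and> g \<cdot> x (Some False) = x None" for X x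
    using assms by (auto simp: is_cone_def all_bool_option)
  note pc = lim[unfolded is_limit_def c]
  have "is_pullback C f g (p (Some True)) (p (Some False))"
    unfolding is_pullback_def
  proof (intro conjI allI ballI impI)
    fix X x y assume x: "x \<in> Hom C X (Dom C f)" and y: "y \<in> Hom C X (Dom C g)" and e: "f \<cdot> x = g \<cdot> y"
    let ?x = "case_option (f \<cdot> x) (\<lambda>b. if b then x else y)"
    have "is_cone ?J C ?F X ?x" using x y e assms by (auto simp: c)
    then have "\<exists>!h. h \<in> Hom C X L \<and> (\<forall>j\<in>UNIV. p j \<cdot> h = ?x j)"
      using lim by (simp add: is_limit_def del: Hom_iff)
    moreover have "p None \<cdot> h = f \<cdot> (p (Some True) \<cdot> h)" if "h \<in> Hom C X L" for h
      using that pc assms comp_reduce[of f "p (Some True)" "p None" h] by simp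
    then have "h \<in> Hom C X L \<and> (\<forall>j\<in>UNIV. p j \<cdot> h = ?x j) \<longleftrightarrow> h \<in> Hom C X L \<and> p (Some True) \<cdot> h = x \<and>
        p (Some False) \<cdot> h = y" for h
      by (cases "h \<in> Hom C X L") (auto simp: all_bool_option simp del: Hom_iff)
    ultimately show "\<exists>!h. h \<in> Hom C X (Dom C (p (Some True))) \<and> p (Some True) \<cdot> h = x \<and> p (Some False) \<cdot> h = y"
        using pc by auto
  qed (use pc assms in auto)
  then show ?thesis by blast
qed

end

text \<open>An arbitrary product cone is assumed here, so that the rules serve every choice of products.\<close>

context category
begin

lemma productD:
  assumes "is_product C A B P p q"
  shows "p \<in> Arr C" "q \<in> Arr C" "Dom C p = P" "Dom C q = P" "Cod C p = A" "Cod C q = B" "P \<in> Obj C"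
  using assms by (auto simp: is_product_def)

lemma product_univ:
  assumes "is_product C A B P p q" "f \<in> Arr C" "g \<in> Arr C" "Cod C f = A" "Cod C g = B" "Dom C f = Dom C g"
  obtains h where "h \<in> Arr C" "Dom C h = Dom C f" "Cod C h = P" "p \<cdot> h = f" "q \<cdot> h = g"
proof -
  have "\<exists>!h. h \<in> Hom C (Dom C f) P \<and> p \<cdot> h = f \<and> q \<cdot> h = g"
    using assms unfolding is_product_def by auto
  then show ?thesis using that by auto
qed

lemma product_ext:
  assumes P: "is_product C A B P p q" and hk: "h \<in> Arr C" "k \<in> Arr C" "Cod C h = P" "Cod C k = P" "Dom C h = Dom C k"
    "p \<cdot> h = p \<cdot> k" "q \<cdot> h = q \<cdot> k"
  shows "h = k"
proof -
  have "\<exists>!l. l \<in> Hom C (Dom C h) P \<and> p \<cdot> l = p \<cdot> h \<and> q \<cdot> l = q \<cdot> h"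
    using P hk productD[OF P] unfolding is_product_def by auto
  then show ?thesis using hk by auto
qed

lemma terminal_univ:
  assumes "is_terminal C T" "X \<in> Obj C"
  obtains h where "h \<in> Arr C" "Dom C h = X" "Cod C h = T"
  using assms by (auto simp: is_terminal_def)

lemma terminal_ext:
  assumes "is_terminal C T" "h \<in> Arr C" "k \<in> Arr C" "Cod C h = T" "Cod C k = T" "Dom C h = Dom C k"
  shows "h = k"
  using assms Dom_Obj[of h] unfolding is_terminal_def by (metis Hom_iff)

end

context finitely_complete_category
begin

text \<open>The equalizer of f and g is the pullback of the graph of g along the graph of f.\<close>

lemma equalizer_exists:
  assumes f: "f \<in> Arr C" "g \<in> Arr C" "Dom C f = Dom C g" "Cod C f = Cod C g"
  obtains e where "monic C e" "Cod C e = Dom C f"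
    "\<And>x. \<lbrakk>x \<in> Arr C; Cod C x = Dom C f\<rbrakk> \<Longrightarrow> factors_through C x e \<longleftrightarrow> f \<cdot> x = g \<cdot> x"
proof -
  obtain P p q where P: "is_product C (Dom C f) (Cod C f) P p q" using product_exists assms by fastforce
  note [simp] = productD[OF P]
  let ?I = "Ident C (Dom C f)"
  obtain a where a: "a \<in> Arr C" "Dom C a = Dom C f" "Cod C a = P" "p \<cdot> a = ?I" "q \<cdot> a = f"
    using product_univ[OF P, of ?I f] f by auto
  obtain b where b: "b \<in> Arr C" "Dom C b = Dom C f" "Cod C b = P" "p \<cdot> b = ?I" "q \<cdot> b = g"
    using product_univ[OF P, of ?I g] f by auto
  have "monic C b" using monic_cancel[of p b] b f ident_monic by simp
  have ax: "p \<cdot> (a \<cdot> x) = x" "q \<cdot> (a \<cdot> x) = f \<cdot> x" if "x \<in> Arr C" "Cod C x = Dom C f" for x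
    using that f a by (simp_all add: comp_reduce[OF a(4)] comp_reduce[OF a(5)])
  have bx: "p \<cdot> (b \<cdot> x) = x" "q \<cdot> (b \<cdot> x) = g \<cdot> x" if "x \<in> Arr C" "Cod C x = Dom C f" for x
    using that f b by (simp_all add: comp_reduce[OF b(4)] comp_reduce[OF b(5)])
  obtain e e' where pb: "is_pullback C a b e e'" using pullback_exists a b by fastforce
  show ?thesis
  proof (rule that)
    show "monic C e" "Cod C e = Dom C f" using pullback_monic[OF pb \<open>monic C b\<close>] pullbackD[OF pb] a by auto
    fix x assume x: "x \<in> Arr C" "Cod C x = Dom C f"
    have "factors_through C (a \<cdot> x) b \<longleftrightarrow> f \<cdot> x = g \<cdot> x"
    proof
      assume "factors_through C (a \<cdot> x) b"
      then obtain k where k: "k \<in> Arr C" "Dom C k = Dom C x" "Cod C k = Dom C b" "b \<cdot> k = a \<cdot> x"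
        using a x by (auto simp: factors_iff)
      then show "f \<cdot> x = g \<cdot> x" using ax[of x] bx[of k] x b(2) by metis
    next
      assume "f \<cdot> x = g \<cdot> x"
      then have "a \<cdot> x = b \<cdot> x"
        using a b x ax[of x] bx[of x] product_ext[OF P, of "a \<cdot> x" "b \<cdot> x"] by simp
      then show "factors_through C (a \<cdot> x) b" using b x by simp
    qed
    then show "factors_through C x e \<longleftrightarrow> f \<cdot> x = g \<cdot> x"
      using pullback_factors[OF pb \<open>monic C b\<close>] a x by simp
  qed
qed

end

definition is_coproduct :: "('o, 'a) cat \<Rightarrow> 'x set \<Rightarrow> ('x \<Rightarrow> 'o) \<Rightarrow> 'o \<Rightarrow> ('x \<Rightarrow> 'a) \<Rightarrow> bool" where
  "is_coproduct C U X Q i \<longleftrightarrow> Q \<in> Obj C \<and> (\<forall>u\<in>U. i u \<in> Hom C (X u) Q) \<and>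
     (\<forall>A\<in>Obj C. \<forall>f. (\<forall>u\<in>U. f u \<in> Hom C (X u) A) \<longrightarrow>
        (\<exists>!h. h \<in> Hom C Q A \<and> (\<forall>u\<in>U. h \<cdot>\<^bsub>C\<^esub> i u = f u)))"

locale finitely_complete_cocomplete = finitely_complete_category C for C :: "('o, 'a) cat" (structure) +
  fixes \<kappa> :: "'u rel"
  assumes infinite_kappa: "Cinfinite \<kappa>" and cocomplete_kappa: "cocomplete \<kappa> C"
begin

lemma coproduct_exists:
  assumes U: "small \<kappa> U" and m: "\<And>u. u \<in> U \<Longrightarrow> X u \<in> Obj C"
  shows "\<exists>Q i. is_coproduct C U X Q i"
proof -
  let ?J = "preorder_cat U (Id_on U)"
  let ?F = "\<lparr>fobj = X, farr = (\<lambda>u. Ident C (X (fst u)))\<rparr>"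
  have J: "category ?J" by (rule preorder_category) (auto simp: trans_def)
  have F: "is_functor ?J C ?F" using J category_axioms m by (auto simp: is_functor_def)
  have "small \<kappa> (Id_on U)" by (rule small_inj[OF U, of fst]) (auto simp: inj_on_def)
  then obtain Q i where colim: "is_colimit ?J C ?F Q i"
    using cocomplete_colimit[OF cocomplete_kappa infinite_kappa J _ _ F] U by auto
  have c: "is_cocone ?J C ?F A f \<longleftrightarrow> A \<in> Obj C \<and> (\<forall>u\<in>U. f u \<in> Hom C (X u) A)" for A f
    by (auto simp: is_cocone_def)
  have "is_coproduct C U X Q i"
    using colim by (auto simp: is_colimit_def is_coproduct_def c simp del: Hom_iff)
  then show ?thesis by blast
qed

lemma pushout_exists:
  assumes "f \<in> Arr C" "g \<in> Arr C" "Dom C f = Dom C g"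
  obtains i j where "i \<in> Arr C" "j \<in> Arr C" "Dom C i = Cod C f" "Dom C j = Cod C g" "Cod C i = Cod C j"
      "i \<cdot> f = j \<cdot> g"
    "\<And>x y. \<lbrakk>x \<in> Arr C; y \<in> Arr C; Dom C x = Cod C f; Dom C y = Cod C g; Cod C x = Cod C y; x \<cdot> f = y \<cdot> g\<rbrakk>
      \<Longrightarrow> \<exists>h \<in> Arr C. Dom C h = Cod C i \<and> Cod C h = Cod C x \<and> h \<cdot> i = x \<and> h \<cdot> j = y"
proof -
  let ?R = "{(x, y). x = y \<or> x = None} :: (bool option \<times> bool option) set"
  let ?J = "preorder_cat UNIV ?R"
  let ?o = "\<lambda>x. case x of None \<Rightarrow> Dom C f | Some True \<Rightarrow> Cod C f | Some False \<Rightarrow> Cod C g"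
  let ?a = "\<lambda>(x, y). if x = y then Ident C (?o x) else if y = Some True then f else g"
  let ?F = "\<lparr>fobj = ?o, farr = ?a\<rparr> :: (bool option, bool option \<times> bool option, 'o, 'a) fctr"
  have J: "category ?J" by (rule preorder_category) (auto simp: trans_def)
  have F: "is_functor ?J C ?F" using J category_axioms assms
      by (auto simp: is_functor_def split: option.splits bool.splits)
  have "small \<kappa> (UNIV :: bool option set)" "small \<kappa> ?R" by (rule small_finite[OF infinite_kappa finite])+
  then obtain Q p where colim: "is_colimit ?J C ?F Q p"
    using cocomplete_colimit[OF cocomplete_kappa infinite_kappa J _ _ F] by auto
  have c: "is_cocone ?J C ?F X x \<longleftrightarrow> X \<in> Obj C \<and> x (Some True) \<in> Hom C (Cod C f) X \<and>
      x (Some False) \<in> Hom C (Cod C g) X \<and> x None \<in> Hom C (Dom C f) X \<and>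
      x (Some True) \<cdot> f = x None \<and> x (Some False) \<cdot> g = x None" for X x
    using assms by (auto simp: is_cocone_def all_bool_option)
  note pc = colim[unfolded is_colimit_def c]
  show ?thesis
  proof (rule that[of "p (Some True)" "p (Some False)"])
    fix x y assume xy: "x \<in> Arr C" "y \<in> Arr C" "Dom C x = Cod C f" "Dom C y = Cod C g" "Cod C x = Cod C y"
        "x \<cdot> f = y \<cdot> g"
    have "is_cocone ?J C ?F (Cod C x) (case_option (x \<cdot> f) (\<lambda>b. if b then x else y))" using xy assms by (auto simp: c)
    from conjunct2[OF colim[unfolded is_colimit_def], rule_format, OF this]
    obtain h where "h \<in> Hom C Q (Cod C x)" "\<forall>j. h \<cdot> p j = case_option (x \<cdot> f) (\<lambda>b. if b then x else y) j"
      by (auto simp del: Hom_iff)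
    then show "\<exists>h \<in> Arr C. Dom C h = Cod C (p (Some True)) \<and> Cod C h = Cod C x \<and> h \<cdot> p (Some True) = x \<and>
        h \<cdot> p (Some False) = y"
      using pc by (intro bexI[of _ h]) auto
  qed (use pc in auto)
qed

end

section \<open>Jointly covering families and unions of subobjects\<close>

text \<open>A cover is a jointly covering family with one member. A family of subobjects is jointly covering when its union is
everything.\<close>

definition jointly_covering :: "('o, 'a) cat \<Rightarrow> 'o \<Rightarrow> 'a set \<Rightarrow> bool" where
  "jointly_covering C S K \<longleftrightarrow> (\<forall>k\<in>K. k \<in> Arr C \<and> Cod C k = S) \<and>
     (\<forall>n. monic C n \<and> Cod C n = S \<and> (\<forall>k\<in>K. factors_through C k n) \<longrightarrow> isomorphism C n)"

definition is_join :: "('o, 'a) cat \<Rightarrow> 'a set \<Rightarrow> 'a \<Rightarrow> bool" where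
  "is_join C M m \<longleftrightarrow> monic C m \<and> (\<forall>k\<in>M. factors_through C k m) \<and>
     (\<forall>n. monic C n \<and> Cod C n = Cod C m \<and> (\<forall>k\<in>M. factors_through C k n) \<longrightarrow> factors_through C m n)"

text \<open>The universal quantification of the subobject n along f, tested on subobjects of the codomain: this is
  exactly what a right adjoint to pulling back provides.\<close>

definition is_forall :: "('o, 'a) cat \<Rightarrow> 'a \<Rightarrow> 'a \<Rightarrow> 'a \<Rightarrow> bool" where
  "is_forall C f n d \<longleftrightarrow> monic C d \<and> Cod C d = Cod C f \<and>
     (\<forall>s p q. monic C s \<and> is_pullback C f s p q \<longrightarrow> (factors_through C s d \<longleftrightarrow> factors_through C p n))"

locale geometric_category = finitely_complete_cocomplete +
  assumes image_exists: "f \<in> Arr C \<Longrightarrow> \<exists>m. is_image C f m"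
    and forall_exists: "\<lbrakk>f \<in> Arr C; monic C n; Cod C n = Dom C f\<rbrakk> \<Longrightarrow> \<exists>d. is_forall C f n d"
begin

lemma pullback_of_ident:
  assumes "f \<in> Arr C"
  shows "is_pullback C f (Ident C (Cod C f)) (Ident C (Dom C f)) f"
  by (rule pullbackI) (use assms in auto)

text \<open>Let n be a subobject through which the pulled back family factors. By adjointness the family itself factors through the
universal quantification d of n along f. Hence d is everything, and so is n. The pullback of the union never has to be
computed.\<close>

lemma covering_pullback:
  assumes K: "jointly_covering C S K" "\<And>k. k \<in> K \<Longrightarrow> monic C k" and f: "f \<in> Arr C" "Cod C f = S"
  shows "jointly_covering C (Dom C f) {p. \<exists>k\<in>K. \<exists>q. is_pullback C f k p q}"
  unfolding jointly_covering_def
proof (intro conjI allI impI)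
  show "\<forall>k\<in>{p. \<exists>k\<in>K. \<exists>q. is_pullback C f k p q}. k \<in> Arr C \<and> Cod C k = Dom C f" by (auto dest: pullbackD)
next
  fix n assume n: "monic C n \<and> Cod C n = Dom C f \<and>
    (\<forall>p\<in>{p. \<exists>k\<in>K. \<exists>q. is_pullback C f k p q}. factors_through C p n)"
  obtain d where d: "is_forall C f n d" using forall_exists f n by blast
  have "factors_through C k d" if k: "k \<in> K" for k
  proof -
    obtain p q where pq: "is_pullback C f k p q"
      using pullback_exists[of f k] f k K by (auto simp: jointly_covering_def)
    then show ?thesis using d n k K(2) unfolding is_forall_def by blast
  qed
  then have "isomorphism C d" using K f d by (auto simp: jointly_covering_def is_forall_def)
  then have "factors_through C (Ident C S) d" using iso_factors[of d "Ident C S"] d f by (auto simp: is_forall_def)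
  then have "factors_through C (Ident C (Dom C f)) n"
    using d pullback_of_ident[OF f(1)] ident_monic f unfolding is_forall_def by (metis Cod_Obj)
  then show "isomorphism C n" using n split_monic_iso by metis
qed

text \<open>The family factors through the equalizer of the two arrows.\<close>

lemma covering_epic:
  assumes K: "jointly_covering C S K" and ab: "a \<in> Arr C" "b \<in> Arr C" "Dom C a = S" "Dom C b = S" "Cod C a = Cod C b"
    and eq: "\<And>k. k \<in> K \<Longrightarrow> a \<cdot> k = b \<cdot> k"
  shows "a = b"
proof -
  obtain e where e: "monic C e" "Cod C e = Dom C a"
    "\<And>x. \<lbrakk>x \<in> Arr C; Cod C x = Dom C a\<rbrakk> \<Longrightarrow> factors_through C x e \<longleftrightarrow> a \<cdot> x = b \<cdot> x"
    using equalizer_exists[of a b] ab by metis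
  have "isomorphism C e" using K ab e eq by (auto simp: jointly_covering_def)
  then have "factors_through C (Ident C S) e" using iso_factors[of e "Ident C S"] e ab Dom_Obj[of a] by auto
  then show ?thesis using e(3)[of "Ident C S"] ab Dom_Obj[of a] by simp
qed

text \<open>The union is the image of the induced arrow on the coproduct of the domains.\<close>

lemma join_exists:
  assumes I: "small \<kappa> I" and m: "\<And>i. i \<in> I \<Longrightarrow> monic C (m i)" "\<And>i. i \<in> I \<Longrightarrow> Cod C (m i) = A" and A: "A \<in> Obj C"
  obtains j where "is_join C (m ` I) j" "Cod C j = A"
proof -
  obtain Q inj where co: "is_coproduct C I (\<lambda>i. Dom C (m i)) Q inj"
    using coproduct_exists[OF I, of "\<lambda>i. Dom C (m i)"] m by auto
  then have Q: "Q \<in> Obj C" and inj: "\<And>i. i \<in> I \<Longrightarrow> inj i \<in> Hom C (Dom C (m i)) Q"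
    by (auto simp: is_coproduct_def)
  have univ: "\<exists>!h. h \<in> Hom C Q A \<and> (\<forall>i\<in>I. h \<cdot> inj i = f i)"
    if "A \<in> Obj C" "\<And>i. i \<in> I \<Longrightarrow> f i \<in> Hom C (Dom C (m i)) A" for A f
    using co that by (auto simp: is_coproduct_def)
  obtain h where h: "h \<in> Arr C" "Dom C h = Q" "Cod C h = A" "\<forall>i\<in>I. h \<cdot> inj i = m i"
    using ex1_implies_ex[OF univ[OF A, of m]] m by auto
  obtain j where j: "is_image C h j" using image_exists h by blast
  then have jm: "monic C j" "Cod C j = A" "factors_through C h j" using h by (auto simp: is_image_def)
  have "factors_through C (m i) j" if "i \<in> I" for i
    using factors_precomp[OF jm(3), of "inj i"] inj that h jm by auto
  moreover have "factors_through C j n" if n: "monic C n" "Cod C n = A" "\<forall>i\<in>I. factors_through C (m i) n" for n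
  proof -
    have "\<forall>i\<in>I. \<exists>k. k \<in> Arr C \<and> Dom C k = Dom C (m i) \<and> Cod C k = Dom C n \<and> n \<cdot> k = m i"
      using n by (auto simp: factors_iff)
    then obtain k where k: "\<forall>i\<in>I. k i \<in> Arr C \<and> Dom C (k i) = Dom C (m i) \<and> Cod C (k i) = Dom C n \<and> n \<cdot> k i = m i"
      by metis
    obtain l where l: "l \<in> Arr C" "Dom C l = Q" "Cod C l = Dom C n" "\<forall>i\<in>I. l \<cdot> inj i = k i"
      using ex1_implies_ex[OF univ[of "Dom C n" k]] n k by auto
    have "n \<cdot> l \<in> Hom C Q A \<and> (\<forall>i\<in>I. (n \<cdot> l) \<cdot> inj i = m i)" using l k n inj by simp
    moreover have "h \<in> Hom C Q A \<and> (\<forall>i\<in>I. h \<cdot> inj i = m i)" using h by simp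
    moreover have "\<exists>!h. h \<in> Hom C Q A \<and> (\<forall>i\<in>I. h \<cdot> inj i = m i)" using univ[OF A, of m] m by simp
    ultimately have "n \<cdot> l = h" by blast
    then have "factors_through C h n" using l n by (metis factors_comp monic_arr)
    then show ?thesis using j n h by (auto simp: is_image_def)
  qed
  ultimately have "is_join C (m ` I) j" using jm by (auto simp: is_join_def)
  then show ?thesis using that jm by blast
qed

text \<open>A subobject of the domain of m through which all members factor is a subobject of the codomain above all members.\<close>

lemma join_covering:
  assumes "is_join C M m" "\<And>k. k \<in> M \<Longrightarrow> k \<in> Arr C"
  shows "jointly_covering C (Dom C m) {k \<in> Arr C. Cod C k = Dom C m \<and> m \<cdot> k \<in> M}"
  unfolding jointly_covering_def
proof (intro conjI allI impI)
  fix n assume n: "monic C n \<and> Cod C n = Dom C m \<and>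
    (\<forall>k\<in>{k \<in> Arr C. Cod C k = Dom C m \<and> m \<cdot> k \<in> M}. factors_through C k n)"
  have m: "monic C m" using assms by (simp add: is_join_def)
  have "factors_through C x (m \<cdot> n)" if x: "x \<in> M" for x
  proof -
    have "factors_through C x m" using x assms(1) by (simp add: is_join_def)
    then obtain k where k: "k \<in> Arr C" "Dom C k = Dom C x" "Cod C k = Dom C m" "m \<cdot> k = x"
      unfolding factors_iff by blast
    then have "factors_through C k n" using n x by simp
    then have "factors_through C (m \<cdot> k) (m \<cdot> n)" using factors_comp_monic[of m n k] n m k(1,3) by simp
    then show ?thesis using k(4) by simp
  qed
  then have "factors_through C m (m \<cdot> n)" using assms m n monic_comp[of m n] by (auto simp: is_join_def)
  then have "factors_through C (m \<cdot> Ident C (Dom C m)) (m \<cdot> n)" using m by simp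
  then have "factors_through C (Ident C (Dom C m)) n" using factors_comp_monic[of m n "Ident C (Dom C m)"] m n by simp
  then show "isomorphism C n" using n split_monic_iso by metis
qed auto

lemma covering_mono:
  assumes "jointly_covering C S K" "\<And>k. k \<in> K \<Longrightarrow> \<exists>l \<in> L. factors_through C k l" "\<And>l. l \<in> L \<Longrightarrow> l \<in> Arr C \<and> Cod C l = S"
  shows "jointly_covering C S L"
  unfolding jointly_covering_def
proof (intro conjI allI impI)
  show "\<forall>l\<in>L. l \<in> Arr C \<and> Cod C l = S" using assms(3) by blast
  fix n assume n: "monic C n \<and> Cod C n = S \<and> (\<forall>l\<in>L. factors_through C l n)"
  have "factors_through C k n" if k: "k \<in> K" for k
  proof -
    obtain l where "l \<in> L" "factors_through C k l" using assms(2)[OF k] by blast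
    then show ?thesis using factors_trans[of k l n] assms(1,3) n k by (auto simp: jointly_covering_def)
  qed
  then show "isomorphism C n" using assms(1) n by (simp add: jointly_covering_def)
qed

text \<open>The graphs of the \<open>x i\<close> have a union inside S \<times> Y. Its projection to S is monic because the \<open>x i\<close> agree
  wherever the \<open>k i\<close> overlap. Since the \<open>k i\<close> are jointly covering and factor through it, it is an isomorphism, and the
  union is the graph of the glued arrow.\<close>

theorem covering_glue:
  assumes I: "small \<kappa> I" and S: "S \<in> Obj C" "Y \<in> Obj C"
    and k: "\<And>i. i \<in> I \<Longrightarrow> monic C (k i)" and cov: "jointly_covering C S (k ` I)"
    and x: "\<And>i. i \<in> I \<Longrightarrow> x i \<in> Hom C (Dom C (k i)) Y"
    and compat: "\<And>i j p q. \<lbrakk>i \<in> I; j \<in> I; p \<in> Arr C; q \<in> Arr C; Cod C p = Dom C (k i); Cod C q = Dom C (k j);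
      Dom C p = Dom C q; k i \<cdot> p = k j \<cdot> q\<rbrakk> \<Longrightarrow> x i \<cdot> p = x j \<cdot> q"
  shows "\<exists>!h. h \<in> Hom C S Y \<and> (\<forall>i\<in>I. h \<cdot> k i = x i)"
proof -
  have kS [simp]: "Cod C (k i) = S" if "i \<in> I" for i using cov that by (simp add: jointly_covering_def)
  obtain P p1 p2 where P: "is_product C S Y P p1 p2" using product_exists S by blast
  note [simp] = productD[OF P]
  have "\<forall>i\<in>I. \<exists>g. g \<in> Arr C \<and> Dom C g = Dom C (k i) \<and> Cod C g = P \<and> p1 \<cdot> g = k i \<and> p2 \<cdot> g = x i"
  proof
    fix i assume "i \<in> I"
    then show "\<exists>g. g \<in> Arr C \<and> Dom C g = Dom C (k i) \<and> Cod C g = P \<and> p1 \<cdot> g = k i \<and> p2 \<cdot> g = x i"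
      using product_univ[OF P, of "k i" "x i"] k x by (metis Hom_iff kS monic_arr)
  qed
  then obtain g where g: "\<And>i. i \<in> I \<Longrightarrow> g i \<in> Arr C" "\<And>i. i \<in> I \<Longrightarrow> Dom C (g i) = Dom C (k i)"
      "\<And>i. i \<in> I \<Longrightarrow> Cod C (g i) = P"
    "\<And>i. i \<in> I \<Longrightarrow> p1 \<cdot> g i = k i" "\<And>i. i \<in> I \<Longrightarrow> p2 \<cdot> g i = x i" by metis
  have gm: "monic C (g i)" if "i \<in> I" for i using monic_cancel[of p1 "g i"] g that k by simp
  obtain m where m: "is_join C (g ` I) m" "Cod C m = P"
    using join_exists[OF I, of g P] gm g by auto
  then have mm: "monic C m" by (simp add: is_join_def)
  have "\<forall>i\<in>I. \<exists>u. u \<in> Arr C \<and> Dom C u = Dom C (k i) \<and> Cod C u = Dom C m \<and> m \<cdot> u = g i"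
    using m g by (auto simp: is_join_def factors_iff)
  then obtain u where u: "\<And>i. i \<in> I \<Longrightarrow> u i \<in> Arr C" "\<And>i. i \<in> I \<Longrightarrow> Dom C (u i) = Dom C (k i)"
    "\<And>i. i \<in> I \<Longrightarrow> Cod C (u i) = Dom C m" "\<And>i. i \<in> I \<Longrightarrow> m \<cdot> u i = g i" by metis
  have um: "monic C (u i)" if "i \<in> I" for i using monic_cancel[of m "u i"] u[OF that] gm[OF that] mm by simp
  have ucov: "jointly_covering C (Dom C m) (u ` I)"
  proof (rule covering_mono[OF join_covering[OF m(1)]])
    fix v assume "v \<in> {v \<in> Arr C. Cod C v = Dom C m \<and> m \<cdot> v \<in> g ` I}"
    then obtain i where i: "i \<in> I" and v: "v \<in> Arr C" "Cod C v = Dom C m" "m \<cdot> v = g i" by auto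
    have "Dom C v = Dom C (u i)" using v u[OF i] g[OF i] mm by (metis comp_arr(2) monic_arr)
    then have "v = u i" using monicD[OF mm, of v "u i"] v u[OF i] by simp
    then show "\<exists>l\<in>u ` I. factors_through C v l" using i v by (intro bexI[of _ "u i"]) auto
  qed (use g u in auto)
  define \<pi> \<rho> where "\<pi> = p1 \<cdot> m" and "\<rho> = p2 \<cdot> m"
  have [simp]: "\<pi> \<in> Arr C" "\<rho> \<in> Arr C" "Dom C \<pi> = Dom C m" "Dom C \<rho> = Dom C m" "Cod C \<pi> = S" "Cod C \<rho> = Y"
    using mm m by (simp_all add: \<pi>_def \<rho>_def)
  have \<pi>u: "\<pi> \<cdot> u i = k i" "\<rho> \<cdot> u i = x i" if "i \<in> I" for i
    using u[OF that] g[OF that] mm m by (simp_all add: \<pi>_def \<rho>_def)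
  have "monic C \<pi>"
  proof (rule monicI)
    fix a b assume ab: "a \<in> Arr C" "b \<in> Arr C" "Cod C a = Dom C \<pi>" "Cod C b = Dom C \<pi>" "Dom C a = Dom C b"
        "\<pi> \<cdot> a = \<pi> \<cdot> b"
    \<comment> \<open>It suffices to compare a and b after restricting their common domain first to the part where a lies in the i-th graph, then
to the part where b lies in the j-th.\<close>
    have "\<rho> \<cdot> a = \<rho> \<cdot> b"
    proof (rule covering_epic[OF covering_pullback[OF ucov]])
      fix s assume "s \<in> {s. \<exists>u\<in>u ` I. \<exists>q. is_pullback C a u s q}"
      then obtain i s' where i: "i \<in> I" and s: "is_pullback C a (u i) s s'" by auto
      note [simp] = pullbackD(1-4)[OF s] pullbackD(6-8)[OF s]
      have "(\<rho> \<cdot> a) \<cdot> s = (\<rho> \<cdot> b) \<cdot> s"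
      proof (rule covering_epic[OF covering_pullback[OF ucov, of "b \<cdot> s"]])
        fix t assume "t \<in> {t. \<exists>u\<in>u ` I. \<exists>q. is_pullback C (b \<cdot> s) u t q}"
        then obtain j t' where j: "j \<in> I" and t: "is_pullback C (b \<cdot> s) (u j) t t'" by auto
        note [simp] = pullbackD(1-4)[OF t] pullbackD(6-8)[OF t]
        have dt: "Cod C t = Dom C s" using pullbackD(6)[OF t] ab by simp
        have as: "a \<cdot> (s \<cdot> t) = u i \<cdot> (s' \<cdot> t)"
          using comp_reduce[OF pullbackD(9)[OF s], of t] ab dt u[OF i] by simp
        have bs: "b \<cdot> (s \<cdot> t) = u j \<cdot> t'" using pullbackD(9)[OF t] ab dt by simp
        have "\<pi> \<cdot> (a \<cdot> (s \<cdot> t)) = \<pi> \<cdot> (b \<cdot> (s \<cdot> t))"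
          using comp_reduce[OF ab(6), of "s \<cdot> t"] ab dt by simp
        then have "k i \<cdot> (s' \<cdot> t) = k j \<cdot> t'"
          using comp_reduce[OF \<pi>u(1)[OF i], of "s' \<cdot> t"] comp_reduce[OF \<pi>u(1)[OF j], of t'] u[OF i] u[OF j] dt as bs pullbackD(7)[OF s] pullbackD(7)[OF t] by simp
        then have "x i \<cdot> (s' \<cdot> t) = x j \<cdot> t'"
          using compat[OF i j, of "s' \<cdot> t" t'] u[OF i] u[OF j] dt pullbackD(7)[OF s] pullbackD(7)[OF t] by simp
        then have "\<rho> \<cdot> (a \<cdot> (s \<cdot> t)) = \<rho> \<cdot> (b \<cdot> (s \<cdot> t))"
          using comp_reduce[OF \<pi>u(2)[OF i], of "s' \<cdot> t"] comp_reduce[OF \<pi>u(2)[OF j], of t'] u[OF i] u[OF j] dt as bs pullbackD(7)[OF s] pullbackD(7)[OF t] by simp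
        then show "((\<rho> \<cdot> a) \<cdot> s) \<cdot> t = ((\<rho> \<cdot> b) \<cdot> s) \<cdot> t" using ab dt by simp
      qed (use ab um in auto)
      then show "(\<rho> \<cdot> a) \<cdot> s = (\<rho> \<cdot> b) \<cdot> s" .
    qed (use ab um in auto)
    then have "m \<cdot> a = m \<cdot> b"
      using ab mm m by (intro product_ext[OF P, of "m \<cdot> a" "m \<cdot> b"]) (auto simp: \<pi>_def \<rho>_def)
    then show "a = b" using monicD[OF mm, of a b] ab by simp
  qed simp
  moreover have "factors_through C (k i) \<pi>" if "i \<in> I" for i
    using \<pi>u[OF that] u[OF that] by (metis \<open>Dom C \<pi> = Dom C m\<close> \<open>\<pi> \<in> Arr C\<close> factors_comp)
  ultimately have "isomorphism C \<pi>" using cov by (auto simp: jointly_covering_def)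
  then obtain r where r: "r \<in> Arr C" "Dom C r = S" "Cod C r = Dom C m" "r \<cdot> \<pi> = Ident C (Dom C m)"
    by (auto simp: isomorphism_iff)
  show ?thesis
  proof (rule ex1I[of _ "\<rho> \<cdot> r"])
    have "r \<cdot> k i = u i" if "i \<in> I" for i
      using comp_reduce[OF r(4), of "u i"] u[OF that] \<pi>u[OF that] r by simp
    then show gl: "\<rho> \<cdot> r \<in> Hom C S Y \<and> (\<forall>i\<in>I. (\<rho> \<cdot> r) \<cdot> k i = x i)" using r \<pi>u k by simp
    fix h assume h: "h \<in> Hom C S Y \<and> (\<forall>i\<in>I. h \<cdot> k i = x i)"
    show "h = \<rho> \<cdot> r"
    proof (rule covering_epic[OF cov])
      show "h \<cdot> v = (\<rho> \<cdot> r) \<cdot> v" if "v \<in> k ` I" for v using gl h that by (metis imageE)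
    qed (use gl h in simp_all)
  qed
qed

end

text \<open>The right adjoint that a Heyting category has for each pullback of subobjects is universal quantification, read off on
representatives.\<close>

lemma heyting_geometric:
  assumes "category C" "heyting_category C" "cocomplete \<kappa> C" "Cinfinite \<kappa>"
  shows "geometric_category C \<kappa>"
proof -
  interpret category C by fact
  have reg: "regular_category C" using assms by (simp add: heyting_category_def coherent_category_def)
  show ?thesis
  proof (unfold_locales)
    show "finitely_complete C" using reg by (simp add: regular_category_def)
    show "Cinfinite \<kappa>" "cocomplete \<kappa> C" by fact+
    show "\<exists>m. is_image C f m" if "f \<in> Arr C" for f using reg that by (simp add: regular_category_def)
    fix f n assume f: "f \<in> Arr C" and n: "monic C n" "Cod C n = Dom C f"
    obtain all_f where G: "galois_connection
        \<lparr>orderA = Sub C (Cod C f), orderB = Sub C (Dom C f), lower = pull C f, upper = all_f\<rparr>"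
      using assms f by (auto simp: heyting_category_def)
    interpret G: galois_connection "\<lparr>orderA = Sub C (Cod C f), orderB = Sub C (Dom C f), lower =
        pull C f, upper = all_f\<rparr>"
      by (rule G)
    have nS: "subobject C n \<in> carrier (Sub C (Dom C f))" using n by (rule Sub_memI)
    then obtain d where d: "all_f (subobject C n) = subobject C d" "monic C d" "Cod C d = Cod C f"
      using G.upper_closed[of "subobject C n"] by (auto elim: Sub_memE)
    have "factors_through C s d \<longleftrightarrow> factors_through C p n" if s: "monic C s" "is_pullback C f s p q" for s p q
    proof -
      have "subobject C s \<in> carrier (Sub C (Cod C f))" using s pullbackD[OF s(2)] by (intro Sub_memI) auto
      then have "sub_le C (pull C f (subobject C s)) (subobject C n) \<longleftrightarrow> sub_le C (subobject C s) (subobject C d)"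
        using G.galois_property[of "subobject C s" "subobject C n"] nS d by simp
      then show ?thesis using pull_subobject[OF s(2,1)] s d n pullback_monic[OF s(2,1)] by (simp add: sub_le_iff)
    qed
    then show "\<exists>d. is_forall C f n d" using d by (auto simp: is_forall_def)
  qed
qed

section \<open>Joins and meets of subobjects\<close>

context category
begin

lemma Sub_least_iff:
  assumes U: "U \<subseteq> carrier (Sub C A)" and j: "monic C j" "Cod C j = A"
  shows "least (Sub C A) (subobject C j) (Upper (Sub C A) U) \<longleftrightarrow> is_join C (\<Union> U) j"
proof -
  have upper: "subobject C n \<in> Upper (Sub C A) U \<longleftrightarrow> (\<forall>k\<in>\<Union> U. factors_through C k n)"
    if n: "monic C n" "Cod C n = A" for n
  proof -
    have "sub_le C u (subobject C n) \<longleftrightarrow> (\<forall>k\<in>u. factors_through C k n)" if u: "u \<in> U" for u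
    proof -
      have c: "u \<in> carrier (Sub C A)" using U u by blast
      obtain m where m: "u = subobject C m" "monic C m" "Cod C m = A" by (rule Sub_memE[OF c])
      have "sub_le C u (subobject C n) \<longleftrightarrow> factors_through C k n" if "k \<in> u" for k
        using Sub_le_rep[OF c Sub_memI[OF n] that subobject_self[OF n(1)]] .
      then show ?thesis using m subobject_self by blast
    qed
    then show ?thesis using U Sub_memI[OF n] by (auto simp: Upper_def)
  qed
  show ?thesis
  proof
    assume l: "least (Sub C A) (subobject C j) (Upper (Sub C A) U)"
    show "is_join C (\<Union> U) j"
      unfolding is_join_def
    proof (intro conjI allI impI)
      show "monic C j" by fact
      show "\<forall>k\<in>\<Union> U. factors_through C k j" using l upper[OF j] by (simp add: least_def)
      fix n assume n: "monic C n \<and> Cod C n = Cod C j \<and> (\<forall>k\<in>\<Union> U. factors_through C k n)"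
      then have "sub_le C (subobject C j) (subobject C n)" using l upper[of n] j by (auto simp: least_def)
      then show "factors_through C j n" using j n by (simp add: sub_le_iff)
    qed
  next
    assume J: "is_join C (\<Union> U) j"
    show "least (Sub C A) (subobject C j) (Upper (Sub C A) U)"
      unfolding least_def
    proof (intro conjI ballI)
      show "Upper (Sub C A) U \<subseteq> carrier (Sub C A)" by (simp add: Upper_def)
      show "subobject C j \<in> Upper (Sub C A) U" using J upper[OF j] by (simp add: is_join_def)
      fix v assume v: "v \<in> Upper (Sub C A) U"
      then obtain n where n: "v = subobject C n" "monic C n" "Cod C n = A"
        by (auto simp: Upper_def elim: Sub_memE)
      then have "\<forall>k\<in>\<Union> U. factors_through C k n" using upper[of n] v by simp
      then have "factors_through C j n" using J n j by (simp add: is_join_def)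
      then show "le (Sub C A) (subobject C j) v" using n j by (simp add: sub_le_iff)
    qed
  qed
qed

lemma Sub_sup_eqI:
  assumes "least (Sub C A) u (Upper (Sub C A) U)"
  shows "\<Squnion>\<^bsub>Sub C A\<^esub> U = u"
proof -
  interpret partial_order "Sub C A" by (rule Sub_partial_order)
  have un: "u' = u" if u': "least (Sub C A) u' (Upper (Sub C A) U)" for u'
  proof (rule le_antisym)
    show "le (Sub C A) u' u" "le (Sub C A) u u'" using u' assms unfolding least_def by blast+
    show "u' \<in> carrier (Sub C A)" "u \<in> carrier (Sub C A)" using u' assms unfolding least_def by blast+
  qed
  show ?thesis unfolding sup_def by (rule some_equality, rule assms, rule un)
qed

lemma Sub_inf_eqI:
  assumes "greatest (Sub C A) u (Lower (Sub C A) U)"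
  shows "\<Sqinter>\<^bsub>Sub C A\<^esub> U = u"
proof -
  interpret partial_order "Sub C A" by (rule Sub_partial_order)
  have un: "u' = u" if u': "greatest (Sub C A) u' (Lower (Sub C A) U)" for u'
  proof (rule le_antisym)
    show "le (Sub C A) u' u" "le (Sub C A) u u'" using u' assms unfolding greatest_def by blast+
    show "u' \<in> carrier (Sub C A)" "u \<in> carrier (Sub C A)" using u' assms unfolding greatest_def by blast+
  qed
  show ?thesis unfolding inf_def by (rule some_equality, rule assms, rule un)
qed

end

text \<open>The meet is described by its generalized elements: this makes it usable without choosing a pullback.\<close>

lemma (in finitely_complete_category) Sub_meet:
  assumes u: "u \<in> carrier (Sub C A)" "m \<in> u" and v: "v \<in> carrier (Sub C A)" "n \<in> v"
  obtains k where "u \<sqinter>\<^bsub>Sub C A\<^esub> v = subobject C k" "monic C k" "Cod C k = A"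
    "\<And>x. \<lbrakk>x \<in> Arr C; Cod C x = A\<rbrakk> \<Longrightarrow> factors_through C x k \<longleftrightarrow> factors_through C x m \<and> factors_through C x n"
proof -
  note m = Sub_rep[OF u] and n = Sub_rep[OF v]
  obtain p q where pq: "is_pullback C m n p q" using pullback_exists[of m n] m n by auto
  have p: "monic C p" "Cod C p = Dom C m" using pullback_monic[OF pq n(1)] pullbackD[OF pq] by auto
  have k: "monic C (m \<cdot> p)" "Cod C (m \<cdot> p) = A" using monic_comp[of m p] m p by auto
  have f: "factors_through C x (m \<cdot> p) \<longleftrightarrow> factors_through C x m \<and> factors_through C x n" if x: "x \<in> Arr C"
      "Cod C x = A" for x
  proof
    assume "factors_through C x (m \<cdot> p)"
    moreover have "factors_through C (m \<cdot> p) m" using m p by simp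
    moreover have "factors_through C (m \<cdot> p) n" using pullbackD[OF pq] by simp
    ultimately show "factors_through C x m \<and> factors_through C x n"
      using factors_trans[of x "m \<cdot> p"] x k m n by auto
  next
    assume xx: "factors_through C x m \<and> factors_through C x n"
    then obtain y where y: "y \<in> Arr C" "Cod C y = Dom C m" "m \<cdot> y = x" by (auto simp: factors_iff)
    then have "factors_through C y p" using pullback_factors[OF pq n(1), of y] xx by simp
    then show "factors_through C x (m \<cdot> p)" using factors_comp_monic[of m p y] y m p by simp
  qed
  have "greatest (Sub C A) (subobject C (m \<cdot> p)) (Lower (Sub C A) {u, v})"
    unfolding greatest_def
  proof (intro conjI ballI)
    show "Lower (Sub C A) {u, v} \<subseteq> carrier (Sub C A)" by (simp add: Lower_def)
    show "subobject C (m \<cdot> p) \<in> Lower (Sub C A) {u, v}"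
      using Sub_memI[OF k] f[of "m \<cdot> p"] k Sub_le_rep[OF Sub_memI[OF k] u(1) subobject_self[OF k(1)] u(2)]
        Sub_le_rep[OF Sub_memI[OF k] v(1) subobject_self[OF k(1)] v(2)]
      by (auto simp: Lower_def)
    fix w assume w: "w \<in> Lower (Sub C A) {u, v}"
    then have wc: "w \<in> carrier (Sub C A)" by (simp add: Lower_def)
    obtain x where x: "w = subobject C x" "monic C x" "Cod C x = A" by (rule Sub_memE[OF wc])
    have "factors_through C x m \<and> factors_through C x n"
      using w x u v Sub_le_rep[OF wc u(1) _ u(2), of x] Sub_le_rep[OF wc v(1) _ v(2), of x] by (auto simp: Lower_def)
    then show "le (Sub C A) w (subobject C (m \<cdot> p))" using f[of x] x k by (simp add: sub_le_iff)
  qed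
  then have "u \<sqinter>\<^bsub>Sub C A\<^esub> v = subobject C (m \<cdot> p)" unfolding meet_def by (rule Sub_inf_eqI)
  then show ?thesis using that k f by blast
qed

context geometric_category
begin

lemma Sub_join_exists:
  assumes U: "U \<subseteq> carrier (Sub C A)" "small \<kappa> U" and A: "A \<in> Obj C"
  shows "\<exists>j. least (Sub C A) (subobject C j) (Upper (Sub C A) U) \<and> monic C j \<and> Cod C j = A"
proof -
  have "\<forall>u\<in>U. \<exists>m. m \<in> u" using U by (metis Sub_memE subobject_self subsetD)
  then obtain m where m: "\<And>u. u \<in> U \<Longrightarrow> m u \<in> u" by metis
  have rep: "monic C (m u)" "Cod C (m u) = A" "subobject C (m u) = u" if "u \<in> U" for u
    using Sub_rep[OF subsetD[OF U(1) that] m[OF that]] by auto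
  obtain j where j: "is_join C (m ` U) j" "Cod C j = A" using join_exists[OF U(2), of m A] rep A by blast
  have "(\<forall>k\<in>\<Union> U. factors_through C k n) \<longleftrightarrow> (\<forall>k\<in>m ` U. factors_through C k n)" if n: "monic C n" for n
  proof -
    have "factors_through C k n" if "factors_through C (m u) n" "k \<in> u" "u \<in> U" for k u
      using factors_trans[of k "m u" n] that n rep[OF that(3)] by (metis monic_arr subobject_iff)
    then show ?thesis using m by blast
  qed
  then have "is_join C (\<Union> U) j" using j unfolding is_join_def by (simp cong: conj_cong)
  then show ?thesis using Sub_least_iff[OF U(1), of j] j by (auto simp: is_join_def)
qed

text \<open>The infinite distributive law follows from adjointness. Let n be above all a \<sqinter> b. Each b then lies below the
universal quantification, along the inclusion \<alpha> of a, of the inverse image of n; so does the join of the b, and pulling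
back along \<alpha> once more shows that the meet of a with this join lies below n.\<close>

theorem Sub_frame:
  assumes A: "A \<in> Obj C" and sm: "small \<kappa> (carrier (Sub C A))"
  shows "frame (Sub C A)"
proof -
  interpret partial_order "Sub C A" by (rule Sub_partial_order)
  have sup: "\<exists>j. least (Sub C A) (subobject C j) (Upper (Sub C A) U) \<and> monic C j \<and> Cod C j = A"
    if "U \<subseteq> carrier (Sub C A)" for U
    using Sub_join_exists[OF that small_subset[OF sm that] A] .
  have "complete_lattice (Sub C A)"
  proof
    fix U assume U: "U \<subseteq> carrier (Sub C A)"
    show "\<exists>s. least (Sub C A) s (Upper (Sub C A) U)" using sup[OF U] by blast
    have "Lower (Sub C A) U \<subseteq> carrier (Sub C A)" by (simp add: Lower_def)
    then obtain s where "least (Sub C A) s (Upper (Sub C A) (Lower (Sub C A) U))" using sup by blast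
    then have "greatest (Sub C A) s (Lower (Sub C A) U)"
      using U unfolding least_def greatest_def Upper_def Lower_def by blast
    then show "\<exists>s. greatest (Sub C A) s (Lower (Sub C A) U)" by blast
  qed
  moreover have "a \<sqinter>\<^bsub>Sub C A\<^esub> (\<Squnion>\<^bsub>Sub C A\<^esub> B) = \<Squnion>\<^bsub>Sub C A\<^esub> ((\<lambda>b. a \<sqinter>\<^bsub>Sub C A\<^esub> b) ` B)"
    if a: "a \<in> carrier (Sub C A)" and B: "B \<subseteq> carrier (Sub C A)" for a B
  proof -
    obtain \<alpha> where \<alpha>: "a = subobject C \<alpha>" "monic C \<alpha>" "Cod C \<alpha> = A" by (rule Sub_memE[OF a])
    obtain j where j: "least (Sub C A) (subobject C j) (Upper (Sub C A) B)" "monic C j" "Cod C j = A"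
        using sup[OF B] by blast
    have join: "is_join C (\<Union> B) j" using Sub_least_iff[OF B] j by simp
    obtain k where k: "a \<sqinter>\<^bsub>Sub C A\<^esub> (\<Squnion>\<^bsub>Sub C A\<^esub> B) = subobject C k" "monic C k" "Cod C k = A"
      "\<And>x. \<lbrakk>x \<in> Arr C; Cod C x = A\<rbrakk> \<Longrightarrow> factors_through C x k \<longleftrightarrow> factors_through C x \<alpha> \<and> factors_through C x j"
      using Sub_meet[OF a _ Sub_memI[OF j(2,3)] subobject_self[OF j(2)], of \<alpha>] \<alpha> subobject_self[OF \<alpha>(2)]
      unfolding Sub_sup_eqI[OF j(1)] by metis
    have meet_b: "\<exists>l. a \<sqinter>\<^bsub>Sub C A\<^esub> b = subobject C l \<and> monic C l \<and> Cod C l = A \<and>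
       (\<forall>x. x \<in> Arr C \<and> Cod C x = A \<longrightarrow> (factors_through C x l \<longleftrightarrow> factors_through C x \<alpha> \<and> factors_through C x \<beta>))"
      if b: "b \<in> B" "\<beta> \<in> b" for b \<beta>
      using Sub_meet[OF a _ subsetD[OF B b(1)] b(2), of \<alpha>] \<alpha> subobject_self[OF \<alpha>(2)] by metis
    have sub: "(\<lambda>b. a \<sqinter>\<^bsub>Sub C A\<^esub> b) ` B \<subseteq> carrier (Sub C A)"
    proof
      fix c assume "c \<in> (\<lambda>b. a \<sqinter>\<^bsub>Sub C A\<^esub> b) ` B"
      then obtain b where b: "b \<in> B" "c = a \<sqinter>\<^bsub>Sub C A\<^esub> b" by blast
      obtain \<beta> where "b = subobject C \<beta>" "monic C \<beta>" using B b by (blast elim: Sub_memE)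
      then show "c \<in> carrier (Sub C A)" using meet_b[OF b(1), of \<beta>] b Sub_memI by auto
    qed
    have "is_join C (\<Union> ((\<lambda>b. a \<sqinter>\<^bsub>Sub C A\<^esub> b) ` B)) k"
      unfolding is_join_def
    proof (intro conjI allI impI ballI)
      show "monic C k" by fact
      fix x assume "x \<in> \<Union> ((\<lambda>b. a \<sqinter>\<^bsub>Sub C A\<^esub> b) ` B)"
      then obtain b where b: "b \<in> B" "x \<in> a \<sqinter>\<^bsub>Sub C A\<^esub> b" by blast
      obtain \<beta> where \<beta>: "b = subobject C \<beta>" "monic C \<beta>" using B b by (blast elim: Sub_memE)
      have bb: "\<beta> \<in> b" using \<beta> by simp
      obtain l where l: "a \<sqinter>\<^bsub>Sub C A\<^esub> b = subobject C l" "monic C l" "Cod C l = A"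
        "\<forall>x. x \<in> Arr C \<and> Cod C x = A \<longrightarrow> (factors_through C x l \<longleftrightarrow> factors_through C x \<alpha> \<and> factors_through C x \<beta>)"
        using meet_b[OF b(1) bb] by blast
      have x: "monic C x" "Cod C x = A" "factors_through C x l" using b l by (auto simp: subobject_iff)
      then have "factors_through C x \<alpha>" "factors_through C x \<beta>" using l by auto
      moreover have "factors_through C \<beta> j" using join b bb by (auto simp: is_join_def)
      ultimately show "factors_through C x k" using k(4)[of x] x \<beta> j factors_trans[of x \<beta> j] by auto
    next
      fix n assume n: "monic C n \<and> Cod C n = Cod C k \<and> (\<forall>x\<in>\<Union> ((\<lambda>b. a \<sqinter>\<^bsub>Sub C A\<^esub> b) ` B). factors_through C x n)"
      obtain n' t where n': "is_pullback C \<alpha> n n' t" using pullback_exists[of \<alpha> n] \<alpha> n k by auto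
      have n'm: "monic C n'" "Cod C n' = Dom C \<alpha>" using pullback_monic[OF n'] n pullbackD[OF n'] by auto
      obtain d where d: "is_forall C \<alpha> n' d" using forall_exists[of \<alpha> n'] n'm \<alpha> by auto
      have dm: "monic C d" "Cod C d = A" using d \<alpha> by (auto simp: is_forall_def)
      have "factors_through C \<beta> d" if \<beta>: "\<beta> \<in> \<Union> B" for \<beta>
      proof -
        obtain b where b: "b \<in> B" "\<beta> \<in> b" using \<beta> by blast
        note \<beta>m = Sub_rep[OF subsetD[OF B b(1)] b(2)]
        obtain l where l: "a \<sqinter>\<^bsub>Sub C A\<^esub> b = subobject C l" "monic C l" "Cod C l = A"
          "\<forall>x. x \<in> Arr C \<and> Cod C x = A \<longrightarrow> (factors_through C x l \<longleftrightarrow> factors_through C x \<alpha> \<and> factors_through C x \<beta>)"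
          using meet_b[OF b] by blast
        obtain p q where pq: "is_pullback C \<alpha> \<beta> p q" using pullback_exists[of \<alpha> \<beta>] \<alpha> \<beta>m by auto
        note D = pullbackD[OF pq]
        have "factors_through C (\<alpha> \<cdot> p) \<alpha>" using D(1-8) by simp
        moreover have "factors_through C (\<alpha> \<cdot> p) \<beta>" unfolding D(9) using D(1-8) by simp
        ultimately have "factors_through C (\<alpha> \<cdot> p) l" using l(4) D(1-8) \<alpha> by simp
        moreover have "factors_through C l n" using n l b(1) subobject_self[OF l(2)] by auto
        ultimately have "factors_through C (\<alpha> \<cdot> p) n" using factors_trans[of "\<alpha> \<cdot> p" l n] D(1-8) l n by auto
        then have "factors_through C p n'" using pullback_factors[OF n', of p] n D(1-8) by auto
        then show ?thesis using d pq \<beta>m by (auto simp: is_forall_def)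
      qed
      then have "\<forall>\<beta>\<in>\<Union> B. factors_through C \<beta> d" by blast
      then have jd: "factors_through C j d" using join dm j by (simp add: is_join_def)
      obtain p q where pq: "is_pullback C \<alpha> j p q" using pullback_exists[of \<alpha> j] \<alpha> j by auto
      have pn: "factors_through C p n'" using d jd pq j by (auto simp: is_forall_def)
      have "factors_through C k \<alpha>" "factors_through C k j" using k(4)[of k] k by auto
      then obtain y where y: "y \<in> Arr C" "Cod C y = Dom C \<alpha>" "\<alpha> \<cdot> y = k" by (auto simp: factors_iff)
      then have "factors_through C y p" using pullback_factors[OF pq j(2), of y] \<open>factors_through C k j\<close> by simp
      then have "factors_through C y n'" using factors_trans[of y p n'] pn y pullbackD[OF pq] n'm by auto
      then show "factors_through C k n" using pullback_factors[OF n', of y] n y by simp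
    qed
    then show ?thesis using Sub_sup_eqI Sub_least_iff[OF sub k(2,3)] k(1) by auto
  qed
  ultimately show ?thesis by (auto simp: frame_def)
qed

end

section \<open>The cartesian monoidal structure\<close>

locale cartesian_category = category C for C :: "('o, 'a) cat" (structure) +
  fixes P :: "('o, 'a) products"
  assumes chosen: "chosen_products C P"
begin

lemma one_terminal: "is_terminal C (one P)"
  using chosen by (simp add: chosen_products_def)

lemma one_Obj [simp]: "one P \<in> Obj C"
  using one_terminal by (simp add: is_terminal_def)

lemma prd_product: "\<lbrakk>A \<in> Obj C; B \<in> Obj C\<rbrakk> \<Longrightarrow> is_product C A B (prd P A B) (pr1 P A B) (pr2 P A B)"
  using chosen by (simp add: chosen_products_def)

lemma pr_simps [simp]:
  assumes "A \<in> Obj C" "B \<in> Obj C"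
  shows "pr1 P A B \<in> Arr C" "pr2 P A B \<in> Arr C" "Dom C (pr1 P A B) = prd P A B" "Dom C (pr2 P A B) = prd P A B"
    "Cod C (pr1 P A B) = A" "Cod C (pr2 P A B) = B" "prd P A B \<in> Obj C"
  using productD[OF prd_product[OF assms]] by auto

lemma prd_ext:
  assumes "h \<in> Arr C" "k \<in> Arr C" "Dom C h = Dom C k" "Cod C h = prd P A B" "Cod C k = prd P A B"
    "pr1 P A B \<cdot> h = pr1 P A B \<cdot> k" "pr2 P A B \<cdot> h = pr2 P A B \<cdot> k" "A \<in> Obj C" "B \<in> Obj C"
  shows "h = k"
  using product_ext[OF prd_product[OF assms(8,9)], of h k] assms by simp

lemma tuple_simps [simp]:
  assumes "f \<in> Arr C" "g \<in> Arr C" "Dom C f = Dom C g"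
  shows "tuple C P f g \<in> Arr C" "Dom C (tuple C P f g) = Dom C f" "Cod C (tuple C P f g) = prd P (Cod C f) (Cod C g)"
    "\<And>A B. \<lbrakk>A = Cod C f; B = Cod C g\<rbrakk> \<Longrightarrow> pr1 P A B \<cdot> tuple C P f g = f"
    "\<And>A B. \<lbrakk>A = Cod C f; B = Cod C g\<rbrakk> \<Longrightarrow> pr2 P A B \<cdot> tuple C P f g = g"
proof -
  have "\<exists>!h. h \<in> Hom C (Dom C f) (prd P (Cod C f) (Cod C g)) \<and>
     pr1 P (Cod C f) (Cod C g) \<cdot> h = f \<and> pr2 P (Cod C f) (Cod C g) \<cdot> h = g"
    using prd_product[of "Cod C f" "Cod C g"] assms unfolding is_product_def by simp
  from theI'[OF this] show "tuple C P f g \<in> Arr C" "Dom C (tuple C P f g) = Dom C f"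
      "Cod C (tuple C P f g) = prd P (Cod C f) (Cod C g)"
    "\<And>A B. \<lbrakk>A = Cod C f; B = Cod C g\<rbrakk> \<Longrightarrow> pr1 P A B \<cdot> tuple C P f g = f"
    "\<And>A B. \<lbrakk>A = Cod C f; B = Cod C g\<rbrakk> \<Longrightarrow> pr2 P A B \<cdot> tuple C P f g = g"
    by (auto simp: tuple_def)
qed

lemma tuple_reduce [simp]:
  assumes "f \<in> Arr C" "g \<in> Arr C" "Dom C f = Dom C g" "x \<in> Arr C" "Cod C x = Dom C f" "A = Cod C f" "B = Cod C g"
  shows "pr1 P A B \<cdot> (tuple C P f g \<cdot> x) = f \<cdot> x" "pr2 P A B \<cdot> (tuple C P f g \<cdot> x) = g \<cdot> x"
  using assms by (auto intro: comp_reduce)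

lemma tuple_comp [simp]:
  assumes "f \<in> Arr C" "g \<in> Arr C" "Dom C f = Dom C g" "x \<in> Arr C" "Cod C x = Dom C f"
  shows "tuple C P f g \<cdot> x = tuple C P (f \<cdot> x) (g \<cdot> x)"
  by (rule prd_ext[of _ _ "Cod C f" "Cod C g"]) (use assms in auto)

lemma tuple_pr [simp]: "\<lbrakk>A \<in> Obj C; B \<in> Obj C\<rbrakk> \<Longrightarrow> tuple C P (pr1 P A B) (pr2 P A B) = Ident C (prd P A B)"
  by (rule prd_ext[of _ _ A B]) auto

lemma tuple_pr_comp [simp]:
  "\<lbrakk>A \<in> Obj C; B \<in> Obj C; h \<in> Arr C; Cod C h = prd P A B\<rbrakk> \<Longrightarrow> tuple C P (pr1 P A B \<cdot> h) (pr2 P A B \<cdot> h) = h"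
  by (rule prd_ext[of _ _ A B]) auto

lemma cartesian_sel [simp]:
  "tobj (cartesian C P) = prd P" "tunit (cartesian C P) = one P"
  "tarr (cartesian C P) f g = tuple C P (f \<cdot> pr1 P (Dom C f) (Dom C g)) (g \<cdot> pr2 P (Dom C f) (Dom C g))"
  "lunit (cartesian C P) A = pr2 P (one P) A" "runit (cartesian C P) A = pr1 P A (one P)"
  "braid (cartesian C P) A B = tuple C P (pr2 P A B) (pr1 P A B)"
  "assoc (cartesian C P) A B D = tuple C P (pr1 P A B \<cdot> pr1 P (prd P A B) D)
     (tuple C P (pr2 P A B \<cdot> pr1 P (prd P A B) D) (pr2 P (prd P A B) D))"
  by (simp_all add: cartesian_def)

text \<open>The inverse of the associator.\<close>

definition unassoc :: "'o \<Rightarrow> 'o \<Rightarrow> 'o \<Rightarrow> 'a" where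
  "unassoc A B D = tuple C P (tuple C P (pr1 P A (prd P B D)) (pr1 P B D \<cdot> pr2 P A (prd P B D))) (pr2 P B D \<cdot> pr2 P A (prd P B D))"

lemma assoc_inverse:
  assumes [simp]: "A \<in> Obj C" "B \<in> Obj C" "D \<in> Obj C"
  shows "inverse_arrows C (assoc (cartesian C P) A B D) (unassoc A B D)"
  by (auto simp: inverse_arrows_def unassoc_def intro!: prd_ext[of _ _ A "prd P B D"] prd_ext[of _ _
      "prd P A B" D] prd_ext[of _ _ B D] prd_ext[of _ _ A B])

lemma to_one_ext: "\<lbrakk>h \<in> Arr C; k \<in> Arr C; Cod C h = one P; Cod C k = one P; Dom C h = Dom C k\<rbrakk> \<Longrightarrow> h = k"
  by (rule terminal_ext[OF one_terminal])

lemma lunit_isomorphism: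
  assumes [simp]: "A \<in> Obj C"
  shows "isomorphism C (pr2 P (one P) A)" "isomorphism C (pr1 P A (one P))"
proof -
  obtain t where [simp]: "t \<in> Arr C" "Dom C t = A" "Cod C t = one P" using terminal_univ[OF one_terminal assms] .
  have 1: "t \<cdot> pr2 P (one P) A = pr1 P (one P) A" "t \<cdot> pr1 P A (one P) = pr2 P A (one P)" by (rule to_one_ext; simp)+
  show "isomorphism C (pr2 P (one P) A)"
    unfolding isomorphism_iff by (auto simp: 1 intro!: bexI[of _ "tuple C P t (Ident C A)"])
  show "isomorphism C (pr1 P A (one P))"
    unfolding isomorphism_iff by (auto simp: 1 intro!: bexI[of _ "tuple C P (Ident C A) t"])
qed

text \<open>Both sides of each coherence law are tuples of composites of projections, and the rewrite rules for tuples bring them to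
the same form.\<close>

theorem cartesian_braided: "braided_monoidal_category C (cartesian C P)"
proof
  fix A B D E assume [simp]: "A \<in> Obj C" "B \<in> Obj C" "D \<in> Obj C" "E \<in> Obj C"
  show "isomorphism C (assoc (cartesian C P) A B D)" using assoc_inverse[of A B D] by (auto simp: isomorphism_def)
  show "isomorphism C (lunit (cartesian C P) A)" "isomorphism C (runit (cartesian C P) A)"
      using lunit_isomorphism by auto
  show "isomorphism C (braid (cartesian C P) A B)"
    unfolding isomorphism_iff by (auto intro!: bexI[of _ "tuple C P (pr2 P B A) (pr1 P B A)"])
  show "inv_arr C (assoc (cartesian C P) D A B) \<cdot> braid (cartesian C P) (tobj (cartesian C P) A B) D \<cdot> inv_arr C (assoc (cartesian C P) A B D)
        = (tarr (cartesian C P) (braid (cartesian C P) A D) (Ident C B)) \<cdot> inv_arr C (assoc (cartesian C P) A D B) \<cdot> (tarr (cartesian C P) (Ident C A) (braid (cartesian C P) B D))"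
    unfolding inv_arr_eq[OF assoc_inverse[OF \<open>D \<in> Obj C\<close> \<open>A \<in> Obj C\<close> \<open>B \<in> Obj C\<close>]]
      inv_arr_eq[OF assoc_inverse[OF \<open>A \<in> Obj C\<close> \<open>B \<in> Obj C\<close> \<open>D \<in> Obj C\<close>]]
      inv_arr_eq[OF assoc_inverse[OF \<open>A \<in> Obj C\<close> \<open>D \<in> Obj C\<close> \<open>B \<in> Obj C\<close>]]
    by (simp add: unassoc_def)
qed (auto simp: Dom_Obj Cod_Obj)

section \<open>Subunits of a cartesian monoidal category\<close>

lemma subterminal_ext:
  assumes "monic C s" "Cod C s = one P" "f \<in> Arr C" "g \<in> Arr C" "Cod C f = Dom C s" "Cod C g = Dom C s"
      "Dom C f = Dom C g"
  shows "f = g"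
  using assms to_one_ext[of "s \<cdot> f" "s \<cdot> g"] monicD[OF assms(1), of f g] by simp

text \<open>For a subterminal S the two projections from S \<times> S agree, so the arrow with both components the second projection from 1 \<times> S
inverts s \<times> S.\<close>

lemma subunit_iff: "subunit C (cartesian C P) s \<longleftrightarrow> monic C s \<and> Cod C s = one P"
proof
  assume s: "monic C s \<and> Cod C s = one P"
  let ?S = "Dom C s"
  have [simp]: "s \<in> Arr C" "Cod C s = one P" using s by auto
  have 1: "s \<cdot> pr2 P (one P) ?S = pr1 P (one P) ?S" by (rule to_one_ext) auto
  have 2: "pr1 P ?S ?S = pr2 P ?S ?S" using s by (intro subterminal_ext[of s]) auto
  have 3: "tuple C P (pr2 P ?S ?S) (pr2 P ?S ?S) = Ident C (prd P ?S ?S)"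
    using tuple_pr[of ?S ?S] by (simp add: 2)
  have "isomorphism C (tarr (cartesian C P) s (Ident C ?S))"
    unfolding isomorphism_iff
    by (auto simp: 1 3 intro!: bexI[of _ "tuple C P (pr2 P (one P) ?S) (pr2 P (one P) ?S)"])
  then show "subunit C (cartesian C P) s" using s by (simp add: subunit_def)
qed (simp add: subunit_def)

lemma ISub_eq: "ISub C (cartesian C P) = Sub C (one P)"
  by (simp add: ISub_def Sub_def subunit_iff)

lemma act_eq: "\<lbrakk>monic C s; Cod C s = one P; X \<in> Obj C\<rbrakk> \<Longrightarrow> act C (cartesian C P) s X = pr2 P (Dom C s) X"
  by (simp add: act_def)

lemma pr2_monic:
  assumes s: "monic C s" "Cod C s = one P" and [simp]: "X \<in> Obj C"
  shows "monic C (pr2 P (Dom C s) X)"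
proof (rule monicI)
  have [simp]: "s \<in> Arr C" using s by simp
  fix f g assume fg: "f \<in> Arr C" "g \<in> Arr C" "Cod C f = Dom C (pr2 P (Dom C s) X)"
      "Cod C g = Dom C (pr2 P (Dom C s) X)"
    "Dom C f = Dom C g" "pr2 P (Dom C s) X \<cdot> f = pr2 P (Dom C s) X \<cdot> g"
  have "pr1 P (Dom C s) X \<cdot> f = pr1 P (Dom C s) X \<cdot> g" using fg by (intro subterminal_ext[OF s]) auto
  then show "f = g" using fg prd_ext[of f g "Dom C s" X] by simp
qed (use s in simp)

text \<open>All four sides are projections that discard a subterminal factor, S or T. An arrow into a subterminal object is
determined by its domain, so such a projection is monic and compatible arrows to S \<times> X and T \<times> X share their X component.\<close>

theorem cartesian_stiff: "stiff C (cartesian C P)"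
  unfolding stiff_def Let_def
proof (intro ballI allI impI)
  fix X s t assume [simp]: "X \<in> Obj C" and st: "subunit C (cartesian C P) s \<and> subunit C (cartesian C P) t"
  have s: "monic C s" "Cod C s = one P" and t: "monic C t" "Cod C t = one P" using st by (auto simp: subunit_iff)
  have [simp]: "s \<in> Arr C" "t \<in> Arr C" using s t by auto
  let ?S = "Dom C s" and ?T = "Dom C t"
  let ?top = "pr2 P ?S (prd P ?T X)"
  let ?left = "tuple C P (pr1 P ?S (prd P ?T X)) (pr2 P ?T X \<cdot> pr2 P ?S (prd P ?T X))"
  have left: "tarr (cartesian C P) (Ident C ?S) (act C (cartesian C P) t X) = ?left" using t by (simp add: act_eq)
  have pb: "is_pullback C (pr2 P ?T X) (pr2 P ?S X) ?top ?left"
  proof (rule pullbackI)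
    fix x y assume xy: "x \<in> Arr C" "y \<in> Arr C" "Cod C x = Dom C (pr2 P ?T X)" "Cod C y = Dom C (pr2 P ?S X)"
        "Dom C x = Dom C y"
      "pr2 P ?T X \<cdot> x = pr2 P ?S X \<cdot> y"
    show "\<exists>h\<in>Arr C. Dom C h = Dom C x \<and> Cod C h = Dom C ?top \<and> ?top \<cdot> h = x \<and> ?left \<cdot> h = y"
      using xy by (intro bexI[of _ "tuple C P (pr1 P ?S X \<cdot> y) x"]) auto
  next
    fix h k assume hk: "h \<in> Arr C" "k \<in> Arr C" "Cod C h = Dom C ?top" "Cod C k = Dom C ?top" "Dom C h = Dom C k"
        "?top \<cdot> h = ?top \<cdot> k"
    then show "h = k" using monicD[OF pr2_monic[OF s, of "prd P ?T X"], of h k] by simp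
  qed auto
  have leftm: "monic C ?left"
    using pullback_monic[OF pullback_sym[OF pb] pr2_monic[OF t]] by simp
  show "monic C (act C (cartesian C P) s (tobj (cartesian C P) (Dom C t) X)) \<and>
       monic C (tarr (cartesian C P) (Ident C (Dom C s)) (act C (cartesian C P) t X)) \<and>
       monic C (act C (cartesian C P) t X) \<and> monic C (act C (cartesian C P) s X) \<and>
       is_pullback C (act C (cartesian C P) t X) (act C (cartesian C P) s X)
        (act C (cartesian C P) s (tobj (cartesian C P) (Dom C t) X)) (tarr (cartesian C P) (Ident C (Dom C s)) (act C (cartesian C P) t X))"
    unfolding left using pb leftm pr2_monic[OF s] pr2_monic[OF t] s t by (simp add: act_eq)
qed

end

section \<open>Tensoring a union of subunits with an object\<close>

locale geometric_cartesian = geometric_category C \<kappa> + cartesian_category C P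
  for C :: "('o, 'a) cat" (structure) and \<kappa> :: "'u rel" and P :: "('o, 'a) products" +
  assumes small_Sub_one: "small \<kappa> (carrier (Sub C (one P)))"
begin

text \<open>The canonical maps form the pullback, along the projection from (\<Squnion>U) \<times> X, of the inclusions of the members of U into
their union, hence a jointly covering family. Two of them overlap in the one that belongs to the meet of their indices. As
U is closed under meets, a cocone agrees on these overlaps, and gluing applies.\<close>

lemma D_colimit:
  assumes U: "idempotent_subunits C (cartesian C P) U" and [simp]: "X \<in> Obj C"
    and r: "\<And>u. u \<in> carrier (ISub C (cartesian C P)) \<Longrightarrow> r u \<in> u"
  shows "is_colimit (D_shape C (cartesian C P) r U X) C (D_diagram C (cartesian C P) r X)
    (tobj (cartesian C P) (Dom C (r (\<Squnion>\<^bsub>ISub C (cartesian C P)\<^esub> U))) X)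
    (\<lambda>u. canonical_map C (cartesian C P) (r u) (r (\<Squnion>\<^bsub>ISub C (cartesian C P)\<^esub> U)) X)"
proof -
  have Uc: "U \<subseteq> carrier (Sub C (one P))" using U by (simp add: idempotent_subunits_def ISub_eq)
  have smU: "small \<kappa> U" by (rule small_subset[OF small_Sub_one Uc])
  have r_in: "r u \<in> u" if "u \<in> carrier (Sub C (one P))" for u using r that by (simp add: ISub_eq)
  have rep: "monic C (r u)" "r u \<in> Arr C" "Cod C (r u) = one P" "subobject C (r u) = u" if
      "u \<in> carrier (Sub C (one P))" for u
    using Sub_rep[OF that r_in[OF that]] by auto
  obtain j where j: "least (Sub C (one P)) (subobject C j) (Upper (Sub C (one P)) U)" "monic C j" "Cod C j = one P"
    using Sub_join_exists[OF Uc smU] by auto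
  define V where "V = \<Squnion>\<^bsub>Sub C (one P)\<^esub> U"
  have V: "V = subobject C j" using Sub_sup_eqI[OF j(1)] by (simp add: V_def)
  have Vc: "V \<in> carrier (Sub C (one P))" using V j Sub_memI by simp
  define w where "w = r V"
  have w: "monic C w" "w \<in> Arr C" "Cod C w = one P" "subobject C w = V" using rep[OF Vc] by (auto simp: w_def)
  have wjoin: "is_join C (\<Union> U) w" using Sub_least_iff[OF Uc w(1,3)] w(4) V j by simp
  define k where "k u = (THE k. k \<in> Hom C (Dom C (r u)) (Dom C w) \<and> w \<cdot> k = r u)" for u
  have k: "k u \<in> Arr C" "Dom C (k u) = Dom C (r u)" "Cod C (k u) = Dom C w" "w \<cdot> k u = r u" if u: "u \<in> U" for u
  proof -
    have "factors_through C (r u) w" using wjoin u r_in[of u] Uc by (auto simp: is_join_def)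
    then obtain l where l: "l \<in> Hom C (Dom C (r u)) (Dom C w)" "w \<cdot> l = r u" by (auto simp: factors_iff)
    have "k u = l"
      unfolding k_def
    proof (rule the_equality)
      fix m assume "m \<in> Hom C (Dom C (r u)) (Dom C w) \<and> w \<cdot> m = r u"
      then show "m = l" using l monicD[OF w(1), of m l] by simp
    qed (use l in simp)
    then show "k u \<in> Arr C" "Dom C (k u) = Dom C (r u)" "Cod C (k u) = Dom C w" "w \<cdot> k u = r u" using l by auto
  qed
  have km: "monic C (k u)" if "u \<in> U" for u using monic_cancel[of w "k u"] k[OF that] w rep[of u] Uc that by auto
  let ?S = "\<lambda>u. Dom C (r u)"
  define c where "c u = tuple C P (k u \<cdot> pr1 P (?S u) X) (pr2 P (?S u) X)" for u
  have SU [simp]: "?S u \<in> Obj C" if "u \<in> U" for u using rep(2)[of u] Uc that by auto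
  have can: "canonical_map C (cartesian C P) (r u) w X = c u" if "u \<in> U" for u
    using k[OF that] that unfolding canonical_map_def k_def[symmetric] by (simp add: c_def)
  have cS [simp]: "c u \<in> Arr C" "Dom C (c u) = prd P (?S u) X" "Cod C (c u) = prd P (Dom C w) X" if "u \<in> U" for u
    using k[OF that] that by (simp_all add: c_def)
  have c1: "pr1 P (Dom C w) X \<cdot> c u = k u \<cdot> pr1 P (?S u) X" "pr2 P (Dom C w) X \<cdot> c u = pr2 P (?S u) X" if
      "u \<in> U" for u
    using k[OF that] w that by (simp_all add: c_def)
  have cm: "monic C (c u)" if u: "u \<in> U" for u
    using monic_cancel[of "pr2 P (Dom C w) X" "c u"] c1(2)[OF u] pr2_monic[of "r u" X] rep[of u] Uc u w by auto
  have kcov: "jointly_covering C (Dom C w) (k ` U)"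
  proof (rule covering_mono[OF join_covering[OF wjoin]])
    show "x \<in> Arr C" if "x \<in> \<Union> U" for x using that Uc Sub_rep(1) by (metis UnionE monic_arr subsetD)
    fix v assume "v \<in> {v \<in> Arr C. Cod C v = Dom C w \<and> w \<cdot> v \<in> \<Union> U}"
    then obtain u where v: "v \<in> Arr C" "Cod C v = Dom C w" and u: "u \<in> U" "w \<cdot> v \<in> u" by blast
    have "factors_through C (w \<cdot> v) (r u)" using rep(4)[of u] Uc u subobject_iff by (metis subsetD)
    then have "factors_through C (w \<cdot> v) (w \<cdot> k u)" using k[OF u(1)] by simp
    then have "factors_through C v (k u)" using factors_comp_monic[OF w(1) km[OF u(1)]] v k[OF u(1)] by simp
    then show "\<exists>l\<in>k ` U. factors_through C v l" using u by blast
  qed (use k in auto)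
  have ccov: "jointly_covering C (prd P (Dom C w) X) (c ` U)"
  proof (rule covering_mono[where K = "{p. \<exists>l\<in>k ` U. \<exists>q. is_pullback C (pr1 P (Dom C w) X) l p q}"])
    show "jointly_covering C (prd P (Dom C w) X) {p. \<exists>l\<in>k ` U. \<exists>q. is_pullback C (pr1 P (Dom C w) X) l p q}"
      using covering_pullback[OF kcov, of "pr1 P (Dom C w) X"] km w by auto
    fix p assume "p \<in> {p. \<exists>l\<in>k ` U. \<exists>q. is_pullback C (pr1 P (Dom C w) X) l p q}"
    then obtain u q where u: "u \<in> U" and pb: "is_pullback C (pr1 P (Dom C w) X) (k u) p q" by blast
    note D = pullbackD[OF pb]
    have wX: "Dom C w \<in> Obj C" using w by simp
    have q: "Cod C q = ?S u" "Cod C p = prd P (Dom C w) X" using D k[OF u] wX by auto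
    have "c u \<cdot> tuple C P q (pr2 P (Dom C w) X \<cdot> p) = p"
    proof (rule prd_ext[of _ _ "Dom C w" X])
      show "pr1 P (Dom C w) X \<cdot> (c u \<cdot> tuple C P q (pr2 P (Dom C w) X \<cdot> p)) = pr1 P (Dom C w) X \<cdot> p"
        unfolding D(9) using comp_reduce[OF c1(1)[OF u]] D(3,4,8) q u wX k[OF u] by simp
      show "pr2 P (Dom C w) X \<cdot> (c u \<cdot> tuple C P q (pr2 P (Dom C w) X \<cdot> p)) = pr2 P (Dom C w) X \<cdot> p"
        using comp_reduce[OF c1(2)[OF u]] D(3,4,8) q u wX k[OF u] by simp
    qed (use D(3,4,8) q u wX in simp_all)
    moreover have "factors_through C (c u \<cdot> tuple C P q (pr2 P (Dom C w) X \<cdot> p)) (c u)"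
      using D(3,4,8) q u wX by (intro factors_comp) simp_all
    ultimately show "\<exists>l\<in>c ` U. factors_through C p l" using u by auto
  qed auto
  have cocone_c: "c v \<cdot> f = c u"
    if uv: "u \<in> U" "v \<in> U" and f: "f \<in> Arr C" "Dom C f = prd P (?S u) X" "Cod C f = prd P (?S v) X"
      "pr2 P (?S v) X \<cdot> f = pr2 P (?S u) X" for u v f
  proof (rule prd_ext[of _ _ "Dom C w" X])
    show "pr1 P (Dom C w) X \<cdot> (c v \<cdot> f) = pr1 P (Dom C w) X \<cdot> c u"
      using uv f w by (intro subterminal_ext[OF w(1,3)]) auto
    show "pr2 P (Dom C w) X \<cdot> (c v \<cdot> f) = pr2 P (Dom C w) X \<cdot> c u"
      using uv f w comp_reduce[OF c1(2)[OF uv(2)], of f] c1(2)[OF uv(1)] by simp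
  qed (use uv f w in auto)
  have act: "act C (cartesian C P) (r u) X = pr2 P (?S u) X" if "u \<in> U" for u
    using act_eq[of "r u" X] rep[of u] Uc that by auto
  let ?J = "D_shape C (cartesian C P) r U X" and ?D = "D_diagram C (cartesian C P) r X"
  have cocone: "is_cocone ?J C ?D Y x \<longleftrightarrow> Y \<in> Obj C \<and> (\<forall>u\<in>U. x u \<in> Hom C (prd P (?S u) X) Y) \<and>
     (\<forall>u\<in>U. \<forall>v\<in>U. \<forall>f\<in>Hom C (prd P (?S u) X) (prd P (?S v) X). pr2 P (?S v) X \<cdot> f = pr2 P (?S u) X \<longrightarrow> x v \<cdot> f =
         x u)" for Y x
    unfolding is_cocone_def D_shape_def D_diagram_def by (auto simp: act)
  have "is_colimit ?J C ?D (prd P (Dom C w) X) (\<lambda>u. canonical_map C (cartesian C P) (r u) w X)"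
    unfolding is_colimit_def
  proof (intro conjI allI impI)
    show "is_cocone ?J C ?D (prd P (Dom C w) X) (\<lambda>u. canonical_map C (cartesian C P) (r u) w X)"
      unfolding cocone using w cocone_c by (auto simp: can)
    fix Y x assume x: "is_cocone ?J C ?D Y x"
    have "\<exists>!h. h \<in> Hom C (prd P (Dom C w) X) Y \<and> (\<forall>u\<in>U. h \<cdot> c u = x u)"
    proof (rule covering_glue[OF smU _ _ cm ccov])
      show "prd P (Dom C w) X \<in> Obj C" "Y \<in> Obj C" using w x by (auto simp: cocone)
      show "x u \<in> Hom C (Dom C (c u)) Y" if "u \<in> U" for u using x that by (simp add: cocone)
      fix u v p q assume uv: "u \<in> U" "v \<in> U" and pq: "p \<in> Arr C" "q \<in> Arr C" "Cod C p = Dom C (c u)"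
          "Cod C q = Dom C (c v)" "Dom C p = Dom C q"
        and e: "c u \<cdot> p = c v \<cdot> q"
      have uc: "u \<in> carrier (Sub C (one P))" "v \<in> carrier (Sub C (one P))" using uv Uc by auto
      let ?m = "u \<sqinter>\<^bsub>Sub C (one P)\<^esub> v"
      have mU: "?m \<in> U" using U uv unfolding idempotent_subunits_def ISub_eq by blast
      have mc: "?m \<in> carrier (Sub C (one P))" using mU Uc by blast
      obtain n where n: "?m = subobject C n" "monic C n" "Cod C n = one P"
        "\<And>x. \<lbrakk>x \<in> Arr C; Cod C x = one P\<rbrakk> \<Longrightarrow> factors_through C x n \<longleftrightarrow> factors_through C x (r u) \<and>
          factors_through C x (r v)"
        by (rule Sub_meet[OF uc(1) r_in[OF uc(1)] uc(2) r_in[OF uc(2)]]) (rule that)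
      have rm: "factors_through C (r ?m) n" "factors_through C n (r ?m)" using r_in[OF mc] n
          by (auto simp: subobject_iff)
      have mle: "factors_through C (r ?m) (r u)" "factors_through C (r ?m) (r v)"
        using n(4)[of "r ?m"] rm rep[OF mc] by auto
      obtain a where a: "a \<in> Arr C" "Dom C a = ?S ?m" "Cod C a = ?S u" using mle(1) by (auto simp: factors_iff)
      obtain b where b: "b \<in> Arr C" "Dom C b = ?S ?m" "Cod C b = ?S v" using mle(2) by (auto simp: factors_iff)
      let ?p1 = "pr1 P (?S u) X \<cdot> p" and ?q1 = "pr1 P (?S v) X \<cdot> q"
      have t: "r u \<cdot> ?p1 = r v \<cdot> ?q1" using rep[OF uc(1)] rep[OF uc(2)] uv pq by (intro to_one_ext) auto
      have "factors_through C (r u \<cdot> ?p1) (r u)" using rep[OF uc(1)] uv pq by (intro factors_comp) auto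
      moreover have "factors_through C (r u \<cdot> ?p1) (r v)" unfolding t using rep[OF uc(2)] uv pq
          by (intro factors_comp) auto
      moreover have rp: "r u \<cdot> ?p1 \<in> Arr C" "Cod C (r u \<cdot> ?p1) = one P" using rep[OF uc(1)] uv pq by auto
      ultimately have "factors_through C (r u \<cdot> ?p1) n" using n(4) by blast
      then have "factors_through C (r u \<cdot> ?p1) (r ?m)" using factors_trans[of _ n
          "r ?m"] rm(2) rp n(2) rep(2)[OF mc] by auto
      then obtain z where z: "z \<in> Arr C" "Dom C z = Dom C p" "Cod C z = ?S ?m"
        using rep[OF uc(1)] uv pq by (auto simp: factors_iff)
      \<comment> \<open>The arrow z takes p and q into the meet m of u and v; both composites are the restriction of the component at m.\<close>
      have common: "x u \<cdot> p = x ?m \<cdot> tuple C P z (pr2 P (?S u) X \<cdot> p)"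
        if a: "a \<in> Arr C" "Dom C a = ?S ?m" "Cod C a = ?S u" and u: "u \<in> U" and p: "p \<in> Arr C"
          "Cod C p = Dom C (c u)" "Dom C p = Dom C z"
        for a u p
      proof -
        have uc: "u \<in> carrier (Sub C (one P))" using u Uc by blast
        let ?a = "tuple C P (a \<cdot> pr1 P (?S ?m) X) (pr2 P (?S ?m) X)"
        have xu: "x u \<in> Arr C" "Dom C (x u) = prd P (?S u) X" using x u by (auto simp: cocone)
        have xa: "x u \<cdot> ?a = x ?m" using x u mU a by (simp add: cocone)
        have "?a \<cdot> tuple C P z (pr2 P (?S u) X \<cdot> p) = p"
        proof (rule prd_ext[of _ _ "?S u" X])
          show "pr1 P (?S u) X \<cdot> (?a \<cdot> tuple C P z (pr2 P (?S u) X \<cdot> p)) = pr1 P (?S u) X \<cdot> p"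
            by (rule subterminal_ext[OF rep(1,3)[OF uc]]) (use a u p z mU in simp_all)
        qed (use a u p z mU in simp_all)
        then show ?thesis using comp_reduce[OF xa, of "tuple C P z (pr2 P (?S u) X \<cdot> p)"] xu a u p z mU by simp
      qed
      have "pr2 P (?S u) X \<cdot> p = pr2 P (?S v) X \<cdot> q"
        using arg_cong[OF e, of "\<lambda>y. pr2 P (Dom C w) X \<cdot> y"] comp_reduce[OF c1(2)[OF uv(1)], of p] comp_reduce[OF c1(2)[OF uv(2)], of q] uv pq w
        by simp
      then show "x u \<cdot> p = x v \<cdot> q" using common[OF a uv(1) pq(1,3)] common[OF b uv(2) pq(2,4)] z pq(5) by simp
    qed auto
    then show "\<exists>!h. h \<in> Hom C (prd P (Dom C w) X) Y \<and> (\<forall>u\<in>Obj ?J.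
        h \<cdot> canonical_map C (cartesian C P) (r u) w X = x u)"
      by (simp add: can D_shape_def)
  qed
  then show ?thesis by (simp add: ISub_eq w_def V_def)
qed

theorem cartesian_locale: "locale_based C (cartesian C P)"
  unfolding locale_based_def
proof (intro conjI allI impI ballI)
  show "braided_monoidal_category C (cartesian C P)" by (rule cartesian_braided)
  show "stiff C (cartesian C P)" by (rule cartesian_stiff)
  show "frame (ISub C (cartesian C P))" unfolding ISub_eq by (rule Sub_frame[OF _ small_Sub_one]) simp
qed (rule D_colimit, auto)

end

lemma (in finitely_complete_category) chosen_products_exist: "\<exists>P. chosen_products C P"
proof -
  obtain T where T: "is_terminal C T" using terminal_exists by blast
  have "\<forall>A\<in>Obj C. \<forall>B\<in>Obj C. \<exists>x. is_product C A B (fst x) (fst (snd x)) (snd (snd x))"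
    using product_exists by (metis fst_conv snd_conv)
  then obtain f where "\<forall>A\<in>Obj C. \<forall>B\<in>Obj C. is_product C A B (fst (f A B)) (fst (snd (f A B))) (snd (snd (f A B)))"
    by metis
  then have "chosen_products C \<lparr>one = T, prd = (\<lambda>A B. fst (f A B)), pr1 = (\<lambda>A B. fst (snd (f A B))), pr2 =
      (\<lambda>A B. snd (snd (f A B)))\<rparr>"
    using T by (simp add: chosen_products_def)
  then show ?thesis by blast
qed

theorem (in geometric_category) cartesian_locale_basedI:
  assumes "cartesian_small_ISub \<kappa> C"
  shows "cartesian_locale_based C"
  unfolding cartesian_locale_based_def
proof (intro conjI allI impI)
  show "\<exists>P. chosen_products C P" by (rule chosen_products_exist)
  fix P assume P: "chosen_products C P"
  interpret cartesian_category C P by unfold_locales (rule P)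
  interpret geometric_cartesian C \<kappa> P
    using assms[unfolded cartesian_small_ISub_def, rule_format, OF P] by unfold_locales (simp only: ISub_eq)
  show "locale_based C (cartesian C P)" by (rule cartesian_locale)
qed

section \<open>Recognizing Heyting categories\<close>

text \<open>Here universal quantification has its universal property with respect to all arrows into the codomain. For covers that are
not monic this stronger form is needed.\<close>

locale strongly_geometric_category = geometric_category +
  assumes strong_forall_exists: "\<lbrakk>f \<in> Arr C; monic C n; Cod C n = Dom C f\<rbrakk> \<Longrightarrow>
    \<exists>d. monic C d \<and> Cod C d = Cod C f \<and> (\<forall>x p q. is_pullback C f x p q \<longrightarrow> (factors_through C x d \<longleftrightarrow>
        factors_through C p n))"
begin

text \<open>The argument is that of \<open>covering_pullback\<close>, for one arrow g that need not be monic.\<close>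

lemma cover_pullback:
  assumes pb: "is_pullback C f g p q" and g: "cover C g"
  shows "cover C p"
  unfolding cover_def
proof (intro conjI allI impI)
  note D = pullbackD[OF pb]
  show "p \<in> Arr C" by (rule D)
  fix n assume n: "monic C n \<and> Cod C n = Cod C p \<and> factors_through C p n"
  obtain d where d: "monic C d" "Cod C d = Cod C f"
    "\<And>x p q. is_pullback C f x p q \<Longrightarrow> factors_through C x d \<longleftrightarrow> factors_through C p n"
    using strong_forall_exists[of f n] D n by auto
  have "factors_through C g d" using d(3)[OF pb] n by simp
  then have "isomorphism C d" using g d D by (auto simp: cover_def)
  then have "factors_through C (Ident C (Cod C f)) d" using iso_factors[of d "Ident C (Cod C f)"] d D by simp
  then have "factors_through C (Ident C (Dom C f)) n" using d(3)[OF pullback_of_ident[OF D(1)]] by simp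
  then show "isomorphism C n" using n D split_monic_iso[of n] by simp
qed

lemma pull_carrier:
  assumes "f \<in> Arr C" "u \<in> carrier (Sub C (Cod C f))"
  shows "pull C f u \<in> carrier (Sub C (Dom C f))"
proof -
  obtain m where m: "u = subobject C m" "monic C m" "Cod C m = Cod C f" using assms(2) by (rule Sub_memE)
  obtain p q where pq: "is_pullback C f m p q" using pullback_exists[of f m] assms m by auto
  show ?thesis
    using pull_subobject[OF pq m(2)] m Sub_memI[OF pullback_monic[OF pq m(2)]] pullbackD(6)[OF pq] by simp
qed

text \<open>Pulling back has a right adjoint.\<close>

lemma pull_sup:
  assumes f: "f \<in> Arr C" and U: "small \<kappa> U" "U \<subseteq> carrier (Sub C (Cod C f))"
  shows "pull C f (\<Squnion>\<^bsub>Sub C (Cod C f)\<^esub> U) = \<Squnion>\<^bsub>Sub C (Dom C f)\<^esub> (pull C f ` U)"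
proof -
  obtain j where j: "least (Sub C (Cod C f)) (subobject C j) (Upper (Sub C (Cod C f)) U)" "monic C j"
      "Cod C j = Cod C f"
    using Sub_join_exists[OF U(2,1)] f by auto
  have join: "is_join C (\<Union> U) j" using Sub_least_iff[OF U(2), of j] j by simp
  obtain p q where pq: "is_pullback C f j p q" using pullback_exists[of f j] j f by auto
  have p: "monic C p" "Cod C p = Dom C f" using pullback_monic[OF pq j(2)] pullbackD[OF pq] by auto
  have sub: "pull C f ` U \<subseteq> carrier (Sub C (Dom C f))" using pull_carrier[OF f] U by blast
  have "is_join C (\<Union> (pull C f ` U)) p"
    unfolding is_join_def
  proof (intro conjI allI impI ballI)
    show "monic C p" by fact
    fix x assume "x \<in> \<Union> (pull C f ` U)"
    then obtain u m t where u: "u \<in> U" "m \<in> u" and x: "is_pullback C f m x t" by (auto simp: pull_def)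
    have m: "monic C m" using Sub_rep(1)[OF subsetD[OF U(2) u(1)] u(2)] .
    note D = pullbackD[OF x]
    have "factors_through C (f \<cdot> x) m" using pullback_factors[OF x m, of x] D by simp
    moreover have "factors_through C m j" using join u by (auto simp: is_join_def)
    ultimately have "factors_through C (f \<cdot> x) j" using factors_trans[of "f \<cdot> x" m j] D(1-8) j m by simp
    then show "factors_through C x p" using pullback_factors[OF pq j(2), of x] D(1-8) by simp
  next
    fix n assume n: "monic C n \<and> Cod C n = Cod C p \<and> (\<forall>x\<in>\<Union> (pull C f ` U). factors_through C x n)"
    obtain d where d: "is_forall C f n d" using forall_exists[of f n] f n p by auto
    have "factors_through C m d" if m: "m \<in> u" "u \<in> U" for m u
    proof -
      note mm = Sub_rep[OF subsetD[OF U(2) m(2)] m(1)]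
      obtain x t where x: "is_pullback C f m x t" using pullback_exists[of f m] mm f by auto
      have "x \<in> pull C f u" using x m by (auto simp: pull_def)
      then have "factors_through C x n" using n m by blast
      then show ?thesis using d x mm by (auto simp: is_forall_def)
    qed
    then have "\<forall>m\<in>\<Union> U. factors_through C m d" by blast
    then have "factors_through C j d" using join d j by (simp add: is_join_def is_forall_def)
    then show "factors_through C p n" using d pq j by (auto simp: is_forall_def)
  qed
  then have "\<Squnion>\<^bsub>Sub C (Dom C f)\<^esub> (pull C f ` U) = subobject C p"
    using Sub_least_iff[OF sub p] by (intro Sub_sup_eqI) simp
  then show ?thesis using Sub_sup_eqI[OF j(1)] pull_subobject[OF pq j(2)] by simp
qed

lemma pull_adjoint:
  assumes f: "f \<in> Arr C" and v: "v \<in> carrier (Sub C (Dom C f))"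
  shows "\<exists>w. w \<in> carrier (Sub C (Cod C f)) \<and>
    (\<forall>u\<in>carrier (Sub C (Cod C f)). sub_le C (pull C f u) v \<longleftrightarrow> sub_le C u w)"
proof -
  obtain n where n: "v = subobject C n" "monic C n" "Cod C n = Dom C f" using v by (rule Sub_memE)
  obtain d where d: "is_forall C f n d" using forall_exists[of f n] f n by auto
  then have dm: "monic C d" "Cod C d = Cod C f" by (auto simp: is_forall_def)
  have "sub_le C (pull C f u) v \<longleftrightarrow> sub_le C u (subobject C d)" if u: "u \<in> carrier (Sub C (Cod C f))" for u
  proof -
    obtain m where m: "u = subobject C m" "monic C m" "Cod C m = Cod C f" using u by (rule Sub_memE)
    obtain p q where pq: "is_pullback C f m p q" using pullback_exists[of f m] m f by auto
    show ?thesis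
      using d m pq pull_subobject[OF pq m(2)] pullback_monic[OF pq m(2)] n dm by (auto simp: is_forall_def sub_le_iff)
  qed
  then show ?thesis using Sub_memI[OF dm] by blast
qed

theorem heyting: "heyting_category C"
  unfolding heyting_category_def coherent_category_def regular_category_def
proof (intro conjI ballI allI impI)
  show "category C" "finitely_complete C" by (rule category_axioms) (rule fin_complete)
  show "\<exists>m. is_image C f m" if "f \<in> Arr C" for f using image_exists that by blast
  show "cover C p" if "is_pullback C f g p q \<and> cover C g" for f g p q using cover_pullback that by blast
  show "\<exists>s. least (Sub C A) s (Upper (Sub C A) U)" if "A \<in> Obj C" "finite U \<and> U \<subseteq> carrier (Sub C A)" for A U
    using Sub_join_exists[of U A] small_finite[OF infinite_kappa, of U] that by blast
  show "pull C f (\<Squnion>\<^bsub>Sub C (Cod C f)\<^esub> U) = \<Squnion>\<^bsub>Sub C (Dom C f)\<^esub> (pull C f ` U)"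
    if "f \<in> Arr C" "finite U \<and> U \<subseteq> carrier (Sub C (Cod C f))" for f U
    using pull_sup[of f U] small_finite[OF infinite_kappa, of U] that by blast
  fix f assume f: "f \<in> Arr C"
  obtain all_f where a: "\<And>v. v \<in> carrier (Sub C (Dom C f)) \<Longrightarrow> all_f v \<in> carrier (Sub C (Cod C f)) \<and>
    (\<forall>u\<in>carrier (Sub C (Cod C f)). sub_le C (pull C f u) v \<longleftrightarrow> sub_le C u (all_f v))"
    using pull_adjoint[OF f] by metis
  have "galois_connection \<lparr>orderA = Sub C (Cod C f), orderB = Sub C (Dom C f), lower = pull C f, upper = all_f\<rparr>"
    using Sub_partial_order pull_carrier[OF f] a
    by (intro galois_connection.intro connection.intro galois_connection_axioms.intro) auto
  then show "\<exists>all_f. galois_connection \<lparr>orderA = Sub C (Cod C f), orderB = Sub C (Dom C f), lower =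
      pull C f, upper = all_f\<rparr>"
    by blast
qed

end

section \<open>Cocomplete elementary toposes are Heyting categories\<close>

locale topos = finitely_complete_category C for C :: "('o, 'a) cat" (structure) +
  fixes \<Omega> :: 'o and tr :: 'a
  assumes classifier: "is_subobject_classifier C \<Omega> tr"
    and exponential: "\<lbrakk>A \<in> Obj C; B \<in> Obj C\<rbrakk> \<Longrightarrow> \<exists>E P p q ev. is_exponential C A B E P p q ev"
begin

lemma tr: "tr \<in> Arr C" "Cod C tr = \<Omega>" "is_terminal C (Dom C tr)"
  using classifier by (auto simp: is_subobject_classifier_def)

lemma tr_monic: "monic C tr"
proof (rule monicI)
  fix f g assume "f \<in> Arr C" "g \<in> Arr C" "Cod C f = Dom C tr" "Cod C g = Dom C tr" "Dom C f = Dom C g"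
  then show "f = g" using terminal_ext[OF tr(3), of f g] by simp
qed (rule tr)

lemma character_exists:
  assumes m: "monic C m"
  shows "\<exists>\<chi>. \<chi> \<in> Hom C (Cod C m) \<Omega> \<and> (\<forall>x. x \<in> Arr C \<and> Cod C x = Cod C m \<longrightarrow> (factors_through C (\<chi> \<cdot> x) tr \<longleftrightarrow>
      factors_through C x m))"
proof -
  obtain \<chi> t where c: "\<chi> \<in> Hom C (Cod C m) \<Omega>" "is_pullback C \<chi> tr m t"
    using classifier m unfolding is_subobject_classifier_def by metis
  then show ?thesis using pullback_factors[OF c(2) tr_monic] by auto
qed

text \<open>An arrow to \<Omega> is determined by the generalized elements that it sends to truth: the pullback of truth along it has these
as its elements, and it is the character of this pullback.\<close>

lemma character_unique:
  assumes c: "c \<in> Hom C Y \<Omega>" "c' \<in> Hom C Y \<Omega>"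
    and eq: "\<And>x. \<lbrakk>x \<in> Arr C; Cod C x = Y\<rbrakk> \<Longrightarrow> factors_through C (c \<cdot> x) tr \<longleftrightarrow> factors_through C (c' \<cdot> x) tr"
  shows "c = c'"
proof -
  obtain m t where m: "is_pullback C c tr m t" using pullback_exists[of c tr] c tr by auto
  note D = pullbackD[OF m]
  have mm: "monic C m" by (rule pullback_monic[OF m tr_monic])
  have "factors_through C (c \<cdot> m) tr" using pullback_factors[OF m tr_monic, of m] D by simp
  then have "factors_through C (c' \<cdot> m) tr" using eq[of m] D c by simp
  then obtain t' where t': "t' \<in> Arr C" "Dom C t' = Dom C m" "Cod C t' = Dom C tr" "tr \<cdot> t' = c' \<cdot> m"
    using c D by (auto simp: factors_iff)
  have m': "is_pullback C c' tr m t'"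
  proof (rule pullbackI)
    fix x y assume xy: "x \<in> Arr C" "y \<in> Arr C" "Cod C x = Dom C c'" "Cod C y = Dom C tr" "Dom C x = Dom C y"
        "c' \<cdot> x = tr \<cdot> y"
    then have "factors_through C (c' \<cdot> x) tr" using tr by simp
    then have "factors_through C x m" using eq[of x] xy c pullback_factors[OF m tr_monic, of x] by simp
    then obtain h where h: "h \<in> Arr C" "Dom C h = Dom C x" "Cod C h = Dom C m" "m \<cdot> h = x" by (auto simp: factors_iff)
    moreover have "t' \<cdot> h = y" using t' h xy by (intro terminal_ext[OF tr(3)]) auto
    ultimately show "\<exists>h\<in>Arr C. Dom C h = Dom C x \<and> Cod C h = Dom C m \<and> m \<cdot> h = x \<and> t' \<cdot> h = y" by blast
  next
    fix h k assume "h \<in> Arr C" "k \<in> Arr C" "Cod C h = Dom C m" "Cod C k = Dom C m" "Dom C h = Dom C k" "m \<cdot> h = m \<cdot> k"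
    then show "h = k" by (rule monicD[OF mm])
  qed (use c D t' tr in auto)
  have "\<exists>!\<chi>. \<chi> \<in> Hom C (Cod C m) \<Omega> \<and> (\<exists>t. is_pullback C \<chi> tr m t)"
    using classifier mm unfolding is_subobject_classifier_def by blast
  moreover have "c \<in> Hom C (Cod C m) \<Omega>" "c' \<in> Hom C (Cod C m) \<Omega>" using c D by auto
  ultimately show ?thesis using m m' by blast
qed

text \<open>A subobject is the equalizer of its character and the character of the whole object.\<close>

lemma factors_iff_character:
  assumes n: "monic C n"
  obtains c c' where "c \<in> Hom C (Cod C n) \<Omega>" "c' \<in> Hom C (Cod C n) \<Omega>"
    "\<And>x. \<lbrakk>x \<in> Arr C; Cod C x = Cod C n\<rbrakk> \<Longrightarrow> factors_through C x n \<longleftrightarrow> c \<cdot> x = c' \<cdot> x"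
proof -
  obtain c where c: "c \<in> Hom C (Cod C n) \<Omega>"
    "\<And>x. \<lbrakk>x \<in> Arr C; Cod C x = Cod C n\<rbrakk> \<Longrightarrow> factors_through C (c \<cdot> x) tr \<longleftrightarrow> factors_through C x n"
    using character_exists[OF n] by blast
  have I: "monic C (Ident C (Cod C n))" using ident_monic n by simp
  obtain c' where c': "c' \<in> Hom C (Cod C n) \<Omega>"
    "\<And>x. \<lbrakk>x \<in> Arr C; Cod C x = Cod C n\<rbrakk> \<Longrightarrow> factors_through C (c' \<cdot> x) tr \<longleftrightarrow> factors_through C x (Ident C (Cod C n))"
    using character_exists[OF I] n by auto
  have c'x: "factors_through C (c' \<cdot> x) tr" if "x \<in> Arr C" "Cod C x = Cod C n" for x
    using c'(2)[OF that] that n by (auto simp: factors_iff)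
  have "factors_through C x n \<longleftrightarrow> c \<cdot> x = c' \<cdot> x" if x: "x \<in> Arr C" "Cod C x = Cod C n" for x
  proof
    assume "factors_through C x n"
    then have "factors_through C (c \<cdot> x) tr" using c(2)[OF x] by simp
    then obtain k where k: "k \<in> Arr C" "Dom C k = Dom C x" "Cod C k = Dom C tr" "tr \<cdot> k = c \<cdot> x" using c x
        by (auto simp: factors_iff)
    obtain l where l: "l \<in> Arr C" "Dom C l = Dom C x" "Cod C l = Dom C tr" "tr \<cdot> l = c' \<cdot> x"
      using c'x[OF x] c' x by (auto simp: factors_iff)
    have "k = l" using k l by (intro terminal_ext[OF tr(3)]) auto
    then show "c \<cdot> x = c' \<cdot> x" using k l by simp
  next
    assume "c \<cdot> x = c' \<cdot> x" then show "factors_through C x n" using c(2)[OF x] c'x[OF x] by simp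
  qed
  then show ?thesis using that c(1) c'(1) by blast
qed

text \<open>Write \<gamma> for the graph of f in B \<times> A. Two transposes, from B to the exponential of \<Omega> by A, agree after composition with x : X \<rightarrow> B precisely if the
corresponding arrows to \<Omega> agree on X \<times> A. For the characters of \<gamma> and of \<gamma> restricted to n this says that every pair (t, a)
with x t = f a has a in n, that is, that the pullback of x along f factors through n.\<close>

lemma topos_forall:
  assumes f: "f \<in> Arr C" and n: "monic C n" "Cod C n = Dom C f"
  shows "\<exists>d. monic C d \<and> Cod C d = Cod C f \<and> (\<forall>x p q. is_pullback C f x p q \<longrightarrow> (factors_through C x d \<longleftrightarrow>
      factors_through C p n))"
proof -
  let ?A = "Dom C f" and ?B = "Cod C f"
  have \<Omega>: "\<Omega> \<in> Obj C" using tr Cod_Obj by blast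
  obtain E PE p q ev where E: "is_exponential C ?A \<Omega> E PE p q ev" using exponential[of ?A \<Omega>] \<Omega> f by auto
  then have PE: "is_product C E ?A PE p q" and ev: "ev \<in> Hom C PE \<Omega>" by (auto simp: is_exponential_def)
  obtain Q p' q' where Q: "is_product C ?B ?A Q p' q'" using product_exists[of ?B ?A] f by auto
  note [simp] = productD[OF PE] productD[OF Q]
  obtain \<gamma> where \<gamma>: "\<gamma> \<in> Arr C" "Dom C \<gamma> = ?A" "Cod C \<gamma> = Q" "p' \<cdot> \<gamma> = f" "q' \<cdot> \<gamma> = Ident C ?A"
    using product_univ[OF Q, of f "Ident C ?A"] f by auto
  have \<gamma>m: "monic C \<gamma>" using monic_cancel[of q' \<gamma>] \<gamma> f ident_monic by simp
  have \<gamma>nm: "monic C (\<gamma> \<cdot> n)" using monic_comp[OF \<gamma>m n(1)] \<gamma> n by simp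
  obtain c1 where c1: "c1 \<in> Hom C Q \<Omega>"
    "\<And>x. \<lbrakk>x \<in> Arr C; Cod C x = Q\<rbrakk> \<Longrightarrow> factors_through C (c1 \<cdot> x) tr \<longleftrightarrow> factors_through C x \<gamma>"
    using character_exists[OF \<gamma>m] \<gamma> by auto
  obtain c2 where c2: "c2 \<in> Hom C Q \<Omega>"
    "\<And>x. \<lbrakk>x \<in> Arr C; Cod C x = Q\<rbrakk> \<Longrightarrow> factors_through C (c2 \<cdot> x) tr \<longleftrightarrow> factors_through C x (\<gamma> \<cdot> n)"
    using character_exists[OF \<gamma>nm] \<gamma> n by auto
  have transpose: "\<exists>!g. g \<in> Hom C Z E \<and> (\<exists>h\<in>Hom C R PE. p \<cdot> h = g \<cdot> r \<and> q \<cdot> h = s \<and> ev \<cdot> h = c)"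
    if "is_product C Z ?A R r s" "c \<in> Hom C R \<Omega>" for Z R r s c
    using E that unfolding is_exponential_def by blast
  obtain g1 h1 where g1: "g1 \<in> Arr C" "Dom C g1 = ?B" "Cod C g1 = E" and h1: "h1 \<in> Arr C" "Dom C h1 = Q"
      "Cod C h1 = PE"
    "p \<cdot> h1 = g1 \<cdot> p'" "q \<cdot> h1 = q'" "ev \<cdot> h1 = c1"
    using ex1_implies_ex[OF transpose[OF Q c1(1)]] by auto
  obtain g2 h2 where g2: "g2 \<in> Arr C" "Dom C g2 = ?B" "Cod C g2 = E" and h2: "h2 \<in> Arr C" "Dom C h2 = Q"
      "Cod C h2 = PE"
    "p \<cdot> h2 = g2 \<cdot> p'" "q \<cdot> h2 = q'" "ev \<cdot> h2 = c2"
    using ex1_implies_ex[OF transpose[OF Q c2(1)]] by auto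
  obtain d where d: "monic C d" "Cod C d = ?B"
    "\<And>x. \<lbrakk>x \<in> Arr C; Cod C x = ?B\<rbrakk> \<Longrightarrow> factors_through C x d \<longleftrightarrow> g1 \<cdot> x = g2 \<cdot> x"
    using equalizer_exists[of g1 g2] g1 g2 by metis
  have "factors_through C x d \<longleftrightarrow> factors_through C a n" if pb: "is_pullback C f x a t" for x a t
  proof -
    note D = pullbackD[OF pb]
    note [simp] = D(2-4,6-8)
    have Dx [simp]: "Cod C x = ?B" using D(5) by simp
    obtain R r s where R: "is_product C (Dom C x) ?A R r s" using product_exists[of "Dom C x" ?A] f by auto
    note [simp] = productD[OF R]
    obtain y where y: "y \<in> Arr C" "Dom C y = R" "Cod C y = Q" "p' \<cdot> y = x \<cdot> r" "q' \<cdot> y = s"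
      using product_univ[OF Q, of "x \<cdot> r" s] by auto
    have tg: "g \<cdot> x \<in> Hom C (Dom C x) E \<and> (\<exists>h\<in>Hom C R PE. p \<cdot> h = (g \<cdot> x) \<cdot> r \<and> q \<cdot> h = s \<and> ev \<cdot> h = c \<cdot> y)"
      if g: "g \<in> Arr C" "Dom C g = ?B" "Cod C g = E" and h: "h \<in> Arr C" "Dom C h = Q" "Cod C h = PE"
       "p \<cdot> h = g \<cdot> p'" "q \<cdot> h = q'" "ev \<cdot> h = c" for g h c
    proof (intro conjI bexI[of _ "h \<cdot> y"])
      show "p \<cdot> (h \<cdot> y) = (g \<cdot> x) \<cdot> r" using comp_reduce[OF h(4), of y] g h(1-3) y by simp
      show "q \<cdot> (h \<cdot> y) = s" using comp_reduce[OF h(5), of y] h(1-3) y by simp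
      show "ev \<cdot> (h \<cdot> y) = c \<cdot> y" using comp_reduce[OF h(6), of y] h(1-3) ev y by simp
    qed (use g h y in simp_all)
    have eqg: "g1 \<cdot> x = g2 \<cdot> x \<longleftrightarrow> c1 \<cdot> y = c2 \<cdot> y"
    proof
      assume "c1 \<cdot> y = c2 \<cdot> y"
      moreover have "c1 \<cdot> y \<in> Hom C R \<Omega>" using c1 y by simp
      ultimately show "g1 \<cdot> x = g2 \<cdot> x" using transpose[OF R, of "c1 \<cdot> y"] tg[OF g1 h1] tg[OF g2 h2] by auto
    next
      assume e: "g1 \<cdot> x = g2 \<cdot> x"
      have "p \<cdot> (h1 \<cdot> y) = (g1 \<cdot> x) \<cdot> r" "p \<cdot> (h2 \<cdot> y) = (g2 \<cdot> x) \<cdot> r"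
        using comp_reduce[OF h1(4), of y] comp_reduce[OF h2(4), of y] g1 h1(1-3) g2 h2(1-3) y by simp_all
      moreover have "q \<cdot> (h1 \<cdot> y) = s" "q \<cdot> (h2 \<cdot> y) = s"
        using comp_reduce[OF h1(5), of y] comp_reduce[OF h2(5), of y] h1(1-3) h2(1-3) y by simp_all
      ultimately have "h1 \<cdot> y = h2 \<cdot> y"
        using e h1(1-3) h2(1-3) y product_ext[OF PE, of "h1 \<cdot> y" "h2 \<cdot> y"] by simp
      then show "c1 \<cdot> y = c2 \<cdot> y"
        using comp_reduce[OF h1(6), of y] comp_reduce[OF h2(6), of y] h1(1-3) h2(1-3) ev y by simp
    qed
    have "c1 \<cdot> y = c2 \<cdot> y \<longleftrightarrow> factors_through C a n"
    proof
      assume e: "c1 \<cdot> y = c2 \<cdot> y"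
      obtain z where z: "z \<in> Arr C" "Dom C z = Dom C a" "Cod C z = R" "r \<cdot> z = t" "s \<cdot> z = a"
        using product_univ[OF R, of t a] by auto
      have "y \<cdot> z = \<gamma> \<cdot> a"
      proof (rule product_ext[OF Q])
        show "p' \<cdot> (y \<cdot> z) = p' \<cdot> (\<gamma> \<cdot> a)"
          using comp_reduce[OF y(4), of z] comp_reduce[OF \<gamma>(4), of a] y z \<gamma> D(9) by simp
        show "q' \<cdot> (y \<cdot> z) = q' \<cdot> (\<gamma> \<cdot> a)"
          using comp_reduce[OF y(5), of z] comp_reduce[OF \<gamma>(5), of a] y z \<gamma> by simp
      qed (use y z \<gamma> in simp_all)
      moreover have "factors_through C (\<gamma> \<cdot> a) \<gamma>" using \<gamma> by simp
      ultimately have "factors_through C (c1 \<cdot> (\<gamma> \<cdot> a)) tr" using c1(2)[of "\<gamma> \<cdot> a"] \<gamma> by simp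
      moreover have "c1 \<cdot> (\<gamma> \<cdot> a) = c2 \<cdot> (\<gamma> \<cdot> a)"
        using comp_reduce[OF e, of z] c1 c2 y z \<open>y \<cdot> z = \<gamma> \<cdot> a\<close> by simp
      ultimately have "factors_through C (\<gamma> \<cdot> a) (\<gamma> \<cdot> n)" using c2(2)[of "\<gamma> \<cdot> a"] \<gamma> by simp
      then show "factors_through C a n" using factors_comp_monic[OF \<gamma>m n(1), of a] \<gamma> n by simp
    next
      assume an: "factors_through C a n"
      show "c1 \<cdot> y = c2 \<cdot> y"
      proof (rule character_unique)
        show "c1 \<cdot> y \<in> Hom C R \<Omega>" "c2 \<cdot> y \<in> Hom C R \<Omega>" using c1 c2 y by simp_all
        fix z assume z: "z \<in> Arr C" "Cod C z = R"
        have "factors_through C (y \<cdot> z) \<gamma> \<longleftrightarrow> factors_through C (y \<cdot> z) (\<gamma> \<cdot> n)"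
        proof
          assume "factors_through C (y \<cdot> z) (\<gamma> \<cdot> n)"
          then show "factors_through C (y \<cdot> z) \<gamma>"
            using factors_trans[of "y \<cdot> z" "\<gamma> \<cdot> n" \<gamma>] y z \<gamma> n by simp
        next
          assume "factors_through C (y \<cdot> z) \<gamma>"
          then obtain b where b: "b \<in> Arr C" "Dom C b = Dom C z" "Cod C b = ?A" "\<gamma> \<cdot> b = y \<cdot> z"
            using y z \<gamma> by (auto simp: factors_iff)
          have "f \<cdot> b = p' \<cdot> (\<gamma> \<cdot> b)" using comp_reduce[OF \<gamma>(4), of b] \<gamma> b(1-3) by simp
          also have "\<dots> = x \<cdot> (r \<cdot> z)" unfolding b(4) using comp_reduce[OF y(4), of z] y z by simp
          finally have "f \<cdot> b = x \<cdot> (r \<cdot> z)" .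
          then obtain l where l: "l \<in> Arr C" "Dom C l = Dom C b" "Cod C l = Dom C a" "a \<cdot> l = b"
            using pullback_univ[OF pb, of b "r \<cdot> z"] b z by auto
          have "factors_through C (a \<cdot> l) n" using factors_precomp[OF an, of l] l n by simp
          then have "factors_through C (\<gamma> \<cdot> b) (\<gamma> \<cdot> n)" using factors_comp_monic[OF \<gamma>m n(1), of b] \<gamma> n b l by simp
          then show "factors_through C (y \<cdot> z) (\<gamma> \<cdot> n)" by (simp add: b)
        qed
        then show "factors_through C ((c1 \<cdot> y) \<cdot> z) tr \<longleftrightarrow> factors_through C ((c2 \<cdot> y) \<cdot> z) tr"
          using c1(2)[of "y \<cdot> z"] c2(2)[of "y \<cdot> z"] c1(1) c2(1) y z by simp
      qed
    qed
    then show ?thesis using d(3)[of x] eqg by simp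
  qed
  then show ?thesis using d(1,2) by blast
qed

text \<open>A subobject is determined by its character.\<close>

lemma small_Sub:
  assumes "small \<kappa> (Hom C A \<Omega>)"
  shows "small \<kappa> (carrier (Sub C A))"
proof -
  have "\<forall>u\<in>carrier (Sub C A). \<exists>c. c \<in> Hom C A \<Omega> \<and> (\<exists>m. u = subobject C m \<and> monic C m \<and> Cod C m = A \<and>
      (\<forall>x. x \<in> Arr C \<and> Cod C x = A \<longrightarrow> (factors_through C (c \<cdot> x) tr \<longleftrightarrow> factors_through C x m)))"
  proof
    fix u assume "u \<in> carrier (Sub C A)"
    then obtain m where m: "u = subobject C m" "monic C m" "Cod C m = A" by (rule Sub_memE)
    then show "\<exists>c. c \<in> Hom C A \<Omega> \<and> (\<exists>m. u = subobject C m \<and> monic C m \<and> Cod C m = A \<and>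
      (\<forall>x. x \<in> Arr C \<and> Cod C x = A \<longrightarrow> (factors_through C (c \<cdot> x) tr \<longleftrightarrow> factors_through C x m)))"
      using character_exists[OF m(2)] by blast
  qed
  then obtain c where c: "\<And>u. u \<in> carrier (Sub C A) \<Longrightarrow> c u \<in> Hom C A \<Omega> \<and> (\<exists>m. u = subobject C m \<and> monic C m \<and>
      Cod C m = A \<and>
      (\<forall>x. x \<in> Arr C \<and> Cod C x = A \<longrightarrow> (factors_through C (c u \<cdot> x) tr \<longleftrightarrow> factors_through C x m)))"
    by metis
  show ?thesis
  proof (rule small_inj[OF assms])
    show "c ` carrier (Sub C A) \<subseteq> Hom C A \<Omega>" using c by blast
    show "inj_on c (carrier (Sub C A))"
    proof (rule inj_onI)
      fix u v assume uv: "u \<in> carrier (Sub C A)" "v \<in> carrier (Sub C A)" and e: "c u = c v"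
      obtain m where m: "u = subobject C m" "monic C m" "Cod C m = A"
        "\<forall>x. x \<in> Arr C \<and> Cod C x = A \<longrightarrow> (factors_through C (c u \<cdot> x) tr \<longleftrightarrow> factors_through C x m)"
        using c[OF uv(1)] by blast
      obtain n where n: "v = subobject C n" "monic C n" "Cod C n = A"
        "\<forall>x. x \<in> Arr C \<and> Cod C x = A \<longrightarrow> (factors_through C (c v \<cdot> x) tr \<longleftrightarrow> factors_through C x n)"
        using c[OF uv(2)] by blast
      have "factors_through C x m \<longleftrightarrow> factors_through C x n" if "x \<in> Arr C" "Cod C x = A" for x
        using m(4)[rule_format, of x] n(4)[rule_format, of x] that unfolding e by blast
      from this[of m] this[of n] have "factors_through C m n" "factors_through C n m" using m(2,3) n(2,3) by simp_all
      then show "u = v" using subobject_eqI m n by blast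
    qed
  qed
qed

end

text \<open>Let e be the equalizer of the cokernel pair of f. A monomorphism n through which f factors is the equalizer of two arrows
that agree on f; they factor through the cokernel pair, so they agree on e, and e factors through n.\<close>

lemma (in finitely_complete_cocomplete) topos_image:
  assumes "topos C \<Omega> tr" and f: "f \<in> Arr C"
  shows "\<exists>m. is_image C f m"
proof -
  interpret topos C \<Omega> tr by fact
  obtain i j where ij: "i \<in> Arr C" "j \<in> Arr C" "Dom C i = Cod C f" "Dom C j = Cod C f" "Cod C i = Cod C j"
      "i \<cdot> f = j \<cdot> f"
    and univ: "\<And>x y. \<lbrakk>x \<in> Arr C; y \<in> Arr C; Dom C x = Cod C f; Dom C y = Cod C f; Cod C x = Cod C y; x \<cdot> f = y \<cdot> f\<rbrakk>
      \<Longrightarrow> \<exists>h \<in> Arr C. Dom C h = Cod C i \<and> Cod C h = Cod C x \<and> h \<cdot> i = x \<and> h \<cdot> j = y"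
    by (rule pushout_exists[OF f f refl]) (rule that)
  obtain e where e: "monic C e" "Cod C e = Cod C f"
    "\<And>x. \<lbrakk>x \<in> Arr C; Cod C x = Cod C f\<rbrakk> \<Longrightarrow> factors_through C x e \<longleftrightarrow> i \<cdot> x = j \<cdot> x"
    using equalizer_exists[of i j] ij by metis
  have "is_image C f e"
    unfolding is_image_def
  proof (intro conjI allI impI)
    show "monic C e" "Cod C e = Cod C f" by fact+
    show "factors_through C f e" using e(3)[OF f] ij by simp
    fix n assume n: "monic C n \<and> Cod C n = Cod C f \<and> factors_through C f n"
    obtain c c' where c: "c \<in> Hom C (Cod C n) \<Omega>" "c' \<in> Hom C (Cod C n) \<Omega>"
      "\<And>x. \<lbrakk>x \<in> Arr C; Cod C x = Cod C n\<rbrakk> \<Longrightarrow> factors_through C x n \<longleftrightarrow> c \<cdot> x = c' \<cdot> x"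
      using factors_iff_character[of n] n by blast
    have "c \<cdot> f = c' \<cdot> f" using c(3)[of f] f n by simp
    then obtain h where h: "h \<in> Arr C" "Dom C h = Cod C i" "h \<cdot> i = c" "h \<cdot> j = c'"
      using univ[of c c'] c n by auto
    have "i \<cdot> e = j \<cdot> e" using e(3)[of e] e by simp
    then have "c \<cdot> e = c' \<cdot> e"
      using comp_reduce[OF h(3), of e] comp_reduce[OF h(4), of e] h(1,2) ij e by simp
    then show "factors_through C e n" using c(3)[of e] e n by simp
  qed
  then show ?thesis by blast
qed

lemma elementary_topos_locale:
  assumes "elementary_topos C"
  obtains \<Omega> tr where "topos C \<Omega> tr"
proof -
  obtain \<Omega> tr where "is_subobject_classifier C \<Omega> tr" using assms by (auto simp: elementary_topos_def)
  then have "topos C \<Omega> tr"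
    using assms by (simp add: elementary_topos_def topos_def topos_axioms_def finitely_complete_category_def finitely_complete_category_axioms_def)
  then show ?thesis by (rule that)
qed

lemma topos_strongly_geometric:
  assumes T: "topos C \<Omega> tr" and \<kappa>: "Cinfinite \<kappa>" "cocomplete \<kappa> C"
  shows "strongly_geometric_category C \<kappa>"
proof -
  interpret topos C \<Omega> tr by fact
  interpret finitely_complete_cocomplete C \<kappa> using \<kappa> by unfold_locales
  show ?thesis
  proof
    show "\<exists>m. is_image C f m" if "f \<in> Arr C" for f using topos_image[OF T that] .
    fix f n assume fn: "f \<in> Arr C" "monic C n" "Cod C n = Dom C f"
    show "\<exists>d. monic C d \<and> Cod C d = Cod C f \<and> (\<forall>x p q. is_pullback C f x p q \<longrightarrow> (factors_through C x d \<longleftrightarrow>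
        factors_through C p n))"
      by (rule topos_forall[OF fn])
    then show "\<exists>d. is_forall C f n d" unfolding is_forall_def by blast
  qed
qed

lemma topos_small_ISub:
  assumes T: "topos C \<Omega> tr" and "locally_small \<kappa> C"
  shows "cartesian_small_ISub \<kappa> C"
  unfolding cartesian_small_ISub_def
proof (intro allI impI)
  interpret topos C \<Omega> tr by fact
  fix P assume "chosen_products C P"
  then interpret cartesian_category C P by unfold_locales
  have "\<Omega> \<in> Obj C" using tr Cod_Obj by blast
  then show "small \<kappa> (carrier (ISub C (cartesian C P)))"
    unfolding ISub_eq using assms(2) by (intro small_Sub) (simp add: locally_small_def del: Hom_iff)
qed

theorem heyting_locale_based:
  assumes "category C" "Cinfinite \<kappa>" "cocomplete \<kappa> C" "heyting_category C" "cartesian_small_ISub \<kappa> C"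
  shows "cartesian_locale_based C"
  using geometric_category.cartesian_locale_basedI[OF heyting_geometric] assms by blast

theorem topos_heyting:
  assumes "Cinfinite \<kappa>" "cocomplete \<kappa> C" "elementary_topos C"
  shows "heyting_category C"
  using elementary_topos_locale[OF assms(3)] topos_strongly_geometric[OF _ assms(1,2)] strongly_geometric_category.heyting by metis

theorem topos_locale_based:
  assumes "Cinfinite \<kappa>" "cocomplete \<kappa> C" "elementary_topos C" "locally_small \<kappa> C"
  shows "cartesian_small_ISub \<kappa> C \<and> cartesian_locale_based C"
proof -
  have "cartesian_small_ISub \<kappa> C" using elementary_topos_locale[OF assms(3)] topos_small_ISub assms(4) by metis
  then show ?thesis using heyting_locale_based topos_heyting assms by (metis elementary_topos_def)
qed

section \<open>Small sets in a universe\<close>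

lemma small_Pow:
  fixes \<kappa> :: "'u rel"
  assumes \<kappa>: "universe \<kappa>" and A: "small \<kappa> A"
  shows "small \<kappa> (Pow A)"
proof -
  obtain e :: "_ \<Rightarrow> 'u" where e: "inj_on e A" using small_embed[OF _ A] \<kappa> by (auto simp: universe_def)
  have "small \<kappa> (Pow (e ` A))" using \<kappa> small_image[OF A] by (auto simp: universe_def)
  then show ?thesis
    by (rule small_inj[of _ _ "image e"]) (use e in \<open>auto intro!: inj_onI simp: inj_on_image_eq_iff\<close>)
qed

lemma small_Sigma:
  assumes "universe \<kappa>" "small \<kappa> A" "\<And>a. a \<in> A \<Longrightarrow> small \<kappa> (B a)"
  shows "small \<kappa> (Sigma A B)"
  using assms unfolding universe_def small_def cinfinite_def by (intro stable_elim[OF regularCard_stable]) auto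

text \<open>A function is determined by its graph.\<close>

lemma small_functions:
  assumes \<kappa>: "universe \<kappa>" and A: "small \<kappa> A" "\<And>a. a \<in> A \<Longrightarrow> small \<kappa> (B a)"
    and F: "F \<subseteq> {t \<in> extensional A. \<forall>a\<in>A. t a \<in> B a}"
  shows "small \<kappa> F"
proof (rule small_inj[OF small_Pow[OF \<kappa> small_Sigma[OF \<kappa> A]]])
  let ?g = "\<lambda>t. (\<lambda>a. (a, t a)) ` A"
  show "inj_on ?g F"
  proof (rule inj_onI)
    fix s t assume st: "s \<in> F" "t \<in> F" "?g s = ?g t"
    have "s a = t a" if "a \<in> A" for a
    proof -
      have "(a, s a) \<in> ?g t" unfolding st(3)[symmetric] using that by blast
      then show ?thesis by auto
    qed
    then show "s = t" using st F by (intro extensionalityI[of s A t]) auto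
  qed
  show "?g ` F \<subseteq> Pow (Sigma A B)" using F by auto
qed

section \<open>Sheaves of sets on a site\<close>

definition presheaf :: "('d, 'e) cat \<Rightarrow> ('d \<Rightarrow> 'x set) \<Rightarrow> ('e \<Rightarrow> 'x \<Rightarrow> 'x) \<Rightarrow> bool" where
  "presheaf D V r \<longleftrightarrow> (\<forall>f\<in>Arr D. \<forall>x\<in>V (Cod D f). r f x \<in> V (Dom D f)) \<and>
     (\<forall>c\<in>Obj D. \<forall>x\<in>V c. r (Ident D c) x = x) \<and>
     (\<forall>f\<in>Arr D. \<forall>g\<in>Arr D. Cod D g = Dom D f \<longrightarrow> (\<forall>x\<in>V (Cod D f). r (f \<cdot>\<^bsub>D\<^esub> g) x = r g (r f x)))"

definition matching :: "('d, 'e) cat \<Rightarrow> ('d \<Rightarrow> 'x set) \<Rightarrow> ('e \<Rightarrow> 'x \<Rightarrow> 'x) \<Rightarrow> 'e set \<Rightarrow> ('e \<Rightarrow> 'x) \<Rightarrow> bool" where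
  "matching D V r S x \<longleftrightarrow> (\<forall>f\<in>S. x f \<in> V (Dom D f)) \<and>
     (\<forall>f\<in>S. \<forall>g\<in>Arr D. Cod D g = Dom D f \<longrightarrow> x (f \<cdot>\<^bsub>D\<^esub> g) = r g (x f))"

definition sheaf :: "('d, 'e) cat \<Rightarrow> ('d \<Rightarrow> 'e set set) \<Rightarrow> ('d \<Rightarrow> 'x set) \<Rightarrow> ('e \<Rightarrow> 'x \<Rightarrow> 'x) \<Rightarrow> bool" where
  "sheaf D J V r \<longleftrightarrow> presheaf D V r \<and>
     (\<forall>c\<in>Obj D. \<forall>S\<in>J c. \<forall>x. matching D V r S x \<longrightarrow> (\<exists>!y. y \<in> V c \<and> (\<forall>f\<in>S. r f y = x f)))"

definition natural_map ::
  "('d, 'e) cat \<Rightarrow> ('d \<Rightarrow> 'x set) \<Rightarrow> ('e \<Rightarrow> 'x \<Rightarrow> 'x) \<Rightarrow> ('d \<Rightarrow> 'y set) \<Rightarrow> ('e \<Rightarrow> 'y \<Rightarrow> 'y) \<Rightarrow> ('d \<Rightarrow> 'x \<Rightarrow> 'y) \<Rightarrow> bool" where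
  "natural_map D V r W s \<phi> \<longleftrightarrow> (\<forall>c\<in>Obj D. \<forall>x\<in>V c. \<phi> c x \<in> W c) \<and>
     (\<forall>f\<in>Arr D. \<forall>x\<in>V (Cod D f). \<phi> (Dom D f) (r f x) = s f (\<phi> (Cod D f) x))"

definition natural_bij ::
  "('d, 'e) cat \<Rightarrow> ('d \<Rightarrow> 'x set) \<Rightarrow> ('e \<Rightarrow> 'x \<Rightarrow> 'x) \<Rightarrow> ('d \<Rightarrow> 'y set) \<Rightarrow> ('e \<Rightarrow> 'y \<Rightarrow> 'y) \<Rightarrow> ('d \<Rightarrow> 'x \<Rightarrow> 'y) \<Rightarrow> bool" where
  "natural_bij D V r W s \<phi> \<longleftrightarrow> natural_map D V r W s \<phi> \<and> (\<forall>c\<in>Obj D. bij_betw (\<phi> c) (V c) (W c))"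

locale site = category D for D :: "('d, 'e) cat" (structure) +
  fixes J :: "'d \<Rightarrow> 'e set set"
  assumes topology: "grothendieck_topology D J"
begin

lemma cover_sieve:
  assumes "S \<in> J c" "c \<in> Obj D" "f \<in> S"
  shows "f \<in> Arr D" "Cod D f = c" "\<And>g. \<lbrakk>g \<in> Arr D; Cod D g = Dom D f\<rbrakk> \<Longrightarrow> f \<cdot> g \<in> S"
  using assms topology unfolding grothendieck_topology_def sieve_def by auto

lemma cover_max: "c \<in> Obj D \<Longrightarrow> {f \<in> Arr D. Cod D f = c} \<in> J c"
  using topology by (simp add: grothendieck_topology_def)

lemma cover_pull: "\<lbrakk>S \<in> J (Cod D h); h \<in> Arr D\<rbrakk> \<Longrightarrow> {g \<in> Arr D. Cod D g = Dom D h \<and> h \<cdot> g \<in> S} \<in> J (Dom D h)"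
  using topology by (simp add: grothendieck_topology_def pull_sieve_def)

lemma cover_transitive:
  assumes "S \<in> J c" "c \<in> Obj D" "sieve D c R"
    "\<And>h. h \<in> S \<Longrightarrow> {g \<in> Arr D. Cod D g = Dom D h \<and> h \<cdot> g \<in> R} \<in> J (Dom D h)"
  shows "R \<in> J c"
  using assms topology unfolding grothendieck_topology_def pull_sieve_def by blast

lemma cover_superset:
  assumes S: "S \<in> J c" "c \<in> Obj D" and R: "sieve D c R" "S \<subseteq> R"
  shows "R \<in> J c"
proof (rule cover_transitive[OF S R(1)])
  fix h assume h: "h \<in> S"
  then have "{g \<in> Arr D. Cod D g = Dom D h \<and> h \<cdot> g \<in> R} = {g \<in> Arr D. Cod D g = Dom D h}"
    using R cover_sieve(3)[OF S h] by auto
  then show "{g \<in> Arr D. Cod D g = Dom D h \<and> h \<cdot> g \<in> R} \<in> J (Dom D h)"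
    using cover_max cover_sieve(1)[OF S h] by simp
qed

lemma cover_inter:
  assumes S: "S \<in> J c" "c \<in> Obj D" and T: "T \<in> J c"
  shows "S \<inter> T \<in> J c"
proof (rule cover_transitive[OF S])
  show "sieve D c (S \<inter> T)" using cover_sieve[OF S] cover_sieve[OF T S(2)] unfolding sieve_def by blast
  fix h assume h: "h \<in> S"
  have "{g \<in> Arr D. Cod D g = Dom D h \<and> h \<cdot> g \<in> S \<inter> T} = {g \<in> Arr D. Cod D g = Dom D h \<and> h \<cdot> g \<in> T}"
    using cover_sieve(3)[OF S h] by auto
  then show "{g \<in> Arr D. Cod D g = Dom D h \<and> h \<cdot> g \<in> S \<inter> T} \<in> J (Dom D h)"
    using cover_pull[of T h] T cover_sieve[OF S h] by simp
qed

lemma presheaf_simps: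
  assumes "presheaf D V r"
  shows "\<And>f x. \<lbrakk>f \<in> Arr D; x \<in> V (Cod D f)\<rbrakk> \<Longrightarrow> r f x \<in> V (Dom D f)"
    "\<And>c x. \<lbrakk>c \<in> Obj D; x \<in> V c\<rbrakk> \<Longrightarrow> r (Ident D c) x = x"
    "\<And>f g x. \<lbrakk>f \<in> Arr D; g \<in> Arr D; Cod D g = Dom D f; x \<in> V (Cod D f)\<rbrakk> \<Longrightarrow> r (f \<cdot> g) x = r g (r f x)"
  using assms by (auto simp: presheaf_def)

lemma sheaf_presheaf: "sheaf D J V r \<Longrightarrow> presheaf D V r"
  by (simp add: sheaf_def)

lemma sheaf_ext:
  assumes V: "sheaf D J V r" and S: "S \<in> J c" "c \<in> Obj D" and xy: "x \<in> V c" "y \<in> V c" "\<And>f. f \<in> S \<Longrightarrow> r f x = r f y"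
  shows "x = y"
proof -
  note P = presheaf_simps[OF sheaf_presheaf[OF V]]
  have "matching D V r S (\<lambda>f. r f x)"
    unfolding matching_def using P(1,3) cover_sieve[OF S] xy(1) by auto
  then have "\<exists>!y. y \<in> V c \<and> (\<forall>f\<in>S. r f y = r f x)" using V S unfolding sheaf_def by blast
  then show ?thesis using xy by metis
qed

lemma sheaf_glue:
  assumes "sheaf D J V r" "S \<in> J c" "c \<in> Obj D" "matching D V r S x"
  obtains y where "y \<in> V c" "\<And>f. f \<in> S \<Longrightarrow> r f y = x f"
  using assms unfolding sheaf_def by blast

lemma sheafI:
  assumes "presheaf D V r"
    and "\<And>c S x y. \<lbrakk>c \<in> Obj D; S \<in> J c; x \<in> V c; y \<in> V c; \<And>f. f \<in> S \<Longrightarrow> r f x = r f y\<rbrakk> \<Longrightarrow> x = y"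
    and "\<And>c S x. \<lbrakk>c \<in> Obj D; S \<in> J c; matching D V r S x\<rbrakk> \<Longrightarrow> \<exists>y \<in> V c. \<forall>f\<in>S. r f y = x f"
  shows "sheaf D J V r"
  unfolding sheaf_def
proof (intro conjI ballI allI impI)
  fix c S x assume c: "c \<in> Obj D" "S \<in> J c" and m: "matching D V r S x"
  obtain y where y: "y \<in> V c" "\<forall>f\<in>S. r f y = x f" using assms(3)[OF c m] by blast
  show "\<exists>!y. y \<in> V c \<and> (\<forall>f\<in>S. r f y = x f)"
  proof (rule ex1I[of _ y])
    fix z assume "z \<in> V c \<and> (\<forall>f\<in>S. r f z = x f)"
    then show "z = y" using y assms(2)[OF c, of z y] by simp
  qed (use y in simp)
qed (rule assms)

text \<open>The sheaf condition is invariant under isomorphism; the values of the two presheaves may have different types.\<close>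

lemma sheaf_transfer:
  assumes W: "sheaf D J W s" and \<gamma>: "natural_bij D V r W s \<gamma>"
    and r: "\<And>f x. \<lbrakk>f \<in> Arr D; x \<in> V (Cod D f)\<rbrakk> \<Longrightarrow> r f x \<in> V (Dom D f)"
  shows "sheaf D J V r"
proof (rule sheafI)
  note P = presheaf_simps[OF sheaf_presheaf[OF W]]
  have g: "\<gamma> c x \<in> W c" if "c \<in> Obj D" "x \<in> V c" for c x using \<gamma> that by (simp add: natural_bij_def natural_map_def)
  have nat: "\<gamma> (Dom D f) (r f x) = s f (\<gamma> (Cod D f) x)" if "f \<in> Arr D" "x \<in> V (Cod D f)" for f x
    using \<gamma> that by (simp add: natural_bij_def natural_map_def)
  have inj: "x = y" if "\<gamma> c x = \<gamma> c y" "c \<in> Obj D" "x \<in> V c" "y \<in> V c" for c x y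
    using \<gamma> that by (auto simp: natural_bij_def bij_betw_def dest: inj_onD)
  show "presheaf D V r"
    unfolding presheaf_def
  proof (intro conjI ballI impI)
    show "r (Ident D c) x = x" if "c \<in> Obj D" "x \<in> V c" for c x
      using inj[of c "r (Ident D c) x" x] nat[of "Ident D c" x] r[of "Ident D c" x] that P(2) g by simp
    show "r (f \<cdot> g) x = r g (r f x)" if "f \<in> Arr D" "g \<in> Arr D" "Cod D g = Dom D f" "x \<in> V (Cod D f)" for f g x
      using inj[of "Dom D g" "r (f \<cdot> g) x" "r g (r f x)"] nat[of "f \<cdot> g" x] nat[of f x] nat[of g "r f x"]
        r[of "f \<cdot> g" x] r[of f x] r[of g "r f x"] that P(3) g by simp
  qed (rule r)
  fix c S assume c: "c \<in> Obj D" "S \<in> J c"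
  note cs = cover_sieve[OF c(2,1)]
  show "x = y" if "x \<in> V c" "y \<in> V c" "\<And>f. f \<in> S \<Longrightarrow> r f x = r f y" for x y
  proof (rule inj)
    have "s f (\<gamma> c x) = s f (\<gamma> c y)" if "f \<in> S" for f
      using nat[of f x] nat[of f y] that cs(1,2) \<open>x \<in> V c\<close> \<open>y \<in> V c\<close> \<open>\<And>f. f \<in> S \<Longrightarrow> r f x = r f y\<close> by metis
    then show "\<gamma> c x = \<gamma> c y" using sheaf_ext[OF W c(2,1)] g that c by simp
  qed (use that c in simp_all)
  fix x assume x: "matching D V r S x"
  have "matching D W s S (\<lambda>f. \<gamma> (Dom D f) (x f))"
    unfolding matching_def
  proof (intro conjI ballI impI)
    show "\<gamma> (Dom D f) (x f) \<in> W (Dom D f)" if "f \<in> S" for f using g x cs(1)[OF that] that by (simp add: matching_def)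
    show "\<gamma> (Dom D (f \<cdot> h)) (x (f \<cdot> h)) = s h (\<gamma> (Dom D f) (x f))" if "f \<in> S" "h \<in> Arr D" "Cod D h = Dom D f" for f h
      using x cs(1)[OF that(1)] that nat[of h "x f"] by (simp add: matching_def)
  qed
  then obtain w where w: "w \<in> W c" "\<And>f. f \<in> S \<Longrightarrow> s f w = \<gamma> (Dom D f) (x f)" using sheaf_glue[OF W c(2,1)] by blast
  have "\<gamma> c ` V c = W c" using \<gamma> c by (simp add: natural_bij_def bij_betw_def)
  then have "w \<in> \<gamma> c ` V c" using w(1) by simp
  then obtain y where y: "y \<in> V c" "\<gamma> c y = w" by blast
  have "r f y = x f" if f: "f \<in> S" for f
    using inj[of "Dom D f" "r f y" "x f"] nat[of f y] w(2)[OF f] cs(1,2)[OF f] y r[of f y] x f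
        by (simp add: matching_def)
  then show "\<exists>y\<in>V c. \<forall>f\<in>S. r f y = x f" using y by blast
qed

end

section \<open>The sheaf associated with a quotient of a presheaf\<close>

text \<open>Membership in the least local congruence that contains G is generated inductively, so that a natural map to
  a sheaf respects it as soon as it respects G: the kernel of such a map has all the closure properties below.\<close>

inductive local_cong for D :: "('d, 'e) cat" (structure) and J :: "'d \<Rightarrow> 'e set set" and V :: "'d \<Rightarrow> 'x set"
    and r :: "'e \<Rightarrow> 'x \<Rightarrow> 'x" and G :: "'d \<Rightarrow> ('x \<times> 'x) set" where
  gen: "\<lbrakk>c \<in> Obj D; x \<in> V c; y \<in> V c; (x, y) \<in> G c\<rbrakk> \<Longrightarrow> local_cong D J V r G c x y"
| refl: "\<lbrakk>c \<in> Obj D; x \<in> V c\<rbrakk> \<Longrightarrow> local_cong D J V r G c x x"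
| sym: "local_cong D J V r G c x y \<Longrightarrow> local_cong D J V r G c y x"
| trans: "\<lbrakk>local_cong D J V r G c x y; local_cong D J V r G c y z\<rbrakk> \<Longrightarrow> local_cong D J V r G c x z"
| restrict: "\<lbrakk>local_cong D J V r G (Cod D f) x y; f \<in> Arr D\<rbrakk> \<Longrightarrow> local_cong D J V r G (Dom D f) (r f x) (r f y)"
| locality: "\<lbrakk>c \<in> Obj D; x \<in> V c; y \<in> V c; S \<in> J c; \<And>g. g \<in> S \<Longrightarrow> local_cong D J V r G (Dom D g) (r g x) (r g y)\<rbrakk>
    \<Longrightarrow> local_cong D J V r G c x y"

locale quotient_sheaf = site D J for D :: "('d, 'e) cat" (structure) and J +
  fixes V :: "'d \<Rightarrow> 'x set" and r :: "'e \<Rightarrow> 'x \<Rightarrow> 'x" and G :: "'d \<Rightarrow> ('x \<times> 'x) set"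
  assumes presheaf: "presheaf D V r"
begin

lemmas P = presheaf_simps[OF presheaf]

abbreviation E where "E \<equiv> local_cong D J V r G"

lemma E_mem: "E c x y \<Longrightarrow> c \<in> Obj D \<and> x \<in> V c \<and> y \<in> V c"
  by (induction rule: local_cong.induct) (auto intro: P(1))

text \<open>Locality is the only closure property that uses the sheaf condition: elements of a sheaf that agree on a cover are equal.\<close>

lemma E_invariant:
  assumes W: "sheaf D J W s" and \<phi>: "natural_map D V r W s \<phi>"
    and G: "\<And>c x y. \<lbrakk>c \<in> Obj D; x \<in> V c; y \<in> V c; (x, y) \<in> G c\<rbrakk> \<Longrightarrow> \<phi> c x = \<phi> c y"
  shows "E c x y \<Longrightarrow> \<phi> c x = \<phi> c y"
proof (induction rule: local_cong.induct)
  case (restrict f x y)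
  then show ?case using \<phi> E_mem[OF restrict(1)] by (simp add: natural_map_def)
next
  case (locality c x y S)
  have "s g (\<phi> c x) = s g (\<phi> c y)" if g: "g \<in> S" for g
    using locality(6)[OF g] \<phi> cover_sieve(1,2)[OF locality(4,1) g] locality(2,3) unfolding natural_map_def by metis
  then show ?case using sheaf_ext[OF W locality(4,1)] \<phi> locality by (simp add: natural_map_def)
qed (use G in auto)

definition rep :: "'d \<Rightarrow> 'x \<Rightarrow> ('e \<times> 'x) set" where
  "rep c x = {(f, y). f \<in> Arr D \<and> Cod D f = c \<and> E (Dom D f) (r f x) y}"

definition res :: "'e \<Rightarrow> ('e \<times> 'x) set \<Rightarrow> ('e \<times> 'x) set" where
  "res h \<sigma> = {(g, x). g \<in> Arr D \<and> Cod D g = Dom D h \<and> (h \<cdot> g, x) \<in> \<sigma>}"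

text \<open>A section of the quotient is locally an element of V, up to E. It is recorded as the set of all pairs (f, x) such that x
represents its restriction along f. Such a set is closed under restriction, local, and saturated under E; any two elements
over the same arrow are identified by E; and it is inhabited over a cover. In other words it is a closed subobject, over c, of
the quotient of V by E that is locally a singleton.\<close>

definition L :: "'d \<Rightarrow> ('e \<times> 'x) set set" where
  "L c = {\<sigma>. (\<forall>f x. (f, x) \<in> \<sigma> \<longrightarrow> f \<in> Arr D \<and> Cod D f = c \<and> x \<in> V (Dom D f)) \<and>
     (\<forall>f x g. (f, x) \<in> \<sigma> \<and> g \<in> Arr D \<and> Cod D g = Dom D f \<longrightarrow> (f \<cdot> g, r g x) \<in> \<sigma>) \<and>
     (\<forall>f x. f \<in> Arr D \<and> Cod D f = c \<and> x \<in> V (Dom D f) \<and>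
        {g \<in> Arr D. Cod D g = Dom D f \<and> (f \<cdot> g, r g x) \<in> \<sigma>} \<in> J (Dom D f) \<longrightarrow> (f, x) \<in> \<sigma>) \<and>
     (\<forall>f x y. (f, x) \<in> \<sigma> \<longrightarrow> ((f, y) \<in> \<sigma> \<longleftrightarrow> E (Dom D f) x y)) \<and>
     {f \<in> Arr D. Cod D f = c \<and> (\<exists>x. (f, x) \<in> \<sigma>)} \<in> J c}"

lemma L_D:
  assumes "\<sigma> \<in> L c"
  shows "\<And>f x. (f, x) \<in> \<sigma> \<Longrightarrow> f \<in> Arr D \<and> Cod D f = c \<and> x \<in> V (Dom D f)"
    "\<And>f x g. \<lbrakk>(f, x) \<in> \<sigma>; g \<in> Arr D; Cod D g = Dom D f\<rbrakk> \<Longrightarrow> (f \<cdot> g, r g x) \<in> \<sigma>"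
    "\<And>f x. \<lbrakk>f \<in> Arr D; Cod D f = c; x \<in> V (Dom D f); {g \<in> Arr D. Cod D g = Dom D f \<and>
        (f \<cdot> g, r g x) \<in> \<sigma>} \<in> J (Dom D f)\<rbrakk> \<Longrightarrow> (f, x) \<in> \<sigma>"
    "\<And>f x y. (f, x) \<in> \<sigma> \<Longrightarrow> (f, y) \<in> \<sigma> \<longleftrightarrow> E (Dom D f) x y"
    "{f \<in> Arr D. Cod D f = c \<and> (\<exists>x. (f, x) \<in> \<sigma>)} \<in> J c"
proof -
  note A = assms[unfolded L_def mem_Collect_eq]
  note A1 = conjunct1[OF A] and A2 = conjunct2[OF A]
  note A21 = conjunct1[OF A2] and A3 = conjunct2[OF A2]
  note A31 = conjunct1[OF A3] and A4 = conjunct2[OF A3]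
  show "f \<in> Arr D \<and> Cod D f = c \<and> x \<in> V (Dom D f)" if "(f, x) \<in> \<sigma>" for f x using A1 that by blast
  show "(f \<cdot> g, r g x) \<in> \<sigma>" if "(f, x) \<in> \<sigma>" "g \<in> Arr D" "Cod D g = Dom D f" for f x g using A21 that by blast
  show "(f, x) \<in> \<sigma>" if "f \<in> Arr D" "Cod D f = c" "x \<in> V (Dom D f)"
    "{g \<in> Arr D. Cod D g = Dom D f \<and> (f \<cdot> g, r g x) \<in> \<sigma>} \<in> J (Dom D f)" for f x
    using A31[rule_format, of f x] that by simp
  show "(f, y) \<in> \<sigma> \<longleftrightarrow> E (Dom D f) x y" if "(f, x) \<in> \<sigma>" for f x y using conjunct1[OF A4] that by simp
  show "{f \<in> Arr D. Cod D f = c \<and> (\<exists>x. (f, x) \<in> \<sigma>)} \<in> J c" by (rule conjunct2[OF A4])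
qed

lemma rep_L:
  assumes c: "c \<in> Obj D" and x: "x \<in> V c"
  shows "rep c x \<in> L c"
  unfolding L_def mem_Collect_eq
proof (intro conjI allI impI)
  fix f y assume "(f, y) \<in> rep c x"
  then show "f \<in> Arr D" "Cod D f = c" "y \<in> V (Dom D f)" using E_mem by (auto simp: rep_def)
next
  fix f y g assume "(f, y) \<in> rep c x \<and> g \<in> Arr D \<and> Cod D g = Dom D f"
  then show "(f \<cdot> g, r g y) \<in> rep c x"
    using local_cong.restrict[of D J V r G g "r f x" y] x P(3)[of f g x] by (simp add: rep_def)
next
  fix f y assume f: "f \<in> Arr D \<and> Cod D f = c \<and> y \<in> V (Dom D f) \<and>
        {g \<in> Arr D. Cod D g = Dom D f \<and> (f \<cdot> g, r g y) \<in> rep c x} \<in> J (Dom D f)"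
  have "E (Dom D f) (r f x) y"
  proof (rule local_cong.locality)
    show "E (Dom D g) (r g (r f x)) (r g y)" if "g \<in> {g \<in> Arr D. Cod D g = Dom D f \<and> (f \<cdot> g, r g y) \<in> rep c x}" for g
      using that f x P(3)[of f g x] by (auto simp: rep_def)
  qed (use f x P(1) in auto)
  then show "(f, y) \<in> rep c x" using f by (simp add: rep_def)
next
  fix f y z assume "(f, y) \<in> rep c x"
  then have f: "f \<in> Arr D" "Cod D f = c" and e: "E (Dom D f) (r f x) y" by (auto simp: rep_def)
  show "(f, z) \<in> rep c x \<longleftrightarrow> E (Dom D f) y z"
    using local_cong.trans[OF e] local_cong.trans[OF local_cong.sym[OF e]] f by (auto simp: rep_def)
next
  have "(f, r f x) \<in> rep c x" if "f \<in> Arr D" "Cod D f = c" for f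
    using that x P(1)[of f x] local_cong.refl[of "Dom D f" D "r f x" V] by (simp add: rep_def)
  then have "{f \<in> Arr D. Cod D f = c \<and> (\<exists>y. (f, y) \<in> rep c x)} = {f \<in> Arr D. Cod D f = c}" by blast
  then show "{f \<in> Arr D. Cod D f = c \<and> (\<exists>y. (f, y) \<in> rep c x)} \<in> J c" using cover_max[OF c] by simp
qed

lemma res_L:
  assumes h: "h \<in> Arr D" and \<sigma>: "\<sigma> \<in> L (Cod D h)"
  shows "res h \<sigma> \<in> L (Dom D h)"
  unfolding L_def mem_Collect_eq
proof (intro conjI allI impI)
  note S = L_D[OF \<sigma>]
  fix f x assume "(f, x) \<in> res h \<sigma>"
  then show "f \<in> Arr D" "Cod D f = Dom D h" "x \<in> V (Dom D f)" using S(1)[of "h \<cdot> f" x] h by (auto simp: res_def)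
next
  note S = L_D[OF \<sigma>]
  fix f x g assume "(f, x) \<in> res h \<sigma> \<and> g \<in> Arr D \<and> Cod D g = Dom D f"
  then show "(f \<cdot> g, r g x) \<in> res h \<sigma>" using S(2)[of "h \<cdot> f" x g] h by (simp add: res_def)
next
  note S = L_D[OF \<sigma>]
  fix f x assume f: "f \<in> Arr D \<and> Cod D f = Dom D h \<and> x \<in> V (Dom D f) \<and>
        {g \<in> Arr D. Cod D g = Dom D f \<and> (f \<cdot> g, r g x) \<in> res h \<sigma>} \<in> J (Dom D f)"
  have "{g \<in> Arr D. Cod D g = Dom D f \<and> (f \<cdot> g, r g x) \<in> res h \<sigma>} = {g \<in> Arr D. Cod D g = Dom D f \<and>
      ((h \<cdot> f) \<cdot> g, r g x) \<in> \<sigma>}"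
    using f h by (auto simp: res_def)
  then show "(f, x) \<in> res h \<sigma>" using S(3)[of "h \<cdot> f" x] f h by (simp add: res_def)
next
  note S = L_D[OF \<sigma>]
  fix f x y assume "(f, x) \<in> res h \<sigma>"
  then show "(f, y) \<in> res h \<sigma> \<longleftrightarrow> E (Dom D f) x y" using S(4)[of "h \<cdot> f" x y] h by (simp add: res_def)
next
  note S = L_D[OF \<sigma>]
  have "{f \<in> Arr D. Cod D f = Dom D h \<and> (\<exists>x. (f, x) \<in> res h \<sigma>)} =
      {g \<in> Arr D. Cod D g = Dom D h \<and> h \<cdot> g \<in> {f \<in> Arr D. Cod D f = Cod D h \<and> (\<exists>x. (f, x) \<in> \<sigma>)}}"
    using h by (auto simp: res_def)
  then show "{f \<in> Arr D. Cod D f = Dom D h \<and> (\<exists>x. (f, x) \<in> res h \<sigma>)} \<in> J (Dom D h)"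
    using cover_pull[OF S(5) h] by simp
qed

lemma res_rep:
  assumes f: "f \<in> Arr D" and x: "x \<in> V (Cod D f)"
  shows "res f (rep (Cod D f) x) = rep (Dom D f) (r f x)"
  using f x P(3) by (auto simp: res_def rep_def)

lemma rep_eq_iff: "\<lbrakk>c \<in> Obj D; x \<in> V c; y \<in> V c\<rbrakk> \<Longrightarrow> rep c x = rep c y \<longleftrightarrow> E c x y"
proof
  assume c: "c \<in> Obj D" and xy: "x \<in> V c" "y \<in> V c"
  assume "rep c x = rep c y"
  moreover have "(Ident D c, x) \<in> rep c x" using c xy P(2) local_cong.refl[of c D x V] by (simp add: rep_def)
  ultimately have "(Ident D c, x) \<in> rep c y" by simp
  then have "E c y x" using c xy P(2) by (simp add: rep_def)
  then show "E c x y" by (rule local_cong.sym)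
next
  assume c: "c \<in> Obj D" and xy: "x \<in> V c" "y \<in> V c" "E c x y"
  have "E (Dom D f) (r f x) (r f y)" if "f \<in> Arr D" "Cod D f = c" for f
    using local_cong.restrict[of D J V r G f x y] that xy by simp
  then have "E (Dom D f) (r f x) z \<longleftrightarrow> E (Dom D f) (r f y) z" if "f \<in> Arr D" "Cod D f = c" for f z
    using local_cong.trans local_cong.sym that by metis
  then show "rep c x = rep c y" by (auto simp: rep_def)
qed

text \<open>The members of a section are its local representatives. This turns every question about sections into one about elements of V.\<close>

lemma mem_iff_rep:
  assumes \<sigma>: "\<sigma> \<in> L c" and f: "f \<in> Arr D" "Cod D f = c" "x \<in> V (Dom D f)"
  shows "(f, x) \<in> \<sigma> \<longleftrightarrow> res f \<sigma> = rep (Dom D f) x"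
proof
  note S = L_D[OF \<sigma>]
  assume fx: "(f, x) \<in> \<sigma>"
  show "res f \<sigma> = rep (Dom D f) x"
  proof (intro Set.set_eqI iffI; clarify)
    fix g y
    have "(f \<cdot> g, r g x) \<in> \<sigma>" if "g \<in> Arr D" "Cod D g = Dom D f" using S(2)[OF fx] that by simp
    then have *: "(f \<cdot> g, y) \<in> \<sigma> \<longleftrightarrow> E (Dom D g) (r g x) y" if "g \<in> Arr D" "Cod D g = Dom D f"
      using S(4)[of "f \<cdot> g" "r g x" y] that f by simp
    show "(g, y) \<in> rep (Dom D f) x" if "(g, y) \<in> res f \<sigma>" using * that by (simp add: res_def rep_def)
    show "(g, y) \<in> res f \<sigma>" if "(g, y) \<in> rep (Dom D f) x" using * that by (simp add: res_def rep_def)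
  qed
next
  assume e: "res f \<sigma> = rep (Dom D f) x"
  have "(Ident D (Dom D f), x) \<in> rep (Dom D f) x" using f P(2) local_cong.refl[of "Dom D f" D x V]
      by (simp add: rep_def)
  then show "(f, x) \<in> \<sigma>" unfolding e[symmetric] using f by (simp add: res_def)
qed

lemma L_presheaf: "presheaf D L res"
  unfolding presheaf_def
proof (intro conjI ballI impI)
  show "res f \<sigma> \<in> L (Dom D f)" if "f \<in> Arr D" "\<sigma> \<in> L (Cod D f)" for f \<sigma> using res_L that .
  show "res (Ident D c) \<sigma> = \<sigma>" if "c \<in> Obj D" "\<sigma> \<in> L c" for c \<sigma>
  proof -
    have "(g, x) \<in> res (Ident D c) \<sigma> \<longleftrightarrow> (g, x) \<in> \<sigma>" for g x
      using L_D(1)[OF that(2), of g x] that(1) by (auto simp: res_def)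
    then show ?thesis by auto
  qed
  show "res (f \<cdot> g) \<sigma> = res g (res f \<sigma>)" if "f \<in> Arr D" "g \<in> Arr D" "Cod D g = Dom D f" "\<sigma> \<in> L (Cod D f)" for f g \<sigma>
    using that by (auto simp: res_def)
qed

lemma L_separated:
  assumes c: "c \<in> Obj D" "S \<in> J c" and \<sigma>: "\<sigma> \<in> L c" "\<tau> \<in> L c" and eq: "\<And>f. f \<in> S \<Longrightarrow> res f \<sigma> = res f \<tau>"
  shows "\<sigma> \<subseteq> \<tau>"
proof clarify
  fix h x assume hx: "(h, x) \<in> \<sigma>"
  have h: "h \<in> Arr D" "Cod D h = c" "x \<in> V (Dom D h)" using L_D(1)[OF \<sigma>(1) hx] by auto
  show "(h, x) \<in> \<tau>"
  proof (rule L_D(3)[OF \<sigma>(2) h], rule cover_superset)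
    show "{g \<in> Arr D. Cod D g = Dom D h \<and> h \<cdot> g \<in> S} \<in> J (Dom D h)" using cover_pull[of S h] c h by simp
    show "sieve D (Dom D h) {g \<in> Arr D. Cod D g = Dom D h \<and> (h \<cdot> g, r g x) \<in> \<tau>}"
      unfolding sieve_def
    proof (intro conjI ballI impI)
      fix f g assume "f \<in> {g \<in> Arr D. Cod D g = Dom D h \<and> (h \<cdot> g, r g x) \<in> \<tau>}" "g \<in> Arr D" "Cod D g = Dom D f"
      then show "f \<cdot> g \<in> {g \<in> Arr D. Cod D g = Dom D h \<and> (h \<cdot> g, r g x) \<in> \<tau>}"
        using L_D(2)[OF \<sigma>(2), of "h \<cdot> f" "r f x" g] P(3)[of f g x] h by simp
    qed auto
    show "{g \<in> Arr D. Cod D g = Dom D h \<and> h \<cdot> g \<in> S} \<subseteq> {g \<in> Arr D. Cod D g = Dom D h \<and> (h \<cdot> g, r g x) \<in> \<tau>}"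
    proof clarify
      fix g assume g: "g \<in> Arr D" "Cod D g = Dom D h" "h \<cdot> g \<in> S"
      have "(Ident D (Dom D g), r g x) \<in> res (h \<cdot> g) \<sigma>" using L_D(2)[OF \<sigma>(1) hx g(1,2)] g h by (simp add: res_def)
      then have "(Ident D (Dom D g), r g x) \<in> res (h \<cdot> g) \<tau>" using eq[OF g(3)] by simp
      then show "(h \<cdot> g, r g x) \<in> \<tau>" using g h by (simp add: res_def)
    qed
  qed (use h in auto)
qed

text \<open>The glued section consists of the pairs (h, x) such that, locally on the domain of h, the given sections are represented by the
restrictions of x. That it is a section again follows from the local character of covers, because the set \<open>T h x\<close> of arrows
along which x represents the given sections pulls back to a set of the same form.\<close>

theorem L_sheaf: "sheaf D J L res"
proof (rule sheafI[OF L_presheaf])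
  fix c S \<sigma> \<tau> assume "c \<in> Obj D" "S \<in> J c" "\<sigma> \<in> L c" "\<tau> \<in> L c" "\<And>f. f \<in> S \<Longrightarrow> res f \<sigma> = res f \<tau>"
  then show "\<sigma> = \<tau>" using L_separated[of c S \<sigma> \<tau>] L_separated[of c S \<tau> \<sigma>] by simp
next
  fix c S s assume c: "c \<in> Obj D" and S: "S \<in> J c" and m: "matching D L res S s"
  note cs = cover_sieve[OF S c]
  have s: "s f \<in> L (Dom D f)" if "f \<in> S" for f using m that by (simp add: matching_def)
  have sg: "s (f \<cdot> g) = res g (s f)" if "f \<in> S" "g \<in> Arr D" "Cod D g = Dom D f" for f g using m that
      by (simp add: matching_def)
  define T where "T h x = {g \<in> Arr D. Cod D g = Dom D h \<and> h \<cdot> g \<in> S \<and> s (h \<cdot> g) = rep (Dom D g) (r g x)}" for h x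
  have T_sieve: "sieve D (Dom D h) (T h x)" if h: "h \<in> Arr D" "x \<in> V (Dom D h)" for h x
    unfolding sieve_def
  proof (intro conjI ballI impI)
    fix g k assume g: "g \<in> T h x" and k: "k \<in> Arr D" "Cod D k = Dom D g"
    then have g': "g \<in> Arr D" "Cod D g = Dom D h" "h \<cdot> g \<in> S" "s (h \<cdot> g) = rep (Dom D g) (r g x)"
        by (auto simp: T_def)
    have "h \<cdot> (g \<cdot> k) \<in> S" using cs(3)[OF g'(3), of k] g' k h by simp
    moreover have "s (h \<cdot> (g \<cdot> k)) = rep (Dom D k) (r (g \<cdot> k) x)"
      using sg[OF g'(3), of k] res_rep[of k "r g x"] P(1)[of g x] P(3)[of g k x] g' k h by simp
    ultimately show "g \<cdot> k \<in> T h x" using g' k h by (simp add: T_def)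
  qed (auto simp: T_def)
  have T_pull: "{k \<in> Arr D. Cod D k = Dom D g \<and> g \<cdot> k \<in> T h x} = T (h \<cdot> g) (r g x)"
    if "h \<in> Arr D" "x \<in> V (Dom D h)" "g \<in> Arr D" "Cod D g = Dom D h" for h x g
    using that P(3)[of g _ x] by (auto simp: T_def)
  define \<sigma> where "\<sigma> = {(h, x). h \<in> Arr D \<and> Cod D h = c \<and> x \<in> V (Dom D h) \<and> T h x \<in> J (Dom D h)}"
  have res\<sigma>: "res f \<sigma> = s f" if f: "f \<in> S" for f
  proof (intro Set.set_eqI iffI; clarify)
    note f' = cs(1,2)[OF f]
    fix k x
    have key: "T (f \<cdot> k) x \<in> J (Dom D k) \<longleftrightarrow> (k, x) \<in> s f" if k: "k \<in> Arr D" "Cod D k = Dom D f" "x \<in> V (Dom D k)"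
    proof -
      have "T (f \<cdot> k) x = {g \<in> Arr D. Cod D g = Dom D k \<and> (k \<cdot> g, r g x) \<in> s f}"
      proof (intro Set.set_eqI iffI; clarify)
        fix g
        have eqv: "s (f \<cdot> (k \<cdot> g)) = rep (Dom D g) (r g x) \<longleftrightarrow> (k \<cdot> g, r g x) \<in> s f" if g: "g \<in> Arr D"
          "Cod D g = Dom D k"
          using mem_iff_rep[OF s[OF f], of "k \<cdot> g" "r g x"] sg[OF f, of "k \<cdot> g"] g k P(1)[of g x] by simp
        show "g \<in> Arr D \<and> Cod D g = Dom D k \<and> (k \<cdot> g, r g x) \<in> s f" if "g \<in> T (f \<cdot> k) x"
        proof -
          have "g \<in> Arr D" "Cod D g = Dom D (f \<cdot> k)" and e: "s ((f \<cdot> k) \<cdot> g) = rep (Dom D g) (r g x)"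
            using that unfolding T_def by blast+
          then have g: "g \<in> Arr D" "Cod D g = Dom D k" using k f' by simp_all
          have "(f \<cdot> k) \<cdot> g = f \<cdot> (k \<cdot> g)" using g k f' by simp
          then show ?thesis using eqv[OF g] e g by simp
        qed
        show "g \<in> T (f \<cdot> k) x" if "g \<in> Arr D" "Cod D g = Dom D k" "(k \<cdot> g, r g x) \<in> s f"
          using that eqv k f' cs(3)[OF f, of "k \<cdot> g"] by (simp add: T_def)
      qed
      moreover have "{g \<in> Arr D. Cod D g = Dom D k \<and> (k \<cdot> g, r g x) \<in> s f} \<in> J (Dom D k) \<longleftrightarrow> (k, x) \<in> s f"
      proof
        assume kx: "(k, x) \<in> s f"
        have "{g \<in> Arr D. Cod D g = Dom D k \<and> (k \<cdot> g, r g x) \<in> s f} = {g \<in> Arr D. Cod D g = Dom D k}"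
          using L_D(2)[OF s[OF f] kx] by blast
        then show "{g \<in> Arr D. Cod D g = Dom D k \<and> (k \<cdot> g, r g x) \<in> s f} \<in> J (Dom D k)" using cover_max k by simp
      qed (use L_D(3)[OF s[OF f]] k in simp)
      ultimately show ?thesis by simp
    qed
    show "(k, x) \<in> s f" if "(k, x) \<in> res f \<sigma>"
    proof -
      have "k \<in> Arr D" "Cod D k = Dom D f" "x \<in> V (Dom D (f \<cdot> k))" "T (f \<cdot> k) x \<in> J (Dom D (f \<cdot> k))"
        using that unfolding res_def \<sigma>_def by blast+
      then show ?thesis using key f' by simp
    qed
    show "(k, x) \<in> res f \<sigma>" if "(k, x) \<in> s f" using key that f' L_D(1)[OF s[OF f] that] by (simp add: res_def \<sigma>_def)
  qed
  have "\<sigma> \<in> L c"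
    unfolding L_def mem_Collect_eq
  proof (intro conjI allI impI)
    fix f x assume "(f, x) \<in> \<sigma>"
    then show "f \<in> Arr D" "Cod D f = c" "x \<in> V (Dom D f)" by (auto simp: \<sigma>_def)
  next
    fix f x g assume a: "(f, x) \<in> \<sigma> \<and> g \<in> Arr D \<and> Cod D g = Dom D f"
    then have f: "f \<in> Arr D" "Cod D f = c" "x \<in> V (Dom D f)" "T f x \<in> J (Dom D f)" unfolding \<sigma>_def by blast+
    then have "T (f \<cdot> g) (r g x) \<in> J (Dom D g)" using cover_pull[of "T f x" g] T_pull[of f x g] a by simp
    then show "(f \<cdot> g, r g x) \<in> \<sigma>" using a f P(1)[of g x] by (simp add: \<sigma>_def)
  next
    fix f x assume a: "f \<in> Arr D \<and> Cod D f = c \<and> x \<in> V (Dom D f) \<and> {g \<in> Arr D. Cod D g = Dom D f \<and>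
        (f \<cdot> g, r g x) \<in> \<sigma>} \<in> J (Dom D f)"
    have "T f x \<in> J (Dom D f)"
    proof (rule cover_transitive)
      show "{g \<in> Arr D. Cod D g = Dom D f \<and> (f \<cdot> g, r g x) \<in> \<sigma>} \<in> J (Dom D f)" "Dom D f \<in> Obj D" using a by auto
      show "sieve D (Dom D f) (T f x)" using T_sieve a by simp
      fix g assume "g \<in> {g \<in> Arr D. Cod D g = Dom D f \<and> (f \<cdot> g, r g x) \<in> \<sigma>}"
      then have g: "g \<in> Arr D" "Cod D g = Dom D f" "T (f \<cdot> g) (r g x) \<in> J (Dom D (f \<cdot> g))" unfolding \<sigma>_def by blast+
      then show "{k \<in> Arr D. Cod D k = Dom D g \<and> g \<cdot> k \<in> T f x} \<in> J (Dom D g)"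
        using T_pull[of f x g] a by simp
    qed
    then show "(f, x) \<in> \<sigma>" using a by (simp add: \<sigma>_def)
  next
    fix f x y assume fx: "(f, x) \<in> \<sigma>"
    then have f: "f \<in> Arr D" "Cod D f = c" "x \<in> V (Dom D f)" "T f x \<in> J (Dom D f)" unfolding \<sigma>_def by blast+
    show "(f, y) \<in> \<sigma> \<longleftrightarrow> E (Dom D f) x y"
    proof
      assume "(f, y) \<in> \<sigma>"
      then have y: "y \<in> V (Dom D f)" "T f y \<in> J (Dom D f)" unfolding \<sigma>_def by blast+
      show "E (Dom D f) x y"
      proof (rule local_cong.locality)
        show "T f x \<inter> T f y \<in> J (Dom D f)" using cover_inter f y by simp
        show "E (Dom D g) (r g x) (r g y)" if "g \<in> T f x \<inter> T f y" for g
        proof -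
          have g: "g \<in> Arr D" "Cod D g = Dom D f" "s (f \<cdot> g) = rep (Dom D g) (r g x)"
            "s (f \<cdot> g) = rep (Dom D g) (r g y)"
            using that unfolding T_def by blast+
          then show ?thesis using rep_eq_iff[of "Dom D g" "r g x" "r g y"] P(1)[of g] f y by simp
        qed
      qed (use f y in auto)
    next
      assume e: "E (Dom D f) x y"
      have y: "y \<in> V (Dom D f)" using E_mem[OF e] by simp
      have "rep (Dom D g) (r g x) = rep (Dom D g) (r g y)" if "g \<in> Arr D" "Cod D g = Dom D f" for g
        using that rep_eq_iff[of "Dom D g" "r g x" "r g y"] P(1)[of g] f y local_cong.restrict[of D J V r G g x y] e by simp
      then have "T f x = T f y" by (auto simp: T_def)
      then show "(f, y) \<in> \<sigma>" using f y by (simp add: \<sigma>_def)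
    qed
  next
    show "{f \<in> Arr D. Cod D f = c \<and> (\<exists>x. (f, x) \<in> \<sigma>)} \<in> J c"
    proof (rule cover_transitive[OF S c])
      show "sieve D c {f \<in> Arr D. Cod D f = c \<and> (\<exists>x. (f, x) \<in> \<sigma>)}"
        unfolding sieve_def
      proof (intro conjI ballI impI)
        fix f g assume f: "f \<in> {f \<in> Arr D. Cod D f = c \<and> (\<exists>x. (f, x) \<in> \<sigma>)}" and g: "g \<in> Arr D" "Cod D g = Dom D f"
        then obtain x where f: "f \<in> Arr D" "Cod D f = c" "x \<in> V (Dom D f)" "T f x \<in> J (Dom D f)" unfolding \<sigma>_def
          by blast
        then have "T (f \<cdot> g) (r g x) \<in> J (Dom D g)" using cover_pull[of "T f x" g] T_pull[of f x g] g by simp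
        then have "(f \<cdot> g, r g x) \<in> \<sigma>" using f g P(1)[of g x] by (simp add: \<sigma>_def)
        then show "f \<cdot> g \<in> {f \<in> Arr D. Cod D f = c \<and> (\<exists>x. (f, x) \<in> \<sigma>)}" using f g by auto
      qed auto
      fix h assume h: "h \<in> S"
      have "{g \<in> Arr D. Cod D g = Dom D h \<and> h \<cdot> g \<in> {f \<in> Arr D. Cod D f = c \<and> (\<exists>x. (f, x) \<in> \<sigma>)}}
         = {g \<in> Arr D. Cod D g = Dom D h \<and> (\<exists>x. (g, x) \<in> res h \<sigma>)}"
        using cs(1,2)[OF h] by (auto simp: res_def)
      also have "\<dots> \<in> J (Dom D h)" using L_D(5)[OF s[OF h]] res\<sigma>[OF h] by simp
      finally show "{g \<in> Arr D. Cod D g = Dom D h \<and> h \<cdot> g \<in> {f \<in> Arr D. Cod D f = c \<and> (\<exists>x.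
          (f, x) \<in> \<sigma>)}} \<in> J (Dom D h)" .
    qed
  qed
  then show "\<exists>y\<in>L c. \<forall>f\<in>S. res f y = s f" using res\<sigma> by blast
qed

lemma rep_natural: "natural_map D V r L res rep"
  using rep_L res_rep by (simp add: natural_map_def)

lemma rep_invariant: "\<lbrakk>c \<in> Obj D; x \<in> V c; y \<in> V c; (x, y) \<in> G c\<rbrakk> \<Longrightarrow> rep c x = rep c y"
  by (simp add: rep_eq_iff local_cong.gen)

text \<open>A natural map that respects G extends along rep by gluing its values on the members of a section.\<close>

theorem L_universal:
  assumes W: "sheaf D J W s" and \<phi>: "natural_map D V r W s \<phi>"
    and G: "\<And>c x y. \<lbrakk>c \<in> Obj D; x \<in> V c; y \<in> V c; (x, y) \<in> G c\<rbrakk> \<Longrightarrow> \<phi> c x = \<phi> c y"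
  obtains \<psi> where "natural_map D L res W s \<psi>" "\<And>c x. \<lbrakk>c \<in> Obj D; x \<in> V c\<rbrakk> \<Longrightarrow> \<psi> c (rep c x) = \<phi> c x"
proof -
  note PW = presheaf_simps[OF sheaf_presheaf[OF W]]
  have \<phi>1: "\<phi> c x \<in> W c" if "c \<in> Obj D" "x \<in> V c" for c x using \<phi> that by (simp add: natural_map_def)
  have \<phi>2: "\<phi> (Dom D f) (r f x) = s f (\<phi> (Cod D f) x)" if "f \<in> Arr D" "x \<in> V (Cod D f)" for f x
    using \<phi> that by (simp add: natural_map_def)
  have Einv: "\<phi> c x = \<phi> c y" if "E c x y" for c x y by (rule E_invariant[OF W \<phi> G that])
  have ex: "\<exists>w. w \<in> W c \<and> (\<forall>(f, x)\<in>\<sigma>. s f w = \<phi> (Dom D f) x)" if c: "c \<in> Obj D" and \<sigma>: "\<sigma> \<in> L c" for c \<sigma>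
  proof -
    let ?S = "{f \<in> Arr D. Cod D f = c \<and> (\<exists>x. (f, x) \<in> \<sigma>)}"
    define m where "m f = (SOME x. (f, x) \<in> \<sigma>)" for f
    have m: "(f, m f) \<in> \<sigma>" if "f \<in> ?S" for f using that unfolding m_def by (auto intro: someI)
    have \<phi>m: "\<phi> (Dom D f) (m f) = \<phi> (Dom D f) x" if "(f, x) \<in> \<sigma>" for f x
    proof -
      have "f \<in> ?S" using that L_D(1)[OF \<sigma>] by blast
      then have "E (Dom D f) (m f) x" using m L_D(4)[OF \<sigma>, of f "m f" x] that by blast
      then show ?thesis by (rule Einv)
    qed
    have "matching D W s ?S (\<lambda>f. \<phi> (Dom D f) (m f))"
      unfolding matching_def
    proof (intro conjI ballI impI)
      fix f assume f: "f \<in> ?S"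
      show "\<phi> (Dom D f) (m f) \<in> W (Dom D f)" using L_D(1)[OF \<sigma> m[OF f]] \<phi>1 by simp
      fix g assume g: "g \<in> Arr D" "Cod D g = Dom D f"
      have "(f \<cdot> g, r g (m f)) \<in> \<sigma>" using L_D(2)[OF \<sigma> m[OF f] g] .
      then show "\<phi> (Dom D (f \<cdot> g)) (m (f \<cdot> g)) = s g (\<phi> (Dom D f) (m f))"
        using \<phi>m[of "f \<cdot> g"] \<phi>2[of g "m f"] g L_D(1)[OF \<sigma> m[OF f]] by simp
    qed
    then obtain w where w: "w \<in> W c" "\<And>f. f \<in> ?S \<Longrightarrow> s f w = \<phi> (Dom D f) (m f)"
      using sheaf_glue[OF W L_D(5)[OF \<sigma>] c] by blast
    have "s f w = \<phi> (Dom D f) x" if "(f, x) \<in> \<sigma>" for f x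
    proof -
      have "f \<in> ?S" using that L_D(1)[OF \<sigma> that] by blast
      then show ?thesis using w(2) \<phi>m[OF that] by simp
    qed
    then show ?thesis using w(1) by blast
  qed
  have uniq: "w = w'" if c: "c \<in> Obj D" and \<sigma>: "\<sigma> \<in> L c" and w: "w \<in> W c" "w' \<in> W c"
     "\<forall>(f, x)\<in>\<sigma>. s f w = \<phi> (Dom D f) x" "\<forall>(f, x)\<in>\<sigma>. s f w' = \<phi> (Dom D f) x" for c \<sigma> w w'
  proof (rule sheaf_ext[OF W L_D(5)[OF \<sigma>] c w(1,2)])
    show "s f w = s f w'" if "f \<in> {f \<in> Arr D. Cod D f = c \<and> (\<exists>x. (f, x) \<in> \<sigma>)}" for f
      using that w(3,4) by fastforce
  qed
  define \<psi> where "\<psi> c \<sigma> = (SOME w. w \<in> W c \<and> (\<forall>(f, x)\<in>\<sigma>. s f w = \<phi> (Dom D f) x))" for c \<sigma>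
  have \<psi>: "\<psi> c \<sigma> \<in> W c \<and> (\<forall>(f, x)\<in>\<sigma>. s f (\<psi> c \<sigma>) = \<phi> (Dom D f) x)" if "c \<in> Obj D" "\<sigma> \<in> L c" for c \<sigma>
    unfolding \<psi>_def by (rule someI_ex) (rule ex[OF that])
  have "natural_map D L res W s \<psi>"
    unfolding natural_map_def
  proof (intro conjI ballI)
    show "\<psi> c \<sigma> \<in> W c" if "c \<in> Obj D" "\<sigma> \<in> L c" for c \<sigma> using \<psi> that by blast
    fix h \<sigma> assume h: "h \<in> Arr D" and \<sigma>: "\<sigma> \<in> L (Cod D h)"
    show "\<psi> (Dom D h) (res h \<sigma>) = s h (\<psi> (Cod D h) \<sigma>)"
    proof (rule uniq[OF _ res_L[OF h \<sigma>]])
      show "\<psi> (Dom D h) (res h \<sigma>) \<in> W (Dom D h)" "\<forall>(f, x)\<in>res h \<sigma>. s f (\<psi> (Dom D h) (res h \<sigma>)) = \<phi> (Dom D f) x"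
        using \<psi>[OF _ res_L[OF h \<sigma>]] h by simp_all
      show "s h (\<psi> (Cod D h) \<sigma>) \<in> W (Dom D h)" using \<psi>[of "Cod D h" \<sigma>] h \<sigma> PW(1) by simp
      show "\<forall>(f, x)\<in>res h \<sigma>. s f (s h (\<psi> (Cod D h) \<sigma>)) = \<phi> (Dom D f) x"
      proof clarify
        fix f x assume fx: "(f, x) \<in> res h \<sigma>"
        then have f: "f \<in> Arr D" "Cod D f = Dom D h" "(h \<cdot> f, x) \<in> \<sigma>" unfolding res_def by blast+
        have p: "\<psi> (Cod D h) \<sigma> \<in> W (Cod D h)" "\<forall>(f, x)\<in>\<sigma>. s f (\<psi> (Cod D h) \<sigma>) = \<phi> (Dom D f) x"
          using \<psi>[OF _ \<sigma>] h by simp_all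
        have "s (h \<cdot> f) (\<psi> (Cod D h) \<sigma>) = \<phi> (Dom D (h \<cdot> f)) x" using bspec[OF p(2) f(3)] by simp
        then show "s f (s h (\<psi> (Cod D h) \<sigma>)) = \<phi> (Dom D f) x"
          using PW(3)[OF h f(1,2) p(1)] h f(1,2) by simp
      qed
    qed (use h in auto)
  qed
  moreover have "\<psi> c (rep c x) = \<phi> c x" if c: "c \<in> Obj D" and x: "x \<in> V c" for c x
  proof (rule uniq[OF c rep_L[OF c x]])
    show "\<psi> c (rep c x) \<in> W c" "\<forall>(f, y)\<in>rep c x. s f (\<psi> c (rep c x)) = \<phi> (Dom D f) y"
      using \<psi>[OF c rep_L[OF c x]] by simp_all
    show "\<phi> c x \<in> W c" using \<phi>1 c x .
    show "\<forall>(f, y)\<in>rep c x. s f (\<phi> c x) = \<phi> (Dom D f) y"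
    proof clarify
      fix f y assume "(f, y) \<in> rep c x"
      then have "f \<in> Arr D" "Cod D f = c" "E (Dom D f) (r f x) y" unfolding rep_def by blast+
      then show "s f (\<phi> c x) = \<phi> (Dom D f) y" using Einv[of "Dom D f" "r f x" y] \<phi>2[of f x] x by simp
    qed
  qed
  ultimately show ?thesis using that by blast
qed

text \<open>The section \<sigma> is represented by elements of V over a cover.\<close>

lemma L_generated:
  assumes W: "sheaf D J W s" and \<psi>: "natural_map D L res W s \<psi>" "natural_map D L res W s \<psi>'"
    and eq: "\<And>c x. \<lbrakk>c \<in> Obj D; x \<in> V c\<rbrakk> \<Longrightarrow> \<psi> c (rep c x) = \<psi>' c (rep c x)"
    and c: "c \<in> Obj D" and \<sigma>: "\<sigma> \<in> L c"
  shows "\<psi> c \<sigma> = \<psi>' c \<sigma>"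
proof (rule sheaf_ext[OF W L_D(5)[OF \<sigma>] c])
  show "\<psi> c \<sigma> \<in> W c" "\<psi>' c \<sigma> \<in> W c" using \<psi> c \<sigma> by (auto simp: natural_map_def)
  fix f assume "f \<in> {f \<in> Arr D. Cod D f = c \<and> (\<exists>x. (f, x) \<in> \<sigma>)}"
  then obtain x where f: "f \<in> Arr D" "Cod D f = c" "(f, x) \<in> \<sigma>" by blast
  have x: "x \<in> V (Dom D f)" using L_D(1)[OF \<sigma> f(3)] by simp
  have "res f \<sigma> = rep (Dom D f) x" using mem_iff_rep[OF \<sigma> f(1,2) x] f by simp
  then have "\<psi> (Dom D f) (res f \<sigma>) = \<psi>' (Dom D f) (res f \<sigma>)" using eq f x by simp
  then show "s f (\<psi> c \<sigma>) = s f (\<psi>' c \<sigma>)" using \<psi> f \<sigma> unfolding natural_map_def by metis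
qed

lemma L_small:
  assumes "universe \<kappa>" "small \<kappa> (Arr D)" "\<And>c. c \<in> Obj D \<Longrightarrow> small \<kappa> (V c)"
  shows "small \<kappa> (L c)"
proof (rule small_subset[OF small_Pow[OF assms(1) small_Sigma[OF assms(1,2)]]])
  show "small \<kappa> (V (Dom D f))" if "f \<in> Arr D" for f using assms(3) that by simp
  show "L c \<subseteq> Pow (SIGMA f:Arr D. V (Dom D f))" by (auto dest: L_D(1))
qed

end

section \<open>Constructions of sheaves\<close>

lemma natural_map_simps:
  assumes "natural_map D V r W s \<phi>"
  shows "\<And>c x. \<lbrakk>c \<in> Obj D; x \<in> V c\<rbrakk> \<Longrightarrow> \<phi> c x \<in> W c"
    "\<And>f x. \<lbrakk>f \<in> Arr D; x \<in> V (Cod D f)\<rbrakk> \<Longrightarrow> \<phi> (Dom D f) (r f x) = s f (\<phi> (Cod D f) x)"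
  using assms by (auto simp: natural_map_def)

lemma (in category) natural_map_comp:
  assumes \<phi>: "natural_map C V r W s \<phi>" and \<psi>: "natural_map C W s X t \<psi>"
  shows "natural_map C V r X t (\<lambda>c x. \<psi> c (\<phi> c x))"
  unfolding natural_map_def
proof (intro conjI ballI)
  show "\<psi> c (\<phi> c x) \<in> X c" if "c \<in> Obj C" "x \<in> V c" for c x
    using natural_map_simps(1)[OF \<psi> that(1) natural_map_simps(1)[OF \<phi> that]] .
  show "\<psi> (Dom C f) (\<phi> (Dom C f) (r f x)) = t f (\<psi> (Cod C f) (\<phi> (Cod C f) x))" if "f \<in> Arr C" "x \<in> V (Cod C f)"
      for f x
    using natural_map_simps(2)[OF \<phi> that] natural_map_simps(2)[OF \<psi> that(1) natural_map_simps(1)[OF \<phi> Cod_Obj[OF that(1)] that(2)]] by simp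
qed

context site
begin

lemma natural_bij_inverse:
  assumes V: "presheaf D V r" and \<gamma>: "natural_bij D V r W s \<gamma>"
  shows "natural_map D W s V r (\<lambda>c. inv_into (V c) (\<gamma> c))"
  unfolding natural_map_def
proof (intro conjI ballI)
  have bij: "bij_betw (\<gamma> c) (V c) (W c)" if "c \<in> Obj D" for c using \<gamma> that by (simp add: natural_bij_def)
  have nat: "natural_map D V r W s \<gamma>" using \<gamma> by (simp add: natural_bij_def)
  show in_V: "inv_into (V c) (\<gamma> c) y \<in> V c" if "c \<in> Obj D" "y \<in> W c" for c y
    using bij[OF that(1)] that(2) by (simp add: bij_betw_def inv_into_into)
  fix f y assume f: "f \<in> Arr D" and y: "y \<in> W (Cod D f)"
  let ?x = "inv_into (V (Cod D f)) (\<gamma> (Cod D f)) y"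
  have x: "?x \<in> V (Cod D f)" "\<gamma> (Cod D f) ?x = y"
    using in_V[of "Cod D f" y] f y bij[of "Cod D f"] by (auto simp: bij_betw_inv_into_right)
  have "\<gamma> (Dom D f) (r f ?x) = s f y" using natural_map_simps(2)[OF nat f x(1)] x(2) by simp
  then show "inv_into (V (Dom D f)) (\<gamma> (Dom D f)) (s f y) = r f ?x"
    using bij_betw_inv_into_left[OF bij[of "Dom D f"], of "r f ?x"] presheaf_simps(1)[OF V f x(1)] f by simp
qed

text \<open>A subpresheaf of a sheaf is a sheaf as soon as membership is local.\<close>

lemma subsheaf:
  assumes V: "sheaf D J V r" and U: "\<And>c. c \<in> Obj D \<Longrightarrow> U c \<subseteq> V c"
    and res: "\<And>f x. \<lbrakk>f \<in> Arr D; x \<in> U (Cod D f)\<rbrakk> \<Longrightarrow> r f x \<in> U (Dom D f)"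
    and loc: "\<And>c S x. \<lbrakk>c \<in> Obj D; S \<in> J c; x \<in> V c; \<And>f. f \<in> S \<Longrightarrow> r f x \<in> U (Dom D f)\<rbrakk> \<Longrightarrow> x \<in> U c"
  shows "sheaf D J U r"
proof (rule sheafI)
  note P = presheaf_simps[OF sheaf_presheaf[OF V]]
  have UV: "x \<in> V c" if "c \<in> Obj D" "x \<in> U c" for c x using U that by blast
  show "presheaf D U r" unfolding presheaf_def
  proof (intro conjI ballI impI)
    show "r f x \<in> U (Dom D f)" if "f \<in> Arr D" "x \<in> U (Cod D f)" for f x using res that .
    show "r (Ident D c) x = x" if "c \<in> Obj D" "x \<in> U c" for c x using P(2) UV that by blast
    show "r (f \<cdot>\<^bsub>D\<^esub> g) x = r g (r f x)" if "f \<in> Arr D" "g \<in> Arr D" "Cod D g = Dom D f" "x \<in> U (Cod D f)" for f g x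
      using P(3)[OF that(1-3) UV[OF Cod_Obj[OF that(1)] that(4)]] .
  qed
  fix c S assume c: "c \<in> Obj D" "S \<in> J c"
  show "x = y" if "x \<in> U c" "y \<in> U c" "\<And>f. f \<in> S \<Longrightarrow> r f x = r f y" for x y
    using sheaf_ext[OF V c(2,1) UV[OF c(1) that(1)] UV[OF c(1) that(2)] that(3)] .
  fix x assume x: "matching D U r S x"
  have xU: "x f \<in> U (Dom D f)" if "f \<in> S" for f using x that by (simp add: matching_def)
  have "matching D V r S x"
    unfolding matching_def
  proof (intro conjI ballI impI)
    show "x f \<in> V (Dom D f)" if "f \<in> S" for f using UV[OF _ xU[OF that]] cover_sieve(1)[OF c(2,1) that] by simp
    show "x (f \<cdot>\<^bsub>D\<^esub> g) = r g (x f)" if "f \<in> S" "g \<in> Arr D" "Cod D g = Dom D f" for f g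
      using x that by (simp add: matching_def)
  qed
  then obtain y where y: "y \<in> V c" "\<And>f. f \<in> S \<Longrightarrow> r f y = x f" using sheaf_glue[OF V c(2,1)] by blast
  have "y \<in> U c" by (rule loc[OF c y(1)]) (simp add: y(2) xU)
  then show "\<exists>y\<in>U c. \<forall>f\<in>S. r f y = x f" using y(2) by blast
qed

lemma product_sheaf:
  assumes V: "\<And>i. i \<in> I \<Longrightarrow> sheaf D J (V i) (r i)"
  shows "sheaf D J (\<lambda>c. \<Pi>\<^sub>E i\<in>I. V i c) (\<lambda>f t. \<lambda>i\<in>I. r i f (t i))"
proof (rule sheafI)
  note P = presheaf_simps[OF sheaf_presheaf[OF V]]
  show "presheaf D (\<lambda>c. \<Pi>\<^sub>E i\<in>I. V i c) (\<lambda>f t. \<lambda>i\<in>I. r i f (t i))"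
    unfolding presheaf_def
  proof (intro conjI ballI impI)
    show "(\<lambda>i\<in>I. r i f (t i)) \<in> (\<Pi>\<^sub>E i\<in>I. V i (Dom D f))" if "f \<in> Arr D" "t \<in> (\<Pi>\<^sub>E i\<in>I. V i (Cod D f))" for f t
      using that P(1) by (intro restrict_PiE_iff[THEN iffD2] ballI) (auto dest: PiE_mem)
    show "(\<lambda>i\<in>I. r i (Ident D c) (t i)) = t" if "c \<in> Obj D" "t \<in> (\<Pi>\<^sub>E i\<in>I. V i c)" for c t
      using that P(2) by (intro extensionalityI[of _ I]) (auto dest: PiE_mem PiE_ext simp: PiE_iff)
    show "(\<lambda>i\<in>I. r i (f \<cdot>\<^bsub>D\<^esub> g) (t i)) = (\<lambda>i\<in>I. r i g ((\<lambda>i\<in>I. r i f (t i)) i))"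
      if "f \<in> Arr D" "g \<in> Arr D" "Cod D g = Dom D f" "t \<in> (\<Pi>\<^sub>E i\<in>I. V i (Cod D f))" for f g t
      using that P(3) by (intro restrict_ext) (auto dest: PiE_mem)
  qed
  fix c S assume c: "c \<in> Obj D" "S \<in> J c"
  show "x = y" if xy: "x \<in> (\<Pi>\<^sub>E i\<in>I. V i c)" "y \<in> (\<Pi>\<^sub>E i\<in>I. V i c)"
      "\<And>f. f \<in> S \<Longrightarrow> (\<lambda>i\<in>I. r i f (x i)) = (\<lambda>i\<in>I. r i f (y i))" for x y
  proof (rule PiE_ext[OF xy(1,2)])
    fix i assume i: "i \<in> I"
    show "x i = y i"
    proof (rule sheaf_ext[OF V[OF i] c(2,1)])
      show "r i f (x i) = r i f (y i)" if "f \<in> S" for f using fun_cong[OF xy(3)[OF that], of i] i by simp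
    qed (use xy(1,2) i in \<open>auto dest: PiE_mem\<close>)
  qed
  fix x assume x: "matching D (\<lambda>c. \<Pi>\<^sub>E i\<in>I. V i c) (\<lambda>f t. \<lambda>i\<in>I. r i f (t i)) S x"
  have ex: "\<exists>y. y \<in> V i c \<and> (\<forall>f\<in>S. r i f y = x f i)" if i: "i \<in> I" for i
  proof -
    have "matching D (V i) (r i) S (\<lambda>f. x f i)"
      unfolding matching_def
    proof (intro conjI ballI impI)
      show "x f i \<in> V i (Dom D f)" if "f \<in> S" for f using x that i by (auto simp: matching_def dest: PiE_mem)
      show "x (f \<cdot>\<^bsub>D\<^esub> g) i = r i g (x f i)" if "f \<in> S" "g \<in> Arr D" "Cod D g = Dom D f" for f g
        using x that i by (simp add: matching_def)
    qed
    then show ?thesis using sheaf_glue[OF V[OF i] c(2,1)] by metis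
  qed
  then obtain y where y: "\<And>i. i \<in> I \<Longrightarrow> y i \<in> V i c \<and> (\<forall>f\<in>S. r i f (y i) = x f i)" by metis
  show "\<exists>y\<in>(\<Pi>\<^sub>E i\<in>I. V i c). \<forall>f\<in>S. (\<lambda>i\<in>I. r i f (y i)) = x f"
  proof (rule bexI[of _ "restrict y I"], rule ballI)
    fix f assume f: "f \<in> S"
    have "x f \<in> (\<Pi>\<^sub>E i\<in>I. V i (Dom D f))" using x f by (simp add: matching_def)
    then show "(\<lambda>i\<in>I. r i f (restrict y I i)) = x f"
      using y f by (intro extensionalityI[of _ I]) (auto simp: PiE_iff)
  qed (use y in auto)
qed

text \<open>These are the truth values of the category of sheaves: a sieve is closed when it contains every arrow along which it covers.\<close>

definition closed_sieves :: "'d \<Rightarrow> 'e set set" where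
  "closed_sieves c = {S. sieve D c S \<and> (\<forall>f\<in>Arr D. Cod D f = c \<and> pull_sieve D f S \<in> J (Dom D f) \<longrightarrow> f \<in> S)}"

lemma pull_sieve_sieve:
  assumes "f \<in> Arr D" "sieve D (Cod D f) S"
  shows "sieve D (Dom D f) (pull_sieve D f S)"
  using assms unfolding sieve_def pull_sieve_def by (auto simp flip: comp_assoc)

lemma pull_sieve_comp:
  assumes "f \<in> Arr D" "g \<in> Arr D" "Cod D g = Dom D f"
  shows "pull_sieve D (f \<cdot>\<^bsub>D\<^esub> g) S = pull_sieve D g (pull_sieve D f S)"
  using assms by (auto simp: pull_sieve_def)

lemma pull_sieve_max_iff:
  assumes "f \<in> Arr D" "sieve D (Cod D f) S"
  shows "pull_sieve D f S = {g \<in> Arr D. Cod D g = Dom D f} \<longleftrightarrow> f \<in> S"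
proof
  assume "pull_sieve D f S = {g \<in> Arr D. Cod D g = Dom D f}"
  then have "Ident D (Dom D f) \<in> pull_sieve D f S" using assms by simp
  then show "f \<in> S" using assms by (simp add: pull_sieve_def)
next
  assume "f \<in> S"
  then show "pull_sieve D f S = {g \<in> Arr D. Cod D g = Dom D f}"
    using assms by (auto simp: pull_sieve_def sieve_def)
qed

lemma closed_sieves_sheaf: "sheaf D J closed_sieves (pull_sieve D)"
proof (rule sheafI)
  have sv: "sieve D c S" if "S \<in> closed_sieves c" for c S using that by (simp add: closed_sieves_def)
  have cl: "f \<in> S" if "S \<in> closed_sieves c" "f \<in> Arr D" "Cod D f = c" "pull_sieve D f S \<in> J (Dom D f)" for c S f
    using that by (simp add: closed_sieves_def)
  have cov_iff: "pull_sieve D f S \<in> J (Dom D f) \<longleftrightarrow> f \<in> S" if "S \<in> closed_sieves c" "f \<in> Arr D" "Cod D f = c" for c S f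
    using cl[OF that] pull_sieve_max_iff[of f S] sv[OF that(1)] that cover_max[of "Dom D f"] by auto
  show "presheaf D closed_sieves (pull_sieve D)"
    unfolding presheaf_def
  proof (intro conjI ballI impI)
    fix f S assume f: "f \<in> Arr D" and S: "S \<in> closed_sieves (Cod D f)"
    show "pull_sieve D f S \<in> closed_sieves (Dom D f)"
      unfolding closed_sieves_def mem_Collect_eq
    proof (intro conjI ballI impI)
      show "sieve D (Dom D f) (pull_sieve D f S)" using pull_sieve_sieve f sv[OF S] by blast
      fix g assume g: "g \<in> Arr D" "Cod D g = Dom D f \<and> pull_sieve D g (pull_sieve D f S) \<in> J (Dom D g)"
      then have "f \<cdot>\<^bsub>D\<^esub> g \<in> S" using cl[OF S, of "f \<cdot>\<^bsub>D\<^esub> g"] pull_sieve_comp[of f g S] f by simp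
      then show "g \<in> pull_sieve D f S" using g by (simp add: pull_sieve_def)
    qed
  next
    show "pull_sieve D (Ident D c) S = S" if "c \<in> Obj D" "S \<in> closed_sieves c" for c S
      using sv[OF that(2)] that(1) by (auto simp: pull_sieve_def sieve_def)
  qed (rule pull_sieve_comp)
  fix c R assume c: "c \<in> Obj D" "R \<in> J c"
  note cR = cover_sieve[OF c(2,1)]
  show "S = T" if S: "S \<in> closed_sieves c" and T: "T \<in> closed_sieves c" and e:
      "\<And>f. f \<in> R \<Longrightarrow> pull_sieve D f S = pull_sieve D f T" for S T
  proof -
    have *: "S \<subseteq> T" if S: "S \<in> closed_sieves c" and T: "T \<in> closed_sieves c"
      and e: "\<And>f. f \<in> R \<Longrightarrow> pull_sieve D f S = pull_sieve D f T" for S T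
    proof
      fix h assume hS: "h \<in> S"
      then have h: "h \<in> Arr D" "Cod D h = c" using sv[OF S] by (auto simp: sieve_def)
      have "pull_sieve D h T \<in> J (Dom D h)"
      proof (rule cover_superset)
        show "pull_sieve D h R \<in> J (Dom D h)" using cover_pull[of R h] c h by (simp add: pull_sieve_def)
        show "sieve D (Dom D h) (pull_sieve D h T)" using pull_sieve_sieve[of h T] sv[OF T] h by simp
        show "pull_sieve D h R \<subseteq> pull_sieve D h T"
        proof
          fix g assume "g \<in> pull_sieve D h R"
          then have g: "g \<in> Arr D" "Cod D g = Dom D h" "h \<cdot>\<^bsub>D\<^esub> g \<in> R" by (auto simp: pull_sieve_def)
          have "h \<cdot>\<^bsub>D\<^esub> g \<in> S" using hS sv[OF S] g by (auto simp: sieve_def)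
          then have "Ident D (Dom D g) \<in> pull_sieve D (h \<cdot>\<^bsub>D\<^esub> g) S" using g h by (simp add: pull_sieve_def)
          then have "Ident D (Dom D g) \<in> pull_sieve D (h \<cdot>\<^bsub>D\<^esub> g) T" using e[OF g(3)] by simp
          then show "g \<in> pull_sieve D h T" using g h by (simp add: pull_sieve_def)
        qed
      qed (use h in simp)
      then show "h \<in> T" using cl[OF T h] by simp
    qed
    show ?thesis using *[OF S T e] *[OF T S e[symmetric]] by blast
  qed
  fix s assume m: "matching D closed_sieves (pull_sieve D) R s"
  have s: "s f \<in> closed_sieves (Dom D f)" if "f \<in> R" for f using m that by (simp add: matching_def)
  have sg: "s (f \<cdot>\<^bsub>D\<^esub> g) = pull_sieve D g (s f)" if "f \<in> R" "g \<in> Arr D" "Cod D g = Dom D f" for f g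
    using m that by (simp add: matching_def)
  \<comment> \<open>The arrows that some member of the family contains; its closure is the glued sieve.\<close>
  define T where "T = {g \<in> R. Ident D (Dom D g) \<in> s g}"
  have T_mem: "f \<cdot>\<^bsub>D\<^esub> g \<in> T \<longleftrightarrow> g \<in> s f" if "f \<in> R" "g \<in> Arr D" "Cod D g = Dom D f" for f g
    using sg[OF that] cR(3)[OF that] cR(1)[OF that(1)] that by (simp add: T_def pull_sieve_def)
  have T_pull: "pull_sieve D f T = s f" if f: "f \<in> R" for f
    using T_mem[OF f] sv[OF s[OF f]] by (auto simp: pull_sieve_def sieve_def)
  have T_sieve: "sieve D c T"
    unfolding sieve_def
  proof (intro conjI ballI impI)
    show "T \<subseteq> {f \<in> Arr D. Cod D f = c}" using cR by (auto simp: T_def)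
    fix f g assume f: "f \<in> T" and g: "g \<in> Arr D" "Cod D g = Dom D f"
    then have fR: "f \<in> R" "Ident D (Dom D f) \<in> s f" by (auto simp: T_def)
    have "Ident D (Dom D f) \<cdot>\<^bsub>D\<^esub> g \<in> s f" using sv[OF s[OF fR(1)]] fR g cR(1)[OF fR(1)] unfolding sieve_def
        by fastforce
    then have "g \<in> s f" using g by simp
    then show "f \<cdot>\<^bsub>D\<^esub> g \<in> T" using T_mem[OF fR(1) g] by simp
  qed
  define S where "S = {h \<in> Arr D. Cod D h = c \<and> pull_sieve D h T \<in> J (Dom D h)}"
  have S_pull: "pull_sieve D f S = s f" if f: "f \<in> R" for f
  proof -
    have "g \<in> pull_sieve D f S \<longleftrightarrow> g \<in> s f" if g: "g \<in> Arr D" "Cod D g = Dom D f" for g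
    proof -
      have "g \<in> pull_sieve D f S \<longleftrightarrow> f \<cdot>\<^bsub>D\<^esub> g \<in> S" using g by (simp add: pull_sieve_def)
      also have "\<dots> \<longleftrightarrow> g \<in> s f"
        using g cR(1,2)[OF f] pull_sieve_comp[of f g T] T_pull[OF f] cov_iff[OF s[OF f] g] by (simp add: S_def)
      finally show ?thesis .
    qed
    then show ?thesis using sv[OF s[OF f]] by (auto simp: pull_sieve_def sieve_def)
  qed
  have "S \<in> closed_sieves c"
    unfolding closed_sieves_def mem_Collect_eq
  proof (intro conjI ballI impI)
    show "sieve D c S"
      unfolding sieve_def
    proof (intro conjI ballI impI)
      fix f g assume "f \<in> S" and g: "g \<in> Arr D" "Cod D g = Dom D f"
      then have f: "f \<in> Arr D" "Cod D f = c" "pull_sieve D f T \<in> J (Cod D g)" by (auto simp: S_def)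
      then show "f \<cdot>\<^bsub>D\<^esub> g \<in> S"
        using cover_pull[OF f(3) g(1)] g pull_sieve_comp[of f g T] by (simp add: S_def pull_sieve_def[of D g])
    qed (auto simp: S_def)
    fix f assume f: "f \<in> Arr D" "Cod D f = c \<and> pull_sieve D f S \<in> J (Dom D f)"
    have "pull_sieve D f T \<in> J (Dom D f)"
    proof (rule cover_transitive)
      show "pull_sieve D f S \<in> J (Dom D f)" "Dom D f \<in> Obj D" using f by auto
      show "sieve D (Dom D f) (pull_sieve D f T)" using pull_sieve_sieve[of f T] T_sieve f by simp
      fix g assume "g \<in> pull_sieve D f S"
      then have "g \<in> Arr D" "Cod D g = Dom D f" "f \<cdot>\<^bsub>D\<^esub> g \<in> S" by (auto simp: pull_sieve_def)
      then have "pull_sieve D g (pull_sieve D f T) \<in> J (Dom D g)" using pull_sieve_comp[of f g T] f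
          by (simp add: S_def)
      then show "{k \<in> Arr D. Cod D k = Dom D g \<and> g \<cdot>\<^bsub>D\<^esub> k \<in> pull_sieve D f T} \<in> J (Dom D g)"
        by (simp add: pull_sieve_def[of D g])
    qed
    then show "f \<in> S" using f by (simp add: S_def)
  qed
  then show "\<exists>y\<in>closed_sieves c. \<forall>f\<in>R. pull_sieve D f y = s f" using S_pull by blast
qed

text \<open>The elements of the product of the functor represented by c with V.\<close>

definition points :: "('d \<Rightarrow> 'x set) \<Rightarrow> 'd \<Rightarrow> ('e \<times> 'x) set" where
  "points V c = {(f, a). f \<in> Arr D \<and> Cod D f = c \<and> a \<in> V (Dom D f)}"

text \<open>By the Yoneda lemma an element over c of the exponential is a natural map to W from the product of V with the
  functor represented by c.\<close>

definition exponential_sheaf :: "('d \<Rightarrow> 'x set) \<Rightarrow> ('e \<Rightarrow> 'x \<Rightarrow> 'x) \<Rightarrow> ('d \<Rightarrow> 'y set) \<Rightarrow> ('e \<Rightarrow> 'y \<Rightarrow> 'y) \<Rightarrow> 'd \<Rightarrow> ('e \<times> 'x \<Rightarrow> 'y) set" where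
  "exponential_sheaf V r W s c = {\<theta> \<in> extensional (points V c).
     \<forall>(f, a)\<in>points V c. \<theta> (f, a) \<in> W (Dom D f) \<and>
       (\<forall>g\<in>Arr D. Cod D g = Dom D f \<longrightarrow> \<theta> (f \<cdot>\<^bsub>D\<^esub> g, r g a) = s g (\<theta> (f, a)))}"

definition exponential_res :: "('d \<Rightarrow> 'x set) \<Rightarrow> 'e \<Rightarrow> ('e \<times> 'x \<Rightarrow> 'y) \<Rightarrow> ('e \<times> 'x \<Rightarrow> 'y)" where
  "exponential_res V h \<theta> = (\<lambda>(f, a)\<in>points V (Dom D h). \<theta> (h \<cdot>\<^bsub>D\<^esub> f, a))"

lemma exponential_res_apply:
  "\<lbrakk>f \<in> Arr D; Cod D f = Dom D h; a \<in> V (Dom D f)\<rbrakk> \<Longrightarrow> exponential_res V h \<theta> (f, a) = \<theta> (h \<cdot>\<^bsub>D\<^esub> f, a)"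
  by (simp add: exponential_res_def points_def)

lemma exponential_ext:
  assumes "\<theta> \<in> extensional (points V c)" "\<theta>' \<in> extensional (points V c)"
    "\<And>f a. \<lbrakk>f \<in> Arr D; Cod D f = c; a \<in> V (Dom D f)\<rbrakk> \<Longrightarrow> \<theta> (f, a) = \<theta>' (f, a)"
  shows "\<theta> = \<theta>'"
  by (rule extensionalityI[OF assms(1,2)]) (auto simp: points_def assms(3))

text \<open>The value of the glued map at (h, a) is glued from the values of the given maps at the restrictions
of a along those arrows g for which h g lies in the cover.\<close>

lemma exponential_sheaf:
  assumes V: "presheaf D V r" and W: "sheaf D J W s"
  shows "sheaf D J (exponential_sheaf V r W s) (exponential_res V)"
proof (rule sheafI)
  note PV = presheaf_simps[OF V] and PW = presheaf_simps[OF sheaf_presheaf[OF W]]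
  have ex_ext: "\<theta> \<in> extensional (points V c)" if "\<theta> \<in> exponential_sheaf V r W s c" for \<theta> c
    using that by (simp add: exponential_sheaf_def)
  have ex_in: "\<theta> (f, a) \<in> W (Dom D f)"
    if "\<theta> \<in> exponential_sheaf V r W s c" "f \<in> Arr D" "Cod D f = c" "a \<in> V (Dom D f)" for \<theta> c f a
    using that by (auto simp: exponential_sheaf_def points_def)
  have ex_nat: "\<theta> (f \<cdot>\<^bsub>D\<^esub> g, r g a) = s g (\<theta> (f, a))"
    if "\<theta> \<in> exponential_sheaf V r W s c" "f \<in> Arr D" "Cod D f = c" "a \<in> V (Dom D f)" "g \<in> Arr D"
        "Cod D g = Dom D f" for \<theta> c f a g
    using that by (auto simp: exponential_sheaf_def points_def)
  have exI: "\<theta> \<in> exponential_sheaf V r W s c"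
    if "\<theta> \<in> extensional (points V c)" "\<And>f a. \<lbrakk>f \<in> Arr D; Cod D f = c; a \<in> V (Dom D f)\<rbrakk> \<Longrightarrow> \<theta> (f, a) \<in> W (Dom D f)"
     "\<And>f a g. \<lbrakk>f \<in> Arr D; Cod D f = c; a \<in> V (Dom D f); g \<in> Arr D; Cod D g = Dom D f\<rbrakk> \<Longrightarrow> \<theta> (f \<cdot>\<^bsub>D\<^esub> g, r g a) =
         s g (\<theta> (f, a))" for \<theta> c
    using that by (auto simp: exponential_sheaf_def points_def)
  have res_ext: "exponential_res V h \<theta> \<in> extensional (points V (Dom D h))" for h and \<theta> :: "'e \<times> 'a \<Rightarrow> 'b"
    by (simp add: exponential_res_def)
  show "presheaf D (exponential_sheaf V r W s) (exponential_res V)"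
    unfolding presheaf_def
  proof (intro conjI ballI impI)
    fix h \<theta> assume h: "h \<in> Arr D" and \<theta>: "\<theta> \<in> exponential_sheaf V r W s (Cod D h)"
    show "exponential_res V h \<theta> \<in> exponential_sheaf V r W s (Dom D h)"
    proof (rule exI[OF res_ext])
      show "exponential_res V h \<theta> (f, a) \<in> W (Dom D f)" if "f \<in> Arr D" "Cod D f = Dom D h" "a \<in> V (Dom D f)" for f a
        using ex_in[OF \<theta>, of "h \<cdot>\<^bsub>D\<^esub> f" a] h that by (simp add: exponential_res_apply)
      show "exponential_res V h \<theta> (f \<cdot>\<^bsub>D\<^esub> g, r g a) = s g (exponential_res V h \<theta> (f, a))"
        if "f \<in> Arr D" "Cod D f = Dom D h" "a \<in> V (Dom D f)" "g \<in> Arr D" "Cod D g = Dom D f" for f a g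
        using ex_nat[OF \<theta>, of "h \<cdot>\<^bsub>D\<^esub> f" a g] PV(1)[of g a] h that by (simp add: exponential_res_apply)
    qed
  next
    fix c \<theta> assume c: "c \<in> Obj D" and \<theta>: "\<theta> \<in> exponential_sheaf V r W s c"
    show "exponential_res V (Ident D c) \<theta> = \<theta>"
      using res_ext[of "Ident D c"] c by (intro exponential_ext[OF _ ex_ext[OF \<theta>]]) (auto simp: exponential_res_apply)
  next
    fix f g \<theta> assume f: "f \<in> Arr D" "g \<in> Arr D" "Cod D g = Dom D f" and \<theta>: "\<theta> \<in> exponential_sheaf V r W s (Cod D f)"
    show "exponential_res V (f \<cdot>\<^bsub>D\<^esub> g) \<theta> = exponential_res V g (exponential_res V f \<theta>)"
    proof (rule exponential_ext[OF _ res_ext])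
      show "exponential_res V (f \<cdot>\<^bsub>D\<^esub> g) \<theta> \<in> extensional (points V (Dom D g))" using res_ext[of "f \<cdot>\<^bsub>D\<^esub> g" \<theta>] f
          by simp
    qed (use f in \<open>simp add: exponential_res_apply\<close>)
  qed
  fix c S assume c: "c \<in> Obj D" "S \<in> J c"
  note cs = cover_sieve[OF c(2,1)]
  have pull: "{g \<in> Arr D. Cod D g = Dom D h \<and> h \<cdot>\<^bsub>D\<^esub> g \<in> S} \<in> J (Dom D h)" if "h \<in> Arr D" "Cod D h = c" for h
    using cover_pull[of S h] c that by simp
  show "\<theta> = \<theta>'" if \<theta>: "\<theta> \<in> exponential_sheaf V r W s c" "\<theta>' \<in> exponential_sheaf V r W s c"
    and e: "\<And>f. f \<in> S \<Longrightarrow> exponential_res V f \<theta> = exponential_res V f \<theta>'" for \<theta> \<theta>'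
  proof (rule exponential_ext[OF ex_ext[OF \<theta>(1)] ex_ext[OF \<theta>(2)]])
    fix h a assume h: "h \<in> Arr D" "Cod D h = c" "a \<in> V (Dom D h)"
    show "\<theta> (h, a) = \<theta>' (h, a)"
    proof (rule sheaf_ext[OF W pull[OF h(1,2)]])
      fix g assume "g \<in> {g \<in> Arr D. Cod D g = Dom D h \<and> h \<cdot>\<^bsub>D\<^esub> g \<in> S}"
      then have g: "g \<in> Arr D" "Cod D g = Dom D h" "h \<cdot>\<^bsub>D\<^esub> g \<in> S" by auto
      have "\<theta> (h \<cdot>\<^bsub>D\<^esub> g, r g a) = \<theta>' (h \<cdot>\<^bsub>D\<^esub> g, r g a)"
        using fun_cong[OF e[OF g(3)], of "(Ident D (Dom D g), r g a)"] g h PV(1)[of g a]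
          by (simp add: exponential_res_apply)
      then show "s g (\<theta> (h, a)) = s g (\<theta>' (h, a))"
        using ex_nat[OF \<theta>(1) h g(1,2)] ex_nat[OF \<theta>(2) h g(1,2)] by simp
    qed (use h ex_in[OF \<theta>(1)] ex_in[OF \<theta>(2)] in auto)
  qed
  fix t assume m: "matching D (exponential_sheaf V r W s) (exponential_res V) S t"
  have t: "t f \<in> exponential_sheaf V r W s (Dom D f)" if "f \<in> S" for f using m that by (simp add: matching_def)
  have tg: "t (f \<cdot>\<^bsub>D\<^esub> g) = exponential_res V g (t f)" if "f \<in> S" "g \<in> Arr D" "Cod D g = Dom D f" for f g
      using m that by (simp add: matching_def)
  have tI: "t (f \<cdot>\<^bsub>D\<^esub> g) (Ident D (Dom D g), b) = t f (g, b)" if "f \<in> S" "g \<in> Arr D" "Cod D g = Dom D f"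
      "b \<in> V (Dom D g)" for f g b
    using tg[OF that(1-3)] that by (simp add: exponential_res_apply)
  have ex: "\<exists>w. w \<in> W (Dom D h) \<and> (\<forall>g\<in>Arr D. Cod D g = Dom D h \<and> h \<cdot>\<^bsub>D\<^esub> g \<in> S \<longrightarrow> s g w =
      t (h \<cdot>\<^bsub>D\<^esub> g) (Ident D (Dom D g), r g a))"
    if h: "h \<in> Arr D" "Cod D h = c" and a: "a \<in> V (Dom D h)" for h a
  proof -
    have "matching D W s {g \<in> Arr D. Cod D g = Dom D h \<and> h \<cdot>\<^bsub>D\<^esub> g \<in> S} (\<lambda>g. t (h \<cdot>\<^bsub>D\<^esub> g) (Ident D (Dom D g), r g a))"
      unfolding matching_def
    proof (intro conjI ballI impI)
      fix g assume "g \<in> {g \<in> Arr D. Cod D g = Dom D h \<and> h \<cdot>\<^bsub>D\<^esub> g \<in> S}"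
      then have g: "g \<in> Arr D" "Cod D g = Dom D h" "h \<cdot>\<^bsub>D\<^esub> g \<in> S" by auto
      show "t (h \<cdot>\<^bsub>D\<^esub> g) (Ident D (Dom D g), r g a) \<in> W (Dom D g)"
        using ex_in[OF t[OF g(3)], of "Ident D (Dom D g)" "r g a"] g h a PV(1)[of g a] by simp
      fix k assume k: "k \<in> Arr D" "Cod D k = Dom D g"
      have "t (h \<cdot>\<^bsub>D\<^esub> (g \<cdot>\<^bsub>D\<^esub> k)) (Ident D (Dom D k), r k (r g a)) = t (h \<cdot>\<^bsub>D\<^esub> g) (k, r k (r g a))"
        using tI[OF g(3), of k "r k (r g a)"] PV(1)[of g a] PV(1)[of k "r g a"] g h a k by simp
      also have "\<dots> = s k (t (h \<cdot>\<^bsub>D\<^esub> g) (Ident D (Dom D g), r g a))"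
        using ex_nat[OF t[OF g(3)], of "Ident D (Dom D g)" "r g a" k] PV(1)[of g a] g h a k by simp
      finally show "t (h \<cdot>\<^bsub>D\<^esub> (g \<cdot>\<^bsub>D\<^esub> k)) (Ident D (Dom D (g \<cdot>\<^bsub>D\<^esub> k)), r (g \<cdot>\<^bsub>D\<^esub> k) a) =
          s k (t (h \<cdot>\<^bsub>D\<^esub> g) (Ident D (Dom D g), r g a))"
        using PV(3)[of g k a] g k a by simp
    qed
    then obtain w where w: "w \<in> W (Dom D h)"
      "\<And>g. g \<in> {g \<in> Arr D. Cod D g = Dom D h \<and> h \<cdot>\<^bsub>D\<^esub> g \<in> S} \<Longrightarrow> s g w = t (h \<cdot>\<^bsub>D\<^esub> g) (Ident D (Dom D g), r g a)"
      using sheaf_glue[OF W pull[OF h]] h(1) by (metis (no_types, lifting) Dom_Obj)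
    then show ?thesis by blast
  qed
  define \<theta>0 where "\<theta>0 h a = (SOME w. w \<in> W (Dom D h) \<and> (\<forall>g\<in>Arr D. Cod D g = Dom D h \<and> h \<cdot>\<^bsub>D\<^esub> g \<in> S \<longrightarrow> s g w =
      t (h \<cdot>\<^bsub>D\<^esub> g) (Ident D (Dom D g), r g a)))" for h a
  have \<theta>0: "\<theta>0 h a \<in> W (Dom D h) \<and> (\<forall>g\<in>Arr D. Cod D g = Dom D h \<and> h \<cdot>\<^bsub>D\<^esub> g \<in> S \<longrightarrow> s g (\<theta>0 h a) =
      t (h \<cdot>\<^bsub>D\<^esub> g) (Ident D (Dom D g), r g a))"
    if "h \<in> Arr D" "Cod D h = c" "a \<in> V (Dom D h)" for h a
    unfolding \<theta>0_def by (rule someI_ex) (rule ex[OF that])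
  define \<theta> where "\<theta> = (\<lambda>(h, a)\<in>points V c. \<theta>0 h a)"
  have \<theta>_apply: "\<theta> (h, a) = \<theta>0 h a" if "h \<in> Arr D" "Cod D h = c" "a \<in> V (Dom D h)" for h a
    using that by (simp add: \<theta>_def points_def)
  have \<theta>_ext: "\<theta> \<in> extensional (points V c)" by (simp add: \<theta>_def)
  have "\<theta> \<in> exponential_sheaf V r W s c"
  proof (rule exI[OF \<theta>_ext])
    fix h a assume h: "h \<in> Arr D" "Cod D h = c" "a \<in> V (Dom D h)"
    show "\<theta> (h, a) \<in> W (Dom D h)" using \<theta>0[OF h] \<theta>_apply[OF h] by simp
    fix k assume k: "k \<in> Arr D" "Cod D k = Dom D h"
    have hk: "h \<cdot>\<^bsub>D\<^esub> k \<in> Arr D" "Cod D (h \<cdot>\<^bsub>D\<^esub> k) = c" "Dom D (h \<cdot>\<^bsub>D\<^esub> k) = Dom D k" "r k a \<in> V (Dom D k)"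
        using h k PV(1)[of k a] by simp_all
    have "\<theta>0 (h \<cdot>\<^bsub>D\<^esub> k) (r k a) = s k (\<theta>0 h a)"
    proof (rule sheaf_ext[OF W pull[OF hk(1,2)]])
      show "Dom D (h \<cdot>\<^bsub>D\<^esub> k) \<in> Obj D" unfolding hk(3) using k by simp
      show "\<theta>0 (h \<cdot>\<^bsub>D\<^esub> k) (r k a) \<in> W (Dom D (h \<cdot>\<^bsub>D\<^esub> k))" using \<theta>0[of "h \<cdot>\<^bsub>D\<^esub> k" "r k a"] hk by simp
      show "s k (\<theta>0 h a) \<in> W (Dom D (h \<cdot>\<^bsub>D\<^esub> k))" using \<theta>0[OF h] PW(1)[of k "\<theta>0 h a"] k hk by simp
      fix g assume "g \<in> {g \<in> Arr D. Cod D g = Dom D (h \<cdot>\<^bsub>D\<^esub> k) \<and> (h \<cdot>\<^bsub>D\<^esub> k) \<cdot>\<^bsub>D\<^esub> g \<in> S}"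
      then have "g \<in> Arr D" "Cod D g = Dom D (h \<cdot>\<^bsub>D\<^esub> k)" and gS: "(h \<cdot>\<^bsub>D\<^esub> k) \<cdot>\<^bsub>D\<^esub> g \<in> S" by auto
      then have g: "g \<in> Arr D" "Cod D g = Dom D k" using hk by simp_all
      have as: "(h \<cdot>\<^bsub>D\<^esub> k) \<cdot>\<^bsub>D\<^esub> g = h \<cdot>\<^bsub>D\<^esub> (k \<cdot>\<^bsub>D\<^esub> g)" using g h k by simp
      have "s g (\<theta>0 (h \<cdot>\<^bsub>D\<^esub> k) (r k a)) = t (h \<cdot>\<^bsub>D\<^esub> (k \<cdot>\<^bsub>D\<^esub> g)) (Ident D (Dom D g), r g (r k a))"
        using \<theta>0[of "h \<cdot>\<^bsub>D\<^esub> k" "r k a"] hk g gS as by simp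
      also have "\<dots> = s (k \<cdot>\<^bsub>D\<^esub> g) (\<theta>0 h a)"
        using \<theta>0[OF h] g gS as k PV(3)[of k g a] h by simp
      also have "\<dots> = s g (s k (\<theta>0 h a))" using PW(3)[of k g "\<theta>0 h a"] \<theta>0[OF h] g k by simp
      finally show "s g (\<theta>0 (h \<cdot>\<^bsub>D\<^esub> k) (r k a)) = s g (s k (\<theta>0 h a))" .
    qed
    then show "\<theta> (h \<cdot>\<^bsub>D\<^esub> k, r k a) = s k (\<theta> (h, a))" using \<theta>_apply[OF h] \<theta>_apply[of "h \<cdot>\<^bsub>D\<^esub> k" "r k a"] hk by simp
  qed
  moreover have "exponential_res V f \<theta> = t f" if f: "f \<in> S" for f
  proof (rule exponential_ext[OF res_ext ex_ext[OF t[OF f]]])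
    note f' = cs(1,2)[OF f]
    fix k a assume k: "k \<in> Arr D" "Cod D k = Dom D f" "a \<in> V (Dom D k)"
    have fk: "f \<cdot>\<^bsub>D\<^esub> k \<in> Arr D" "Cod D (f \<cdot>\<^bsub>D\<^esub> k) = c" "Dom D (f \<cdot>\<^bsub>D\<^esub> k) = Dom D k" "f \<cdot>\<^bsub>D\<^esub> k \<in> S"
        using f' k cs(3)[OF f] by simp_all
    have "\<theta>0 (f \<cdot>\<^bsub>D\<^esub> k) a = t (f \<cdot>\<^bsub>D\<^esub> k) (Ident D (Dom D k), a)"
      using \<theta>0[of "f \<cdot>\<^bsub>D\<^esub> k" a] fk k PV(2)[of "Dom D k" a] PW(2)[of "Dom D k" "\<theta>0 (f \<cdot>\<^bsub>D\<^esub> k) a"] f'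
          by (auto dest!: bspec[of "Arr D" _ "Ident D (Dom D k)"])
    also have "\<dots> = t f (k, a)" using tI[OF f k] .
    finally show "exponential_res V f \<theta> (k, a) = t f (k, a)"
      using k fk \<theta>_apply[of "f \<cdot>\<^bsub>D\<^esub> k" a] by (simp add: exponential_res_apply)
  qed
  ultimately show "\<exists>y\<in>exponential_sheaf V r W s c. \<forall>f\<in>S. exponential_res V f y = t f" by blast
qed

end

section \<open>Categories that are represented by the sheaves on a small site\<close>

text \<open>The category C need not consist of sheaves: objects have elements, arrows act on them, and C is equivalent to the category of
sheaves through these. Working with elements of objects of C makes it unnecessary to transport limits, exponentials and
classifiers along an equivalence.\<close>

locale sheaf_representation = site D J + C: category C
  for D :: "('d, 'e) cat" and J :: "'d \<Rightarrow> 'e set set" and C :: "('o, 'a) cat" +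
  fixes \<kappa> :: "'u rel" and el :: "'o \<Rightarrow> 'd \<Rightarrow> 'u set" and rs :: "'o \<Rightarrow> 'e \<Rightarrow> 'u \<Rightarrow> 'u" and ap :: "'a \<Rightarrow> 'd \<Rightarrow> 'u \<Rightarrow> 'u"
  assumes universe: "universe \<kappa>" and small_Obj: "small \<kappa> (Obj D)" and small_Arr: "small \<kappa> (Arr D)"
    and el_sheaf: "A \<in> Obj C \<Longrightarrow> sheaf D J (el A) (rs A)"
    and el_small: "\<lbrakk>A \<in> Obj C; c \<in> Obj D\<rbrakk> \<Longrightarrow> small \<kappa> (el A c)"
    and ap_natural: "a \<in> Arr C \<Longrightarrow> natural_map D (el (Dom C a)) (rs (Dom C a)) (el (Cod C a)) (rs (Cod C a)) (ap a)"
    and ap_comp: "\<lbrakk>a \<in> Arr C; b \<in> Arr C; Cod C a = Dom C b; c \<in> Obj D; x \<in> el (Dom C a) c\<rbrakk> \<Longrightarrow> ap (b \<cdot>\<^bsub>C\<^esub> a) c x =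
        ap b c (ap a c x)"
    and ap_ident: "\<lbrakk>A \<in> Obj C; c \<in> Obj D; x \<in> el A c\<rbrakk> \<Longrightarrow> ap (Ident C A) c x = x"
    and ap_ext: "\<lbrakk>a \<in> Arr C; b \<in> Arr C; Dom C a = Dom C b; Cod C a = Cod C b;
        \<And>c x. \<lbrakk>c \<in> Obj D; x \<in> el (Dom C a) c\<rbrakk> \<Longrightarrow> ap a c x = ap b c x\<rbrakk> \<Longrightarrow> a = b"
    and ap_full: "\<lbrakk>A \<in> Obj C; B \<in> Obj C; natural_map D (el A) (rs A) (el B) (rs B) \<phi>\<rbrakk> \<Longrightarrow>
        \<exists>a\<in>Arr C. Dom C a = A \<and> Cod C a = B \<and> (\<forall>c\<in>Obj D. \<forall>x\<in>el A c. ap a c x = \<phi> c x)"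
    and realization: "\<lbrakk>sheaf D J (V :: 'd \<Rightarrow> 'u set) r; \<And>c. c \<in> Obj D \<Longrightarrow> small \<kappa> (V c)\<rbrakk> \<Longrightarrow>
        \<exists>A\<in>Obj C. \<exists>\<gamma>. natural_bij D (el A) (rs A) V r \<gamma>"
begin

declare C.Dom_Obj [simp] C.Cod_Obj [simp]

lemma infinite_kappa: "Cinfinite \<kappa>"
  using universe by (simp add: universe_def)

lemmas rs_simps = presheaf_simps[OF sheaf_presheaf[OF el_sheaf]]

lemma ap_in: "\<lbrakk>a \<in> Arr C; c \<in> Obj D; x \<in> el (Dom C a) c; B = Cod C a\<rbrakk> \<Longrightarrow> ap a c x \<in> el B c"
  using natural_map_simps(1)[OF ap_natural] by blast

lemma ap_nat: "\<lbrakk>a \<in> Arr C; f \<in> Arr D; x \<in> el (Dom C a) (Cod D f)\<rbrakk> \<Longrightarrow>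
    ap a (Dom D f) (rs (Dom C a) f x) = rs (Cod C a) f (ap a (Cod D f) x)"
  using natural_map_simps(2)[OF ap_natural] by blast

text \<open>A small set embeds into the type on which the cardinal \<kappa> lives, so the sheaves built below may have values in whatever type
is convenient.\<close>

lemma realization_any:
  fixes V :: "'d \<Rightarrow> 'x set"
  assumes V: "sheaf D J V r" and small: "\<And>c. c \<in> Obj D \<Longrightarrow> small \<kappa> (V c)"
  obtains A \<gamma> where "A \<in> Obj C" "natural_bij D (el A) (rs A) V r \<gamma>"
proof -
  note P = presheaf_simps[OF sheaf_presheaf[OF V]]
  have "\<forall>c\<in>Obj D. \<exists>e :: 'x \<Rightarrow> 'u. inj_on e (V c)" using small_embed[OF infinite_kappa small] by metis
  then obtain e :: "'d \<Rightarrow> 'x \<Rightarrow> 'u" where e: "\<And>c. c \<in> Obj D \<Longrightarrow> inj_on (e c) (V c)" by metis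
  define V' where "V' c = e c ` V c" for c
  define e' where "e' c = inv_into (V c) (e c)" for c
  define r' where "r' f y = e (Dom D f) (r f (e' (Cod D f) y))" for f y
  have e'e [simp]: "e' c (e c x) = x" if "c \<in> Obj D" "x \<in> V c" for c x using e[OF that(1)] that(2)
      by (simp add: e'_def)
  have bij: "natural_bij D V' r' V r e'"
    unfolding natural_bij_def natural_map_def
  proof (intro conjI ballI)
    show "e' c x \<in> V c" if "c \<in> Obj D" "x \<in> V' c" for c x using that by (auto simp: V'_def)
    show "e' (Dom D f) (r' f x) = r f (e' (Cod D f) x)" if "f \<in> Arr D" "x \<in> V' (Cod D f)" for f x
      using that P(1) by (auto simp: V'_def r'_def)
    show "bij_betw (e' c) (V' c) (V c)" if "c \<in> Obj D" for c
      using e[OF that] unfolding e'_def V'_def by (simp add: bij_betw_inv_into inj_on_imp_bij_betw)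
  qed
  have V'sheaf: "sheaf D J V' r'"
    by (rule sheaf_transfer[OF V bij]) (use P(1) in \<open>auto simp: V'_def r'_def\<close>)
  obtain A \<gamma> where A: "A \<in> Obj C" "natural_bij D (el A) (rs A) V' r' \<gamma>"
    using realization[OF V'sheaf] small small_image by (metis V'_def)
  have "natural_bij D (el A) (rs A) V r (\<lambda>c x. e' c (\<gamma> c x))"
    unfolding natural_bij_def
  proof (intro conjI ballI)
    show "natural_map D (el A) (rs A) V r (\<lambda>c x. e' c (\<gamma> c x))"
      by (rule natural_map_comp[where W = V' and s = r']) (use A(2) bij in \<open>simp_all add: natural_bij_def\<close>)
    show "bij_betw (\<lambda>x. e' c (\<gamma> c x)) (el A c) (V c)" if "c \<in> Obj D" for c
      using bij_betw_trans[of "\<gamma> c" "el A c" "V' c" "e' c" "V c"] A(2) bij that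
          by (simp add: natural_bij_def comp_def)
  qed
  with A(1) show ?thesis by (rule that)
qed

lemma ap_full_Hom:
  assumes "A \<in> Obj C" "B \<in> Obj C" "natural_map D (el A) (rs A) (el B) (rs B) \<phi>"
  shows "\<exists>a. a \<in> Hom C A B \<and> (\<forall>c\<in>Obj D. \<forall>x\<in>el A c. ap a c x = \<phi> c x)"
  using ap_full[OF assms] unfolding Hom_iff by blast

context
  fixes A :: 'o and V :: "'d \<Rightarrow> 'x set" and r \<gamma>
  assumes A: "A \<in> Obj C" and \<gamma>: "natural_bij D (el A) (rs A) V r \<gamma>"
begin

lemma real_in: "\<lbrakk>c \<in> Obj D; x \<in> el A c\<rbrakk> \<Longrightarrow> \<gamma> c x \<in> V c"
  using \<gamma> by (simp add: natural_bij_def natural_map_def)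

lemma real_nat: "\<lbrakk>f \<in> Arr D; x \<in> el A (Cod D f)\<rbrakk> \<Longrightarrow> \<gamma> (Dom D f) (rs A f x) = r f (\<gamma> (Cod D f) x)"
  using \<gamma> by (simp add: natural_bij_def natural_map_def)

lemma real_inj: "\<lbrakk>c \<in> Obj D; x \<in> el A c; y \<in> el A c; \<gamma> c x = \<gamma> c y\<rbrakk> \<Longrightarrow> x = y"
  using \<gamma> by (auto simp: natural_bij_def bij_betw_def dest: inj_onD)

lemma real_surj: "\<lbrakk>c \<in> Obj D; v \<in> V c\<rbrakk> \<Longrightarrow> \<exists>x\<in>el A c. \<gamma> c x = v"
  using \<gamma> unfolding natural_bij_def by (metis bij_betw_imp_surj_on imageE)

text \<open>Arrows into and out of the realization of a sheaf are natural maps into and out of that sheaf.\<close>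

lemma into_real:
  assumes X: "X \<in> Obj C" and \<phi>: "natural_map D (el X) (rs X) V r \<phi>"
  shows "\<exists>!a. a \<in> Hom C X A \<and> (\<forall>c\<in>Obj D. \<forall>x\<in>el X c. \<gamma> c (ap a c x) = \<phi> c x)"
proof -
  let ?i = "\<lambda>c. inv_into (el A c) (\<gamma> c)"
  have bij: "bij_betw (\<gamma> c) (el A c) (V c)" if "c \<in> Obj D" for c using \<gamma> that by (simp add: natural_bij_def)
  have "natural_map D (el X) (rs X) (el A) (rs A) (\<lambda>c x. ?i c (\<phi> c x))"
    by (rule natural_map_comp[OF \<phi> natural_bij_inverse[OF sheaf_presheaf[OF el_sheaf[OF A]] \<gamma>]])
  then obtain a where a: "a \<in> Hom C X A" "\<forall>c\<in>Obj D. \<forall>x\<in>el X c. ap a c x = ?i c (\<phi> c x)"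
    using ap_full_Hom[OF X A] by blast
  show ?thesis
  proof (rule ex1I[of _ a])
    have *: "\<gamma> c (ap a c x) = \<phi> c x" if "c \<in> Obj D" "x \<in> el X c" for c x
      using a(2) that bij_betw_inv_into_right[OF bij[OF that(1)] natural_map_simps(1)[OF \<phi> that]] by simp
    then show "a \<in> Hom C X A \<and> (\<forall>c\<in>Obj D. \<forall>x\<in>el X c. \<gamma> c (ap a c x) = \<phi> c x)" using a(1) by blast
    fix b assume b: "b \<in> Hom C X A \<and> (\<forall>c\<in>Obj D. \<forall>x\<in>el X c. \<gamma> c (ap b c x) = \<phi> c x)"
    show "b = a"
    proof (rule ap_ext)
      fix c x assume c: "c \<in> Obj D" and "x \<in> el (Dom C b) c"
      then have x: "x \<in> el X c" using b by simp
      have "ap b c x \<in> el A c" "ap a c x \<in> el A c" using a(1) b c x by (simp_all add: ap_in)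
      moreover have "\<gamma> c (ap b c x) = \<gamma> c (ap a c x)" using *[OF c x] b c x by simp
      ultimately show "ap b c x = ap a c x" by (rule real_inj[OF c])
    qed (use a b in auto)
  qed
qed

lemma out_of_real:
  assumes X: "X \<in> Obj C" and \<phi>: "natural_map D V r (el X) (rs X) \<phi>"
  shows "\<exists>a. a \<in> Hom C A X \<and> (\<forall>c\<in>Obj D. \<forall>x\<in>el A c. ap a c x = \<phi> c (\<gamma> c x))"
proof -
  have "natural_map D (el A) (rs A) (el X) (rs X) (\<lambda>c x. \<phi> c (\<gamma> c x))"
    by (rule natural_map_comp[where W = V and s = r]) (use \<gamma> \<phi> in \<open>simp_all add: natural_bij_def\<close>)
  then show ?thesis by (rule ap_full_Hom[OF A X])
qed

end

text \<open>Limits are computed elementwise, as compatible tuples of elements.\<close>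

lemma small_limit:
  assumes I: "category I" and small: "small \<kappa> (Obj I)" and F: "is_functor I C F"
  shows "\<exists>L p. is_limit I C F L p"
proof -
  interpret I: category I by (rule I)
  have FO: "fobj F i \<in> Obj C" if "i \<in> Obj I" for i using F that by (simp add: is_functor_def)
  have FA: "farr F u \<in> Arr C" "Dom C (farr F u) = fobj F (Dom I u)" "Cod C (farr F u) = fobj F (Cod I u)" if
      "u \<in> Arr I" for u
    using F that by (auto simp: is_functor_def)
  let ?r = "\<lambda>f t. \<lambda>i\<in>Obj I. rs (fobj F i) f (t i)"
  define V where "V c = {t \<in> (\<Pi>\<^sub>E i\<in>Obj I. el (fobj F i) c). \<forall>u\<in>Arr I. ap (farr F u) c (t (Dom I u)) =
      t (Cod I u)}" for c
  have tin: "t i \<in> el (fobj F i) c" if "t \<in> V c" "i \<in> Obj I" for t c i using that by (auto simp: V_def dest: PiE_mem)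
  have Vsheaf: "sheaf D J V ?r"
  proof (rule subsheaf[OF product_sheaf[of "Obj I" "\<lambda>i. el (fobj F i)" "\<lambda>i. rs (fobj F i)"]])
    show "sheaf D J (el (fobj F i)) (rs (fobj F i))" if "i \<in> Obj I" for i using el_sheaf FO that by simp
    show "V c \<subseteq> (\<Pi>\<^sub>E i\<in>Obj I. el (fobj F i) c)" for c by (auto simp: V_def)
    fix f t assume f: "f \<in> Arr D" and t: "t \<in> V (Cod D f)"
    have "ap (farr F u) (Dom D f) (rs (fobj F (Dom I u)) f (t (Dom I u))) =
        rs (fobj F (Cod I u)) f (t (Cod I u))" if u: "u \<in> Arr I" for u
      using ap_nat[OF FA(1)[OF u] f, of "t (Dom I u)"] FA[OF u] tin[OF t] t u by (simp add: V_def)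
    then show "?r f t \<in> V (Dom D f)"
      using tin[OF t] rs_simps(1)[OF FO] f by (simp add: V_def)
  next
    fix c S t assume c: "c \<in> Obj D" "S \<in> J c" and t: "t \<in> (\<Pi>\<^sub>E i\<in>Obj I. el (fobj F i) c)"
      and loc: "\<And>f. f \<in> S \<Longrightarrow> ?r f t \<in> V (Dom D f)"
    have ti: "t i \<in> el (fobj F i) c" if "i \<in> Obj I" for i using t that by (auto dest: PiE_mem)
    have "ap (farr F u) c (t (Dom I u)) = t (Cod I u)" if u: "u \<in> Arr I" for u
    proof (rule sheaf_ext[OF el_sheaf[OF FO] c(2,1)])
      show "Cod I u \<in> Obj I" using u by simp
      show "ap (farr F u) c (t (Dom I u)) \<in> el (fobj F (Cod I u)) c" using FA[OF u] ti u c by (intro ap_in) auto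
      show "t (Cod I u) \<in> el (fobj F (Cod I u)) c" using ti u by simp
      fix f assume f: "f \<in> S"
      note fa = cover_sieve(1,2)[OF c(2,1) f]
      have "ap (farr F u) (Dom D f) (rs (fobj F (Dom I u)) f (t (Dom I u))) = rs (fobj F (Cod I u)) f (t (Cod I u))"
        using loc[OF f] u by (simp add: V_def)
      then show "rs (fobj F (Cod I u)) f (ap (farr F u) c (t (Dom I u))) = rs (fobj F (Cod I u)) f (t (Cod I u))"
        using ap_nat[OF FA(1)[OF u] fa(1), of "t (Dom I u)"] FA[OF u] ti[of "Dom I u"] u fa by simp
    qed
    then show "t \<in> V c" using t by (simp add: V_def)
  qed
  have "small \<kappa> (V c)" if c: "c \<in> Obj D" for c
    by (rule small_functions[OF universe small, of "\<lambda>i. el (fobj F i) c"])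
      (use el_small[OF FO c] in \<open>auto simp: V_def PiE_iff\<close>)
  then obtain L \<gamma> where L: "L \<in> Obj C" and \<gamma>: "natural_bij D (el L) (rs L) V ?r \<gamma>"
    using realization_any[OF Vsheaf] by blast
  note R = real_in[OF L \<gamma>]
  have "\<exists>p. p \<in> Hom C L (fobj F i) \<and> (\<forall>c\<in>Obj D. \<forall>x\<in>el L c. ap p c x = \<gamma> c x i)" if i: "i \<in> Obj I" for i
    by (rule out_of_real[OF L \<gamma> FO[OF i], of "\<lambda>c t. t i"]) (use i tin in \<open>auto simp: natural_map_def\<close>)
  then obtain p where p: "\<And>i. i \<in> Obj I \<Longrightarrow> p i \<in> Hom C L (fobj F i) \<and> (\<forall>c\<in>Obj D. \<forall>x\<in>el L c. ap (p i) c x =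
      \<gamma> c x i)" by metis
  have "is_limit I C F L p"
    unfolding is_limit_def
  proof (intro conjI allI impI)
    show "is_cone I C F L p"
      unfolding is_cone_def
    proof (intro conjI ballI)
      fix u assume u: "u \<in> Arr I"
      show "farr F u \<cdot>\<^bsub>C\<^esub> p (Dom I u) = p (Cod I u)"
      proof (rule ap_ext)
        show "ap (farr F u \<cdot>\<^bsub>C\<^esub> p (Dom I u)) c x = ap (p (Cod I u)) c x" if "c \<in> Obj D"
          "x \<in> el (Dom C (farr F u \<cdot>\<^bsub>C\<^esub> p (Dom I u))) c" for c x
          using that u p[of "Dom I u"] p[of "Cod I u"] FA[OF u] R[of c x] by (simp add: ap_comp V_def)
      qed (use u p[of "Dom I u"] p[of "Cod I u"] FA[OF u] in auto)
    qed (use L p in auto)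
    fix X x assume x: "is_cone I C F X x"
    then have X: "X \<in> Obj C" and xi: "\<And>i. i \<in> Obj I \<Longrightarrow> x i \<in> Hom C X (fobj F i)"
      and xu: "\<And>u. u \<in> Arr I \<Longrightarrow> farr F u \<cdot>\<^bsub>C\<^esub> x (Dom I u) = x (Cod I u)" by (auto simp: is_cone_def)
    have "natural_map D (el X) (rs X) V ?r (\<lambda>c e. \<lambda>i\<in>Obj I. ap (x i) c e)"
      unfolding natural_map_def
    proof (intro conjI ballI)
      fix c e assume c: "c \<in> Obj D" and e: "e \<in> el X c"
      have "ap (farr F u) c (ap (x (Dom I u)) c e) = ap (x (Cod I u)) c e" if u: "u \<in> Arr I" for u
        using xu[OF u] ap_comp[of "x (Dom I u)" "farr F u" c e] xi[of "Dom I u"] FA[OF u] u c e by simp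
      moreover have "ap (x i) c e \<in> el (fobj F i) c" if "i \<in> Obj I" for i using xi[OF that] c e by (intro ap_in) auto
      ultimately show "(\<lambda>i\<in>Obj I. ap (x i) c e) \<in> V c" by (simp add: V_def)
    next
      fix f e assume f: "f \<in> Arr D" and e: "e \<in> el X (Cod D f)"
      show "(\<lambda>i\<in>Obj I. ap (x i) (Dom D f) (rs X f e)) = ?r f (\<lambda>i\<in>Obj I. ap (x i) (Cod D f) e)"
      proof (intro restrict_ext)
        fix i assume i: "i \<in> Obj I"
        show "ap (x i) (Dom D f) (rs X f e) = rs (fobj F i) f ((\<lambda>i\<in>Obj I. ap (x i) (Cod D f) e) i)"
          using ap_nat[of "x i" f e] xi[OF i] f e i by simp
      qed
    qed
    from into_real[OF L \<gamma> X this] obtain h where h: "h \<in> Hom C X L"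
      "\<And>c e. \<lbrakk>c \<in> Obj D; e \<in> el X c\<rbrakk> \<Longrightarrow> \<gamma> c (ap h c e) = (\<lambda>i\<in>Obj I. ap (x i) c e)" by blast
    have ph: "ap (p i \<cdot>\<^bsub>C\<^esub> k) c e = \<gamma> c (ap k c e) i" if "i \<in> Obj I" "k \<in> Hom C X L" "c \<in> Obj D" "e \<in> el X c"
        for i k c e
      using p[OF that(1)] that by (simp add: ap_comp ap_in)
    show "\<exists>!h. h \<in> Hom C X L \<and> (\<forall>i\<in>Obj I. p i \<cdot>\<^bsub>C\<^esub> h = x i)"
    proof (rule ex1I[of _ h])
      have "p i \<cdot>\<^bsub>C\<^esub> h = x i" if i: "i \<in> Obj I" for i
      proof (rule ap_ext)
        show "ap (p i \<cdot>\<^bsub>C\<^esub> h) c e = ap (x i) c e" if "c \<in> Obj D" "e \<in> el (Dom C (p i \<cdot>\<^bsub>C\<^esub> h)) c" for c e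
          using ph[OF i h(1)] h p[OF i] that i by simp
      qed (use p[OF i] h xi[OF i] in auto)
      then show "h \<in> Hom C X L \<and> (\<forall>i\<in>Obj I. p i \<cdot>\<^bsub>C\<^esub> h = x i)" using h by blast
      fix k assume k: "k \<in> Hom C X L \<and> (\<forall>i\<in>Obj I. p i \<cdot>\<^bsub>C\<^esub> k = x i)"
      show "k = h"
      proof (rule ap_ext)
        fix c e assume c: "c \<in> Obj D" and e: "e \<in> el (Dom C k) c"
        then have e: "e \<in> el X c" using k by simp
        have kh: "ap k c e \<in> el L c" "ap h c e \<in> el L c" using k h(1) c e by (auto intro!: ap_in)
        have "\<gamma> c (ap k c e) i = \<gamma> c (ap h c e) i" if "i \<in> Obj I" for i
          using ph[OF that _ c e, of k] k h(2)[OF c e] that by simp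
        then have "\<gamma> c (ap k c e) = \<gamma> c (ap h c e)"
          using R[OF c kh(1)] R[OF c kh(2)] by (intro extensionalityI[of _ "Obj I"]) (auto simp: V_def PiE_iff)
        then show "ap k c e = ap h c e" using real_inj[OF L \<gamma> c kh] by simp
      qed (use k h in auto)
    qed
  qed
  then show ?thesis by blast
qed

lemma finitely_complete: "finitely_complete C"
  unfolding finitely_complete_def using small_limit small_finite[OF infinite_kappa] by blast

sublocale C: finitely_complete_category C
  by unfold_locales (rule finitely_complete)

text \<open>Jointly monic arrows are jointly injective on elements: two elements with the same images are the two
  components of a point of the sheaf of all such pairs, on which the two projections have equal composites.\<close>

lemma jointly_monic_injective:
  assumes Z: "Z \<in> Obj C" and M: "\<And>m. m \<in> M \<Longrightarrow> m \<in> Arr C \<and> Dom C m = Z"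
    and mono: "\<And>X h k. \<lbrakk>h \<in> Hom C X Z; k \<in> Hom C X Z; \<And>m. m \<in> M \<Longrightarrow> m \<cdot>\<^bsub>C\<^esub> h = m \<cdot>\<^bsub>C\<^esub> k\<rbrakk> \<Longrightarrow> h = k"
    and c: "c \<in> Obj D" and xy: "x \<in> el Z c" "y \<in> el Z c" "\<And>m. m \<in> M \<Longrightarrow> ap m c x = ap m c y"
  shows "x = y"
proof -
  let ?W = "\<lambda>c. \<Pi>\<^sub>E b\<in>(UNIV :: bool set). el Z c" and ?r = "\<lambda>f t. \<lambda>b\<in>(UNIV :: bool set). rs Z f (t b)"
  define V where "V c = {t \<in> ?W c. \<forall>m\<in>M. ap m c (t True) = ap m c (t False)}" for c
  have tin: "t b \<in> el Z c" if "t \<in> V c" for t b c using that by (auto simp: V_def dest: PiE_mem)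
  have Vsheaf: "sheaf D J V ?r"
  proof (rule subsheaf[OF product_sheaf[of UNIV "\<lambda>b. el Z" "\<lambda>b. rs Z"]])
    show "sheaf D J (el Z) (rs Z)" for b :: bool by (rule el_sheaf[OF Z])
    show "V c \<subseteq> ?W c" for c by (auto simp: V_def)
    fix f t assume f: "f \<in> Arr D" and t: "t \<in> V (Cod D f)"
    have "ap m (Dom D f) (rs Z f (t True)) = ap m (Dom D f) (rs Z f (t False))" if m: "m \<in> M" for m
      using ap_nat[of m f "t True"] ap_nat[of m f "t False"] M[OF m] f tin[OF t] t m by (simp add: V_def)
    then show "?r f t \<in> V (Dom D f)" using rs_simps(1)[OF Z f] tin[OF t] by (simp add: V_def)
  next
    fix c S t assume c: "c \<in> Obj D" "S \<in> J c" and t: "t \<in> ?W c" and loc: "\<And>f. f \<in> S \<Longrightarrow> ?r f t \<in> V (Dom D f)"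
    have ti: "t b \<in> el Z c" for b using t by (auto dest: PiE_mem)
    have "ap m c (t True) = ap m c (t False)" if m: "m \<in> M" for m
    proof (rule sheaf_ext[OF el_sheaf c(2,1)])
      show "Cod C m \<in> Obj C" using M[OF m] by simp
      show "ap m c (t True) \<in> el (Cod C m) c" "ap m c (t False) \<in> el (Cod C m) c" using M[OF m] ti c
          by (auto intro!: ap_in)
      fix f assume f: "f \<in> S"
      note fa = cover_sieve(1,2)[OF c(2,1) f]
      show "rs (Cod C m) f (ap m c (t True)) = rs (Cod C m) f (ap m c (t False))"
        using loc[OF f] m ap_nat[of m f "t True"] ap_nat[of m f "t False"] M[OF m] fa ti by (simp add: V_def)
    qed
    then show "t \<in> V c" using t by (simp add: V_def)
  qed
  have "small \<kappa> (V c)" if c: "c \<in> Obj D" for c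
    by (rule small_functions[OF universe small_finite[OF infinite_kappa finite], where B = "\<lambda>i. el Z c" and A = UNIV])
      (use el_small[OF Z c] in \<open>auto simp: V_def PiE_iff\<close>)
  then obtain L \<gamma> where L: "L \<in> Obj C" and \<gamma>: "natural_bij D (el L) (rs L) V ?r \<gamma>"
    using realization_any[OF Vsheaf] by blast
  have nat: "natural_map D V ?r (el Z) (rs Z) (\<lambda>c t. t b)" for b using tin by (simp add: natural_map_def)
  obtain h where h: "h \<in> Hom C L Z" "\<And>c x. \<lbrakk>c \<in> Obj D; x \<in> el L c\<rbrakk> \<Longrightarrow> ap h c x = \<gamma> c x True"
    using out_of_real[OF L \<gamma> Z nat[of True]] by blast
  obtain k where k: "k \<in> Hom C L Z" "\<And>c x. \<lbrakk>c \<in> Obj D; x \<in> el L c\<rbrakk> \<Longrightarrow> ap k c x = \<gamma> c x False"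
    using out_of_real[OF L \<gamma> Z nat[of False]] by blast
  have "m \<cdot>\<^bsub>C\<^esub> h = m \<cdot>\<^bsub>C\<^esub> k" if m: "m \<in> M" for m
  proof (rule ap_ext)
    show "ap (m \<cdot>\<^bsub>C\<^esub> h) c x = ap (m \<cdot>\<^bsub>C\<^esub> k) c x" if "c \<in> Obj D" "x \<in> el (Dom C (m \<cdot>\<^bsub>C\<^esub> h)) c" for c x
      using that h k M[OF m] real_in[OF L \<gamma>, of c x] m by (simp add: ap_comp V_def)
  qed (use h k M[OF m] in auto)
  then have hk: "h = k" by (rule mono[OF h(1) k(1)])
  have "(\<lambda>b. if b then x else y) \<in> V c" using xy by (simp add: V_def PiE_iff)
  then obtain z where "z \<in> el L c" "\<gamma> c z = (\<lambda>b. if b then x else y)" using real_surj[OF L \<gamma> c] by blast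
  then show ?thesis using h(2)[OF c, of z] k(2)[OF c, of z] hk by simp
qed

lemma monic_injective:
  assumes m: "monic C m" and c: "c \<in> Obj D" "x \<in> el (Dom C m) c" "y \<in> el (Dom C m) c" "ap m c x = ap m c y"
  shows "x = y"
  by (rule jointly_monic_injective[of "Dom C m" "{m}"]) (use m c C.monicD[OF m] in auto)

text \<open>An element of A and an element of B form a point of the sheaf of pairs, whose two projections induce an arrow to the given
product; it takes that point to the required element.\<close>

lemma product_elements:
  assumes P: "is_product C A B Pr p q" and c: "c \<in> Obj D"
  shows "\<lbrakk>a \<in> el A c; b \<in> el B c\<rbrakk> \<Longrightarrow> \<exists>z\<in>el Pr c. ap p c z = a \<and> ap q c z = b"
    and "\<lbrakk>x \<in> el Pr c; y \<in> el Pr c; ap p c x = ap p c y; ap q c x = ap q c y\<rbrakk> \<Longrightarrow> x = y"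
proof -
  note PD = C.productD[OF P]
  have AB: "A \<in> Obj C" "B \<in> Obj C" using PD by auto
  show "x = y" if "x \<in> el Pr c" "y \<in> el Pr c" "ap p c x = ap p c y" "ap q c x = ap q c y"
  proof (rule jointly_monic_injective[of Pr "{p, q}"])
    fix X h k assume "h \<in> Hom C X Pr" "k \<in> Hom C X Pr" "\<And>m. m \<in> {p, q} \<Longrightarrow> m \<cdot>\<^bsub>C\<^esub> h = m \<cdot>\<^bsub>C\<^esub> k"
    then show "h = k" using C.product_ext[OF P, of h k] by simp
  qed (use that PD c in auto)
  assume ab: "a \<in> el A c" "b \<in> el B c"
  let ?AB = "\<lambda>i. if i then A else B"
  let ?V = "\<lambda>c. \<Pi>\<^sub>E i\<in>(UNIV :: bool set). el (?AB i) c" and ?r = "\<lambda>f t. \<lambda>i\<in>(UNIV :: bool set). rs (?AB i) f (t i)"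
  have Vsheaf: "sheaf D J ?V ?r" by (rule product_sheaf) (use el_sheaf AB in auto)
  have "small \<kappa> (?V c)" if c: "c \<in> Obj D" for c
  proof (rule small_functions[OF universe small_finite[OF infinite_kappa finite], where B = "\<lambda>i. el (?AB i) c"
      and A = UNIV])
    show "?V c \<subseteq> {t \<in> extensional UNIV. \<forall>i\<in>UNIV. t i \<in> el (?AB i) c}" unfolding PiE_def Pi_def by blast
  qed (use el_small[OF _ c] AB in simp)
  then obtain L \<gamma> where L: "L \<in> Obj C" and \<gamma>: "natural_bij D (el L) (rs L) ?V ?r \<gamma>"
    using realization_any[OF Vsheaf] by blast
  have nat: "natural_map D ?V ?r (el (?AB i)) (rs (?AB i)) (\<lambda>c t. t i)" for i
    unfolding natural_map_def using PiE_mem[of _ UNIV "\<lambda>i. el (?AB i) _" i] by simp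
  obtain h where h: "h \<in> Hom C L A" "\<And>c x. \<lbrakk>c \<in> Obj D; x \<in> el L c\<rbrakk> \<Longrightarrow> ap h c x = \<gamma> c x True"
    using out_of_real[OF L \<gamma>, of A "\<lambda>c t. t True"] nat[of True] AB by auto
  obtain k where k: "k \<in> Hom C L B" "\<And>c x. \<lbrakk>c \<in> Obj D; x \<in> el L c\<rbrakk> \<Longrightarrow> ap k c x = \<gamma> c x False"
    using out_of_real[OF L \<gamma>, of B "\<lambda>c t. t False"] nat[of False] AB by auto
  obtain l where l: "l \<in> Arr C" "Dom C l = L" "Cod C l = Pr" "p \<cdot>\<^bsub>C\<^esub> l = h" "q \<cdot>\<^bsub>C\<^esub> l = k"
    using C.product_univ[OF P, of h k] h k by auto
  have "(\<lambda>i. if i then a else b) \<in> ?V c" using ab by (simp add: PiE_iff)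
  then obtain z where z: "z \<in> el L c" "\<gamma> c z = (\<lambda>i. if i then a else b)" using real_surj[OF L \<gamma> c] by blast
  have "ap p c (ap l c z) = a" "ap q c (ap l c z) = b"
    using ap_comp[of l p c z] ap_comp[of l q c z] h(2)[OF c z(1)] k(2)[OF c z(1)] l PD c z by simp_all
  then show "\<exists>z\<in>el Pr c. ap p c z = a \<and> ap q c z = b" using ap_in[of l c z Pr] l c z by auto
qed

lemma locally_small: "locally_small \<kappa> C"
  unfolding locally_small_def
proof (intro ballI)
  fix A B assume AB: "A \<in> Obj C" "B \<in> Obj C"
  let ?S = "SIGMA c:Obj D. el A c"
  let ?g = "\<lambda>a. \<lambda>(c, x)\<in>?S. ap a c x"
  have sm: "small \<kappa> (?g ` Hom C A B)"
  proof (rule small_functions[OF universe small_Sigma[OF universe small_Obj], of "el A" "\<lambda>(c, x). el B c"])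
    show "?g ` Hom C A B \<subseteq> {t \<in> extensional ?S. \<forall>a\<in>?S. t a \<in> (case a of (c, x) \<Rightarrow> el B c)}"
      by (auto intro!: ap_in)
  qed (use el_small AB in auto)
  show "small \<kappa> (Hom C A B)"
  proof (rule small_inj[OF sm, of ?g])
    show "inj_on ?g (Hom C A B)"
    proof (rule inj_onI)
      fix a b assume a: "a \<in> Hom C A B" and b: "b \<in> Hom C A B" and e: "?g a = ?g b"
      have "ap a c x = ap b c x" if "c \<in> Obj D" "x \<in> el A c" for c x using fun_cong[OF e, of "(c, x)"] that by simp
      then show "a = b" using a b by (intro ap_ext) auto
    qed
  qed simp
qed

end

context sheaf_representation
begin

section \<open>The elementary topos of small sheaves and its colimits\<close>

text \<open>The character of a monomorphism m sends an element x to the sieve of all arrows along which x restricts into the image of m. This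
sieve is closed because the image of m is itself a sheaf. An arrow \<psi> is determined by the elements that it sends to the maximal
sieve, since f belongs to a sieve precisely if the sieve pulls back to the maximal one along f.\<close>

lemma classifier_exists: "\<exists>\<Omega> tr. is_subobject_classifier C \<Omega> tr"
proof -
  let ?max = "\<lambda>c. {f \<in> Arr D. Cod D f = c}"
  have "small \<kappa> (closed_sieves c)" for c
    by (rule small_subset[OF small_Pow[OF universe small_Arr]]) (auto simp: closed_sieves_def sieve_def)
  then obtain \<Omega> \<gamma> where \<Omega>: "\<Omega> \<in> Obj C" and \<gamma>: "natural_bij D (el \<Omega>) (rs \<Omega>) closed_sieves (pull_sieve D) \<gamma>"
    using realization_any[OF closed_sieves_sheaf] by blast
  have sv: "sieve D c S" if "S \<in> closed_sieves c" for S c using that by (simp add: closed_sieves_def)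
  have max: "?max c \<in> closed_sieves c" if "c \<in> Obj D" for c by (auto simp: closed_sieves_def sieve_def)
  have pull_max: "pull_sieve D f (?max (Cod D f)) = ?max (Dom D f)" if "f \<in> Arr D" for f
    using that by (auto simp: pull_sieve_def)
  obtain T where T: "is_terminal C T" using C.terminal_exists by blast
  then have TO: "T \<in> Obj C" by (simp add: is_terminal_def)
  have "natural_map D (el T) (rs T) closed_sieves (pull_sieve D) (\<lambda>c x. ?max c)"
    using max pull_max by (simp add: natural_map_def)
  from into_real[OF \<Omega> \<gamma> TO this] obtain tr where tr: "tr \<in> Hom C T \<Omega>"
    "\<And>c x. \<lbrakk>c \<in> Obj D; x \<in> el T c\<rbrakk> \<Longrightarrow> \<gamma> c (ap tr c x) = ?max c" by blast
  have tr_comp: "\<gamma> c (ap (tr \<cdot>\<^bsub>C\<^esub> t) c x) = ?max c" if "t \<in> Hom C X T" "c \<in> Obj D" "x \<in> el X c" for t X c x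
    using tr that by (simp add: ap_comp ap_in)
  have tr_eq: "a = tr \<cdot>\<^bsub>C\<^esub> t" if a: "a \<in> Hom C X \<Omega>" "\<And>c x. \<lbrakk>c \<in> Obj D; x \<in> el X c\<rbrakk> \<Longrightarrow> \<gamma> c (ap a c x) = ?max c"
      and t: "t \<in> Hom C X T" for a X t
  proof (rule ap_ext)
    fix c x assume c: "c \<in> Obj D" and "x \<in> el (Dom C a) c"
    then have x: "x \<in> el X c" using a(1) by simp
    have "\<gamma> c (ap a c x) = \<gamma> c (ap (tr \<cdot>\<^bsub>C\<^esub> t) c x)" using a(2)[OF c x] tr_comp[OF t c x] by simp
    then show "ap a c x = ap (tr \<cdot>\<^bsub>C\<^esub> t) c x"
      using a(1) t tr(1) c x by (intro real_inj[OF \<Omega> \<gamma> c, of "ap a c x" "ap (tr \<cdot>\<^bsub>C\<^esub> t) c x"] ap_in) auto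
  qed (use a(1) t tr(1) in auto)
  have "\<exists>!\<chi>. \<chi> \<in> Hom C (Cod C m) \<Omega> \<and> (\<exists>t. is_pullback C \<chi> tr m t)" if m: "monic C m" for m
  proof -
    let ?M = "Dom C m" and ?B = "Cod C m"
    have mO: "?M \<in> Obj C" "?B \<in> Obj C" "m \<in> Arr C" using m by auto
    note PB = rs_simps[OF mO(2)]
    define im where "im c = ap m c ` el ?M c" for c
    have im_in: "x \<in> el ?B c" if "c \<in> Obj D" "x \<in> im c" for x c using that mO by (auto simp: im_def intro!: ap_in)
    have im_res: "rs ?B f x \<in> im (Dom D f)" if f: "f \<in> Arr D" and x: "x \<in> im (Cod D f)" for f x
    proof -
      obtain z where "z \<in> el ?M (Cod D f)" "x = ap m (Cod D f) z" using x by (auto simp: im_def)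
      then show ?thesis using ap_nat[OF mO(3) f, of z] rs_simps(1)[OF mO(1) f, of z] unfolding im_def
          by (metis imageI)
    qed
    have im_loc: "x \<in> im c" if c: "c \<in> Obj D" "S \<in> J c" and x: "x \<in> el ?B c" and loc:
        "\<And>f. f \<in> S \<Longrightarrow> rs ?B f x \<in> im (Dom D f)" for c S x
    proof -
      note cs = cover_sieve[OF c(2,1)]
      define z where "z f = (SOME z. z \<in> el ?M (Dom D f) \<and> ap m (Dom D f) z = rs ?B f x)" for f
      have z: "z f \<in> el ?M (Dom D f) \<and> ap m (Dom D f) (z f) = rs ?B f x" if "f \<in> S" for f
        unfolding z_def by (rule someI_ex) (use loc[OF that] in \<open>unfold im_def image_iff, metis\<close>)
      have "matching D (el ?M) (rs ?M) S z"
        unfolding matching_def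
      proof (intro conjI ballI impI)
        fix f assume f: "f \<in> S"
        show "z f \<in> el ?M (Dom D f)" using z[OF f] by simp
        fix g assume g: "g \<in> Arr D" "Cod D g = Dom D f"
        note fg = cs(3)[OF f g]
        have D: "Dom D (f \<cdot>\<^bsub>D\<^esub> g) = Dom D g" using cs(1)[OF f] g by simp
        show "z (f \<cdot>\<^bsub>D\<^esub> g) = rs ?M g (z f)"
        proof (rule monic_injective[OF m])
          show "Dom D g \<in> Obj D" using g by simp
          show "z (f \<cdot>\<^bsub>D\<^esub> g) \<in> el ?M (Dom D g)" using z[OF fg] D by simp
          show "rs ?M g (z f) \<in> el ?M (Dom D g)" using rs_simps(1)[OF mO(1) g(1), of "z f"] z[OF f] g by simp
          show "ap m (Dom D g) (z (f \<cdot>\<^bsub>D\<^esub> g)) = ap m (Dom D g) (rs ?M g (z f))"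
            using z[OF fg] D ap_nat[OF mO(3) g(1), of "z f"] z[OF f] g PB(3)[OF cs(1)[OF f] g, of x] cs(2)[OF f] x by simp
        qed
      qed
      then obtain y where y: "y \<in> el ?M c" "\<And>f. f \<in> S \<Longrightarrow> rs ?M f y = z f"
          using sheaf_glue[OF el_sheaf[OF mO(1)] c(2,1)] by blast
      have "ap m c y = x"
      proof (rule sheaf_ext[OF el_sheaf[OF mO(2)] c(2,1)])
        show "ap m c y \<in> el ?B c" using ap_in[OF mO(3) c(1) y(1)] by simp
        show "rs ?B f (ap m c y) = rs ?B f x" if f: "f \<in> S" for f
          using ap_nat[OF mO(3) cs(1)[OF f], of y] cs(2)[OF f] y(1) y(2)[OF f] z[OF f] by simp
      qed (rule x)
      then show ?thesis using y by (auto simp: im_def)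
    qed
    define \<phi> where "\<phi> c x = {f \<in> Arr D. Cod D f = c \<and> rs ?B f x \<in> im (Dom D f)}" for c x
    have \<phi>nat: "natural_map D (el ?B) (rs ?B) closed_sieves (pull_sieve D) \<phi>"
      unfolding natural_map_def
    proof (intro conjI ballI)
      fix c x assume c: "c \<in> Obj D" and x: "x \<in> el ?B c"
      show "\<phi> c x \<in> closed_sieves c"
        unfolding closed_sieves_def mem_Collect_eq
      proof (intro conjI ballI impI)
        show "sieve D c (\<phi> c x)"
          unfolding sieve_def
        proof (intro conjI ballI impI)
          fix f g assume "f \<in> \<phi> c x" and g: "g \<in> Arr D" "Cod D g = Dom D f"
          then have f: "f \<in> Arr D" "Cod D f = c" "rs ?B f x \<in> im (Cod D g)" by (auto simp: \<phi>_def)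
          then show "f \<cdot>\<^bsub>D\<^esub> g \<in> \<phi> c x" using im_res[OF g(1) f(3)] PB(3)[OF f(1) g, of x] g x by (simp add: \<phi>_def)
        qed (auto simp: \<phi>_def)
        fix f assume f: "f \<in> Arr D" "Cod D f = c \<and> pull_sieve D f (\<phi> c x) \<in> J (Dom D f)"
        have "rs ?B f x \<in> im (Dom D f)"
        proof (rule im_loc)
          show "pull_sieve D f (\<phi> c x) \<in> J (Dom D f)" "Dom D f \<in> Obj D" using f by simp_all
          show "rs ?B f x \<in> el ?B (Dom D f)" using PB(1)[OF f(1), of x] f x by simp
          fix g assume "g \<in> pull_sieve D f (\<phi> c x)"
          then have g: "g \<in> Arr D" "Cod D g = Dom D f" "f \<cdot>\<^bsub>D\<^esub> g \<in> \<phi> c x" by (auto simp: pull_sieve_def)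
          then have "rs ?B (f \<cdot>\<^bsub>D\<^esub> g) x \<in> im (Dom D (f \<cdot>\<^bsub>D\<^esub> g))" by (simp add: \<phi>_def)
          then show "rs ?B g (rs ?B f x) \<in> im (Dom D g)" using PB(3)[OF f(1) g(1,2), of x] f g x by simp
        qed
        then show "f \<in> \<phi> c x" using f by (simp add: \<phi>_def)
      qed
    next
      fix f x assume f: "f \<in> Arr D" and x: "x \<in> el ?B (Cod D f)"
      have "rs ?B (f \<cdot>\<^bsub>D\<^esub> g) x = rs ?B g (rs ?B f x)" if "g \<in> Arr D" "Cod D g = Dom D f" for g
          using PB(3)[OF f that x] .
      then show "\<phi> (Dom D f) (rs ?B f x) = pull_sieve D f (\<phi> (Cod D f) x)"
        using f by (auto simp: \<phi>_def pull_sieve_def)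
    qed
    from into_real[OF \<Omega> \<gamma> mO(2) \<phi>nat] obtain \<chi> where \<chi>: "\<chi> \<in> Hom C ?B \<Omega>"
      "\<And>c x. \<lbrakk>c \<in> Obj D; x \<in> el ?B c\<rbrakk> \<Longrightarrow> \<gamma> c (ap \<chi> c x) = \<phi> c x" by blast
    have \<phi>max: "\<phi> c x = ?max c \<longleftrightarrow> x \<in> im c" if c: "c \<in> Obj D" and x: "x \<in> el ?B c" for c x
    proof
      assume "\<phi> c x = ?max c"
      then have "Ident D c \<in> \<phi> c x" using c by simp
      then show "x \<in> im c" using PB(2)[OF c x] c by (simp add: \<phi>_def)
    next
      assume "x \<in> im c"
      then show "\<phi> c x = ?max c" using im_res by (auto simp: \<phi>_def)
    qed
    obtain t where t: "t \<in> Hom C ?M T" using C.terminal_univ[OF T mO(1)] by auto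
    have pb: "is_pullback C \<chi> tr m t"
    proof (rule C.pullbackI)
      show "\<chi> \<cdot>\<^bsub>C\<^esub> m = tr \<cdot>\<^bsub>C\<^esub> t"
      proof (rule tr_eq[OF _ _ t])
        show "\<chi> \<cdot>\<^bsub>C\<^esub> m \<in> Hom C ?M \<Omega>" using \<chi>(1) mO by simp
        show "\<gamma> c (ap (\<chi> \<cdot>\<^bsub>C\<^esub> m) c x) = ?max c" if "c \<in> Obj D" "x \<in> el ?M c" for c x
          using that \<chi> mO \<phi>max[of c "ap m c x"] by (simp add: ap_comp ap_in im_def)
      qed
    next
      fix x y assume xy: "x \<in> Arr C" "y \<in> Arr C" "Cod C x = Dom C \<chi>" "Cod C y = Dom C tr" "Dom C x = Dom C y"
          "\<chi> \<cdot>\<^bsub>C\<^esub> x = tr \<cdot>\<^bsub>C\<^esub> y"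
      let ?X = "Dom C x"
      have xB: "Cod C x = ?B" "Cod C y = T" using xy \<chi> tr by auto
      have xi: "ap x c e \<in> im c" if c: "c \<in> Obj D" and e: "e \<in> el ?X c" for c e
      proof -
        have xe: "ap x c e \<in> el ?B c" using ap_in[OF xy(1) c e] xB by simp
        have "\<gamma> c (ap (\<chi> \<cdot>\<^bsub>C\<^esub> x) c e) = ?max c" unfolding xy(6) using tr_comp[of y ?X c e] xy(2,5) xB c e by simp
        then have "\<phi> c (ap x c e) = ?max c" using \<chi> xy(1,3) c e xe by (simp add: ap_comp)
        then show ?thesis using \<phi>max[OF c xe] by simp
      qed
      have imn: "natural_map D im (rs ?B) (el ?M) (rs ?M) (\<lambda>c. inv_into (el ?M c) (ap m c))"
      proof (rule natural_bij_inverse[OF sheaf_presheaf[OF el_sheaf[OF mO(1)]]])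
        show "natural_bij D (el ?M) (rs ?M) im (rs ?B) (ap m)"
          unfolding natural_bij_def natural_map_def
        proof (intro conjI ballI)
          show "ap m (Dom D f) (rs ?M f x) = rs ?B f (ap m (Cod D f) x)" if "f \<in> Arr D" "x \<in> el ?M (Cod D f)" for f x
            using ap_nat[OF mO(3) that] .
          show "bij_betw (ap m c) (el ?M c) (im c)" if "c \<in> Obj D" for c
            unfolding bij_betw_def im_def using monic_injective[OF m that] by (auto intro: inj_onI)
        qed (auto simp: im_def)
      qed
      have xn: "natural_map D (el ?X) (rs ?X) im (rs ?B) (ap x)"
        unfolding natural_map_def using xi ap_nat[OF xy(1)] xB by simp
      obtain h where h: "h \<in> Hom C ?X ?M" "\<forall>c\<in>Obj D. \<forall>e\<in>el ?X c. ap h c e = inv_into (el ?M c) (ap m c) (ap x c e)"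
        using ap_full_Hom[OF C.Dom_Obj[OF xy(1)] mO(1) natural_map_comp[OF xn imn]] by blast
      have "m \<cdot>\<^bsub>C\<^esub> h = x"
      proof (rule ap_ext)
        fix c e assume c: "c \<in> Obj D" and e: "e \<in> el (Dom C (m \<cdot>\<^bsub>C\<^esub> h)) c"
        then have e: "e \<in> el ?X c" using h(1) mO by simp
        show "ap (m \<cdot>\<^bsub>C\<^esub> h) c e = ap x c e"
          using ap_comp[of h m c e] h mO c e f_inv_into_f[of "ap x c e" "ap m c" "el ?M c"] xi[OF c e]
            by (simp add: im_def)
      qed (use h(1) mO xB xy(1) in simp_all)
      moreover have "t \<cdot>\<^bsub>C\<^esub> h = y" using C.terminal_ext[OF T, of "t \<cdot>\<^bsub>C\<^esub> h" y] t h(1) xy(2,5) xB by simp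
      ultimately show "\<exists>h\<in>Arr C. Dom C h = Dom C x \<and> Cod C h = Dom C m \<and> m \<cdot>\<^bsub>C\<^esub> h = x \<and> t \<cdot>\<^bsub>C\<^esub> h = y"
        using h(1) unfolding Hom_iff by blast
    next
      fix h k assume "h \<in> Arr C" "k \<in> Arr C" "Cod C h = Dom C m" "Cod C k = Dom C m" "Dom C h = Dom C k"
          "m \<cdot>\<^bsub>C\<^esub> h = m \<cdot>\<^bsub>C\<^esub> k"
      then show "h = k" by (rule C.monicD[OF m])
    qed (use \<chi> tr mO t in auto)
    show ?thesis
    proof (rule ex1I[of _ \<chi>])
      show "\<chi> \<in> Hom C ?B \<Omega> \<and> (\<exists>t. is_pullback C \<chi> tr m t)" using \<chi>(1) pb by blast
      fix \<psi> assume "\<psi> \<in> Hom C ?B \<Omega> \<and> (\<exists>t. is_pullback C \<psi> tr m t)"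
      then obtain t' where \<psi>: "\<psi> \<in> Hom C ?B \<Omega>" and pb': "is_pullback C \<psi> tr m t'" by blast
      define W where "W c = {x \<in> el ?B c. \<gamma> c (ap \<psi> c x) = ?max c}" for c
      have \<psi>in: "ap \<psi> c x \<in> el \<Omega> c" if "c \<in> Obj D" "x \<in> el ?B c" for c x using ap_in[of \<psi> c x \<Omega>] \<psi> that by simp
      have \<psi>nat: "\<gamma> (Dom D f) (ap \<psi> (Dom D f) (rs ?B f x)) = pull_sieve D f (\<gamma> (Cod D f) (ap \<psi> (Cod D f) x))"
        if "f \<in> Arr D" "x \<in> el ?B (Cod D f)" for f x
        using ap_nat[of \<psi> f x] real_nat[OF \<Omega> \<gamma> that(1) \<psi>in] \<psi> that by simp
      have W_im: "W c = im c" if c: "c \<in> Obj D" for c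
      proof
        show "im c \<subseteq> W c"
        proof
          fix x assume "x \<in> im c"
          then obtain z where z: "z \<in> el ?M c" "x = ap m c z" by (auto simp: im_def)
          have "\<gamma> c (ap (\<psi> \<cdot>\<^bsub>C\<^esub> m) c z) = ?max c"
            unfolding C.pullbackD(9)[OF pb'] using tr_comp[of t' ?M c z] C.pullbackD(1-8)[OF pb'] tr(1) c z by simp
          then show "x \<in> W c" using z \<psi> mO c by (simp add: W_def ap_comp ap_in)
        qed
        \<comment> \<open>The elements that \<psi> sends to the maximal sieve form a sheaf W; its inclusion factors through the pullback m.\<close>
        have Wsheaf: "sheaf D J W (rs ?B)"
        proof (rule subsheaf[OF el_sheaf[OF mO(2)]])
          show "rs ?B f x \<in> W (Dom D f)" if "f \<in> Arr D" "x \<in> W (Cod D f)" for f x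
            using that \<psi>nat[of f x] pull_max PB(1) by (simp add: W_def)
          show "x \<in> W c" if c: "c \<in> Obj D" "S \<in> J c" "x \<in> el ?B c" and loc:
            "\<And>f. f \<in> S \<Longrightarrow> rs ?B f x \<in> W (Dom D f)" for c S x
          proof -
            have "\<gamma> c (ap \<psi> c x) = ?max c"
            proof (rule sheaf_ext[OF closed_sieves_sheaf c(2,1)])
              show "\<gamma> c (ap \<psi> c x) \<in> closed_sieves c" using real_in[OF \<Omega> \<gamma> c(1) \<psi>in[OF c(1,3)]] .
              show "?max c \<in> closed_sieves c" using max c by simp
              fix f assume f: "f \<in> S"
              note fa = cover_sieve(1,2)[OF c(2,1) f]
              show "pull_sieve D f (\<gamma> c (ap \<psi> c x)) = pull_sieve D f (?max c)"
                using \<psi>nat[OF fa(1), of x] loc[OF f] pull_max[OF fa(1)] fa c by (simp add: W_def)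
            qed
            then show ?thesis using c by (simp add: W_def)
          qed
        qed (auto simp: W_def)
        have "small \<kappa> (W c)" if "c \<in> Obj D" for c by (rule small_subset[OF el_small[OF mO(2) that]]) (auto simp: W_def)
        then obtain L \<delta> where L: "L \<in> Obj C" and \<delta>: "natural_bij D (el L) (rs L) W (rs ?B) \<delta>"
          using realization_any[OF Wsheaf] by blast
        have "natural_map D W (rs ?B) (el ?B) (rs ?B) (\<lambda>c x. x)" by (simp add: natural_map_def W_def)
        then obtain i where i: "i \<in> Hom C L ?B" "\<And>c x. \<lbrakk>c \<in> Obj D; x \<in> el L c\<rbrakk> \<Longrightarrow> ap i c x = \<delta> c x"
          using out_of_real[OF L \<delta> mO(2)] by blast
        obtain l where l: "l \<in> Hom C L T" using C.terminal_univ[OF T L] by auto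
        have "\<psi> \<cdot>\<^bsub>C\<^esub> i = tr \<cdot>\<^bsub>C\<^esub> l"
        proof (rule tr_eq[OF _ _ l])
          show "\<psi> \<cdot>\<^bsub>C\<^esub> i \<in> Hom C L \<Omega>" using \<psi> i by simp
          show "\<gamma> c (ap (\<psi> \<cdot>\<^bsub>C\<^esub> i) c x) = ?max c" if "c \<in> Obj D" "x \<in> el L c" for c x
            using that \<psi> i real_in[OF L \<delta> that] by (simp add: ap_comp W_def)
        qed
        then obtain h where h: "h \<in> Arr C" "Dom C h = L" "Cod C h = ?M" "m \<cdot>\<^bsub>C\<^esub> h = i"
          using C.pullback_univ[OF pb', of i l] i(1) l \<psi> tr(1) unfolding Hom_iff by metis
        show "W c \<subseteq> im c"
        proof
          fix x assume "x \<in> W c"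
          then obtain z where z: "z \<in> el L c" "\<delta> c z = x" using real_surj[OF L \<delta> c] by blast
          have "ap m c (ap h c z) = x" using ap_comp[of h m c z] h mO c z i(2)[OF c z(1)] by simp
          then show "x \<in> im c" using ap_in[of h c z ?M] h c z by (auto simp: im_def)
        qed
      qed
      show "\<psi> = \<chi>"
      proof (rule ap_ext)
        fix c x assume c: "c \<in> Obj D" and "x \<in> el (Dom C \<psi>) c"
        then have x: "x \<in> el ?B c" using \<psi> by simp
        have S: "\<gamma> c (ap \<psi> c x) \<in> closed_sieves c" using real_in[OF \<Omega> \<gamma> c \<psi>in[OF c x]] .
        have "f \<in> \<gamma> c (ap \<psi> c x) \<longleftrightarrow> f \<in> \<phi> c x" if f: "f \<in> Arr D" "Cod D f = c" for f
        proof -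
          have rx: "rs ?B f x \<in> el ?B (Dom D f)" using PB(1)[OF f(1), of x] f x by simp
          have "f \<in> \<gamma> c (ap \<psi> c x) \<longleftrightarrow> pull_sieve D f (\<gamma> c (ap \<psi> c x)) = ?max (Dom D f)"
            using pull_sieve_max_iff[OF f(1), of "\<gamma> c (ap \<psi> c x)"] sv[OF S] f by simp
          also have "\<dots> \<longleftrightarrow> rs ?B f x \<in> W (Dom D f)" using \<psi>nat[OF f(1), of x] f x rx by (simp add: W_def)
          also have "\<dots> \<longleftrightarrow> f \<in> \<phi> c x" using W_im[of "Dom D f"] f by (simp add: \<phi>_def)
          finally show ?thesis .
        qed
        then have "\<gamma> c (ap \<psi> c x) = \<phi> c x" using sv[OF S] by (auto simp: \<phi>_def sieve_def)
        moreover have "ap \<chi> c x \<in> el \<Omega> c" using ap_in[of \<chi> c x \<Omega>] \<chi>(1) c x by simp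
        ultimately show "ap \<psi> c x = ap \<chi> c x" using \<chi>(2)[OF c x] real_inj[OF \<Omega> \<gamma> c \<psi>in[OF c x]] by simp
      qed (use \<psi> \<chi> in auto)
    qed
  qed
  then have "is_subobject_classifier C \<Omega> tr" using T tr(1) by (simp add: is_subobject_classifier_def)
  then show ?thesis by blast
qed

text \<open>Evaluation applies a natural map over c to the identity of c. The transpose of f sends z to the natural map that takes (k, a) to
the value of f at the pair of a with the restriction of z along k.\<close>

lemma exponential_exists:
  assumes A: "A \<in> Obj C" and B: "B \<in> Obj C"
  shows "\<exists>E P p q ev. is_exponential C A B E P p q ev"
proof -
  let ?V = "exponential_sheaf (el A) (rs A) (el B) (rs B)" and ?r =
      "exponential_res (el A) :: 'e \<Rightarrow> ('e \<times> 'u \<Rightarrow> 'u) \<Rightarrow> _"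
  note PA = rs_simps[OF A] and PB = rs_simps[OF B]
  have Vsheaf: "sheaf D J ?V ?r" by (rule exponential_sheaf[OF sheaf_presheaf[OF el_sheaf[OF A]] el_sheaf[OF B]])
  have Vin: "\<theta> (f, a) \<in> el B (Dom D f)" if "\<theta> \<in> ?V c" "f \<in> Arr D" "Cod D f = c" "a \<in> el A (Dom D f)" for \<theta> c f a
    using that by (auto simp: exponential_sheaf_def points_def)
  have Vnat: "\<theta> (f \<cdot>\<^bsub>D\<^esub> g, rs A g a) = rs B g (\<theta> (f, a))"
    if "\<theta> \<in> ?V c" "f \<in> Arr D" "Cod D f = c" "a \<in> el A (Dom D f)" "g \<in> Arr D" "Cod D g = Dom D f" for \<theta> c f a g
    using that by (auto simp: exponential_sheaf_def points_def)
  have "small \<kappa> (?V c)" for c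
  proof (rule small_functions[OF universe, of "points (el A) c" "\<lambda>(f, a). el B (Dom D f)"])
    show "small \<kappa> (points (el A) c)"
    proof (rule small_subset)
      show "small \<kappa> (SIGMA f:Arr D. el A (Dom D f))" by (rule small_Sigma[OF universe small_Arr]) (simp add: el_small[OF A])
    qed (auto simp: points_def)
    show "small \<kappa> (case x of (f, a) \<Rightarrow> el B (Dom D f))" if "x \<in> points (el A) c" for x
      using that el_small[OF B] by (auto simp: points_def)
    show "?V c \<subseteq> {t \<in> extensional (points (el A) c). \<forall>x\<in>points (el A) c. t x \<in> (case x of (f, a) \<Rightarrow> el B (Dom D f))}"
      by (auto simp: exponential_sheaf_def)
  qed
  then obtain E \<gamma> where E: "E \<in> Obj C" and \<gamma>: "natural_bij D (el E) (rs E) ?V ?r \<gamma>"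
    using realization_any[OF Vsheaf] by blast
  note R = real_in[OF E \<gamma>] and Rn = real_nat[OF E \<gamma>]
  obtain P p q where P: "is_product C E A P p q" using C.product_exists[OF E A] by blast
  note PD = C.productD[OF P]
  have pq_in: "ap p c y \<in> el E c" "ap q c y \<in> el A c" if "c \<in> Obj D" "y \<in> el P c" for c y
    using that PD ap_in[of p c y E] ap_in[of q c y A] by simp_all
  have "natural_map D (el P) (rs P) (el B) (rs B) (\<lambda>c y. \<gamma> c (ap p c y) (Ident D c, ap q c y))"
    unfolding natural_map_def
  proof (intro conjI ballI)
    show "\<gamma> c (ap p c y) (Ident D c, ap q c y) \<in> el B c" if c: "c \<in> Obj D" and y: "y \<in> el P c" for c y
      using Vin[OF R[OF c pq_in(1)[OF c y]], of "Ident D c" "ap q c y"] pq_in[OF c y] c by simp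
    fix f y assume f: "f \<in> Arr D" and y: "y \<in> el P (Cod D f)"
    let ?\<theta> = "\<gamma> (Cod D f) (ap p (Cod D f) y)" and ?a = "ap q (Cod D f) y"
    have in1: "ap p (Cod D f) y \<in> el E (Cod D f)" "?a \<in> el A (Cod D f)" using pq_in[of "Cod D f" y] f y by simp_all
    have "\<gamma> (Dom D f) (ap p (Dom D f) (rs P f y)) = ?r f ?\<theta>"
      using ap_nat[of p f y] Rn[OF f in1(1)] PD f y by simp
    moreover have "ap q (Dom D f) (rs P f y) = rs A f ?a" using ap_nat[of q f y] PD f y by simp
    moreover have "?r f ?\<theta> (Ident D (Dom D f), rs A f ?a) = rs B f (?\<theta> (Ident D (Cod D f), ?a))"
      using exponential_res_apply[of "Ident D (Dom D f)" f "rs A f ?a" "el A" ?\<theta>] PA(1)[OF f in1(2)]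
        Vnat[OF R[OF _ in1(1)], of "Ident D (Cod D f)" ?a f] f in1 by simp
    ultimately show "\<gamma> (Dom D f) (ap p (Dom D f) (rs P f y)) (Ident D (Dom D f), ap q (Dom D f) (rs P f y)) =
        rs B f (?\<theta> (Ident D (Cod D f), ?a))"
      by simp
  qed
  from ap_full_Hom[OF PD(7) B this] obtain ev where ev: "ev \<in> Hom C P B"
    "\<And>c y. \<lbrakk>c \<in> Obj D; y \<in> el P c\<rbrakk> \<Longrightarrow> ap ev c y = \<gamma> c (ap p c y) (Ident D c, ap q c y)" by blast
  have "\<exists>!g. g \<in> Hom C Z E \<and> (\<exists>h\<in>Hom C Q P. p \<cdot>\<^bsub>C\<^esub> h = g \<cdot>\<^bsub>C\<^esub> p' \<and> q \<cdot>\<^bsub>C\<^esub> h = q' \<and> ev \<cdot>\<^bsub>C\<^esub> h = f)"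
    if Q: "is_product C Z A Q p' q'" and f: "f \<in> Hom C Q B" for Z Q p' q' f
  proof -
    note QD = C.productD[OF Q]
    have Z: "Z \<in> Obj C" using QD by auto
    note PZ = rs_simps[OF Z] and PQ = rs_simps[OF QD(7)]
    define pair where "pair c z a = (SOME y. y \<in> el Q c \<and> ap p' c y = z \<and> ap q' c y = a)" for c z a
    have pair: "pair c z a \<in> el Q c \<and> ap p' c (pair c z a) = z \<and> ap q' c (pair c z a) = a"
      if "c \<in> Obj D" "z \<in> el Z c" "a \<in> el A c" for c z a
      unfolding pair_def by (rule someI_ex) (use product_elements(1)[OF Q that] in blast)
    have pair_eq: "pair c (ap p' c y) (ap q' c y) = y" if c: "c \<in> Obj D" and y: "y \<in> el Q c" for c y
    proof -
      have i: "ap p' c y \<in> el Z c" "ap q' c y \<in> el A c" using QD c y ap_in[of p' c y Z] ap_in[of q' c y A] by simp_all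
      show ?thesis using pair[OF c i] y product_elements(2)[OF Q c, of "pair c (ap p' c y) (ap q' c y)" y] by simp
    qed
    have pair_nat: "rs Q g (pair (Cod D g) z a) = pair (Dom D g) (rs Z g z) (rs A g a)"
      if g: "g \<in> Arr D" and z: "z \<in> el Z (Cod D g)" and a: "a \<in> el A (Cod D g)" for g z a
    proof -
      have p0: "pair (Cod D g) z a \<in> el Q (Cod D g) \<and> ap p' (Cod D g) (pair (Cod D g) z a) = z \<and>
          ap q' (Cod D g) (pair (Cod D g) z a) = a"
        using pair[OF _ z a] g by simp
      have "ap p' (Dom D g) (rs Q g (pair (Cod D g) z a)) = rs Z g z"
          "ap q' (Dom D g) (rs Q g (pair (Cod D g) z a)) = rs A g a"
        using ap_nat[of p' g "pair (Cod D g) z a"] ap_nat[of q' g "pair (Cod D g) z a"] p0 QD g by simp_all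
      then show ?thesis using pair_eq[of "Dom D g" "rs Q g (pair (Cod D g) z a)"] PQ(1)[OF g, of
          "pair (Cod D g) z a"] p0 g by simp
    qed
    define \<phi> where "\<phi> c z = (\<lambda>(k, a)\<in>points (el A) c. ap f (Dom D k) (pair (Dom D k) (rs Z k z) a))" for c z
    have \<phi>_apply: "\<phi> c z (k, a) = ap f (Dom D k) (pair (Dom D k) (rs Z k z) a)" if "k \<in> Arr D" "Cod D k = c"
        "a \<in> el A (Dom D k)" for c z k a
      using that by (simp add: \<phi>_def points_def)
    have \<phi>in: "\<phi> c z \<in> ?V c" if c: "c \<in> Obj D" and z: "z \<in> el Z c" for c z
      unfolding exponential_sheaf_def mem_Collect_eq
    proof (intro conjI ballI)
      show "\<phi> c z \<in> extensional (points (el A) c)" by (simp add: \<phi>_def)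
      fix x assume "x \<in> points (el A) c"
      then obtain k a where x: "x = (k, a)" and k: "k \<in> Arr D" "Cod D k = c" and a: "a \<in> el A (Dom D k)"
          by (auto simp: points_def)
      have rz: "rs Z k z \<in> el Z (Dom D k)" using PZ(1)[OF k(1), of z] k z by simp
      have pr: "pair (Dom D k) (rs Z k z) a \<in> el Q (Dom D k)" using pair[OF _ rz a] k by simp
      have "\<phi> c z (k, a) \<in> el B (Dom D k)" using \<phi>_apply[OF k a] ap_in[of f "Dom D k" _ B] f pr k by simp
      moreover have "\<phi> c z (k \<cdot>\<^bsub>D\<^esub> g, rs A g a) = rs B g (\<phi> c z (k, a))" if g: "g \<in> Arr D" "Cod D g = Dom D k" for g
      proof -
        have ra: "rs A g a \<in> el A (Dom D g)" using PA(1)[OF g(1), of a] g a by simp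
        have "\<phi> c z (k \<cdot>\<^bsub>D\<^esub> g, rs A g a) = ap f (Dom D g) (pair (Dom D g) (rs Z g (rs Z k z)) (rs A g a))"
          using \<phi>_apply[of "k \<cdot>\<^bsub>D\<^esub> g" c "rs A g a" z] PZ(3)[OF k(1) g, of z] k g ra z by simp
        also have "\<dots> = ap f (Dom D g) (rs Q g (pair (Dom D k) (rs Z k z) a))"
          using pair_nat[OF g(1), of "rs Z k z" a] g rz a by simp
        also have "\<dots> = rs B g (\<phi> c z (k, a))"
          using ap_nat[of f g "pair (Dom D k) (rs Z k z) a"] f g pr \<phi>_apply[OF k a] by simp
        finally show ?thesis .
      qed
      ultimately show "case x of (f, a) \<Rightarrow> \<phi> c z (f, a) \<in> el B (Dom D f) \<and>
          (\<forall>g\<in>Arr D. Cod D g = Dom D f \<longrightarrow> \<phi> c z (f \<cdot>\<^bsub>D\<^esub> g, rs A g a) = rs B g (\<phi> c z (f, a)))" using x by simp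
    qed
    have "natural_map D (el Z) (rs Z) ?V ?r \<phi>"
      unfolding natural_map_def
    proof (intro conjI ballI)
      show "\<phi> c z \<in> ?V c" if "c \<in> Obj D" "z \<in> el Z c" for c z using \<phi>in[OF that] .
      fix h z assume h: "h \<in> Arr D" and z: "z \<in> el Z (Cod D h)"
      show "\<phi> (Dom D h) (rs Z h z) = ?r h (\<phi> (Cod D h) z)"
      proof (rule exponential_ext[of _ "el A" "Dom D h"])
        show "\<phi> (Dom D h) (rs Z h z) \<in> extensional (points (el A) (Dom D h))" by (simp add: \<phi>_def)
        show "?r h (\<phi> (Cod D h) z) \<in> extensional (points (el A) (Dom D h))" by (simp add: exponential_res_def)
        fix k a assume k: "k \<in> Arr D" "Cod D k = Dom D h" "a \<in> el A (Dom D k)"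
        show "\<phi> (Dom D h) (rs Z h z) (k, a) = ?r h (\<phi> (Cod D h) z) (k, a)"
          using \<phi>_apply[OF k(1,2,3)] \<phi>_apply[of "h \<cdot>\<^bsub>D\<^esub> k" "Cod D h" a z] PZ(3)[OF h k(1,2) z] exponential_res_apply[of k h a "el A" "\<phi> (Cod D h) z"] k h by simp
      qed
    qed
    from into_real[OF E \<gamma> Z this] obtain g where g: "g \<in> Hom C Z E"
      and g\<phi>: "\<And>c z. \<lbrakk>c \<in> Obj D; z \<in> el Z c\<rbrakk> \<Longrightarrow> \<gamma> c (ap g c z) = \<phi> c z"
      and g_unique: "\<And>g'. \<lbrakk>g' \<in> Hom C Z E; \<And>c z. \<lbrakk>c \<in> Obj D; z \<in> el Z c\<rbrakk> \<Longrightarrow> \<gamma> c (ap g' c z) = \<phi> c z\<rbrakk> \<Longrightarrow> g' = g"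
      by (elim ex1E) blast
    have ev_h: "ap (ev \<cdot>\<^bsub>C\<^esub> h) c y = \<gamma> c (ap g' c (ap p' c y)) (Ident D c, ap q' c y)"
      if g': "g' \<in> Hom C Z E" and h: "h \<in> Hom C Q P" "p \<cdot>\<^bsub>C\<^esub> h = g' \<cdot>\<^bsub>C\<^esub> p'" "q \<cdot>\<^bsub>C\<^esub> h = q'" and c: "c \<in> Obj D"
          and y: "y \<in> el Q c" for g' h c y
    proof -
      have hy: "ap h c y \<in> el P c" using ap_in[of h c y P] h c y by simp
      have "ap p c (ap h c y) = ap g' c (ap p' c y)"
        using ap_comp[of h p c y] ap_comp[of p' g' c y] h g' PD QD c y by simp
      moreover have "ap q c (ap h c y) = ap q' c y" using ap_comp[of h q c y] h PD c y by simp
      ultimately show ?thesis using ap_comp[of h ev c y] ev(1) ev(2)[OF c hy] h c y by simp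
    qed
    show ?thesis
    proof (rule ex1I[of _ g])
      obtain h where h: "h \<in> Hom C Q P" "p \<cdot>\<^bsub>C\<^esub> h = g \<cdot>\<^bsub>C\<^esub> p'" "q \<cdot>\<^bsub>C\<^esub> h = q'"
        using C.product_univ[OF P, of "g \<cdot>\<^bsub>C\<^esub> p'" q'] g QD by auto
      have "ev \<cdot>\<^bsub>C\<^esub> h = f"
      proof (rule ap_ext)
        fix c y assume c: "c \<in> Obj D" and "y \<in> el (Dom C (ev \<cdot>\<^bsub>C\<^esub> h)) c"
        then have y: "y \<in> el Q c" using h(1) ev(1) by simp
        have i: "ap p' c y \<in> el Z c" "ap q' c y \<in> el A c" using QD c y ap_in[of p' c y Z] ap_in[of q' c y A]
          by simp_all
        show "ap (ev \<cdot>\<^bsub>C\<^esub> h) c y = ap f c y"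
          using ev_h[OF g h c y] g\<phi>[OF c i(1)] \<phi>_apply[of "Ident D c" c "ap q' c y"
            "ap p' c y"] i PZ(2)[OF c i(1)] pair_eq[OF c y] c by simp
      qed (use h ev(1) f in auto)
      then show "g \<in> Hom C Z E \<and> (\<exists>h\<in>Hom C Q P. p \<cdot>\<^bsub>C\<^esub> h = g \<cdot>\<^bsub>C\<^esub> p' \<and> q \<cdot>\<^bsub>C\<^esub> h = q' \<and> ev \<cdot>\<^bsub>C\<^esub> h = f)" using g h
          by blast
      fix g' assume "g' \<in> Hom C Z E \<and> (\<exists>h\<in>Hom C Q P. p \<cdot>\<^bsub>C\<^esub> h = g' \<cdot>\<^bsub>C\<^esub> p' \<and> q \<cdot>\<^bsub>C\<^esub> h = q' \<and> ev \<cdot>\<^bsub>C\<^esub> h = f)"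
      then obtain h' where g': "g' \<in> Hom C Z E" and h': "h' \<in> Hom C Q P" "p \<cdot>\<^bsub>C\<^esub> h' = g' \<cdot>\<^bsub>C\<^esub> p'"
          "q \<cdot>\<^bsub>C\<^esub> h' = q'" and evf: "ev \<cdot>\<^bsub>C\<^esub> h' = f" by blast
      show "g' = g"
      proof (rule g_unique[OF g'])
        fix c z assume c: "c \<in> Obj D" and z: "z \<in> el Z c"
        have g'z: "ap g' c z \<in> el E c" using ap_in[of g' c z E] g' c z by simp
        note \<theta> = R[OF c g'z]
        show "\<gamma> c (ap g' c z) = \<phi> c z"
        proof (rule exponential_ext[of _ "el A" c])
          show "\<gamma> c (ap g' c z) \<in> extensional (points (el A) c)" using \<theta> by (simp add: exponential_sheaf_def)
          show "\<phi> c z \<in> extensional (points (el A) c)" by (simp add: \<phi>_def)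
          fix k a assume k: "k \<in> Arr D" "Cod D k = c" and a: "a \<in> el A (Dom D k)"
          have rz: "rs Z k z \<in> el Z (Dom D k)" using PZ(1)[OF k(1), of z] k z by simp
          have Dk: "Dom D k \<in> Obj D" using k by simp
          let ?y = "pair (Dom D k) (rs Z k z) a"
          have y: "?y \<in> el Q (Dom D k)" "ap p' (Dom D k) ?y = rs Z k z" "ap q' (Dom D k) ?y = a"
            using pair[OF Dk rz a] by auto
          have "\<phi> c z (k, a) = ap (ev \<cdot>\<^bsub>C\<^esub> h') (Dom D k) ?y" using \<phi>_apply[OF k a] evf by simp
          also have "\<dots> = \<gamma> (Dom D k) (ap g' (Dom D k) (rs Z k z)) (Ident D (Dom D k), a)"
            using ev_h[OF g' h' Dk y(1)] y by simp
          also have "\<gamma> (Dom D k) (ap g' (Dom D k) (rs Z k z)) = ?r k (\<gamma> c (ap g' c z))"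
            using ap_nat[of g' k z] Rn[OF k(1), of "ap g' c z"] g' g'z k z by simp
          also have "\<dots> (Ident D (Dom D k), a) = \<gamma> c (ap g' c z) (k, a)"
            using exponential_res_apply[of "Ident D (Dom D k)" k a "el A" "\<gamma> c (ap g' c z)"] k a by simp
          finally show "\<gamma> c (ap g' c z) (k, a) = \<phi> c z (k, a)" by simp
        qed
      qed
    qed
  qed
  then have "is_exponential C A B E P p q ev" using P ev(1) by (simp add: is_exponential_def del: Hom_iff)
  then show ?thesis by blast
qed

theorem elementary_topos: "elementary_topos C"
  unfolding elementary_topos_def
  using C.category_axioms finitely_complete exponential_exists classifier_exists by blast

text \<open>The colimit of F is the sheaf associated with the quotient of the disjoint union of the sheaves F i by the identifications
that the arrows of the diagram prescribe.\<close>

theorem cocomplete: "cocomplete \<kappa> C"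
  unfolding cocomplete_def
proof (intro allI impI)
  fix I :: "('u, 'u) cat" and F
  assume "category I \<and> small \<kappa> (Obj I) \<and> small \<kappa> (Arr I) \<and> is_functor I C F"
  then have I: "category I" and smI: "small \<kappa> (Obj I)" and F: "is_functor I C F" by auto
  interpret I: category I by (rule I)
  have FO: "fobj F i \<in> Obj C" if "i \<in> Obj I" for i using F that by (simp add: is_functor_def)
  have FA: "farr F u \<in> Arr C" "Dom C (farr F u) = fobj F (Dom I u)" "Cod C (farr F u) = fobj F (Cod I u)" if
      "u \<in> Arr I" for u
    using F that by (auto simp: is_functor_def)
  define V where "V c = (SIGMA i:Obj I. el (fobj F i) c)" for c
  define r where "r f = (\<lambda>(i, x). (i, rs (fobj F i) f x))" for f
  define G where "G c = {((Dom I u, x), (Cod I u, ap (farr F u) c x)) | u x. u \<in> Arr I \<and>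
      x \<in> el (fobj F (Dom I u)) c}" for c
  have V: "presheaf D V r"
    unfolding presheaf_def V_def r_def using rs_simps[OF FO] by auto
  interpret Q: quotient_sheaf D J V r G by unfold_locales (rule V)
  have "small \<kappa> (V c)" if "c \<in> Obj D" for c
    unfolding V_def by (rule small_Sigma[OF universe smI]) (use el_small FO that in auto)
  then have "small \<kappa> (Q.L c)" for c using Q.L_small[OF universe small_Arr] by blast
  then obtain L \<gamma> where L: "L \<in> Obj C" and \<gamma>: "natural_bij D (el L) (rs L) Q.L Q.res \<gamma>"
    using realization_any[OF Q.L_sheaf] by blast
  have "\<exists>a. a \<in> Hom C (fobj F i) L \<and> (\<forall>c\<in>Obj D. \<forall>x\<in>el (fobj F i) c. \<gamma> c (ap a c x) = Q.rep c (i, x))" if i: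
      "i \<in> Obj I" for i
  proof -
    have "natural_map D (el (fobj F i)) (rs (fobj F i)) V r (\<lambda>c x. (i, x))" using i
        by (simp add: natural_map_def V_def r_def)
    from into_real[OF L \<gamma> FO[OF i] natural_map_comp[OF this Q.rep_natural]] show ?thesis by blast
  qed
  then obtain inj where inj: "\<And>i. i \<in> Obj I \<Longrightarrow> inj i \<in> Hom C (fobj F i) L"
    "\<And>i c x. \<lbrakk>i \<in> Obj I; c \<in> Obj D; x \<in> el (fobj F i) c\<rbrakk> \<Longrightarrow> \<gamma> c (ap (inj i) c x) = Q.rep c (i, x)" by metis
  have "is_colimit I C F L inj"
    unfolding is_colimit_def
  proof (intro conjI allI impI)
    show "is_cocone I C F L inj"
      unfolding is_cocone_def
    proof (intro conjI ballI)
      fix u assume u: "u \<in> Arr I"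
      have uO: "Dom I u \<in> Obj I" "Cod I u \<in> Obj I" using u by auto
      show "inj (Cod I u) \<cdot>\<^bsub>C\<^esub> farr F u = inj (Dom I u)"
      proof (rule ap_ext)
        fix c x assume c: "c \<in> Obj D" and "x \<in> el (Dom C (inj (Cod I u) \<cdot>\<^bsub>C\<^esub> farr F u)) c"
        then have x: "x \<in> el (fobj F (Dom I u)) c" using FA[OF u] inj(1)[OF uO(2)] by simp
        have ux: "ap (farr F u) c x \<in> el (fobj F (Cod I u)) c" using ap_in[of "farr F u" c x] FA[OF u] c x by simp
        have e: "ap (inj (Cod I u) \<cdot>\<^bsub>C\<^esub> farr F u) c x = ap (inj (Cod I u)) c (ap (farr F u) c x)"
          using FA[OF u] inj(1)[OF uO(2)] c x by (simp add: ap_comp)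
        have "Q.rep c (Dom I u, x) = Q.rep c (Cod I u, ap (farr F u) c x)"
          using c x ux uO u by (intro Q.rep_invariant) (auto simp: V_def G_def)
        then have "\<gamma> c (ap (inj (Cod I u)) c (ap (farr F u) c x)) = \<gamma> c (ap (inj (Dom I u)) c x)"
          using inj(2)[OF uO(2) c ux] inj(2)[OF uO(1) c x] by simp
        moreover have "ap (inj (Cod I u)) c (ap (farr F u) c x) \<in> el L c" "ap (inj (Dom I u)) c x \<in> el L c"
          using inj(1)[OF uO(1)] inj(1)[OF uO(2)] c x ux by (simp_all add: ap_in)
        ultimately show "ap (inj (Cod I u) \<cdot>\<^bsub>C\<^esub> farr F u) c x = ap (inj (Dom I u)) c x"
          unfolding e using real_inj[OF L \<gamma> c] by blast
      qed (use FA[OF u] inj(1)[OF uO(1)] inj(1)[OF uO(2)] in auto)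
    qed (use L inj in auto)
    fix Y y assume y: "is_cocone I C F Y y"
    then have Y: "Y \<in> Obj C" and yi: "\<And>i. i \<in> Obj I \<Longrightarrow> y i \<in> Hom C (fobj F i) Y"
      and yu: "\<And>u. u \<in> Arr I \<Longrightarrow> y (Cod I u) \<cdot>\<^bsub>C\<^esub> farr F u = y (Dom I u)" by (auto simp: is_cocone_def)
    define \<phi> where "\<phi> c = (\<lambda>(i, x). ap (y i) c x)" for c
    have \<phi>: "natural_map D V r (el Y) (rs Y) \<phi>"
      unfolding natural_map_def
    proof (intro conjI ballI)
      show "\<phi> c v \<in> el Y c" if "c \<in> Obj D" "v \<in> V c" for c v
        using that yi by (auto simp: V_def \<phi>_def intro!: ap_in)
      fix f v assume f: "f \<in> Arr D" and "v \<in> V (Cod D f)"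
      then obtain i x where v: "v = (i, x)" and i: "i \<in> Obj I" and x: "x \<in> el (fobj F i) (Cod D f)"
          by (auto simp: V_def)
      show "\<phi> (Dom D f) (r f v) = rs Y f (\<phi> (Cod D f) v)" using ap_nat[of "y i" f x] yi[OF i] f x v
          by (simp add: \<phi>_def r_def)
    qed
    have \<phi>G: "\<phi> c v = \<phi> c w" if c: "c \<in> Obj D" and "v \<in> V c" "w \<in> V c" and vw: "(v, w) \<in> G c" for c v w
    proof -
      obtain u x where u: "u \<in> Arr I" and x: "x \<in> el (fobj F (Dom I u)) c" and v: "v = (Dom I u, x)"
          "w = (Cod I u, ap (farr F u) c x)"
        using vw by (auto simp: G_def)
      have "ap (y (Dom I u)) c x = ap (y (Cod I u)) c (ap (farr F u) c x)"
        unfolding yu[OF u, symmetric] using ap_comp[of "farr F u" "y (Cod I u)" c x] FA[OF u] yi[of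
          "Cod I u"] u c x by simp
      then show ?thesis by (simp add: \<phi>_def v)
    qed
    obtain \<psi> where \<psi>: "natural_map D Q.L Q.res (el Y) (rs Y) \<psi>" "\<And>c x. \<lbrakk>c \<in> Obj D; x \<in> V c\<rbrakk> \<Longrightarrow> \<psi> c (Q.rep c x) = \<phi> c x"
      using Q.L_universal[OF el_sheaf[OF Y] \<phi> \<phi>G] by blast
    obtain h where h: "h \<in> Hom C L Y" "\<And>c x. \<lbrakk>c \<in> Obj D; x \<in> el L c\<rbrakk> \<Longrightarrow> ap h c x = \<psi> c (\<gamma> c x)"
      using out_of_real[OF L \<gamma> Y \<psi>(1)] by blast
    show "\<exists>!h. h \<in> Hom C L Y \<and> (\<forall>i\<in>Obj I. h \<cdot>\<^bsub>C\<^esub> inj i = y i)"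
    proof (rule ex1I[of _ h])
      have "h \<cdot>\<^bsub>C\<^esub> inj i = y i" if i: "i \<in> Obj I" for i
      proof (rule ap_ext)
        fix c x assume c: "c \<in> Obj D" and "x \<in> el (Dom C (h \<cdot>\<^bsub>C\<^esub> inj i)) c"
        then have x: "x \<in> el (fobj F i) c" using h(1) inj(1)[OF i] by simp
        have "ap (inj i) c x \<in> el L c" using ap_in[of "inj i" c x L] inj(1)[OF i] c x by simp
        then show "ap (h \<cdot>\<^bsub>C\<^esub> inj i) c x = ap (y i) c x"
          using ap_comp[of "inj i" h c x] h inj(1)[OF i] inj(2)[OF i c x] \<psi>(2)[OF c, of "(i, x)"] c x i
            by (simp add: \<phi>_def V_def)
      qed (use h(1) inj(1)[OF i] yi[OF i] in auto)
      then show "h \<in> Hom C L Y \<and> (\<forall>i\<in>Obj I. h \<cdot>\<^bsub>C\<^esub> inj i = y i)" using h(1) by blast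
      fix k assume k: "k \<in> Hom C L Y \<and> (\<forall>i\<in>Obj I. k \<cdot>\<^bsub>C\<^esub> inj i = y i)"
      let ?i = "\<lambda>c. inv_into (el L c) (\<gamma> c)"
      have kn: "natural_map D Q.L Q.res (el Y) (rs Y) (\<lambda>c \<sigma>. ap k c (?i c \<sigma>))"
        using natural_map_comp[OF natural_bij_inverse[OF sheaf_presheaf[OF el_sheaf[OF L]] \<gamma>], of "el Y" "rs Y"
          "ap k"] ap_natural[of k] k by simp
      have i\<gamma>: "?i c (\<gamma> c x) = x" if "c \<in> Obj D" "x \<in> el L c" for c x
        using \<gamma> that by (simp add: natural_bij_def bij_betw_def)
      have rep_agree: "ap k c (?i c (Q.rep c v)) = \<psi> c (Q.rep c v)" if c: "c \<in> Obj D" and "v \<in> V c" for c v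
      proof -
        obtain i x where v: "v = (i, x)" and i: "i \<in> Obj I" and x: "x \<in> el (fobj F i) c" using \<open>v \<in> V c\<close>
          by (auto simp: V_def)
        have j: "ap (inj i) c x \<in> el L c" using ap_in[of "inj i" c x L] inj(1)[OF i] c x by simp
        have "?i c (Q.rep c v) = ap (inj i) c x" using i\<gamma>[OF c j] inj(2)[OF i c x] v by simp
        then have "ap k c (?i c (Q.rep c v)) = ap (k \<cdot>\<^bsub>C\<^esub> inj i) c x" using ap_comp[of
          "inj i" k c x] inj(1)[OF i] k c x by simp
        also have "\<dots> = ap (y i) c x" using k i by simp
        finally show ?thesis using \<psi>(2)[OF c \<open>v \<in> V c\<close>] v by (simp add: \<phi>_def)
      qed
      have agree: "ap k c (?i c \<sigma>) = \<psi> c \<sigma>" if "c \<in> Obj D" "\<sigma> \<in> Q.L c" for c \<sigma>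
        by (rule Q.L_generated[OF el_sheaf[OF Y] kn \<psi>(1) rep_agree that])
      show "k = h"
      proof (rule ap_ext)
        fix c x assume c: "c \<in> Obj D" and "x \<in> el (Dom C k) c"
        then have x: "x \<in> el L c" using k by simp
        show "ap k c x = ap h c x" using agree[OF c real_in[OF L \<gamma> c x]] i\<gamma>[OF c x] h(2)[OF c x] by simp
      qed (use k h(1) in auto)
    qed
  qed
  then show "\<exists>L i. is_colimit I C F L i" by blast
qed

end

section \<open>Grothendieck toposes\<close>

lemma set_cat_sel [simp]:
  "Obj (set_cat \<kappa>) = {A. small \<kappa> A}"
  "Arr (set_cat \<kappa>) = {(A, f, B) | A f B. small \<kappa> A \<and> small \<kappa> B \<and> f \<in> A \<rightarrow>\<^sub>E B}"
  "Dom (set_cat \<kappa>) = fst" "Cod (set_cat \<kappa>) = (\<lambda>f. snd (snd f))"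
  "Ident (set_cat \<kappa>) A = (A, (\<lambda>x\<in>A. x), A)"
  "Comp (set_cat \<kappa>) g f = (fst f, compose (fst f) (set_app g) (set_app f), snd (snd g))"
  by (auto simp: set_cat_def)

lemma set_app_simp [simp]: "set_app (A, f, B) = f"
  by (simp add: set_app_def)

lemma set_arr_eqI:
  assumes "a \<in> Hom (set_cat \<kappa>) A B" "b \<in> Hom (set_cat \<kappa>) A B" "\<And>x. x \<in> A \<Longrightarrow> set_app a x = set_app b x"
  shows "a = b"
proof -
  obtain f g where "a = (A, f, B)" "b = (A, g, B)" "f \<in> A \<rightarrow>\<^sub>E B" "g \<in> A \<rightarrow>\<^sub>E B" using assms(1,2) by auto
  then show ?thesis using assms(3) PiE_ext[of f A "\<lambda>_. B" g] by simp
qed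

lemma set_app_in: "\<lbrakk>a \<in> Hom (set_cat \<kappa>) A B; x \<in> A\<rbrakk> \<Longrightarrow> set_app a x \<in> B"
  by (auto dest: PiE_mem)

lemma set_app_comp: "\<lbrakk>a \<in> Hom (set_cat \<kappa>) A B; x \<in> A\<rbrakk> \<Longrightarrow> set_app (b \<cdot>\<^bsub>set_cat \<kappa>\<^esub> a) x = set_app b (set_app a x)"
  by (auto simp: compose_def)

lemma set_category: "category (set_cat \<kappa>)"
proof
  fix f g h A B D E
  assume "f \<in> Hom (set_cat \<kappa>) A B" "g \<in> Hom (set_cat \<kappa>) B D" "h \<in> Hom (set_cat \<kappa>) D E"
  then show "h \<cdot>\<^bsub>set_cat \<kappa>\<^esub> (g \<cdot>\<^bsub>set_cat \<kappa>\<^esub> f) = h \<cdot>\<^bsub>set_cat \<kappa>\<^esub> g \<cdot>\<^bsub>set_cat \<kappa>\<^esub> f"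
    by (auto simp: compose_def fun_eq_iff dest: PiE_mem)
next
  fix f g A B D
  assume "f \<in> Hom (set_cat \<kappa>) A B" "g \<in> Hom (set_cat \<kappa>) B D"
  then show "g \<cdot>\<^bsub>set_cat \<kappa>\<^esub> f \<in> Hom (set_cat \<kappa>) A D"
    by (auto simp: compose_def PiE_iff)
next
  fix f A B assume "f \<in> Hom (set_cat \<kappa>) A B"
  then show "f \<cdot>\<^bsub>set_cat \<kappa>\<^esub> Ident (set_cat \<kappa>) A = f" "Ident (set_cat \<kappa>) B \<cdot>\<^bsub>set_cat \<kappa>\<^esub> f = f"
    by (auto simp: PiE_def compose_Id Id_compose)
qed auto

lemma op_sel [simp]: "Obj (op_cat D) = Obj D" "Arr (op_cat D) = Arr D" "Dom (op_cat D) = Cod D"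
    "Cod (op_cat D) = Dom D"
  "Ident (op_cat D) = Ident D" "Comp (op_cat D) g f = f \<cdot>\<^bsub>D\<^esub> g"
  by (simp_all add: op_cat_def)

lemma (in category) op_category: "category (op_cat C)"
  by unfold_locales auto

definition sheaf_cat :: "'u rel \<Rightarrow> ('d, 'e) cat \<Rightarrow> ('d \<Rightarrow> 'e set set) \<Rightarrow>
    (('d, 'e, 'u set, 'u set_arr) fctr,
     ('d, 'e, 'u set, 'u set_arr) fctr \<times> ('d \<Rightarrow> 'u set_arr) \<times> ('d, 'e, 'u set, 'u set_arr) fctr) cat" where
  "sheaf_cat \<kappa> D J = full_subcat (functor_cat (op_cat D) (set_cat \<kappa>)) (sheaves \<kappa> D J)"

definition component :: "('f \<times> ('d \<Rightarrow> 'u set_arr) \<times> 'g) \<Rightarrow> 'd \<Rightarrow> 'u \<Rightarrow> 'u" where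
  "component \<eta> c = set_app (fst (snd \<eta>) c)"

definition action :: "('d, 'e, 'u set, 'u set_arr) fctr \<Rightarrow> 'e \<Rightarrow> 'u \<Rightarrow> 'u" where
  "action F f = set_app (farr F f)"

context site
begin

lemma set_functor_D:
  assumes "is_functor (op_cat D) (set_cat \<kappa>) F"
  shows "\<And>c. c \<in> Obj D \<Longrightarrow> small \<kappa> (fobj F c)"
    "\<And>f. f \<in> Arr D \<Longrightarrow> farr F f \<in> Hom (set_cat \<kappa>) (fobj F (Cod D f)) (fobj F (Dom D f))"
    "\<And>c. c \<in> Obj D \<Longrightarrow> farr F (Ident D c) = Ident (set_cat \<kappa>) (fobj F c)"
    "\<And>f g. \<lbrakk>f \<in> Arr D; g \<in> Arr D; Cod D g = Dom D f\<rbrakk> \<Longrightarrow> farr F (f \<cdot>\<^bsub>D\<^esub> g) = farr F g \<cdot>\<^bsub>set_cat \<kappa>\<^esub> farr F f"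
proof -
  note A = assms[unfolded is_functor_def op_sel]
  show "small \<kappa> (fobj F c)" if "c \<in> Obj D" for c using A that by simp
  show "farr F f \<in> Hom (set_cat \<kappa>) (fobj F (Cod D f)) (fobj F (Dom D f))" if "f \<in> Arr D" for f using A that by blast
  show "farr F (Ident D c) = Ident (set_cat \<kappa>) (fobj F c)" if "c \<in> Obj D" for c using A that by blast
  show "farr F (f \<cdot>\<^bsub>D\<^esub> g) = farr F g \<cdot>\<^bsub>set_cat \<kappa>\<^esub> farr F f" if "f \<in> Arr D" "g \<in> Arr D" "Cod D g = Dom D f" for f g
    using A that by (metis (no_types, lifting))
qed

lemma functor_presheaf:
  assumes F: "is_functor (op_cat D) (set_cat \<kappa>) F"
  shows "presheaf D (fobj F) (action F)"
  unfolding presheaf_def action_def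
proof (intro conjI ballI impI)
  note S = set_functor_D[OF F]
  show "set_app (farr F f) x \<in> fobj F (Dom D f)" if "f \<in> Arr D" "x \<in> fobj F (Cod D f)" for f x
    using set_app_in[OF S(2)[OF that(1)] that(2)] .
  show "set_app (farr F (Ident D c)) x = x" if "c \<in> Obj D" "x \<in> fobj F c" for c x
    using S(3)[OF that(1)] that(2) by simp
  show "set_app (farr F (f \<cdot>\<^bsub>D\<^esub> g)) x = set_app (farr F g) (set_app (farr F f) x)"
    if "f \<in> Arr D" "g \<in> Arr D" "Cod D g = Dom D f" "x \<in> fobj F (Cod D f)" for f g x
    unfolding S(4)[OF that(1-3)] by (rule set_app_comp[OF S(2)[OF that(1)] that(4)])
qed

lemma sheaves_iff: "F \<in> sheaves \<kappa> D J \<longleftrightarrow> is_functor (op_cat D) (set_cat \<kappa>) F \<and> sheaf D J (fobj F) (action F)"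
  using functor_presheaf unfolding sheaves_def sheaf_def matching_def action_def by auto

lemma sheaf_cat_sel:
  "Obj (sheaf_cat \<kappa> D J) = sheaves \<kappa> D J"
  "Arr (sheaf_cat \<kappa> D J) = {(F, \<eta>, G) | F \<eta> G. F \<in> sheaves \<kappa> D J \<and> G \<in> sheaves \<kappa> D J \<and>
     nat_trans (op_cat D) (set_cat \<kappa>) F G \<eta> \<and> \<eta> \<in> extensional (Obj D)}"
  "Dom (sheaf_cat \<kappa> D J) = fst" "Cod (sheaf_cat \<kappa> D J) = (\<lambda>a. snd (snd a))"
  "Ident (sheaf_cat \<kappa> D J) F = (F, (\<lambda>c\<in>Obj D. Ident (set_cat \<kappa>) (fobj F c)), F)"
  "Comp (sheaf_cat \<kappa> D J) b a = (fst a, (\<lambda>c\<in>Obj D. fst (snd b) c \<cdot>\<^bsub>set_cat \<kappa>\<^esub> fst (snd a) c), snd (snd b))"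
proof -
  show "Obj (sheaf_cat \<kappa> D J) = sheaves \<kappa> D J"
    by (auto simp: sheaf_cat_def full_subcat_def functor_cat_def sheaves_def simp del: set_cat_sel)
qed (auto simp: sheaf_cat_def full_subcat_def functor_cat_def simp del: set_cat_sel)

lemma sheaf_arr_D:
  assumes a: "a \<in> Hom (sheaf_cat \<kappa> D J) F G"
  shows "F \<in> sheaves \<kappa> D J" "G \<in> sheaves \<kappa> D J"
    "\<And>c. c \<in> Obj D \<Longrightarrow> fst (snd a) c \<in> Hom (set_cat \<kappa>) (fobj F c) (fobj G c)"
    "natural_map D (fobj F) (action F) (fobj G) (action G) (component a)"
    "fst (snd a) \<in> extensional (Obj D)"
proof -
  obtain \<eta> where \<eta>: "a = (F, \<eta>, G)" "F \<in> sheaves \<kappa> D J" "G \<in> sheaves \<kappa> D J" "nat_trans (op_cat D) (set_cat \<kappa>) F G \<eta>"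
    "\<eta> \<in> extensional (Obj D)"
    using a by (auto simp: sheaf_cat_sel simp del: set_cat_sel)
  show "F \<in> sheaves \<kappa> D J" "G \<in> sheaves \<kappa> D J" "fst (snd a) \<in> extensional (Obj D)" using \<eta> by auto
  show c: "fst (snd a) c \<in> Hom (set_cat \<kappa>) (fobj F c) (fobj G c)" if "c \<in> Obj D" for c
    using \<eta> that by (simp add: nat_trans_def del: set_cat_sel)
  have F: "is_functor (op_cat D) (set_cat \<kappa>) F" and G: "is_functor (op_cat D) (set_cat \<kappa>) G" using \<eta>
      by (auto simp: nat_trans_def)
  show "natural_map D (fobj F) (action F) (fobj G) (action G) (component a)"
    unfolding natural_map_def component_def action_def
  proof (intro conjI ballI)
    show "set_app (fst (snd a) d) x \<in> fobj G d" if "d \<in> Obj D" "x \<in> fobj F d" for d x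
        using set_app_in[OF c[OF that(1)] that(2)] .
    fix f x assume f: "f \<in> Arr D" and x: "x \<in> fobj F (Cod D f)"
    have "\<eta> (Dom D f) \<cdot>\<^bsub>set_cat \<kappa>\<^esub> farr F f = farr G f \<cdot>\<^bsub>set_cat \<kappa>\<^esub> \<eta> (Cod D f)"
      using \<eta>(4) f by (simp add: nat_trans_def del: set_cat_sel)
    then have "set_app (\<eta> (Dom D f) \<cdot>\<^bsub>set_cat \<kappa>\<^esub> farr F f) x = set_app (farr G f \<cdot>\<^bsub>set_cat \<kappa>\<^esub> \<eta> (Cod D f)) x"
        by (rule arg_cong)
    then show "set_app (fst (snd a) (Dom D f)) (set_app (farr F f) x) =
        set_app (farr G f) (set_app (fst (snd a) (Cod D f)) x)"
      using set_app_comp[OF set_functor_D(2)[OF F f] x] set_app_comp[OF c[of "Cod D f"] x] f \<eta>(1)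
          by (simp del: set_cat_sel Hom_iff)
  qed
qed

lemma sheaf_arr_ext:
  assumes a: "a \<in> Hom (sheaf_cat \<kappa> D J) F G" and b: "b \<in> Hom (sheaf_cat \<kappa> D J) F G"
    and eq: "\<And>c x. \<lbrakk>c \<in> Obj D; x \<in> fobj F c\<rbrakk> \<Longrightarrow> component a c x = component b c x"
  shows "a = b"
proof -
  have "fst (snd a) = fst (snd b)"
  proof (rule extensionalityI[OF sheaf_arr_D(5)[OF a] sheaf_arr_D(5)[OF b]])
    fix c assume c: "c \<in> Obj D"
    show "fst (snd a) c = fst (snd b) c"
      by (rule set_arr_eqI[OF sheaf_arr_D(3)[OF a c] sheaf_arr_D(3)[OF b c]])
          (use eq[OF c] in \<open>simp add: component_def\<close>)
  qed
  moreover have "fst a = F" "fst b = F" "snd (snd a) = G" "snd (snd b) = G" using a b by (auto simp: sheaf_cat_sel)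
  ultimately show ?thesis by (simp add: prod_eq_iff)
qed

lemma sheaf_arr_exists:
  assumes F: "F \<in> sheaves \<kappa> D J" and G: "G \<in> sheaves \<kappa> D J"
    and \<phi>: "natural_map D (fobj F) (action F) (fobj G) (action G) \<phi>"
  shows "\<exists>a. a \<in> Hom (sheaf_cat \<kappa> D J) F G \<and> (\<forall>c\<in>Obj D. \<forall>x\<in>fobj F c. component a c x = \<phi> c x)"
proof -
  have FF: "is_functor (op_cat D) (set_cat \<kappa>) F" and GG: "is_functor (op_cat D) (set_cat \<kappa>) G" using F G
      by (auto simp: sheaves_iff)
  note SF = set_functor_D[OF FF] and SG = set_functor_D[OF GG]
  define \<eta> where "\<eta> = (\<lambda>c\<in>Obj D. (fobj F c, \<lambda>x\<in>fobj F c. \<phi> c x, fobj G c))"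
  have \<eta>c: "\<eta> c \<in> Hom (set_cat \<kappa>) (fobj F c) (fobj G c)" if c: "c \<in> Obj D" for c
    unfolding \<eta>_def using c SF(1)[OF c] SG(1)[OF c] natural_map_simps(1)[OF \<phi> c] by auto
  have \<eta>_app: "set_app (\<eta> c) x = \<phi> c x" if "c \<in> Obj D" "x \<in> fobj F c" for c x using that by (simp add: \<eta>_def)
  interpret S: category "set_cat \<kappa>" by (rule set_category)
  have "nat_trans (op_cat D) (set_cat \<kappa>) F G \<eta>"
    unfolding nat_trans_def
  proof (intro conjI ballI FF GG)
    show "\<eta> X \<in> Hom (set_cat \<kappa>) (fobj F X) (fobj G X)" if "X \<in> Obj (op_cat D)" for X using \<eta>c that by simp
    fix f assume "f \<in> Arr (op_cat D)"
    then have f: "f \<in> Arr D" by simp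
    have "\<eta> (Dom D f) \<cdot>\<^bsub>set_cat \<kappa>\<^esub> farr F f = farr G f \<cdot>\<^bsub>set_cat \<kappa>\<^esub> \<eta> (Cod D f)"
    proof (rule set_arr_eqI)
      show "\<eta> (Dom D f) \<cdot>\<^bsub>set_cat \<kappa>\<^esub> farr F f \<in> Hom (set_cat \<kappa>) (fobj F (Cod D f)) (fobj G (Dom D f))"
        by (rule S.Comp_Hom[OF SF(2)[OF f] \<eta>c]) (use f in simp)
      show "farr G f \<cdot>\<^bsub>set_cat \<kappa>\<^esub> \<eta> (Cod D f) \<in> Hom (set_cat \<kappa>) (fobj F (Cod D f)) (fobj G (Dom D f))"
        by (rule S.Comp_Hom[OF \<eta>c SG(2)[OF f]]) (use f in simp)
      fix x assume x: "x \<in> fobj F (Cod D f)"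
      have cO: "Cod D f \<in> Obj D" "Dom D f \<in> Obj D" using f by auto
      have "set_app (farr F f) x \<in> fobj F (Dom D f)" using set_app_in[OF SF(2)[OF f] x] .
      then show "set_app (\<eta> (Dom D f) \<cdot>\<^bsub>set_cat \<kappa>\<^esub> farr F f) x = set_app (farr G f \<cdot>\<^bsub>set_cat \<kappa>\<^esub> \<eta> (Cod D f)) x"
        unfolding set_app_comp[OF SF(2)[OF f] x] set_app_comp[OF \<eta>c[OF cO(1)] x]
        using natural_map_simps(2)[OF \<phi> f x] \<eta>_app[OF cO(2)] \<eta>_app[OF cO(1) x] by (simp add: action_def)
    qed
    then show "\<eta> (Cod (op_cat D) f) \<cdot>\<^bsub>set_cat \<kappa>\<^esub> farr F f = farr G f \<cdot>\<^bsub>set_cat \<kappa>\<^esub> \<eta> (Dom (op_cat D) f)"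
      by (simp only: op_sel)
  qed
  then have "(F, \<eta>, G) \<in> Hom (sheaf_cat \<kappa> D J) F G" using F G by (simp add: sheaf_cat_sel \<eta>_def)
  moreover have "component (F, \<eta>, G) c x = \<phi> c x" if "c \<in> Obj D" "x \<in> fobj F c" for c x
    using \<eta>_app[OF that] by (simp add: component_def)
  ultimately show ?thesis by blast
qed

text \<open>A presheaf given by functions on sets becomes a functor by restricting these functions to their domains.\<close>

lemma sheaf_object:
  assumes V: "sheaf D J V r" and small: "\<And>c. c \<in> Obj D \<Longrightarrow> small \<kappa> (V c)"
  obtains F where "F \<in> sheaves \<kappa> D J" "fobj F = V" "\<And>f x. \<lbrakk>f \<in> Arr D; x \<in> V (Cod D f)\<rbrakk> \<Longrightarrow> action F f x = r f x"
proof -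
  note P = presheaf_simps[OF sheaf_presheaf[OF V]]
  define F where "F = \<lparr>fobj = V, farr = (\<lambda>f. (V (Cod D f), \<lambda>x\<in>V (Cod D f). r f x, V (Dom D f)))\<rparr>"
  have a: "action F f x = r f x" if "f \<in> Arr D" "x \<in> V (Cod D f)" for f x using that by (simp add: action_def F_def)
  have "is_functor (op_cat D) (set_cat \<kappa>) F"
    unfolding is_functor_def
  proof (intro conjI ballI impI)
    show "category (op_cat D)" "category (set_cat \<kappa>)" by (rule op_category) (rule set_category)
    show "fobj F X \<in> Obj (set_cat \<kappa>)" if "X \<in> Obj (op_cat D)" for X using that small by (simp add: F_def)
    show "farr F f \<in> Hom (set_cat \<kappa>) (fobj F (Dom (op_cat D) f)) (fobj F (Cod (op_cat D) f))" if
        "f \<in> Arr (op_cat D)" for f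
      using that small P(1) by (auto simp: F_def)
    show "farr F (Ident (op_cat D) X) = Ident (set_cat \<kappa>) (fobj F X)" if "X \<in> Obj (op_cat D)" for X
      using that P(2) by (auto simp: F_def intro!: restrict_ext)
    show "farr F (g \<cdot>\<^bsub>op_cat D\<^esub> f) = farr F g \<cdot>\<^bsub>set_cat \<kappa>\<^esub> farr F f"
      if "f \<in> Arr (op_cat D)" "g \<in> Arr (op_cat D)" "Cod (op_cat D) f = Dom (op_cat D) g" for f g
    proof -
      have fg: "f \<in> Arr D" "g \<in> Arr D" "Cod D g = Dom D f" using that by simp_all
      have "r f x \<in> V (Cod D g)" if "x \<in> V (Cod D f)" for x using P(1)[OF fg(1) that] fg by simp
      then show ?thesis using fg P(3)[OF fg] by (auto simp: F_def compose_def intro!: restrict_ext)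
    qed
  qed
  moreover have "sheaf D J (fobj F) (action F)"
  proof (rule sheaf_transfer[OF V])
    show "natural_bij D (fobj F) (action F) V r (\<lambda>c x. x)"
      using a by (simp add: natural_bij_def natural_map_def F_def bij_betw_def)
    show "action F f x \<in> fobj F (Dom D f)" if "f \<in> Arr D" "x \<in> fobj F (Cod D f)" for f x
      using a[of f x] that P(1)[of f x] by (simp add: F_def)
  qed
  ultimately have "F \<in> sheaves \<kappa> D J" by (simp add: sheaves_iff)
  then show ?thesis using that a by (simp add: F_def)
qed

end

text \<open>Faithfulness of F follows from the naturality of \<eta>, and that of G in the same way from \<epsilon>. Then F is full: given h, the arrow
obtained from G h by conjugation with \<eta> has the same image as h under the composite with the faithful functor G.\<close>

lemma equivalence_fully_faithful:
  assumes "equivalent_cats A B"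
  obtains F where "is_functor A B F"
    "\<And>f g. \<lbrakk>f \<in> Arr A; g \<in> Arr A; Dom A f = Dom A g; Cod A f = Cod A g; farr F f = farr F g\<rbrakk> \<Longrightarrow> f = g"
    "\<And>X Y h. \<lbrakk>X \<in> Obj A; Y \<in> Obj A; h \<in> Hom B (fobj F X) (fobj F Y)\<rbrakk> \<Longrightarrow> \<exists>f\<in>Hom A X Y. farr F f = h"
    "\<And>Y. Y \<in> Obj B \<Longrightarrow> \<exists>X\<in>Obj A. \<exists>e\<in>Hom B (fobj F X) Y. isomorphism B e"
proof -
  obtain F G \<eta> \<epsilon> where F: "is_functor A B F" and G: "is_functor B A G"
    and \<eta>: "nat_iso A A id_functor (comp_functor G F) \<eta>" and \<epsilon>: "nat_iso B B (comp_functor F G) id_functor \<epsilon>"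
    using assms by (auto simp: equivalent_cats_def)
  interpret A: category A using F by (simp add: is_functor_def)
  interpret B: category B using F by (simp add: is_functor_def)
  have FO: "fobj F X \<in> Obj B" if "X \<in> Obj A" for X using F that by (simp add: is_functor_def)
  have GO: "fobj G X \<in> Obj A" if "X \<in> Obj B" for X using G that by (simp add: is_functor_def)
  have FA: "farr F f \<in> Arr B" "Dom B (farr F f) = fobj F (Dom A f)" "Cod B (farr F f) = fobj F (Cod A f)" if
      "f \<in> Arr A" for f
    using F that by (auto simp: is_functor_def)
  have GA: "farr G f \<in> Arr A" "Dom A (farr G f) = fobj G (Dom B f)" "Cod A (farr G f) = fobj G (Cod B f)" if
      "f \<in> Arr B" for f
    using G that by (auto simp: is_functor_def)
  have \<eta>c: "\<eta> X \<in> Arr A" "Dom A (\<eta> X) = X" "Cod A (\<eta> X) = fobj G (fobj F X)" "isomorphism A (\<eta> X)" if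
      "X \<in> Obj A" for X
    using \<eta> that by (auto simp: nat_iso_def nat_trans_def id_functor_def comp_functor_def)
  have \<eta>n: "\<eta> (Cod A f) \<cdot>\<^bsub>A\<^esub> f = farr G (farr F f) \<cdot>\<^bsub>A\<^esub> \<eta> (Dom A f)" if "f \<in> Arr A" for f
    using \<eta> that by (auto simp: nat_iso_def nat_trans_def id_functor_def comp_functor_def)
  have \<epsilon>c: "\<epsilon> Y \<in> Arr B" "Dom B (\<epsilon> Y) = fobj F (fobj G Y)" "Cod B (\<epsilon> Y) = Y" "isomorphism B (\<epsilon> Y)" if
      "Y \<in> Obj B" for Y
    using \<epsilon> that by (auto simp: nat_iso_def nat_trans_def id_functor_def comp_functor_def)
  have \<epsilon>n: "\<epsilon> (Cod B f) \<cdot>\<^bsub>B\<^esub> farr F (farr G f) = f \<cdot>\<^bsub>B\<^esub> \<epsilon> (Dom B f)" if "f \<in> Arr B" for f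
    using \<epsilon> that by (auto simp: nat_iso_def nat_trans_def id_functor_def comp_functor_def)
  have F_faithful: "f = g" if fg: "f \<in> Arr A" "g \<in> Arr A" "Dom A f = Dom A g" "Cod A f = Cod A g"
      "farr F f = farr F g" for f g
  proof (rule A.monicD[OF A.iso_monic[OF \<eta>c(4)[of "Cod A f"]]])
    show "\<eta> (Cod A f) \<cdot>\<^bsub>A\<^esub> f = \<eta> (Cod A f) \<cdot>\<^bsub>A\<^esub> g" using \<eta>n[OF fg(1)] \<eta>n[OF fg(2)] fg by simp
  qed (use fg \<eta>c in auto)
  have G_faithful: "f = g" if fg: "f \<in> Arr B" "g \<in> Arr B" "Dom B f = Dom B g" "Cod B f = Cod B g"
      "farr G f = farr G g" for f g
  proof -
    have e: "f \<cdot>\<^bsub>B\<^esub> \<epsilon> (Dom B f) = g \<cdot>\<^bsub>B\<^esub> \<epsilon> (Dom B f)" using \<epsilon>n[OF fg(1)] \<epsilon>n[OF fg(2)] fg by simp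
    note \<epsilon>f = \<epsilon>c[OF B.Dom_Obj[OF fg(1)]]
    obtain d where d: "d \<in> Arr B" "Dom B d = Dom B f" "Cod B d = Dom B (\<epsilon> (Dom B f))"
        "\<epsilon> (Dom B f) \<cdot>\<^bsub>B\<^esub> d = Ident B (Dom B f)"
      using \<epsilon>f B.isomorphism_iff by metis
    have "f = f \<cdot>\<^bsub>B\<^esub> (\<epsilon> (Dom B f) \<cdot>\<^bsub>B\<^esub> d)" using d fg by simp
    also have "\<dots> = g \<cdot>\<^bsub>B\<^esub> (\<epsilon> (Dom B f) \<cdot>\<^bsub>B\<^esub> d)"
      using B.comp_reduce[OF e, of d] B.comp_assoc[of d "\<epsilon> (Dom B f)" g] d(1-3) \<epsilon>f fg by simp
    also have "\<dots> = g" using d fg by simp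
    finally show ?thesis .
  qed
  have F_full: "\<exists>f\<in>Hom A X Y. farr F f = h" if X: "X \<in> Obj A" and Y: "Y \<in> Obj A" and h:
      "h \<in> Hom B (fobj F X) (fobj F Y)" for X Y h
  proof -
    obtain i where i: "i \<in> Arr A" "Dom A i = Cod A (\<eta> Y)" "Cod A i = Y" "\<eta> Y \<cdot>\<^bsub>A\<^esub> i = Ident A (Cod A (\<eta> Y))"
      using \<eta>c[OF Y] A.isomorphism_iff by metis
    obtain k where k: "k \<in> Arr A" "Dom A k = Cod A (\<eta> X)" "Cod A k = X" "\<eta> X \<cdot>\<^bsub>A\<^esub> k = Ident A (Cod A (\<eta> X))"
      using \<eta>c[OF X] A.isomorphism_iff by metis
    note GH = GA[of h]
    define f where "f = i \<cdot>\<^bsub>A\<^esub> (farr G h \<cdot>\<^bsub>A\<^esub> \<eta> X)"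
    have f: "f \<in> Arr A" "Dom A f = X" "Cod A f = Y" using i GH h \<eta>c[OF X] \<eta>c[OF Y] by (auto simp: f_def)
    have "\<eta> Y \<cdot>\<^bsub>A\<^esub> f = farr G h \<cdot>\<^bsub>A\<^esub> \<eta> X"
      unfolding f_def using A.comp_reduce[OF i(4), of "farr G h \<cdot>\<^bsub>A\<^esub> \<eta> X"] i(1-3) GH h \<eta>c[OF X] \<eta>c[OF Y] by simp
    then have e: "farr G (farr F f) \<cdot>\<^bsub>A\<^esub> \<eta> X = farr G h \<cdot>\<^bsub>A\<^esub> \<eta> X" using \<eta>n[OF f(1)] f by simp
    note GF = GA[OF FA(1)[OF f(1)]]
    have "farr G (farr F f) = farr G (farr F f) \<cdot>\<^bsub>A\<^esub> (\<eta> X \<cdot>\<^bsub>A\<^esub> k)" using k GF FA[OF f(1)] f \<eta>c[OF X] by simp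
    also have "\<dots> = farr G h \<cdot>\<^bsub>A\<^esub> (\<eta> X \<cdot>\<^bsub>A\<^esub> k)"
      using A.comp_reduce[OF e, of k] A.comp_assoc[of k "\<eta> X" "farr G h"] k(1-3) GF GH h FA[OF f(1)] f \<eta>c[OF X]
          by simp
    also have "\<dots> = farr G h" using k GH h \<eta>c[OF X] by simp
    finally have "farr F f = h" using G_faithful[of "farr F f" h] FA[OF f(1)] f h by simp
    then show ?thesis using f by auto
  qed
  show ?thesis
  proof (rule that[OF F F_faithful F_full])
    show "\<exists>X\<in>Obj A. \<exists>e\<in>Hom B (fobj F X) Y. isomorphism B e" if "Y \<in> Obj B" for Y
      using \<epsilon>c[OF that] GO[OF that] by (intro bexI[of _ "fobj G Y"] bexI[of _ "\<epsilon> Y"]) simp_all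
  qed
qed

text \<open>The elements of an object of C are those of the sheaf that an equivalence assigns to it.\<close>

theorem grothendieck_representation:
  assumes U: "universe \<kappa>" and C: "category C" and D: "category D" and small: "small \<kappa> (Obj D)" "small \<kappa> (Arr D)"
    and J: "grothendieck_topology D J" and eq: "equivalent_cats C (sheaf_cat \<kappa> D J)"
  shows "\<exists>(el :: 'o \<Rightarrow> 'd \<Rightarrow> 'u set) rs ap. sheaf_representation D J (C :: ('o, 'a) cat) \<kappa> el rs ap"
proof -
  let ?S = "sheaf_cat \<kappa> D J"
  interpret D: site D J using D J by (simp add: site_def site_axioms_def)
  interpret C: category C by (rule C)
  obtain F where F: "is_functor C ?S F"
    and faithful: "\<And>f g. \<lbrakk>f \<in> Arr C; g \<in> Arr C; Dom C f = Dom C g; Cod C f = Cod C g; farr F f = farr F g\<rbrakk> \<Longrightarrow> f = g"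
    and full: "\<And>X Y h. \<lbrakk>X \<in> Obj C; Y \<in> Obj C; h \<in> Hom ?S (fobj F X) (fobj F Y)\<rbrakk> \<Longrightarrow> \<exists>f\<in>Hom C X Y. farr F f = h"
    and surj: "\<And>Y. Y \<in> Obj ?S \<Longrightarrow> \<exists>X\<in>Obj C. \<exists>e\<in>Hom ?S (fobj F X) Y. isomorphism ?S e"
    by (rule equivalence_fully_faithful[OF eq]) blast
  interpret S: category ?S using F by (simp add: is_functor_def)
  have FO: "fobj F A \<in> sheaves \<kappa> D J" if "A \<in> Obj C" for A
  proof -
    have "fobj F A \<in> Obj ?S" using F that by (simp add: is_functor_def)
    then show ?thesis by (simp add: D.sheaf_cat_sel)
  qed
  have FA: "farr F f \<in> Hom ?S (fobj F (Dom C f)) (fobj F (Cod C f))" if "f \<in> Arr C" for f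
    using F that by (simp add: is_functor_def del: Hom_iff)
  have comp_app: "component (b \<cdot>\<^bsub>?S\<^esub> a) c x = component b c (component a c x)"
    if a: "a \<in> Hom ?S X Y" and c: "c \<in> Obj D" and x: "x \<in> fobj X c" for a b X Y c x
    using set_app_comp[OF D.sheaf_arr_D(3)[OF a c] x, of "fst (snd b) c"] c
        by (simp add: component_def D.sheaf_cat_sel del: set_cat_sel)
  have id_app: "component (Ident ?S X) c x = x" if "c \<in> Obj D" "x \<in> fobj X c" for X c x
    using that by (simp add: component_def D.sheaf_cat_sel)
  have "sheaf_representation D J C \<kappa> (\<lambda>A. fobj (fobj F A)) (\<lambda>A. action (fobj F A)) (\<lambda>a. component (farr F a))"
  proof unfold_locales
    show "universe \<kappa>" "small \<kappa> (Obj D)" "small \<kappa> (Arr D)" by fact+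
    show "sheaf D J (fobj (fobj F A)) (action (fobj F A))" if "A \<in> Obj C" for A
      using FO[OF that] by (simp add: D.sheaves_iff)
    show "small \<kappa> (fobj (fobj F A) c)" if "A \<in> Obj C" "c \<in> Obj D" for A c
      using FO[OF that(1)] D.set_functor_D(1) that(2) by (auto simp: D.sheaves_iff)
    show "natural_map D (fobj (fobj F (Dom C a))) (action (fobj F (Dom C a))) (fobj (fobj F (Cod C a))) (action (fobj F (Cod C a))) (component (farr F a))"
      if "a \<in> Arr C" for a using D.sheaf_arr_D(4)[OF FA[OF that]] .
    show "component (farr F (b \<cdot>\<^bsub>C\<^esub> a)) c x = component (farr F b) c (component (farr F a) c x)"
      if "a \<in> Arr C" "b \<in> Arr C" "Cod C a = Dom C b" "c \<in> Obj D" "x \<in> fobj (fobj F (Dom C a)) c" for a b c x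
    proof -
      have "farr F (b \<cdot>\<^bsub>C\<^esub> a) = farr F b \<cdot>\<^bsub>?S\<^esub> farr F a" using F that by (simp add: is_functor_def)
      then show ?thesis using comp_app[OF FA[OF that(1)] that(4,5)] by simp
    qed
    show "component (farr F (Ident C A)) c x = x" if "A \<in> Obj C" "c \<in> Obj D" "x \<in> fobj (fobj F A) c" for A c x
    proof -
      have "farr F (Ident C A) = Ident ?S (fobj F A)" using F that by (simp add: is_functor_def)
      then show ?thesis using id_app that by simp
    qed
    show "a = b" if ab: "a \<in> Arr C" "b \<in> Arr C" "Dom C a = Dom C b" "Cod C a = Cod C b"
      "\<And>c x. \<lbrakk>c \<in> Obj D; x \<in> fobj (fobj F (Dom C a)) c\<rbrakk> \<Longrightarrow> component (farr F a) c x = component (farr F b) c x" for a b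
    proof (rule faithful[OF ab(1-4)])
      have "farr F b \<in> Hom ?S (fobj F (Dom C a)) (fobj F (Cod C a))" unfolding ab(3,4) by (rule FA[OF ab(2)])
      then show "farr F a = farr F b" using ab(5) by (rule D.sheaf_arr_ext[OF FA[OF ab(1)]])
    qed
    show "\<exists>a\<in>Arr C. Dom C a = A \<and> Cod C a = B \<and> (\<forall>c\<in>Obj D. \<forall>x\<in>fobj (fobj F A) c. component (farr F a) c x = \<phi> c x)"
      if A: "A \<in> Obj C" and B: "B \<in> Obj C" and \<phi>: "natural_map D (fobj (fobj F A)) (action (fobj F A)) (fobj (fobj F B)) (action (fobj F B)) \<phi>" for A B \<phi>
    proof -
      obtain h where h: "h \<in> Hom ?S (fobj F A) (fobj F B)" "\<forall>c\<in>Obj D. \<forall>x\<in>fobj (fobj F A) c. component h c x = \<phi> c x"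
        using D.sheaf_arr_exists[OF FO[OF A] FO[OF B] \<phi>] by blast
      obtain a where "a \<in> Hom C A B" "farr F a = h" using full[OF A B h(1)] by blast
      then show ?thesis using h(2) by auto
    qed
    fix V :: "'d \<Rightarrow> 'u set" and r assume V: "sheaf D J V r" and sm: "\<And>c. c \<in> Obj D \<Longrightarrow> small \<kappa> (V c)"
    obtain G where G: "G \<in> sheaves \<kappa> D J" "fobj G = V" "\<And>f x. \<lbrakk>f \<in> Arr D; x \<in> V (Cod D f)\<rbrakk> \<Longrightarrow> action G f x = r f x"
      using D.sheaf_object[OF V sm] by blast
    obtain A e where A: "A \<in> Obj C" and e: "e \<in> Hom ?S (fobj F A) G" and iso: "isomorphism ?S e"
      using surj[of G] G(1) by (auto simp: D.sheaf_cat_sel(1) simp del: Hom_iff)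
    obtain k where k: "k \<in> Hom ?S G (fobj F A)" "k \<cdot>\<^bsub>?S\<^esub> e = Ident ?S (fobj F A)" "e \<cdot>\<^bsub>?S\<^esub> k = Ident ?S G"
      using iso e unfolding S.isomorphism_iff by auto
    have ke: "component k c (component e c x) = x" if "c \<in> Obj D" "x \<in> fobj (fobj F A) c" for c x
      using comp_app[OF e that, of k] k(2) id_app[OF that] by simp
    have ek: "component e c (component k c x) = x" if "c \<in> Obj D" "x \<in> V c" for c x
      using comp_app[OF k(1) that(1), of x e] k(3) id_app[of c x G] that G(2) by simp
    note en = D.sheaf_arr_D(4)[OF e] and kn = D.sheaf_arr_D(4)[OF k(1)]
    have "natural_bij D (fobj (fobj F A)) (action (fobj F A)) V r (component e)"
      unfolding natural_bij_def
    proof (intro conjI ballI)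
      show "natural_map D (fobj (fobj F A)) (action (fobj F A)) V r (component e)"
        using en G(2,3) unfolding natural_map_def by (metis D.Cod_Obj)
      show "bij_betw (component e c) (fobj (fobj F A) c) (V c)" if c: "c \<in> Obj D" for c
      proof (rule bij_betwI[where g = "component k c"])
        show "component e c \<in> fobj (fobj F A) c \<rightarrow> V c" using natural_map_simps(1)[OF en c] G(2) by auto
        show "component k c \<in> V c \<rightarrow> fobj (fobj F A) c" using natural_map_simps(1)[OF kn c] G(2) by auto
      qed (use ke ek c in auto)
    qed
    then show "\<exists>A\<in>Obj C. \<exists>\<gamma>. natural_bij D (fobj (fobj F A)) (action (fobj F A)) V r \<gamma>" using A by blast
  qed
  then show ?thesis by blast
qed

theorem proposition7p12:
  fixes \<kappa> :: "'u rel" and C :: "('o, 'a) cat"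
  assumes "category C" and "Cinfinite \<kappa>"
  shows "(cocomplete \<kappa> C \<and> heyting_category C \<and> cartesian_small_ISub \<kappa> C \<longrightarrow> cartesian_locale_based C)
    \<and> (cocomplete \<kappa> C \<and> elementary_topos C \<longrightarrow> heyting_category C \<and>
         (locally_small \<kappa> C \<longrightarrow> cartesian_small_ISub \<kappa> C \<and> cartesian_locale_based C))
    \<and> (universe \<kappa> \<and> grothendieck_topos \<kappa> C \<longrightarrow>
         cocomplete \<kappa> C \<and> elementary_topos C \<and> locally_small \<kappa> C \<and> cartesian_locale_based C)"
proof (intro conjI impI)
  show "cartesian_locale_based C" if "cocomplete \<kappa> C \<and> heyting_category C \<and> cartesian_small_ISub \<kappa> C"
    using heyting_locale_based[OF assms] that by blast
  show "heyting_category C" if "cocomplete \<kappa> C \<and> elementary_topos C"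
    using topos_heyting[OF assms(2)] that by blast
  show "cartesian_small_ISub \<kappa> C" "cartesian_locale_based C" if "cocomplete \<kappa> C \<and> elementary_topos C"
      "locally_small \<kappa> C"
    using topos_locale_based[OF assms(2)] that by blast+
  assume G: "universe \<kappa> \<and> grothendieck_topos \<kappa> C"
  then obtain D :: "('u, 'u) cat" and J where D: "category D" "small \<kappa> (Obj D)" "small \<kappa> (Arr D)"
    "grothendieck_topology D J" "equivalent_cats C (sheaf_cat \<kappa> D J)"
    by (auto simp: grothendieck_topos_def sheaf_cat_def)
  obtain el :: "'o \<Rightarrow> 'u \<Rightarrow> 'u set" and rs ap where "sheaf_representation D J C \<kappa> el rs ap"
    using grothendieck_representation[OF _ assms(1) D] G by blast
  then interpret sheaf_representation D J C \<kappa> el rs ap .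
  show "cocomplete \<kappa> C" "elementary_topos C" "locally_small \<kappa> C"
    by (rule cocomplete, rule elementary_topos, rule locally_small)
  then show "cartesian_locale_based C" using topos_locale_based[OF assms(2)] by blast
qed

end
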